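(* Let $\Gamma_1=\Gamma_d(m,n,r_1)$ and $\Gamma_2=\Gamma_d(m,n,r_2)$ be non-cyclic fixed point free Type I groups. If $n=2d$ and $r_1r_2\equiv -1\pmod m$, then for every positive integer $p$ and all integers $k_1,l_1,\dots,k_p,l_p$ satisfying $\gcd(k_j,m)=1=\gcd(l_j,n)$ for all $j$, the spherical space forms $$S^{2dp-1}/\big(\rho^{(1)}_{k_1,l_1}\oplus\dots\oplus\rho^{(1)}_{k_p,l_p}\big)(\Gamma_1)\quad\text{and}\quad S^{2dp-1}/\big(\rho^{(2)}_{k_1,l_1}\oplus\dots\oplus\rho^{(2)}_{k_p,l_p}\big)(\Gamma_2)$$ are strongly isospectral.
   Context: A finite group is of Type I if all its Sylow subgroups are cyclic. Notation: let $m,n,r$ be positive integers satisfying $\gcd((r-1)n,m)=1$ and $r^n\equiv 1\pmod m$, and let $d$ be the order of the class of $r$ in the multiplicative group $\mathbb{Z}_m^\times$ of integers modulo $m$. Then $\Gamma_d(m,n,r)$ denotes the group with generators $A,B$ and relations $A^m=B^n=1$, $BAB^{-1}=A^r$; it has order $mn$ and is of Type I. Whenever $\Gamma_d(m,n,r)$ is written, it is understood that $m,n,r,d$ satisfy these conditions. A finite group $\Gamma$ is fixed point free if it admits a faithful real representation $\rho:\Gamma\to\mathrm{O}(q+1)$, for some $q$, such that $\rho(\Gamma)$ acts freely on the unit sphere $S^q\subset\mathbb{R}^{q+1}$; such a $\rho$ is called a fixed point free representation. (It is known that $\Gamma_d(m,n,r)$ is fixed point free if and only if every prime divisor of $d$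 divides $n/d$.) For $\theta\in\mathbb{R}$ put $R(\theta)=\begin{pmatrix}\cos(2\pi\theta)&\sin(2\pi\theta)\\-\sin(2\pi\theta)&\cos(2\pi\theta)\end{pmatrix}$. For $i\in\{1,2\}$ let $A_i,B_i$ be the generators of $\Gamma_i=\Gamma_d(m,n,r_i)$ satisfying the defining relations $A_i^m=B_i^n=1$, $B_iA_iB_i^{-1}=A_i^{r_i}$. For integers $k,l$ with $\gcd(k,m)=1=\gcd(l,n)$, $\rho^{(i)}_{k,l}$ is the real representation of $\Gamma_i$ of degree $2d$ determined, in terms of $d\times d$ arrays of $2\times 2$ blocks, as follows: $\rho^{(i)}_{k,l}(A_i)$ is block diagonal with diagonal blocks $R(k/m),R(kr_i/m),\dots,R(kr_i^{d-1}/m)$; and $\rho^{(i)}_{k,l}(B_i)$ has the $2\times2$ identity in the block positions $(j,j+1)$ for $1\le j\le d-1$, has $R\big(\tfrac{l}{n/d}\big)$ in the block position $(d,1)$, and zeros in all other blocks. These representations (and their direct sums) are known to be fixed point free when $\Gamma_i$ is fixed point free of order at least $3$, so the quotients in the claim are spherical space forms, i.e. quotients of the unit sphere (with its round metric of curvature $1$) by finite groups of isometries acting freely, with the induced metric. Two compact Riemannian manifolds are strongly isospectral if any natural operator acting on the same natural bundle on both manifolds has the same spectrum (eigenvalues with multiplicities). Here a natural bundle is a vector bundle functorially associated to Riemannian manifolds and local isometries, and a natural operator is an (elliptic, self-adjoint) differential operator on sections of such a bundle, canonically determined by the metric and commuting with the maps induced by local isometries (for example the Laplace–Beltrami operator on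 functions and the Hodge–Laplace operators on $p$-forms). *)

theory Defs
  imports
    "HOL-Analysis.Analysis"
    "HOL-Algebra.Elementary_Groups"
    "HOL-Number_Theory.Number_Theory"
    "Jordan_Normal_Form.Matrix"
begin

text \<open>
  Two kinds of vectors occur. Coordinates on manifolds live in \<open>real^'k\<close>, so that the derivatives
  of the analysis library apply. Representation spaces, the ambient space of the sphere and the
  fibres of vector bundles have a dimension that varies inside the statements; they are
  \<open>carrier_vec N\<close> for the dimension-free type \<open>real vec\<close>. Below, \<open>$\<close> always denotes the
  component of a \<open>real vec\<close>.
\<close>

no_notation vec_nth (infixl \<open>$\<close> 90)


section \<open>Groups given by generators and relations\<close>

text \<open>A letter \<open>(x, True)\<close> stands for the generator \<open>x\<close>, and \<open>(x, False)\<close> for its inverse.\<close>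

type_synonym 'g gword = "('g \<times> bool) list"

inductive word_eq :: "'g gword set \<Rightarrow> 'g gword \<Rightarrow> 'g gword \<Rightarrow> bool" for R where
  refl: "word_eq R w w"
| sym: "word_eq R v w \<Longrightarrow> word_eq R w v"
| trans: "word_eq R u v \<Longrightarrow> word_eq R v w \<Longrightarrow> word_eq R u w"
| cancel: "word_eq R (u @ [(x, b), (x, \<not> b)] @ v) (u @ v)"
| relator: "r \<in> R \<Longrightarrow> word_eq R (u @ r @ v) (u @ v)"

definition word_class :: "'g gword set \<Rightarrow> 'g gword \<Rightarrow> 'g gword set" where
  "word_class R w = {v. word_eq R v w}"

definition presented_group :: "'g gword set \<Rightarrow> 'g gword set monoid" where
  "presented_group R =
     \<lparr>carrier = range (word_class R),
      mult = (\<lambda>C C'. {w. \<exists>u\<in>C. \<exists>v\<in>C'. word_eq R w (u @ v)}),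
      one = word_class R []\<rparr>"

datatype gen = GenA | GenB

text \<open>The relators \<open>A^m\<close>, \<open>B^n\<close> and \<open>B A B^-1 A^-r\<close>.\<close>

definition Gamma_relators :: "nat \<Rightarrow> nat \<Rightarrow> nat \<Rightarrow> gen gword set" where
  "Gamma_relators m n r =
     {replicate m (GenA, True),
      replicate n (GenB, True),
      [(GenB, True), (GenA, True), (GenB, False)] @ replicate r (GenA, False)}"

definition Gamma_group :: "nat \<Rightarrow> nat \<Rightarrow> nat \<Rightarrow> gen gword set monoid" where
  "Gamma_group m n r = presented_group (Gamma_relators m n r)"

definition Gamma_gen :: "nat \<Rightarrow> nat \<Rightarrow> nat \<Rightarrow> gen \<Rightarrow> gen gword set" where
  "Gamma_gen m n r x = word_class (Gamma_relators m n r) [(x, True)]"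

definition Gamma_params :: "nat \<Rightarrow> nat \<Rightarrow> nat \<Rightarrow> nat \<Rightarrow> bool" where
  "Gamma_params d m n r \<longleftrightarrow>
     m > 0 \<and> n > 0 \<and> r > 0 \<and> gcd ((r - 1) * n) m = 1 \<and> [r ^ n = 1] (mod m) \<and> d = ord m r"

definition type_I :: "('a, 'b) monoid_scheme \<Rightarrow> bool" where
  "type_I G \<longleftrightarrow> group G \<and> finite (carrier G) \<and>
     (\<forall>p H. Factorial_Ring.prime p \<longrightarrow> subgroup H G \<longrightarrow>
        card H = p ^ multiplicity p (order G) \<longrightarrow> cyclic_group (G\<lparr>carrier := H\<rparr>))"


section \<open>Orthogonal representations\<close>

definition orthogonal_group :: "nat \<Rightarrow> real mat monoid" where
  "orthogonal_group N =
     \<lparr>carrier = {M \<in> carrier_mat N N. transpose_mat M * M = 1\<^sub>m N},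
      mult = (*),
      one = 1\<^sub>m N\<rparr>"

definition unit_sphere :: "nat \<Rightarrow> real vec set" where
  "unit_sphere N = {v \<in> carrier_vec N. scalar_prod v v = 1}"

definition fixed_point_free :: "('a, 'b) monoid_scheme \<Rightarrow> bool" where
  "fixed_point_free G \<longleftrightarrow> group G \<and> finite (carrier G) \<and>
     (\<exists>q \<rho>. \<rho> \<in> hom G (orthogonal_group (q + 1)) \<and> inj_on \<rho> (carrier G) \<and>
        (\<forall>g\<in>carrier G. \<forall>v\<in>unit_sphere (q + 1). \<rho> g *\<^sub>v v = v \<longrightarrow> g = \<one>\<^bsub>G\<^esub>))"

definition rot :: "real \<Rightarrow> real mat" where
  "rot \<theta> = mat_of_rows_list 2
     [[cos (2 * pi * \<theta>), sin (2 * pi * \<theta>)],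
      [- sin (2 * pi * \<theta>), cos (2 * pi * \<theta>)]]"

text \<open>A \<open>d \<times> d\<close> array of \<open>2 \<times> 2\<close> blocks; block positions are counted from 0.\<close>

definition block_array :: "nat \<Rightarrow> (nat \<Rightarrow> nat \<Rightarrow> real mat) \<Rightarrow> real mat" where
  "block_array d F =
     Matrix.mat (2 * d) (2 * d) (\<lambda>(i, j). F (i div 2) (j div 2) $$ (i mod 2, j mod 2))"

definition rho_A :: "nat \<Rightarrow> nat \<Rightarrow> nat \<Rightarrow> int \<Rightarrow> real mat" where
  "rho_A d m r k =
     block_array d (\<lambda>a b. if a = b then rot (of_int k * of_nat r ^ a / of_nat m) else 0\<^sub>m 2 2)"

definition rho_B :: "nat \<Rightarrow> nat \<Rightarrow> int \<Rightarrow> real mat" where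
  "rho_B d n l =
     block_array d (\<lambda>a b.
       if b = a + 1 then 1\<^sub>m 2
       else if a + 1 = d \<and> b = 0 then rot (of_int l / (of_nat n / of_nat d))
       else 0\<^sub>m 2 2)"

definition rho ::
  "nat \<Rightarrow> nat \<Rightarrow> nat \<Rightarrow> nat \<Rightarrow> int \<Rightarrow> int \<Rightarrow> gen gword set \<Rightarrow> real mat" where
  "rho d m n r k l =
     (THE \<rho>. \<rho> \<in> hom (Gamma_group m n r) (orthogonal_group (2 * d)) \<and>
             \<rho> \<in> extensional (carrier (Gamma_group m n r)) \<and>
             \<rho> (Gamma_gen m n r GenA) = rho_A d m r k \<and>
             \<rho> (Gamma_gen m n r GenB) = rho_B d n l)"

definition rho_sum ::
  "nat \<Rightarrow> nat \<Rightarrow> nat \<Rightarrow> nat \<Rightarrow> nat \<Rightarrow> (nat \<Rightarrow> int) \<Rightarrow> (nat \<Rightarrow> int) \<Rightarrow> gen gword set \<Rightarrow> real mat"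
  where
  "rho_sum d m n r p k l g = diag_block_mat (map (\<lambda>j. rho d m n r (k j) (l j) g) [1..<p+1])"


section \<open>Smooth functions\<close>

text \<open>Iterated partial derivatives along the list of coordinate directions \<open>w\<close>.\<close>

fun pderivs :: "'k::finite list \<Rightarrow> (real^'k \<Rightarrow> 'b::real_normed_vector) \<Rightarrow> real^'k \<Rightarrow> 'b" where
  "pderivs [] f = f"
| "pderivs (i # w) f = (\<lambda>x. frechet_derivative (pderivs w f) (at x) (axis i 1))"

text \<open>Only meant for open \<open>V\<close>.\<close>

definition smooth_on :: "(real^'k::finite) set \<Rightarrow> (real^'k \<Rightarrow> 'b::real_normed_vector) \<Rightarrow> bool" where
  "smooth_on V f \<longleftrightarrow> (\<forall>w. \<forall>x\<in>V. pderivs w f differentiable (at x))"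


section \<open>Riemannian manifolds\<close>

text \<open>
  Manifolds of dimension \<open>CARD('k)\<close> are described by an atlas (not necessarily maximal) of
  parametrisations \<open>(V, \<psi>)\<close>, where \<open>\<psi>\<close> maps the open set \<open>V\<close> of coordinates injectively into the
  manifold; the values of \<open>\<psi>\<close> outside \<open>V\<close> are irrelevant. The metric is given by its Gram matrix in
  each of these parametrisations. The topology is the one determined by the atlas.
\<close>

type_synonym ('a, 'k) param = "(real^'k) set \<times> (real^'k \<Rightarrow> 'a)"

record ('a, 'k) riem =
  params :: "('a, 'k) param set"
  gram :: "('a, 'k) param \<Rightarrow> real^'k \<Rightarrow> real^'k^'k"

definition points :: "('a, 'k::finite) riem \<Rightarrow> 'a set" where
  "points M = (\<Union>(V, \<psi>)\<in>params M. \<psi> ` V)"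

definition mtop :: "('a, 'k::finite) riem \<Rightarrow> 'a topology" where
  "mtop M = topology (\<lambda>W. W \<subseteq> points M \<and> (\<forall>(V, \<psi>)\<in>params M. open {x \<in> V. \<psi> x \<in> W}))"

text \<open>
  Smooth maps whose differential is isometric on every tangent space; as both manifolds have
  dimension \<open>CARD('k)\<close>, these are the local isometries.
\<close>

definition local_isometry ::
  "('a, 'k::finite) riem \<Rightarrow> ('a, 'k) riem \<Rightarrow> ('a \<Rightarrow> 'a) \<Rightarrow> bool" where
  "local_isometry M N f \<longleftrightarrow> f ` points M \<subseteq> points N \<and>
     (\<forall>(V, \<psi>)\<in>params M. \<forall>(V', \<psi>')\<in>params N.
        let O1 = {x \<in> V. f (\<psi> x) \<in> \<psi>' ` V'};
            h = (\<lambda>x. inv_into V' \<psi>' (f (\<psi> x)))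
        in open O1 \<and> smooth_on O1 h \<and>
           (\<forall>x\<in>O1. \<forall>u v.
              inner (frechet_derivative h (at x) u)
                    (gram N (V', \<psi>') (h x) *v frechet_derivative h (at x) v)
              = inner u (gram M (V, \<psi>) x *v v)))"

text \<open>
  The condition \<open>local_isometry M M id\<close> says that coordinate changes are smooth with
  open domain and that the Gram matrices transform as a tensor.
\<close>

definition riemannian_manifold :: "('a, 'k::finite) riem \<Rightarrow> bool" where
  "riemannian_manifold M \<longleftrightarrow>
     (\<forall>(V, \<psi>)\<in>params M. open V \<and> inj_on \<psi> V \<and>
        (\<forall>i j. smooth_on V (\<lambda>x. vec_nth (vec_nth (gram M (V, \<psi>) x) i) j)) \<and>
        (\<forall>x\<in>V. transpose (gram M (V, \<psi>) x) = gram M (V, \<psi>) x \<and>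
                (\<forall>u. u \<noteq> 0 \<longrightarrow> inner u (gram M (V, \<psi>) x *v u) > 0))) \<and>
     local_isometry M M id \<and>
     Hausdorff_space (mtop M) \<and> second_countable (mtop M)"

definition smooth_fun :: "('a, 'k::finite) riem \<Rightarrow> 'a set \<Rightarrow> ('a \<Rightarrow> real) \<Rightarrow> bool" where
  "smooth_fun M W h \<longleftrightarrow> (\<forall>(V, \<psi>)\<in>params M. smooth_on {x \<in> V. \<psi> x \<in> W} (h \<circ> \<psi>))"

definition smooth_mat :: "('a, 'k::finite) riem \<Rightarrow> 'a set \<Rightarrow> nat \<Rightarrow> ('a \<Rightarrow> real mat) \<Rightarrow> bool" where
  "smooth_mat M W k c \<longleftrightarrow> (\<forall>x\<in>W. c x \<in> carrier_mat k k) \<and>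
     (\<forall>i<k. \<forall>j<k. smooth_fun M W (\<lambda>x. c x $$ (i, j)))"

definition riemannian_measure :: "('a, 'k::finite) riem \<Rightarrow> 'a measure \<Rightarrow> bool" where
  "riemannian_measure M \<mu> \<longleftrightarrow>
     space \<mu> = points M \<and> sets \<mu> = sigma_sets (points M) {W. openin (mtop M) W} \<and>
     (\<forall>(V, \<psi>)\<in>params M. \<forall>A\<in>sets borel. A \<subseteq> V \<longrightarrow>
        emeasure \<mu> (\<psi> ` A) = (\<integral>\<^sup>+x\<in>A. ennreal (sqrt (det (gram M (V, \<psi>) x))) \<partial>lborel))"


section \<open>Quotients of the unit sphere\<close>

definition orbit_of :: "real mat set \<Rightarrow> real vec \<Rightarrow> real vec set" where
  "orbit_of G v = (\<lambda>g. g *\<^sub>v v) ` G"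

text \<open>
  \<open>s\<close> is a smooth immersion of \<open>W\<close> into the unit sphere of \<open>\<real>^N\<close> that lifts the map \<open>\<psi>\<close> into the
  orbit space.
\<close>

definition sphere_lift ::
  "nat \<Rightarrow> real mat set \<Rightarrow> (real^'k::finite \<Rightarrow> real vec set) \<Rightarrow>
   (real^'k) set \<Rightarrow> (real^'k \<Rightarrow> real vec) \<Rightarrow> bool" where
  "sphere_lift N G \<psi> W s \<longleftrightarrow> open W \<and>
     (\<forall>y\<in>W. s y \<in> unit_sphere N \<and> \<psi> y = orbit_of G (s y)) \<and>
     (\<forall>i<N. smooth_on W (\<lambda>y. s y $ i)) \<and>
     (\<forall>y\<in>W. \<forall>u. (\<forall>i<N. frechet_derivative (\<lambda>z. s z $ i) (at y) u = 0) \<longrightarrow> u = 0)"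

text \<open>
  The quotient of the unit sphere of \<open>\<real>^N\<close> by a finite group \<open>G\<close> of orthogonal matrices acting
  freely, for \<open>CARD('k) = N - 1\<close>. The atlas consists of all injective maps into the orbit space that
  lift locally to parametrisations of the sphere. The Gram matrix is that of any local lift: two
  lifts near a point differ by an element of \<open>G\<close>, hence the choice does not matter.
\<close>

definition sphere_quotient :: "nat \<Rightarrow> real mat set \<Rightarrow> (real vec set, 'k::finite) riem" where
  "sphere_quotient N G =
     \<lparr>params = {(V, \<psi>). open V \<and> inj_on \<psi> V \<and>
        (\<forall>x\<in>V. \<exists>W s. x \<in> W \<and> W \<subseteq> V \<and> sphere_lift N G \<psi> W s)},
      gram = (\<lambda>(V, \<psi>) x.
        let s = (SOME s. \<exists>W. x \<in> W \<and> W \<subseteq> V \<and> sphere_lift N G \<psi> W s)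
        in \<chi> a b. \<Sum>i<N. frechet_derivative (\<lambda>y. s y $ i) (at x) (axis a 1) *
                           frechet_derivative (\<lambda>y. s y $ i) (at x) (axis b 1))\<rparr>"


section \<open>Vector bundles\<close>

text \<open>
  A real vector bundle of rank \<open>k\<close>. Every fibre is identified with \<open>\<real>^k\<close> by a linear isomorphism
  that need not depend continuously on the point, so that the total space is \<open>points M \<times> \<real>^k\<close> as a
  set. All of the topological and smooth structure is carried by the local trivialisations
  \<open>(U, \<tau>)\<close>, where \<open>\<tau> x\<close> maps the fibre over \<open>x\<close> to the typical fibre. Up to isomorphism this is
  every vector bundle of rank \<open>k\<close>.
\<close>

record 'a vbundle =
  rk :: nat
  trivs :: "('a set \<times> ('a \<Rightarrow> real mat)) set"

definition vector_bundle :: "('a, 'k::finite) riem \<Rightarrow> 'a vbundle \<Rightarrow> bool" where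
  "vector_bundle M E \<longleftrightarrow>
     (\<Union>(U, \<tau>)\<in>trivs E. U) = points M \<and>
     (\<forall>(U, \<tau>)\<in>trivs E. openin (mtop M) U \<and>
        (\<forall>x\<in>U. \<tau> x \<in> carrier_mat (rk E) (rk E) \<and> invertible_mat (\<tau> x))) \<and>
     (\<forall>(U, \<tau>)\<in>trivs E. \<forall>(U', \<tau>')\<in>trivs E.
        \<exists>c. smooth_mat M (U \<inter> U') (rk E) c \<and> (\<forall>x\<in>U \<inter> U'. \<tau>' x = c x * \<tau> x))"

type_synonym 'a sect = "'a \<Rightarrow> real vec"

definition smooth_section :: "('a, 'k::finite) riem \<Rightarrow> 'a vbundle \<Rightarrow> 'a sect \<Rightarrow> bool" where
  "smooth_section M E s \<longleftrightarrow> (\<forall>x\<in>points M. s x \<in> carrier_vec (rk E)) \<and>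
     (\<forall>(U, \<tau>)\<in>trivs E. \<forall>i<rk E. smooth_fun M U (\<lambda>x. (\<tau> x *\<^sub>v s x) $ i))"

text \<open>
  A smooth bundle map over \<open>f\<close> that is an isomorphism on every fibre; \<open>L x\<close> maps the fibre over \<open>x\<close>
  to the fibre over \<open>f x\<close>.
\<close>

definition bundle_map ::
  "('a, 'k::finite) riem \<Rightarrow> 'a vbundle \<Rightarrow> 'a vbundle \<Rightarrow> ('a \<Rightarrow> 'a) \<Rightarrow> ('a \<Rightarrow> real mat) \<Rightarrow> bool" where
  "bundle_map M E F f L \<longleftrightarrow>
     (\<forall>x\<in>points M. L x \<in> carrier_mat (rk F) (rk E) \<and> invertible_mat (L x)) \<and>
     (\<forall>(U, \<tau>)\<in>trivs E. \<forall>(U', \<tau>')\<in>trivs F.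
        \<exists>c. smooth_mat M {x \<in> U. f x \<in> U'} (rk E) c \<and>
            (\<forall>x\<in>U. f x \<in> U' \<longrightarrow> \<tau>' (f x) * L x = c x * \<tau> x))"

definition fibre_metric ::
  "('a, 'k::finite) riem \<Rightarrow> 'a vbundle \<Rightarrow> ('a \<Rightarrow> real mat) \<Rightarrow> bool" where
  "fibre_metric M E h \<longleftrightarrow>
     (\<forall>x\<in>points M. h x \<in> carrier_mat (rk E) (rk E) \<and> transpose_mat (h x) = h x \<and>
        (\<forall>v\<in>carrier_vec (rk E). v \<noteq> 0\<^sub>v (rk E) \<longrightarrow> scalar_prod v (h x *\<^sub>v v) > 0)) \<and>
     (\<forall>(U, \<tau>)\<in>trivs E. \<exists>c. smooth_mat M U (rk E) c \<and>
        (\<forall>x\<in>U. h x = transpose_mat (\<tau> x) * c x * \<tau> x))"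


section \<open>Differential operators\<close>

text \<open>
  In a parametrisation and a trivialisation an operator of order \<open>r\<close> is
  \<open>\<Sum> a\<^sub>w \<partial>\<^sup>w\<close>, where \<open>w\<close> runs over the lists of at most \<open>r\<close> coordinate directions. Using
  lists rather than multi-indices makes the coefficients non-unique, but not the operator or its
  principal symbol.
\<close>

definition represents_diff_op ::
  "('a, 'k::finite) riem \<Rightarrow> 'a vbundle \<Rightarrow> ('a sect \<Rightarrow> 'a sect) \<Rightarrow> nat \<Rightarrow>
   (real^'k) set \<times> (real^'k \<Rightarrow> 'a) \<Rightarrow> 'a set \<times> ('a \<Rightarrow> real mat) \<Rightarrow>
   ('k list \<Rightarrow> nat \<Rightarrow> nat \<Rightarrow> real^'k \<Rightarrow> real) \<Rightarrow> bool" where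
  "represents_diff_op M E D r = (\<lambda>(V, \<psi>) (U, \<tau>) a.
     (\<forall>w. length w \<le> r \<longrightarrow>
        (\<forall>i<rk E. \<forall>j<rk E. smooth_on {x \<in> V. \<psi> x \<in> U} (a w i j))) \<and>
     (\<forall>s. smooth_section M E s \<longrightarrow> (\<forall>x\<in>V. \<psi> x \<in> U \<longrightarrow> (\<forall>i<rk E.
        (\<tau> (\<psi> x) *\<^sub>v D s (\<psi> x)) $ i =
        (\<Sum>w | length w \<le> r. \<Sum>j<rk E.
           a w i j x * pderivs w (\<lambda>y. (\<tau> (\<psi> y) *\<^sub>v s (\<psi> y)) $ j) x)))))"

definition principal_symbol ::
  "nat \<Rightarrow> nat \<Rightarrow> ('k::finite list \<Rightarrow> nat \<Rightarrow> nat \<Rightarrow> real^'k \<Rightarrow> real) \<Rightarrow>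
   real^'k \<Rightarrow> real^'k \<Rightarrow> real mat" where
  "principal_symbol k r a x \<xi> =
     Matrix.mat k k (\<lambda>(i, j). \<Sum>w | length w = r. a w i j x * prod_list (map (vec_nth \<xi>) w))"

definition elliptic_diff_op ::
  "('a, 'k::finite) riem \<Rightarrow> 'a vbundle \<Rightarrow> ('a sect \<Rightarrow> 'a sect) \<Rightarrow> bool" where
  "elliptic_diff_op M E D \<longleftrightarrow>
     (\<forall>s. smooth_section M E s \<longrightarrow> smooth_section M E (D s)) \<and>
     (\<exists>r. \<forall>(V, \<psi>)\<in>params M. \<forall>(U, \<tau>)\<in>trivs E. \<exists>a.
        represents_diff_op M E D r (V, \<psi>) (U, \<tau>) a \<and>
        (\<forall>x\<in>V. \<psi> x \<in> U \<longrightarrow> (\<forall>\<xi>. \<xi> \<noteq> 0 \<longrightarrow>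
           invertible_mat (principal_symbol (rk E) r a x \<xi>))))"

definition compact_support :: "('a, 'k::finite) riem \<Rightarrow> 'a vbundle \<Rightarrow> 'a sect \<Rightarrow> bool" where
  "compact_support M E s \<longleftrightarrow>
     (\<exists>K. compactin (mtop M) K \<and> (\<forall>x\<in>points M - K. s x = 0\<^sub>v (rk E)))"

text \<open>Formal self-adjointness for the \<open>L\<^sup>2\<close> product defined by some smooth fibre metric.\<close>

definition self_adjoint_op ::
  "('a, 'k::finite) riem \<Rightarrow> 'a vbundle \<Rightarrow> ('a sect \<Rightarrow> 'a sect) \<Rightarrow> bool" where
  "self_adjoint_op M E D \<longleftrightarrow>
     (\<exists>h. fibre_metric M E h \<and>
        (\<forall>\<mu> s t. riemannian_measure M \<mu> \<longrightarrow>
           smooth_section M E s \<longrightarrow> compact_support M E s \<longrightarrow>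
           smooth_section M E t \<longrightarrow> compact_support M E t \<longrightarrow>
           (\<integral>x. scalar_prod (D s x) (h x *\<^sub>v t x) \<partial>\<mu>) =
           (\<integral>x. scalar_prod (s x) (h x *\<^sub>v D t x) \<partial>\<mu>)))"


section \<open>Natural bundles and natural operators\<close>

text \<open>
  A functor from the category of Riemannian manifolds of dimension \<open>CARD('k)\<close> with points in \<open>'a\<close>
  and local isometries to vector bundles and bundle maps. \<open>E M\<close> is the bundle over \<open>M\<close>, and
  \<open>L M N f\<close> is the bundle map over the local isometry \<open>f\<close> from \<open>M\<close> to \<open>N\<close>. As soon as \<open>'a\<close> has at
  least the cardinality of the continuum, every such manifold has an isomorphic copy in \<open>'a\<close>.
\<close>

definition natural_bundle ::
  "(('a, 'k::finite) riem \<Rightarrow> 'a vbundle) \<Rightarrow>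
   (('a, 'k) riem \<Rightarrow> ('a, 'k) riem \<Rightarrow> ('a \<Rightarrow> 'a) \<Rightarrow> 'a \<Rightarrow> real mat) \<Rightarrow> bool" where
  "natural_bundle E L \<longleftrightarrow>
     (\<forall>M. riemannian_manifold M \<longrightarrow> vector_bundle M (E M)) \<and>
     (\<forall>M N f. riemannian_manifold M \<longrightarrow> riemannian_manifold N \<longrightarrow> local_isometry M N f \<longrightarrow>
        bundle_map M (E M) (E N) f (L M N f)) \<and>
     (\<forall>M N f f'. riemannian_manifold M \<longrightarrow> riemannian_manifold N \<longrightarrow>
        local_isometry M N f \<longrightarrow> local_isometry M N f' \<longrightarrow> (\<forall>x\<in>points M. f x = f' x) \<longrightarrow>
        (\<forall>x\<in>points M. L M N f x = L M N f' x)) \<and>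
     (\<forall>M. riemannian_manifold M \<longrightarrow> (\<forall>x\<in>points M. L M M id x = 1\<^sub>m (rk (E M)))) \<and>
     (\<forall>M N P f h. riemannian_manifold M \<longrightarrow> riemannian_manifold N \<longrightarrow> riemannian_manifold P \<longrightarrow>
        local_isometry M N f \<longrightarrow> local_isometry N P h \<longrightarrow>
        (\<forall>x\<in>points M. L M P (h \<circ> f) x = L N P h (f x) * L M N f x))"

text \<open>
  The last condition says that \<open>D\<close> commutes with pulling back sections along local isometries:
  \<open>t\<close> is the pull-back of \<open>s\<close> by \<open>f\<close> if \<open>L M N f x\<close> maps \<open>t x\<close> to \<open>s (f x)\<close> for all \<open>x\<close>.
\<close>

definition natural_operator ::
  "(('a, 'k::finite) riem \<Rightarrow> 'a vbundle) \<Rightarrow>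
   (('a, 'k) riem \<Rightarrow> ('a, 'k) riem \<Rightarrow> ('a \<Rightarrow> 'a) \<Rightarrow> 'a \<Rightarrow> real mat) \<Rightarrow>
   (('a, 'k) riem \<Rightarrow> 'a sect \<Rightarrow> 'a sect) \<Rightarrow> bool" where
  "natural_operator E L D \<longleftrightarrow>
     (\<forall>M. riemannian_manifold M \<longrightarrow>
        elliptic_diff_op M (E M) (D M) \<and> self_adjoint_op M (E M) (D M)) \<and>
     (\<forall>M N f s t. riemannian_manifold M \<longrightarrow> riemannian_manifold N \<longrightarrow> local_isometry M N f \<longrightarrow>
        smooth_section N (E N) s \<longrightarrow> smooth_section M (E M) t \<longrightarrow>
        (\<forall>x\<in>points M. L M N f x *\<^sub>v t x = s (f x)) \<longrightarrow>
        (\<forall>x\<in>points M. L M N f x *\<^sub>v D M t x = D N s (f x)))"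


section \<open>Spectra and strong isospectrality\<close>

definition eigensection ::
  "('a, 'k::finite) riem \<Rightarrow> 'a vbundle \<Rightarrow> ('a sect \<Rightarrow> 'a sect) \<Rightarrow> real \<Rightarrow> 'a sect \<Rightarrow> bool" where
  "eigensection M E D ev s \<longleftrightarrow>
     smooth_section M E s \<and> (\<forall>x\<in>points M. D s x = ev \<cdot>\<^sub>v s x)"

definition independent_sections ::
  "('a, 'k::finite) riem \<Rightarrow> 'a vbundle \<Rightarrow> nat \<Rightarrow> (nat \<Rightarrow> 'a sect) \<Rightarrow> bool" where
  "independent_sections M E n t \<longleftrightarrow>
     (\<forall>c :: nat \<Rightarrow> real.
        (\<forall>x\<in>points M. \<forall>j<rk E. (\<Sum>i<n. c i * t i x $ j) = 0) \<longrightarrow> (\<forall>i<n. c i = 0))"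

text \<open>The dimension of the eigenspace for \<open>ev\<close>; it is 0 iff \<open>ev\<close> is not an eigenvalue.\<close>

definition eigen_multiplicity ::
  "('a, 'k::finite) riem \<Rightarrow> 'a vbundle \<Rightarrow> ('a sect \<Rightarrow> 'a sect) \<Rightarrow> real \<Rightarrow> enat" where
  "eigen_multiplicity M E D ev =
     (SUP n \<in> {n. \<exists>t. (\<forall>i<n. eigensection M E D ev (t i)) \<and> independent_sections M E n t}. enat n)"

definition strongly_isospectral :: "('a, 'k::finite) riem \<Rightarrow> ('a, 'k) riem \<Rightarrow> bool" where
  "strongly_isospectral M N \<longleftrightarrow>
     riemannian_manifold M \<and> compact_space (mtop M) \<and>
     riemannian_manifold N \<and> compact_space (mtop N) \<and>
     (\<forall>E L D. natural_bundle E L \<longrightarrow> natural_operator E L D \<longrightarrow>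
        (\<forall>ev. eigen_multiplicity M (E M) (D M) ev = eigen_multiplicity N (E N) (D N) ev))"

end

theory Submission
  imports Defs "Jordan_Normal_Form.Determinant" "HOL-Library.Function_Algebras"
begin

text \<open>
  Put \<open>M0 = S\<^sup>N\<^sup>-\<^sup>1\<close>. Sections over \<open>M0/G\<close> are the \<open>G\<close>-invariant sections over \<open>M0\<close>, and a natural operator
  commutes with the action of the whole orthogonal group on the sections over \<open>M0\<close>. It therefore
  suffices to find, on every eigenspace \<open>V\<close> of the operator over \<open>M0\<close>, an injective linear map from the
  \<open>\<Gamma>\<^sub>1\<close>-invariants to the \<open>\<Gamma>\<^sub>2\<close>-invariants, and to exchange the roles of \<open>\<Gamma>\<^sub>1\<close> and \<open>\<Gamma>\<^sub>2\<close>.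

  Freeness of the action forces \<open>d\<close> to be a power of 2. Since \<open>l\<^sub>j\<close> is odd, \<open>B\<close> does not depend on
  \<open>l\<^sub>j\<close>. Let \<open>S\<close> be complex conjugation of all blocks and \<open>D\<close> that of the blocks in odd position. After
  conjugation by a suitable \<open>J\<close>, which is where \<open>r\<^sub>1 r\<^sub>2 \<equiv> -1\<close> enters, \<open>\<Gamma>\<^sub>2\<close> is generated by \<open>A\<close> and \<open>B S\<close>,
  where \<open>A\<close> and \<open>B\<close> generate \<open>\<Gamma>\<^sub>1\<close>; both groups have the same invariants in the part of \<open>V\<close> fixed by
  \<open>S\<close>. Write \<open>A = A\<^sub>e A\<^sub>o\<close> according to the parity of the blocks. On the part where \<open>S = -1\<close> the map is
  \<open>\<Sum> c\<^sub>i A\<^sub>e\<^sup>i + D P\<close>, where \<open>P\<close> is the mean of the powers of \<open>A\<^sub>e\<close> and \<open>c\<close> is the Fourier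
  transform of an even function with values \<open>\<plusminus>1\<close> outside 0 that changes sign under multiplication
  by \<open>r\<^sub>1\<close>. Such a function exists because \<open>r\<^sub>1\<^sup>n x \<equiv> \<plusminus>x\<close> with odd \<open>n\<close> implies \<open>x \<equiv> 0\<close> modulo \<open>m\<close>.
\<close>

section \<open>A signed kernel on the integers modulo m\<close>

text \<open>Where \<open>S = -1\<close>, an invariant of the first group satisfies
  \<open>B v = v\<close>, but an invariant of the conjugated second group must satisfy
  \<open>B u = - u\<close>. So the sign of \<open>B\<close> has to be reversed without losing
  invariance under \<open>A\<close>. Polynomials in \<open>A\<^sub>e\<close> keep the latter, and on
  invariants of \<open>A\<close> passing \<open>B\<close> across multiplies exponents of
  \<open>A\<^sub>e\<close> by \<open>- r1\<close>; an even \<open>c\<close> that changes sign under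
  \<open>r1\<close> therefore gives the required sign. Such a \<open>c\<close> has sum 0, so its
  operator kills the vectors fixed by \<open>A\<^sub>e\<close>; elsewhere it is invertible because
  its square is \<open>1 - P\<close>. On the killed part \<open>D\<close> takes over:
  \<open>B D = D B S\<close> gives the sign, and although \<open>D\<close> inverts
  \<open>A\<^sub>o\<close>, this is harmless where \<open>A\<^sub>e\<close> and
  \<open>A\<^sub>o\<close> both act trivially.

  That \<open>d\<close> is a power of 2 has this reason: for an odd prime \<open>q\<close> dividing
  \<open>d\<close>, the element \<open>B^(2 d / q)\<close> has order \<open>q\<close> and acts on
  the powers of \<open>A\<close> with order exactly \<open>q\<close>, and averaging over conjugates
  shows that such a semidirect product cannot act freely.

  Multiplicities are suprema of sizes of independent families, so injections in both directions give
  equality by antisymmetry.\<close>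

lemma sum_mult_mod:
  fixes m k :: nat and F :: "nat \<Rightarrow> 'b::comm_monoid_add"
  assumes m: "m > 0" and co: "coprime k m"
  shows "(\<Sum>i<m. F (k * i mod m)) = (\<Sum>i<m. F i)"
proof (rule sum.reindex_bij_betw[of "\<lambda>i. k * i mod m"])
  have inj: "inj_on (\<lambda>i. k * i mod m) {..<m}"
  proof (rule inj_onI)
    fix i j assume ij: "i \<in> {..<m}" "j \<in> {..<m}" "k * i mod m = k * j mod m"
    then have "[k * i = k * j] (mod m)" by (simp add: cong_def)
    then have "[i = j] (mod m)" using cong_mult_lcancel_nat[OF co] by blast
    then show "i = j" using ij(1,2) by (simp add: cong_less_modulus_unique_nat)
  qed
  moreover have "(\<lambda>i. k * i mod m) ` {..<m} \<subseteq> {..<m}" using m by auto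
  ultimately show "bij_betw (\<lambda>i. k * i mod m) {..<m} {..<m}"
    unfolding bij_betw_def by (metis card_image card_subset_eq finite_lessThan)
qed

definition omega :: "nat \<Rightarrow> int \<Rightarrow> complex" where
  "omega m z = cis (2 * pi * of_int z / of_nat m)"

lemma omega_add: "omega m (z + w) = omega m z * omega m w"
  unfolding omega_def cis_mult by (simp add: add_divide_distrib distrib_left)

lemma omega_0 [simp]: "omega m 0 = 1"
  by (simp add: omega_def)

lemma omega_uminus: "omega m (- z) = cnj (omega m z)"
  by (simp add: omega_def cis_cnj)

lemma omega_power: "omega m z ^ i = omega m (z * int i)"
  unfolding omega_def Complex.DeMoivre by (simp add: mult.commute mult.left_commute)

lemma omega_eq_1_iff:
  assumes "m > 0"
  shows "omega m z = 1 \<longleftrightarrow> int m dvd z"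
proof
  assume "omega m z = 1"
  then have "cos (2 * pi * of_int z / of_nat m) = 1"
    unfolding omega_def by (simp add: complex_eq_iff)
  then obtain n :: int where "2 * pi * of_int z / of_nat m = of_int n * 2 * pi"
    using cos_one_2pi_int by (metis mult.commute mult.left_commute)
  then have "real_of_int z = real_of_int (n * int m)"
    using assms by (simp add: field_simps)
  then show "int m dvd z" by (simp only: of_int_eq_iff dvd_triv_right)
next
  assume "int m dvd z"
  then obtain n where "z = int m * n" by blast
  then have "2 * pi * of_int z / of_nat m = 2 * pi * of_int n" using assms by simp
  then show "omega m z = 1" unfolding omega_def by (simp add: cis_multiple_2pi)
qed

lemma sum_omega:
  assumes m: "m > 0"
  shows "(\<Sum>i<m. omega m (z * int i)) = (if int m dvd z then of_nat m else 0)"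
proof (cases "int m dvd z")
  case True
  then have "omega m (z * int i) = 1" for i using omega_eq_1_iff[OF m] by simp
  then show ?thesis using True by simp
next
  case False
  then have "omega m z \<noteq> 1" using omega_eq_1_iff[OF m] by simp
  moreover have "omega m z ^ m = 1" unfolding omega_power using omega_eq_1_iff[OF m] by simp
  ultimately have "(\<Sum>i<m. omega m z ^ i) = 0" by (simp add: geometric_sum)
  then show ?thesis using False by (simp add: omega_power)
qed

text \<open>
  The Fourier transform of the kernel is a sign function on the nonzero residues that is even and
  changes sign under multiplication by \<open>r\<close>. The sign compares the least elements of the two cosets
  \<open>\<plusminus>r\<^sup>2\<^sup>j x\<close> and \<open>\<plusminus>r\<^sup>2\<^sup>j\<^sup>+\<^sup>1 x\<close>, which are different.
\<close>

lemma odd_sign_exists: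
  fixes m r d :: nat
  assumes m: "m > 0" and d: "[r ^ d = 1] (mod m)" "even d" "d > 0"
    and no: "\<And>x :: int. \<And>n. odd n \<Longrightarrow> \<not> int m dvd x \<Longrightarrow> \<not> int m dvd (int r ^ n * x - x) \<and> \<not> int m dvd (int r ^ n * x + x)"
  obtains \<epsilon> :: "int \<Rightarrow> real" where "\<And>x y. int m dvd x - y \<Longrightarrow> \<epsilon> x = \<epsilon> y"
    "\<And>x. \<epsilon> (- x) = \<epsilon> x" "\<And>x. \<epsilon> (int r * x) = - \<epsilon> x"
    "\<And>x. \<epsilon> x * \<epsilon> x = (if int m dvd x then 0 else 1)"
proof -
  \<comment> \<open>Cutting the coset down to representatives in \<open>[0, m)\<close> makes it
    finite, so that \<open>Min\<close> is meaningful.\<close>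
  define C where "C = (\<lambda>x. {y \<in> {0..<int m}. \<exists>j. int m dvd (int r ^ (2 * j) * x - y) \<or> int m dvd (int r ^ (2 * j) * x + y)})"
  define \<epsilon> :: "int \<Rightarrow> real" where
    "\<epsilon> = (\<lambda>x. if int m dvd x then 0 else if Min (C x) < Min (C (int r * x)) then 1 else -1)"
  have fin: "finite (C x)" for x
    by (rule finite_subset[of _ "{0..<int m}"]) (auto simp: C_def)
  have ne: "C x \<noteq> {}" for x
  proof -
    have "x mod int m \<in> C x"
      unfolding C_def using m by (auto intro!: exI[of _ 0])
    then show ?thesis by blast
  qed
  have Ccong: "C x = C y" if "int m dvd x - y" for x y
  proof -
    have *: "C x \<subseteq> C y" if xy: "int m dvd x - y" for x y
    proof
      fix z assume "z \<in> C x"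
      then obtain j where z: "z \<in> {0..<int m}"
        and j: "int m dvd (int r ^ (2 * j) * x - z) \<or> int m dvd (int r ^ (2 * j) * x + z)"
        unfolding C_def by blast
      have "int m dvd int r ^ (2 * j) * (x - y)" using xy by simp
      then have e: "int m dvd (int r ^ (2 * j) * x + w) \<longleftrightarrow> int m dvd (int r ^ (2 * j) * y + w)" for w
        using dvd_add_right_iff[of "int m" "int r ^ (2 * j) * (x - y)" "int r ^ (2 * j) * y + w"]
        by (simp add: algebra_simps)
      show "z \<in> C y" unfolding C_def using z j e[of z] e[of "- z"] by auto
    qed
    show ?thesis using *[OF that] *[of y x] that by (simp add: dvd_diff_commute subset_antisym)
  qed
  have Cneg: "C (- x) = C x" for x
  proof -
    have "int r ^ (2 * j) * (- x) - y = - (int r ^ (2 * j) * x + y)"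
      "int r ^ (2 * j) * (- x) + y = - (int r ^ (2 * j) * x - y)" for j y by simp_all
    then have "int m dvd (int r ^ (2 * j) * (- x) - y) \<longleftrightarrow> int m dvd (int r ^ (2 * j) * x + y)"
      "int m dvd (int r ^ (2 * j) * (- x) + y) \<longleftrightarrow> int m dvd (int r ^ (2 * j) * x - y)" for j y
      by (simp_all only: dvd_minus_iff)
    then show ?thesis unfolding C_def by blast
  qed
  have rd: "int m dvd int r ^ (d * j) - 1" for j
  proof -
    have "[int r ^ d = 1] (mod int m)" using d(1) by (metis cong_int_iff of_nat_1 of_nat_power)
    then have "[(int r ^ d) ^ j = 1 ^ j] (mod int m)" by (rule cong_pow)
    then show ?thesis by (simp add: power_mult cong_iff_dvd_diff)
  qed
  \<comment> \<open>A factor \<open>r^2\<close> only shifts \<open>j\<close>, which gives one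
    inclusion. The other goes once around the cycle: with \<open>d = 2 * e\<close>, \<open>x\<close>
    is \<open>r^(2 e) x\<close> modulo \<open>m\<close>.\<close>
  have Crr: "C (int r * (int r * x)) = C x" for x
  proof -
    have s1: "C (int r * (int r * x)) \<subseteq> C x" for x
    proof
      fix z assume "z \<in> C (int r * (int r * x))"
      then obtain j where z: "z \<in> {0..<int m}"
        and j: "int m dvd (int r ^ (2 * j) * (int r * (int r * x)) - z) \<or> int m dvd (int r ^ (2 * j) * (int r * (int r * x)) + z)"
        unfolding C_def by blast
      have "int r ^ (2 * j) * (int r * (int r * x)) = int r ^ (2 * Suc j) * x" by (simp add: power_add)
      then have "int m dvd (int r ^ (2 * Suc j) * x - z) \<or> int m dvd (int r ^ (2 * Suc j) * x + z)"
        using j by (simp only:)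
      then show "z \<in> C x" unfolding C_def using z by blast
    qed
    have iter: "C (int r ^ (2 * n) * x) \<subseteq> C x" for n x
    proof (induction n arbitrary: x)
      case (Suc n)
      have "C (int r ^ (2 * Suc n) * x) = C (int r ^ (2 * n) * (int r * (int r * x)))"
        by (simp add: mult.assoc mult.left_commute)
      then show ?case using Suc[of "int r * (int r * x)"] s1[of x] by simp
    qed simp
    obtain e where e: "d = 2 * e" "e > 0" using d(2,3) by (auto elim: evenE)
    have "int m dvd int r ^ (2 * e) * x - x"
    proof -
      have "int r ^ (2 * e) * x - x = (int r ^ (d * 1) - 1) * x" by (simp add: e(1) left_diff_distrib)
      then show ?thesis using dvd_mult2[OF rd[of 1], of x] by (simp only:)
    qed
    then have "C x = C (int r ^ (2 * e) * x)" by (rule Ccong[symmetric])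
    also have "\<dots> = C (int r ^ (2 * (e - 1)) * (int r * (int r * x)))"
      using e(2) by (cases e) (simp_all add: mult.assoc mult.left_commute)
    also have "\<dots> \<subseteq> C (int r * (int r * x))" by (rule iter)
    finally show ?thesis using s1[of x] by blast
  qed
  have disj: "C x \<inter> C (int r * x) = {}" if x: "\<not> int m dvd x" for x
  proof (rule ccontr)
    assume "C x \<inter> C (int r * x) \<noteq> {}"
    then obtain y i j where
      i: "int m dvd (int r ^ (2 * i) * x - y) \<or> int m dvd (int r ^ (2 * i) * x + y)" and
      j: "int m dvd (int r ^ (2 * j) * (int r * x) - y) \<or> int m dvd (int r ^ (2 * j) * (int r * x) + y)"
      unfolding C_def by blast
    let ?a = "int r ^ (2 * i) * x" and ?b = "int r ^ (2 * j) * (int r * x)"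
    have ab: "int m dvd (?b - ?a) \<or> int m dvd (?b + ?a)"
      using i j
    proof (elim disjE)
      assume "int m dvd ?a - y" "int m dvd ?b - y"
      then show ?thesis using dvd_diff[of "int m" "?b - y" "?a - y"] by simp
    next
      assume "int m dvd ?a - y" "int m dvd ?b + y"
      then show ?thesis using dvd_add[of "int m" "?b + y" "?a - y"] by simp
    next
      assume "int m dvd ?a + y" "int m dvd ?b - y"
      then show ?thesis using dvd_add[of "int m" "?b - y" "?a + y"] by simp
    next
      assume "int m dvd ?a + y" "int m dvd ?b + y"
      then show ?thesis using dvd_diff[of "int m" "?b + y" "?a + y"] by simp
    qed
    \<comment> \<open>Multiplying by \<open>?p\<close>, which inverts \<open>r^(2 i)\<close> modulo
      \<open>m\<close>, turns the coincidence of cosets into \<open>r^n x = x\<close> or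
      \<open>r^n x = - x\<close> modulo \<open>m\<close>. The padding is even, so \<open>n\<close>
      is odd.\<close>
    define n where "n = 2 * j + 1 + (d * (2 * i) - 2 * i)"
    have di: "2 * i \<le> d * (2 * i)" using d(3) by simp
    have oddn: "odd n" unfolding n_def using d(2) by (simp add: even_diff_nat)
    let ?p = "int r ^ (d * (2 * i) - 2 * i)"
    have pb: "?p * ?b = int r ^ n * x" by (simp add: n_def power_add mult_ac)
    have pa: "int m dvd ?p * ?a - x"
    proof -
      have "?p * int r ^ (2 * i) = int r ^ (d * (2 * i))"
        unfolding power_add[symmetric] using di by simp
      then have "?p * ?a = int r ^ (d * (2 * i)) * x" by (metis mult.assoc)
      then have "?p * ?a - x = (int r ^ (d * (2 * i)) - 1) * x" by (simp only: left_diff_distrib mult_1)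
      then show ?thesis using dvd_mult2[OF rd[of "2 * i"], of x] by (simp only:)
    qed
    from ab show False
    proof
      assume "int m dvd ?b - ?a"
      then have "int m dvd ?p * (?b - ?a)" by (rule dvd_mult)
      then have "int m dvd ?p * (?b - ?a) + (?p * ?a - x)" using pa by (rule dvd_add)
      then have "int m dvd int r ^ n * x - x" using pb by (simp add: right_diff_distrib)
      then show False using no[OF oddn x] by blast
    next
      assume "int m dvd ?b + ?a"
      then have "int m dvd ?p * (?b + ?a)" by (rule dvd_mult)
      then have "int m dvd ?p * (?b + ?a) - (?p * ?a - x)" using pa by (rule dvd_diff)
      then have "int m dvd int r ^ n * x + x" using pb by (simp add: distrib_left)
      then show False using no[OF oddn x] by blast
    qed
  qed
  have dvd_r: "int m dvd int r * x \<longleftrightarrow> int m dvd x" for x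
  proof
    assume "int m dvd int r * x"
    then have "int m dvd int r ^ (d - 1) * (int r * x)" by (rule dvd_mult)
    then have "int m dvd int r ^ d * x"
      using d(3) by (cases d) (simp_all add: mult.assoc mult.left_commute)
    then have "int m dvd int r ^ d * x - (int r ^ d - 1) * x"
      using rd[of 1] dvd_mult2[of "int m" "int r ^ d - 1" x] by (intro dvd_diff) simp_all
    then show "int m dvd x" by (simp add: algebra_simps)
  qed simp
  show thesis
  proof (rule that[of \<epsilon>])
    fix x y
    show "\<epsilon> x = \<epsilon> y" if xy: "int m dvd x - y"
    proof -
      have "int m dvd int r * x - int r * y" using dvd_mult[OF xy, of "int r"] by (simp add: right_diff_distrib)
      moreover have "int m dvd x \<longleftrightarrow> int m dvd y"
        using dvd_add_right_iff[OF xy, of y] by simp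
      ultimately show ?thesis unfolding \<epsilon>_def using Ccong[OF xy] Ccong[of "int r * x" "int r * y"] by simp
    qed
    show "\<epsilon> (- x) = \<epsilon> x" unfolding \<epsilon>_def using Cneg[of x] Cneg[of "int r * x"] by simp
    \<comment> \<open>By \<open>Crr\<close> the step from \<open>x\<close> to \<open>r x\<close>
      swaps the two sets that are compared, and disjoint sets have different minima.\<close>
    show "\<epsilon> (int r * x) = - \<epsilon> x"
    proof (cases "int m dvd x")
      case False
      have "Min (C x) \<noteq> Min (C (int r * x))"
        using Min_in[OF fin ne, of x] Min_in[OF fin ne, of "int r * x"] disj[OF False] by force
      then show ?thesis unfolding \<epsilon>_def dvd_r Crr using False by auto
    qed (simp add: \<epsilon>_def)
    show "\<epsilon> x * \<epsilon> x = (if int m dvd x then 0 else 1)" by (simp add: \<epsilon>_def)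
  qed
qed

text \<open>The last item is the convolution theorem: the square of the sign function is 1 away from
  0 and 0 at 0, and the transform of this square is the delta function minus \<open>1 / m\<close>.
  The sum of \<open>c\<close> is the value of the sign function at 0.\<close>

lemma signed_kernel_exists:
  fixes m r d :: nat
  assumes m: "m > 0" and d: "[r ^ d = 1] (mod m)" "even d" "d > 0"
    and no: "\<And>x :: int. \<And>n. odd n \<Longrightarrow> \<not> int m dvd x \<Longrightarrow> \<not> int m dvd (int r ^ n * x - x) \<and> \<not> int m dvd (int r ^ n * x + x)"
  obtains c :: "int \<Rightarrow> real" where "\<And>i j. int m dvd i - j \<Longrightarrow> c i = c j"
    "\<And>i. c (- i) = c i" "\<And>i. c (int r * i) = - c i" "(\<Sum>i<m. c (int i)) = 0"
    "\<And>k. (\<Sum>i<m. c (int i) * c (k - int i)) = (if int m dvd k then 1 else 0) - 1 / real m"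
proof -
  obtain \<epsilon> :: "int \<Rightarrow> real" where e: "\<And>x y. int m dvd x - y \<Longrightarrow> \<epsilon> x = \<epsilon> y"
    "\<And>x. \<epsilon> (- x) = \<epsilon> x" "\<And>x. \<epsilon> (int r * x) = - \<epsilon> x"
    "\<And>x. \<epsilon> x * \<epsilon> x = (if int m dvd x then 0 else 1)"
    using odd_sign_exists[OF m d no] by metis
  \<comment> \<open>With the factor \<open>1 / m\<close> the transform of a product is the
    convolution of the transforms, without a further constant.\<close>
  define Cc where "Cc = (\<lambda>i. (1 / of_nat m) * (\<Sum>x<m. of_real (\<epsilon> (int x)) * omega m (int x * i)))"
  define c where "c = (\<lambda>i. Re (Cc i))"
  have om_cong: "omega m z = omega m w" if "int m dvd z - w" for z w
    using omega_add[of m "z - w" w] omega_eq_1_iff[OF m] that by simp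
  have modd: "int m dvd int (k * i mod m) - int k * int i" for k i
    by (metis cong_def cong_iff_dvd_diff mod_mod_trivial of_nat_mod of_nat_mult)
  have cop: "coprime r m" 
  proof -
    have "r * r ^ (d - 1) = r ^ d" using d(3) by (cases d) auto
    then show ?thesis using d(1) by (metis cong_imp_coprime cong_sym coprime_1_left coprime_mult_left_iff)
  qed
  have reidx: "(\<Sum>x<m. F (int k * int x)) = (\<Sum>x<m. F (int x))"
    if "coprime k m" "\<And>x y. int m dvd x - y \<Longrightarrow> F x = F y" for F :: "int \<Rightarrow> complex" and k
  proof -
    have "(\<Sum>x<m. F (int x)) = (\<Sum>x<m. F (int (k * x mod m)))"
      using sum_mult_mod[OF m that(1), of "\<lambda>x. F (int x)"] by simp
    also have "\<dots> = (\<Sum>x<m. F (int k * int x))"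
      by (intro sum.cong HOL.refl that(2) modd)
    finally show ?thesis by simp
  qed
  have Ccong: "Cc i = Cc j" if "int m dvd i - j" for i j
  proof -
    have "omega m (int x * i) = omega m (int x * j)" for x
      using dvd_mult[OF that, of "int x"] by (intro om_cong) (simp add: right_diff_distrib)
    then show ?thesis unfolding Cc_def by simp
  qed
  have Cneg: "Cc (- i) = Cc i" for i
  proof -
    define F where "F = (\<lambda>x. of_real (\<epsilon> x) * omega m (x * i))"
    have F: "F x = F y" if "int m dvd x - y" for x y
    proof -
      have "int m dvd x * i - y * i" using dvd_mult2[OF that, of i] by (simp add: left_diff_distrib)
      then show ?thesis unfolding F_def using e(1)[OF that] om_cong by metis
    qed
    \<comment> \<open>Negation of residues is multiplication by \<open>m - 1\<close>, which brings
      it under \<open>reidx\<close>.\<close>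
    have co: "coprime (m - 1) m" using m coprime_diff_one_left_nat by simp
    have neg: "(\<Sum>x<m. F (int (m - 1) * int x)) = (\<Sum>x<m. of_real (\<epsilon> (int x)) * omega m (int x * (- i)))"
    proof (rule sum.cong[OF HOL.refl])
      fix x
      have "int (m - 1) * int x - - int x = int m * int x" using m by (simp add: of_nat_diff algebra_simps)
      then have "F (int (m - 1) * int x) = F (- int x)" by (intro F) simp
      then show "F (int (m - 1) * int x) = of_real (\<epsilon> (int x)) * omega m (int x * (- i))"
        by (simp add: F_def e(2))
    qed
    show ?thesis
      unfolding Cc_def using neg reidx[where F = F, OF co F] by (simp only: F_def)
  qed
  have Cr: "Cc (int r * i) = - Cc i" for i
  proof -
    define F where "F = (\<lambda>x. of_real (\<epsilon> x) * omega m (x * i))"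
    have F: "F x = F y" if "int m dvd x - y" for x y
    proof -
      have "int m dvd x * i - y * i" using dvd_mult2[OF that, of i] by (simp add: left_diff_distrib)
      then show ?thesis unfolding F_def using e(1)[OF that] om_cong by metis
    qed
    have "(\<Sum>x<m. F (int x)) = (\<Sum>x<m. F (int r * int x))"
      by (rule reidx[where F = F, OF cop F, symmetric])
    also have "\<dots> = - (\<Sum>x<m. of_real (\<epsilon> (int x)) * omega m (int x * (int r * i)))"
      unfolding F_def e(3) sum_negf[symmetric] by (intro sum.cong) (auto simp: mult_ac)
    finally show ?thesis unfolding Cc_def F_def by simp
  qed
  \<comment> \<open>The values of \<open>\<epsilon>\<close> are real, so conjugation replaces
    \<open>i\<close> by \<open>- i\<close>; as the transform is even, it is real.\<close>
  have cnjC: "cnj (Cc i) = Cc i" for i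
  proof -
    have "cnj (Cc i) = Cc (- i)" unfolding Cc_def by (simp add: omega_uminus)
    then show ?thesis using Cneg by simp
  qed
  then have creal: "of_real (c i) = Cc i" for i
    unfolding c_def by (metis complex_cnj_cancel_iff complex_is_Real_iff Reals_cnj_iff of_real_Re)
  have conv: "(\<Sum>i<m. Cc (int i) * Cc (k - int i)) = (if int m dvd k then 1 else 0) - 1 / of_nat m" for k
  proof -
    have "(\<Sum>i<m. Cc (int i) * Cc (k - int i)) =
      (\<Sum>i<m. \<Sum>x<m. \<Sum>y<m. (1 / of_nat m)\<^sup>2 * (of_real (\<epsilon> (int x)) * of_real (\<epsilon> (int y)) * omega m (int y * k) * omega m ((int x - int y) * int i)))"
    proof (rule sum.cong[OF HOL.refl])
      fix i
      let ?a = "\<lambda>x. of_real (\<epsilon> (int x)) * omega m (int x * int i)"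
      let ?b = "\<lambda>y. of_real (\<epsilon> (int y)) * omega m (int y * (k - int i))"
      have om: "omega m (int x * int i) * omega m (int y * (k - int i)) = omega m (int y * k) * omega m ((int x - int y) * int i)" for x y
        unfolding omega_add[symmetric] by (simp add: algebra_simps)
      have "?a x * ?b y = of_real (\<epsilon> (int x)) * of_real (\<epsilon> (int y)) * (omega m (int x * int i) * omega m (int y * (k - int i)))" for x y
        by (simp only: mult_ac)
      then have ab: "?a x * ?b y = of_real (\<epsilon> (int x)) * of_real (\<epsilon> (int y)) * omega m (int y * k) * omega m ((int x - int y) * int i)" for x y
        unfolding om by (simp only: mult.assoc)
      have "Cc (int i) * Cc (k - int i) = (1 / of_nat m)\<^sup>2 * ((\<Sum>x<m. ?a x) * (\<Sum>y<m. ?b y))"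
        unfolding Cc_def power2_eq_square by (simp only: mult_ac)
      then show "Cc (int i) * Cc (k - int i) = (\<Sum>x<m. \<Sum>y<m. (1 / of_nat m)\<^sup>2 * (of_real (\<epsilon> (int x)) * of_real (\<epsilon> (int y)) * omega m (int y * k) * omega m ((int x - int y) * int i)))"
        by (simp only: sum_product ab) (simp only: sum_distrib_left)
    qed
    \<comment> \<open>Summing over \<open>i\<close> first leaves only the diagonal
      \<open>x = y\<close>, by orthogonality of characters.\<close>
    also have "\<dots> = (\<Sum>x<m. \<Sum>y<m. (1 / of_nat m)\<^sup>2 * (of_real (\<epsilon> (int x)) * of_real (\<epsilon> (int y)) * omega m (int y * k) * (\<Sum>i<m. omega m ((int x - int y) * int i))))"
      unfolding sum_distrib_left by (subst sum.swap, rule sum.cong[OF HOL.refl], rule sum.swap)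
    also have "\<dots> = (\<Sum>x<m. \<Sum>y<m. if y = x then (1 / of_nat m) * (of_real (\<epsilon> (int x) * \<epsilon> (int x)) * omega m (int x * k)) else 0)"
    proof (intro sum.cong HOL.refl)
      fix x y assume xy: "x \<in> {..<m}" "y \<in> {..<m}"
      have "int m dvd int x - int y \<longleftrightarrow> y = x"
      proof
        assume "int m dvd int x - int y"
        then have "[x = y] (mod m)" by (simp add: cong_iff_dvd_diff cong_int_iff[symmetric])
        then show "y = x" using xy by (simp add: cong_def)
      qed simp
      then show "(1 / of_nat m)\<^sup>2 * (of_real (\<epsilon> (int x)) * of_real (\<epsilon> (int y)) * omega m (int y * k) * (\<Sum>i<m. omega m ((int x - int y) * int i)))
        = (if y = x then (1 / of_nat m) * (of_real (\<epsilon> (int x) * \<epsilon> (int x)) * omega m (int x * k)) else 0)"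
        unfolding sum_omega[OF m] using m by (simp add: power2_eq_square)
    qed
    also have "\<dots> = (\<Sum>x<m. (1 / of_nat m) * (of_real (\<epsilon> (int x) * \<epsilon> (int x)) * omega m (int x * k)))"
      by (intro sum.cong HOL.refl) (simp add: sum.delta)
    also have "\<dots> = (1 / of_nat m) * (\<Sum>x<m. omega m (int x * k) - (if x = 0 then 1 else 0))"
      unfolding sum_distrib_left[symmetric]
    proof (rule arg_cong[where f = "(*) _"], rule sum.cong[OF HOL.refl])
      fix x assume "x \<in> {..<m}"
      then have "int m dvd int x \<longleftrightarrow> x = 0" by (auto simp: nat_dvd_not_less)
      then show "of_real (\<epsilon> (int x) * \<epsilon> (int x)) * omega m (int x * k) = omega m (int x * k) - (if x = 0 then 1 else 0)"
        unfolding e(4) by simp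
    qed
    also have "(\<Sum>x<m. omega m (int x * k) - (if x = 0 then 1 else 0)) = (if int m dvd k then of_nat m else 0) - 1"
      using sum_omega[OF m, of k] m by (simp add: sum_subtractf sum.delta mult.commute)
    finally show ?thesis using m by (simp add: right_diff_distrib)
  qed
  have sum0: "(\<Sum>i<m. Cc (int i)) = 0"
  proof -
    have "(\<Sum>i<m. Cc (int i)) = (1 / of_nat m) * (\<Sum>x<m. of_real (\<epsilon> (int x)) * (\<Sum>i<m. omega m (int x * int i)))"
      unfolding Cc_def sum_distrib_left by (rule sum.swap)
    also have "(\<Sum>x<m. of_real (\<epsilon> (int x)) * (\<Sum>i<m. omega m (int x * int i))) = 0"
    proof (rule sum.neutral, intro ballI)
      fix x assume "x \<in> {..<m}"
      have "\<epsilon> (int x) = 0" if "int m dvd int x" using e(4)[of "int x"] that by simp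
      then show "of_real (\<epsilon> (int x)) * (\<Sum>i<m. omega m (int x * int i)) = 0"
        unfolding sum_omega[OF m] by auto
    qed
    finally show ?thesis by simp
  qed
  show thesis
  proof (rule that[of c])
    show "c i = c j" if "int m dvd i - j" for i j unfolding c_def using Ccong[OF that] by simp
    show "c (- i) = c i" for i unfolding c_def using Cneg by simp
    show "c (int r * i) = - c i" for i unfolding c_def using Cr by simp
    show "(\<Sum>i<m. c (int i)) = 0" unfolding c_def using sum0 by (metis Re_sum zero_complex.simps(1))
    show "(\<Sum>i<m. c (int i) * c (k - int i)) = (if int m dvd k then 1 else 0) - 1 / real m" for k
    proof -
      have "complex_of_real (\<Sum>i<m. c (int i) * c (k - int i)) = of_real ((if int m dvd k then 1 else 0) - 1 / real m)"
        using conv[of k] by (simp add: creal)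
      then show ?thesis by (simp only: of_real_eq_iff)
    qed
  qed
qed

section \<open>Transplantation\<close>

text \<open>The maps stand for the actions of \<open>A\<^sub>e\<close>, \<open>A\<^sub>o\<close>,
  \<open>B\<close>, \<open>S\<close> and \<open>D\<close> on an eigenspace \<open>V\<close>. They
  are linear on the whole ambient type but obey the relations on \<open>V\<close> only. That
  \<open>s\<close> and \<open>\<delta>\<close> invert a map \<open>a\<close> is written as
  \<open>a s a = s\<close>, so that no inverse maps occur.\<close>

locale transplantation =
  fixes V :: "'v::real_vector set" and a\<^sub>e a\<^sub>o b s \<delta> :: "'v \<Rightarrow> 'v" and m r :: nat and c :: "int \<Rightarrow> real"
  assumes m: "m > 0" and co: "coprime r m"
    and V: "subspace V"
    and lin: "linear a\<^sub>e" "linear a\<^sub>o" "linear b" "linear s" "linear \<delta>"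
    and closed: "\<And>v. v \<in> V \<Longrightarrow> a\<^sub>e v \<in> V" "\<And>v. v \<in> V \<Longrightarrow> a\<^sub>o v \<in> V" "\<And>v. v \<in> V \<Longrightarrow> b v \<in> V"
      "\<And>v. v \<in> V \<Longrightarrow> s v \<in> V" "\<And>v. v \<in> V \<Longrightarrow> \<delta> v \<in> V"
    and aem: "\<And>v. v \<in> V \<Longrightarrow> (a\<^sub>e ^^ m) v = v"
    and comm: "\<And>v. v \<in> V \<Longrightarrow> a\<^sub>o (a\<^sub>e v) = a\<^sub>e (a\<^sub>o v)"
    and ss: "\<And>v. v \<in> V \<Longrightarrow> s (s v) = v" and \<delta>\<delta>: "\<And>v. v \<in> V \<Longrightarrow> \<delta> (\<delta> v) = v"
    and asa: "\<And>v. v \<in> V \<Longrightarrow> a\<^sub>e (s (a\<^sub>e v)) = s v" "\<And>v. v \<in> V \<Longrightarrow> a\<^sub>o (s (a\<^sub>o v)) = s v"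
    and \<delta>a: "\<And>v. v \<in> V \<Longrightarrow> \<delta> (a\<^sub>e v) = a\<^sub>e (\<delta> v)" "\<And>v. v \<in> V \<Longrightarrow> a\<^sub>o (\<delta> (a\<^sub>o v)) = \<delta> v"
    and sb: "\<And>v. v \<in> V \<Longrightarrow> s (b v) = b (s v)" and s\<delta>: "\<And>v. v \<in> V \<Longrightarrow> s (\<delta> v) = \<delta> (s v)"
    and b\<delta>: "\<And>v. v \<in> V \<Longrightarrow> b (\<delta> v) = \<delta> (b (s v))"
    and ba: "\<And>v. v \<in> V \<Longrightarrow> b (a\<^sub>e v) = (a\<^sub>o ^^ r) (b v)"
    and c: "\<And>i j. int m dvd i - j \<Longrightarrow> c i = c j" "\<And>i. c (- i) = c i" "\<And>i. c (int r * i) = - c i"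
      "(\<Sum>i<m. c (int i)) = 0"
      "\<And>k. (\<Sum>i<m. c (int i) * c (k - int i)) = (if int m dvd k then 1 else 0) - 1 / real m"
begin

definition F1 :: "'v set" where "F1 = {v \<in> V. a\<^sub>e (a\<^sub>o v) = v \<and> b v = v}"

text \<open>The invariants of the conjugate of the second group by \<open>J\<close>.\<close>

definition F2 :: "'v set" where "F2 = {v \<in> V. a\<^sub>e (a\<^sub>o v) = v \<and> b (s v) = v}"

definition W :: "'v set" where "W = {v \<in> V. a\<^sub>e (a\<^sub>o v) = v \<and> b v = v \<and> s v = - v}"

definition P :: "'v \<Rightarrow> 'v" where "P v = (1 / real m) *\<^sub>R (\<Sum>i<m. (a\<^sub>e ^^ i) v)"

definition T :: "'v \<Rightarrow> 'v" where "T v = (\<Sum>i<m. c (int i) *\<^sub>R (a\<^sub>e ^^ i) v)"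

definition \<Psi> :: "'v \<Rightarrow> 'v" where
  "\<Psi> v = (1 / 2) *\<^sub>R (v + s v) + (T ((1 / 2) *\<^sub>R (v - s v)) + \<delta> (P ((1 / 2) *\<^sub>R (v - s v))))"

lemma linear_pow: "linear (a\<^sub>e ^^ i)" "linear (a\<^sub>o ^^ i)"
proof -
  show "linear (a\<^sub>e ^^ i)"
    by (induction i) (use lin(1) in \<open>auto simp: linear_iff\<close>)
  show "linear (a\<^sub>o ^^ i)"
    by (induction i) (use lin(2) in \<open>auto simp: linear_iff\<close>)
qed

lemma linear_P: "linear P"
  unfolding P_def by (intro linear_compose_scale_right linear_compose_sum ballI linear_pow)

lemma linear_T: "linear T"
  unfolding T_def by (intro linear_compose_scale_right linear_compose_sum ballI linear_pow)

lemma linear_Psi: "linear \<Psi>"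
proof -
  have half: "linear (\<lambda>v. (1 / 2) *\<^sub>R (v - s v))"
    by (intro linear_compose_scale_right linear_compose_sub lin linear_ident)
  show ?thesis
    unfolding \<Psi>_def
    by (intro linear_compose_add linear_compose_scale_right linear_ident lin
        linear_compose[OF half linear_T, unfolded o_def]
        linear_compose[OF linear_compose[OF half linear_P] lin(5), unfolded o_def])
qed

lemma pow_V: "v \<in> V \<Longrightarrow> (a\<^sub>e ^^ i) v \<in> V" "v \<in> V \<Longrightarrow> (a\<^sub>o ^^ i) v \<in> V"
  using closed by (induction i) auto

lemma P_V: "v \<in> V \<Longrightarrow> P v \<in> V" and T_V: "v \<in> V \<Longrightarrow> T v \<in> V"
  unfolding P_def T_def using V pow_V by (auto intro!: subspace_scale subspace_sum)

lemma pow_mult_m: "v \<in> V \<Longrightarrow> (a\<^sub>e ^^ (m * q)) v = v"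
  by (induction q) (simp_all add: funpow_add aem)

lemma pow_mod: "v \<in> V \<Longrightarrow> (a\<^sub>e ^^ i) v = (a\<^sub>e ^^ (i mod m)) v"
proof -
  assume v: "v \<in> V"
  have "(a\<^sub>e ^^ (i mod m + m * (i div m))) v = (a\<^sub>e ^^ (i mod m)) v"
    unfolding funpow_add o_def pow_mult_m[OF v] ..
  then show ?thesis by simp
qed

lemma c_mod: "c (int i) = c (int (i mod m))"
  by (rule c(1)) (simp add: of_nat_mod minus_mod_eq_div_mult[symmetric] minus_mod_eq_mult_div)

lemma P_reindex:
  assumes v: "v \<in> V" and k: "coprime k m"
  shows "(\<Sum>i<m. (a\<^sub>e ^^ (k * i)) v) = (\<Sum>i<m. (a\<^sub>e ^^ i) v)"
  using sum_mult_mod[OF m k, of "\<lambda>i. (a\<^sub>e ^^ i) v"] pow_mod[OF v] by simp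

lemma T_reindex:
  assumes v: "v \<in> V" and k: "coprime k m"
  shows "(\<Sum>i<m. c (int (k * i)) *\<^sub>R (a\<^sub>e ^^ (k * i)) v) = T v"
proof -
  have "c (int (k * i)) *\<^sub>R (a\<^sub>e ^^ (k * i)) v = c (int (k * i mod m)) *\<^sub>R (a\<^sub>e ^^ (k * i mod m)) v" for i
    using pow_mod[OF v, of "k * i"] c_mod[of "k * i"] by simp
  then show ?thesis
    unfolding T_def using sum_mult_mod[OF m k, of "\<lambda>i. c (int i) *\<^sub>R (a\<^sub>e ^^ i) v"] by simp
qed

lemma c_minus1: "c (int ((m - 1) * i)) = c (int i)"
proof -
  have "int ((m - 1) * i) - - int i = int m * int i" using m by (simp add: of_nat_diff algebra_simps)
  then have "c (int ((m - 1) * i)) = c (- int i)" by (intro c(1)) simp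
  then show ?thesis using c(2) by simp
qed

lemma coprime_minus1: "coprime (m - 1) m"
  using m coprime_diff_one_left_nat by simp

lemma pow_pow: "(a\<^sub>e ^^ i) ((a\<^sub>e ^^ j) v) = (a\<^sub>e ^^ (i + j)) v"
  by (simp add: funpow_add)

text \<open>Exponents are natural numbers, so \<open>m - 1\<close> plays the part of
  \<open>- 1\<close> here and below.\<close>

lemma s_ae: "v \<in> V \<Longrightarrow> s (a\<^sub>e v) = (a\<^sub>e ^^ (m - 1)) (s v)"
proof -
  assume v: "v \<in> V"
  have "s (a\<^sub>e v) = (a\<^sub>e ^^ (m - 1)) (a\<^sub>e (s (a\<^sub>e v)))"
    using pow_pow[of "m - 1" 1 "s (a\<^sub>e v)"] m aem[of "s (a\<^sub>e v)"] closed v by simp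
  then show ?thesis using asa(1)[OF v] by simp
qed

lemma s_pow: "v \<in> V \<Longrightarrow> s ((a\<^sub>e ^^ i) v) = (a\<^sub>e ^^ ((m - 1) * i)) (s v)"
proof (induction i)
  case (Suc i)
  have "s ((a\<^sub>e ^^ Suc i) v) = (a\<^sub>e ^^ (m - 1)) (s ((a\<^sub>e ^^ i) v))"
    using s_ae[OF pow_V(1)[OF Suc.prems]] by simp
  then show ?case using Suc by (simp add: pow_pow)
qed simp

text \<open>An invariant of \<open>A\<close> sees \<open>a\<^sub>o\<close> as the inverse of
  \<open>a\<^sub>e\<close>. This is what allows everything to be expressed by powers of
  \<open>a\<^sub>e\<close> alone.\<close>

lemma ao_eq: "v \<in> V \<Longrightarrow> a\<^sub>e (a\<^sub>o v) = v \<Longrightarrow> a\<^sub>o v = (a\<^sub>e ^^ (m - 1)) v"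
proof -
  assume v: "v \<in> V" "a\<^sub>e (a\<^sub>o v) = v"
  have "a\<^sub>o v = (a\<^sub>e ^^ (m - 1)) (a\<^sub>e (a\<^sub>o v))"
    using pow_pow[of "m - 1" 1 "a\<^sub>o v"] m aem[of "a\<^sub>o v"] closed v by simp
  then show ?thesis using v(2) by simp
qed

lemma ao_ae_pow: "v \<in> V \<Longrightarrow> a\<^sub>o ((a\<^sub>e ^^ i) v) = (a\<^sub>e ^^ i) (a\<^sub>o v)"
  by (induction i) (simp_all add: comm pow_V)

lemma ao_pow: "v \<in> V \<Longrightarrow> a\<^sub>e (a\<^sub>o v) = v \<Longrightarrow> (a\<^sub>o ^^ i) v = (a\<^sub>e ^^ ((m - 1) * i)) v"
proof (induction i)
  case (Suc i)
  have "(a\<^sub>o ^^ Suc i) v = (a\<^sub>e ^^ ((m - 1) * i)) (a\<^sub>o v)"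
    using Suc ao_ae_pow[OF Suc.prems(1)] by simp
  also have "\<dots> = (a\<^sub>e ^^ ((m - 1) * Suc i)) v"
    unfolding ao_eq[OF Suc.prems] pow_pow by (simp add: add.commute)
  finally show ?case .
qed simp

lemma b_pow: "v \<in> V \<Longrightarrow> b ((a\<^sub>e ^^ i) v) = (a\<^sub>o ^^ (r * i)) (b v)"
proof (induction i)
  case (Suc i)
  have "b ((a\<^sub>e ^^ Suc i) v) = (a\<^sub>o ^^ r) (b ((a\<^sub>e ^^ i) v))"
    using ba[OF pow_V(1)[OF Suc.prems]] by simp
  then show ?case using Suc by (simp add: funpow_add)
qed simp

lemma s_T: "v \<in> V \<Longrightarrow> s (T v) = T (s v)"
proof -
  assume v: "v \<in> V"
  have "s (T v) = (\<Sum>i<m. c (int ((m - 1) * i)) *\<^sub>R (a\<^sub>e ^^ ((m - 1) * i)) (s v))"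
    unfolding T_def by (simp only: linear_sum[OF lin(4)] linear_cmul[OF lin(4)] s_pow[OF v] c_minus1)
  then show ?thesis using T_reindex[OF closed(4)[OF v] coprime_minus1] by simp
qed

lemma s_P: "v \<in> V \<Longrightarrow> s (P v) = P (s v)"
  unfolding P_def
  by (simp only: linear_sum[OF lin(4)] linear_cmul[OF lin(4)] s_pow P_reindex[OF closed(4) coprime_minus1])

lemma coprime_k: "coprime ((m - 1) * r) m"
  using co coprime_minus1 by simp

text \<open>The exponent stands for \<open>- r i\<close>: passing \<open>b\<close> across yields the
  factor \<open>r\<close> and replaces \<open>a\<^sub>e\<close> by \<open>a\<^sub>o\<close>, which
  is inverse to \<open>a\<^sub>e\<close> on such vectors.\<close>

lemma b_pow_W:
  assumes "v \<in> V" "a\<^sub>e (a\<^sub>o v) = v" "b v = v"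
  shows "b ((a\<^sub>e ^^ i) v) = (a\<^sub>e ^^ ((m - 1) * r * i)) v"
  using b_pow[OF assms(1)] ao_pow[OF assms(1,2)] assms(3) by (simp add: mult.assoc)

text \<open>Reindexing by \<open>- r\<close> restores the powers of \<open>a\<^sub>e\<close>, and
  \<open>c (- r i) = - c i\<close> produces the sign.\<close>

lemma b_T:
  assumes "v \<in> V" "a\<^sub>e (a\<^sub>o v) = v" "b v = v"
  shows "b (T v) = - T v"
proof -
  have "c (int ((m - 1) * r * i)) = - c (int i)" for i
    using c_minus1[of "r * i"] c(3)[of "int i"] by (simp add: mult.assoc)
  then have ci: "c (int i) = - c (int ((m - 1) * r * i))" for i by simp
  have "b (T v) = (\<Sum>i<m. c (int i) *\<^sub>R (a\<^sub>e ^^ ((m - 1) * r * i)) v)"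
    unfolding T_def by (simp only: linear_sum[OF lin(3)] linear_cmul[OF lin(3)] b_pow_W[OF assms])
  also have "\<dots> = - (\<Sum>i<m. c (int ((m - 1) * r * i)) *\<^sub>R (a\<^sub>e ^^ ((m - 1) * r * i)) v)"
    unfolding sum_negf[symmetric] by (rule sum.cong[OF HOL.refl]) (metis ci scaleR_minus_left)
  finally show ?thesis using T_reindex[OF assms(1) coprime_k] by simp
qed

lemma b_P:
  assumes "v \<in> V" "a\<^sub>e (a\<^sub>o v) = v" "b v = v"
  shows "b (P v) = P v"
  unfolding P_def
  by (simp only: linear_sum[OF lin(3)] linear_cmul[OF lin(3)] b_pow_W[OF assms] P_reindex[OF assms(1) coprime_k])

lemma A_T: "v \<in> V \<Longrightarrow> a\<^sub>e (a\<^sub>o v) = v \<Longrightarrow> a\<^sub>e (a\<^sub>o (T v)) = T v"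
proof -
  assume v: "v \<in> V" "a\<^sub>e (a\<^sub>o v) = v"
  have "a\<^sub>e (a\<^sub>o ((a\<^sub>e ^^ i) v)) = (a\<^sub>e ^^ i) v" for i
  proof -
    have "a\<^sub>e (a\<^sub>o ((a\<^sub>e ^^ i) v)) = (a\<^sub>e ^^ (Suc i)) (a\<^sub>o v)" using ao_ae_pow[OF v(1)] by simp
    also have "\<dots> = (a\<^sub>e ^^ i) (a\<^sub>e (a\<^sub>o v))" by (simp add: funpow_swap1)
    finally show ?thesis using v(2) by simp
  qed
  then show ?thesis
    unfolding T_def
    by (simp add: linear_sum[OF lin(1)] linear_cmul[OF lin(1)] linear_sum[OF lin(2)] linear_cmul[OF lin(2)])
qed

lemma P_pow: "v \<in> V \<Longrightarrow> P ((a\<^sub>e ^^ j) v) = P v"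
proof (induction j)
  case (Suc j)
  have "(\<Sum>i<m. (a\<^sub>e ^^ i) (a\<^sub>e u)) = (\<Sum>i<m. (a\<^sub>e ^^ i) u)" if u: "u \<in> V" for u
  proof -
    have "(\<Sum>i<m. (a\<^sub>e ^^ i) (a\<^sub>e u)) + (a\<^sub>e ^^ 0) u = (\<Sum>i<m. (a\<^sub>e ^^ Suc i) u) + (a\<^sub>e ^^ 0) u"
      by (simp add: funpow_swap1)
    also have "\<dots> = (\<Sum>i<Suc m. (a\<^sub>e ^^ i) u)"
      by (simp only: sum.lessThan_Suc_shift add.commute)
    also have "\<dots> = (\<Sum>i<m. (a\<^sub>e ^^ i) u) + u" using aem[OF u] by simp
    finally show ?thesis by simp
  qed
  from this[OF pow_V(1)[OF Suc.prems]] show ?case using Suc unfolding P_def by simp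
qed simp

lemma ae_P: "v \<in> V \<Longrightarrow> a\<^sub>e (P v) = P v"
proof -
  assume v: "v \<in> V"
  have "a\<^sub>e (P v) = P (a\<^sub>e v)"
    unfolding P_def by (simp add: linear_sum[OF lin(1)] linear_cmul[OF lin(1)] funpow_swap1)
  then show ?thesis using P_pow[OF v, of 1] by simp
qed

lemma ao_P: "v \<in> V \<Longrightarrow> a\<^sub>e (a\<^sub>o v) = v \<Longrightarrow> a\<^sub>o (P v) = P v"
proof -
  assume v: "v \<in> V" "a\<^sub>e (a\<^sub>o v) = v"
  have "a\<^sub>o (P v) = P (a\<^sub>o v)"
    unfolding P_def by (simp add: linear_sum[OF lin(2)] linear_cmul[OF lin(2)] ao_ae_pow[OF v(1)])
  then show ?thesis using ao_eq[OF v] P_pow[OF v(1)] by simp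
qed

lemma P_P: "v \<in> V \<Longrightarrow> P (P v) = P v"
proof -
  assume v: "v \<in> V"
  have "(a\<^sub>e ^^ i) (P v) = P v" for i by (induction i) (simp_all add: ae_P[OF v])
  then show ?thesis unfolding P_def[of "P v"] using m by (simp add: sum_constant_scaleR)
qed

text \<open>\<open>P\<close> absorbs every power of \<open>a\<^sub>e\<close>, so that only the sum
  of the coefficients remains.\<close>

lemma P_T: "v \<in> V \<Longrightarrow> P (T v) = 0"
proof -
  assume v: "v \<in> V"
  have "P (T v) = (\<Sum>i<m. c (int i)) *\<^sub>R P v"
    unfolding T_def
    by (simp add: linear_sum[OF linear_P] linear_cmul[OF linear_P] P_pow[OF v] scaleR_left.sum)
  then show ?thesis by (simp add: c(4))
qed

lemma P_delta: "v \<in> V \<Longrightarrow> P (\<delta> v) = \<delta> (P v)"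
proof -
  assume v: "v \<in> V"
  have "\<delta> ((a\<^sub>e ^^ i) v) = (a\<^sub>e ^^ i) (\<delta> v)" for i
    by (induction i) (simp_all add: \<delta>a(1) pow_V(1)[OF v])
  then show ?thesis unfolding P_def by (simp add: linear_sum[OF lin(5)] linear_cmul[OF lin(5)])
qed

text \<open>Composition of two such sums is cyclic convolution of their coefficients. The delta
  function in \<open>c(5)\<close> contributes the identity and the constant \<open>1 / m\<close>
  contributes \<open>P\<close>; thus \<open>T\<close> is an involution on the kernel of
  \<open>P\<close>.\<close>

lemma T_T: "v \<in> V \<Longrightarrow> T (T v) = v - P v"
proof -
  assume v: "v \<in> V"
  have "T (T v) = (\<Sum>i<m. \<Sum>j<m. (c (int i) * c (int j)) *\<^sub>R (a\<^sub>e ^^ (i + j)) v)"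
    unfolding T_def
    by (simp add: linear_sum[OF linear_pow(1)] linear_cmul[OF linear_pow(1)] scaleR_sum_right pow_pow)
  also have "\<dots> = (\<Sum>i<m. \<Sum>k<m. (c (int i) * c (int k - int i)) *\<^sub>R (a\<^sub>e ^^ k) v)"
  proof (rule sum.cong[OF HOL.refl])
    fix i assume i: "i \<in> {..<m}"
    define h where "h = (\<lambda>k. (c (int i) * c (int k - int i)) *\<^sub>R (a\<^sub>e ^^ k) v)"
    have bij: "bij_betw (\<lambda>j. (i + j) mod m) {..<m} {..<m}"
    proof -
      have inj: "inj_on (\<lambda>j. (i + j) mod m) {..<m}"
      proof (rule inj_onI)
        fix j j' assume j: "j \<in> {..<m}" "j' \<in> {..<m}" "(i + j) mod m = (i + j') mod m"
        then have "[i + j = i + j'] (mod m)" by (simp add: cong_def)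
        then have "[j = j'] (mod m)" by (simp only: cong_add_lcancel_nat)
        then show "j = j'" using j by (simp add: cong_def)
      qed
      moreover have "(\<lambda>j. (i + j) mod m) ` {..<m} \<subseteq> {..<m}" using m by auto
      ultimately show ?thesis
        unfolding bij_betw_def by (metis card_image card_subset_eq finite_lessThan)
    qed
    have "h ((i + j) mod m) = (c (int i) * c (int j)) *\<^sub>R (a\<^sub>e ^^ (i + j)) v" for j
    proof -
      have "int m dvd int ((i + j) mod m) - int i - int j"
        by (simp add: of_nat_mod minus_mod_eq_div_mult[symmetric] dvd_eq_mod_eq_0 mod_diff_left_eq diff_diff_eq)
      then have "c (int ((i + j) mod m) - int i) = c (int j)" by (rule c(1))
      then show ?thesis unfolding h_def using pow_mod[OF v, of "i + j"] by simp
    qed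
    then show "(\<Sum>j<m. (c (int i) * c (int j)) *\<^sub>R (a\<^sub>e ^^ (i + j)) v) = (\<Sum>k<m. (c (int i) * c (int k - int i)) *\<^sub>R (a\<^sub>e ^^ k) v)"
      using sum.reindex_bij_betw[OF bij, of h] unfolding h_def by simp
  qed
  also have "\<dots> = (\<Sum>k<m. (\<Sum>i<m. c (int i) * c (int k - int i)) *\<^sub>R (a\<^sub>e ^^ k) v)"
    by (subst sum.swap) (simp add: scaleR_left.sum)
  also have "\<dots> = (\<Sum>k<m. (if k = 0 then 1 else 0) *\<^sub>R (a\<^sub>e ^^ k) v - (1 / real m) *\<^sub>R (a\<^sub>e ^^ k) v)"
  proof (rule sum.cong[OF HOL.refl])
    fix k assume "k \<in> {..<m}"
    then have "int m dvd int k \<longleftrightarrow> k = 0" by (auto simp: nat_dvd_not_less)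
    then show "(\<Sum>i<m. c (int i) * c (int k - int i)) *\<^sub>R (a\<^sub>e ^^ k) v =
        (if k = 0 then 1 else 0) *\<^sub>R (a\<^sub>e ^^ k) v - (1 / real m) *\<^sub>R (a\<^sub>e ^^ k) v"
      unfolding c(5) by (simp add: scaleR_diff_left)
  qed
  also have "\<dots> = v - P v"
  proof -
    have "(\<Sum>k<m. (if k = 0 then 1 else 0) *\<^sub>R (a\<^sub>e ^^ k) v) = (\<Sum>k<m. if k = 0 then v else 0)"
      by (intro sum.cong) auto
    also have "\<dots> = v" using m by (simp add: sum.delta)
    finally show ?thesis unfolding sum_subtractf P_def scaleR_sum_right by simp
  qed
  finally show ?thesis .
qed

text \<open>As \<open>s\<close> commutes with \<open>b\<close> and inverts \<open>a\<^sub>e\<close>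
  and \<open>a\<^sub>o\<close>, it preserves the invariants of the first group, which split into its
  two eigenspaces.\<close>

lemma F1_parts:
  assumes "v \<in> F1"
  shows "(1 / 2) *\<^sub>R (v + s v) \<in> F1" "s ((1 / 2) *\<^sub>R (v + s v)) = (1 / 2) *\<^sub>R (v + s v)"
    "(1 / 2) *\<^sub>R (v - s v) \<in> W"
proof -
  have v: "v \<in> V" "a\<^sub>e (a\<^sub>o v) = v" "b v = v" using assms by (auto simp: F1_def)
  have sv: "s v \<in> V" "b (s v) = s v" using closed v sb[OF v(1)] by auto
  \<comment> \<open>Writing \<open>v\<close> as \<open>a\<^sub>o (a\<^sub>e v)\<close> under
    \<open>s\<close> lets both outer maps cancel.\<close>
  have asv: "a\<^sub>e (a\<^sub>o (s v)) = s v"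
  proof -
    have "a\<^sub>e (a\<^sub>o (s v)) = a\<^sub>e (a\<^sub>o (s (a\<^sub>o (a\<^sub>e v))))" using v(2) comm[OF v(1)] by simp
    also have "\<dots> = s v" using asa closed(1) v(1) by simp
    finally show ?thesis .
  qed
  have half: "(1 / 2) *\<^sub>R (v + s v) \<in> V" "(1 / 2) *\<^sub>R (v - s v) \<in> V"
    using V v(1) sv(1) by (auto intro!: subspace_scale subspace_add subspace_diff)
  note add = linear_add[OF lin(1)] linear_add[OF lin(2)] linear_add[OF lin(3)] linear_add[OF lin(4)]
    and diff = linear_diff[OF lin(1)] linear_diff[OF lin(2)] linear_diff[OF lin(3)] linear_diff[OF lin(4)]
    and cmul = linear_cmul[OF lin(1)] linear_cmul[OF lin(2)] linear_cmul[OF lin(3)] linear_cmul[OF lin(4)]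
  show "(1 / 2) *\<^sub>R (v + s v) \<in> F1"
    unfolding F1_def using half v sv asv by (simp add: add cmul)
  show "s ((1 / 2) *\<^sub>R (v + s v)) = (1 / 2) *\<^sub>R (v + s v)"
    using ss[OF v(1)] by (simp add: add cmul add.commute)
  show "(1 / 2) *\<^sub>R (v - s v) \<in> W"
    unfolding W_def using half v sv asv ss[OF v(1)]
    by (simp add: diff cmul scaleR_minus_right[symmetric] del: scaleR_minus_right)
qed

text \<open>For vectors with \<open>s u = - u\<close> membership in \<open>F2\<close> demands
  \<open>b u = - u\<close>. For \<open>T w\<close> the sign comes from \<open>c\<close>; for
  \<open>\<delta> (P w)\<close> it comes from \<open>b \<delta> = \<delta> b s\<close> together with
  \<open>s = -1\<close>.\<close>

lemma W_image:
  assumes "w \<in> W"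
  shows "T w + \<delta> (P w) \<in> F2" "s (T w + \<delta> (P w)) = - (T w + \<delta> (P w))"
proof -
  have w: "w \<in> V" "a\<^sub>e (a\<^sub>o w) = w" "b w = w" "s w = - w" using assms by (auto simp: W_def)
  note Pw = P_V[OF w(1)] and Tw = T_V[OF w(1)]
  have Pa: "a\<^sub>e (P w) = P w" "a\<^sub>o (P w) = P w" "b (P w) = P w" "s (P w) = - P w"
    using ae_P[OF w(1)] ao_P[OF w(1,2)] b_P[OF w(1-3)] s_P[OF w(1)] w(4) linear_neg[OF linear_P] by auto
  have sT: "s (T w) = - T w" using s_T[OF w(1)] w(4) linear_neg[OF linear_T] by simp
  have s\<delta>P: "s (\<delta> (P w)) = - \<delta> (P w)" using s\<delta>[OF Pw] Pa(4) linear_neg[OF lin(5)] by simp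
  show sneg: "s (T w + \<delta> (P w)) = - (T w + \<delta> (P w))"
    using sT s\<delta>P linear_add[OF lin(4)] by simp
  have b\<delta>P: "b (\<delta> (P w)) = - \<delta> (P w)"
    using b\<delta>[OF Pw] Pa(3,4) linear_neg[OF lin(5)] linear_neg[OF lin(3)] by simp
  \<comment> \<open>Here \<open>a\<^sub>o\<close> fixes \<open>P w\<close>, so the relation
    \<open>a\<^sub>o \<delta> a\<^sub>o = \<delta>\<close> says that it fixes
    \<open>\<delta> (P w)\<close> too.\<close>
  have A\<delta>P: "a\<^sub>e (a\<^sub>o (\<delta> (P w))) = \<delta> (P w)"
    using \<delta>a(2)[OF Pw] \<delta>a(1)[OF Pw] Pa by simp
  show "T w + \<delta> (P w) \<in> F2"
    unfolding F2_def mem_Collect_eq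
  proof (intro conjI)
    show "T w + \<delta> (P w) \<in> V" using V Tw Pw closed(5) by (auto intro: subspace_add)
    show "a\<^sub>e (a\<^sub>o (T w + \<delta> (P w))) = T w + \<delta> (P w)"
      using A_T[OF w(1,2)] A\<delta>P by (simp add: linear_add[OF lin(1)] linear_add[OF lin(2)])
    show "b (s (T w + \<delta> (P w))) = T w + \<delta> (P w)"
      unfolding sneg using b_T[OF w(1-3)] b\<delta>P
      by (simp add: linear_neg[OF lin(3)] linear_add[OF lin(3)] linear_diff[OF lin(3)])
  qed
qed

text \<open>Applying \<open>P\<close> removes \<open>T w\<close> and keeps
  \<open>\<delta> (P w)\<close>, so both summands vanish separately; then
  \<open>T (T w) = w - P w\<close> recovers \<open>w\<close>.\<close>

lemma W_injective:
  assumes w: "w \<in> W" and 0: "T w + \<delta> (P w) = 0"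
  shows "w = 0"
proof -
  have wV: "w \<in> V" using w by (simp add: W_def)
  have "P (T w) + P (\<delta> (P w)) = 0"
    using linear_add[OF linear_P, of "T w" "\<delta> (P w)"] 0 linear_0[OF linear_P] by simp
  then have "\<delta> (P w) = 0" using P_T[OF wV] P_delta[OF P_V[OF wV]] P_P[OF wV] by simp
  moreover from this have "P w = 0" using \<delta>\<delta>[OF P_V[OF wV]] linear_0[OF lin(5)] by metis
  ultimately have "T w = 0" using 0 by simp
  then have "T (T w) = 0" using linear_0[OF linear_T] by simp
  then show ?thesis using T_T[OF wV] \<open>P w = 0\<close> by simp
qed

text \<open>Where \<open>s\<close> is trivial, \<open>b\<close> and \<open>b s\<close> have the same
  fixed vectors, so only the other eigenspace of \<open>s\<close> has to be moved.\<close>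

theorem Psi_F2: "v \<in> F1 \<Longrightarrow> \<Psi> v \<in> F2"
proof -
  assume v: "v \<in> F1"
  note p = F1_parts[OF v] and q = W_image[OF F1_parts(3)[OF v]]
  have "(1 / 2) *\<^sub>R (v + s v) \<in> F2"
    using p(1,2) unfolding F1_def F2_def by simp
  moreover have "x + y \<in> F2" if "x \<in> F2" "y \<in> F2" for x y
    using that V unfolding F2_def
    by (simp add: subspace_add linear_add[OF lin(1)] linear_add[OF lin(2)] linear_add[OF lin(3)] linear_add[OF lin(4)])
  ultimately show ?thesis unfolding \<Psi>_def using q(1) by blast
qed

text \<open>The two summands of \<open>\<Psi> v\<close> belong to different eigenvalues of
  \<open>s\<close>, so both vanish if their sum does.\<close>

theorem Psi_injective: "v \<in> F1 \<Longrightarrow> \<Psi> v = 0 \<Longrightarrow> v = 0"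
proof -
  assume v: "v \<in> F1" and 0: "\<Psi> v = 0"
  note p = F1_parts[OF v] and q = W_image[OF F1_parts(3)[OF v]]
  define u w where "u = (1 / 2) *\<^sub>R (v + s v)" and "w = (1 / 2) *\<^sub>R (v - s v)"
  define z where "z = T w + \<delta> (P w)"
  have uz: "u + z = 0" using 0 unfolding \<Psi>_def u_def z_def w_def .
  have "s (u + z) = u - z"
    using p(2) q(2) linear_add[OF lin(4), of u z] unfolding u_def[symmetric] w_def[symmetric] z_def[symmetric] by simp
  then have "u - z = 0" using uz linear_0[OF lin(4)] by simp
  then have "u = z" by simp
  then have "u = 0" using uz by (simp add: scaleR_2[symmetric])
  then have "z = 0" using uz by simp
  then have "w = 0" using W_injective[OF p(3)] unfolding z_def w_def by blast
  have "v = u + w" unfolding u_def w_def scaleR_add_right[symmetric] by (simp add: scaleR_2[symmetric])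
  then show "v = 0" using \<open>u = 0\<close> \<open>w = 0\<close> by simp
qed

end

section \<open>Calculus of smooth functions\<close>

definition pd :: "'k::finite \<Rightarrow> (real^'k \<Rightarrow> 'b::real_normed_vector) \<Rightarrow> real^'k \<Rightarrow> 'b" where
  "pd i f = (\<lambda>x. frechet_derivative f (at x) (axis i 1))"

text \<open>All partial derivatives of order at most \<open>n\<close> are differentiable on
  \<open>V\<close>. In \<open>pderivs\<close> the head of the list is differentiated last; here the
  recursion differentiates \<open>f\<close> itself first, which suits inductions with
  \<open>f\<close> arbitrary, as in the product and chain rules.\<close>

primrec cn :: "nat \<Rightarrow> (real^'k::finite) set \<Rightarrow> (real^'k \<Rightarrow> 'b::real_normed_vector) \<Rightarrow> bool" where
  "cn 0 V f \<longleftrightarrow> (\<forall>x\<in>V. f differentiable (at x))"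
| "cn (Suc n) V f \<longleftrightarrow> (\<forall>x\<in>V. f differentiable (at x)) \<and> (\<forall>i. cn n V (pd i f))"

lemma pderivs_snoc: "pderivs (w @ [i]) f = pderivs w (pd i f)"
  by (induction w) (auto simp: pd_def)

lemma cn_iff_pderivs:
  "cn n V f \<longleftrightarrow> (\<forall>w. length w \<le> n \<longrightarrow> (\<forall>x\<in>V. pderivs w f differentiable (at x)))"
proof (induction n arbitrary: f)
  case 0
  then show ?case by auto
next
  case (Suc n)
  show ?case
  proof
    assume c: "cn (Suc n) V f"
    show "\<forall>w. length w \<le> Suc n \<longrightarrow> (\<forall>x\<in>V. pderivs w f differentiable (at x))"
    proof (intro allI impI)
      fix w :: "'a list" assume w: "length w \<le> Suc n"
      show "\<forall>x\<in>V. pderivs w f differentiable (at x)"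
      proof (cases w rule: rev_cases)
        case Nil
        then show ?thesis using c by simp
      next
        case (snoc w' i)
        then show ?thesis using c w Suc.IH by (auto simp: pderivs_snoc)
      qed
    qed
  next
    assume c: "\<forall>w. length w \<le> Suc n \<longrightarrow> (\<forall>x\<in>V. pderivs w f differentiable (at x))"
    have "cn n V (pd i f)" for i
      unfolding Suc.IH
    proof (intro allI impI)
      fix w :: "'a list" assume "length w \<le> n"
      then have "length (w @ [i]) \<le> Suc n" by simp
      then show "\<forall>x\<in>V. pderivs w (pd i f) differentiable (at x)"
        using c by (metis pderivs_snoc)
    qed
    moreover have "\<forall>x\<in>V. f differentiable (at x)"
      using c[rule_format, of "[]"] by simp
    ultimately show "cn (Suc n) V f" by simp
  qed
qed

lemma smooth_on_iff_cn: "smooth_on V f \<longleftrightarrow> (\<forall>n. cn n V f)"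
  unfolding smooth_on_def cn_iff_pderivs by blast

lemma smooth_on_pd: "smooth_on V f \<Longrightarrow> smooth_on V (pd i f)"
  unfolding smooth_on_iff_cn by (metis cn.simps(2))

lemma smooth_on_subset: "smooth_on V f \<Longrightarrow> W \<subseteq> V \<Longrightarrow> smooth_on W f"
  unfolding smooth_on_def by blast

lemma smooth_on_locally: "(\<And>x. x \<in> V \<Longrightarrow> \<exists>W. x \<in> W \<and> smooth_on W f) \<Longrightarrow> smooth_on V f"
  unfolding smooth_on_def by blast

lemma cn_differentiable: "cn n V f \<Longrightarrow> x \<in> V \<Longrightarrow> f differentiable (at x)"
  by (cases n) auto

lemma smooth_on_differentiable: "smooth_on V f \<Longrightarrow> x \<in> V \<Longrightarrow> f differentiable (at x)"
  unfolding smooth_on_iff_cn using cn_differentiable by blast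

lemma smooth_on_has_derivative:
  "smooth_on V f \<Longrightarrow> x \<in> V \<Longrightarrow> (f has_derivative frechet_derivative f (at x)) (at x)"
  using smooth_on_differentiable frechet_derivative_works by blast

lemma smooth_on_continuous_on: "smooth_on V f \<Longrightarrow> continuous_on V f"
  by (meson continuous_at_imp_continuous_on differentiable_imp_continuous_within
      smooth_on_differentiable)

lemma cn_Suc_imp: "cn (Suc n) V f \<Longrightarrow> cn n V f"
  unfolding cn_iff_pderivs by auto

text \<open>\<open>frechet_derivative\<close> is a choice among all derivatives, and both functions
  have the same derivatives at \<open>x\<close>; so the choices agree even where there is
  none.\<close>

lemma frechet_derivative_cong:
  assumes "open V" "x \<in> V" "\<And>y. y \<in> V \<Longrightarrow> f y = g y"
  shows "frechet_derivative f (at x) = frechet_derivative g (at x)"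
proof -
  have "(f has_derivative f') (at x) \<longleftrightarrow> (g has_derivative f') (at x)" for f'
    using assms has_derivative_transform_within_open[of f f' x UNIV V g]
      has_derivative_transform_within_open[of g f' x UNIV V f] by auto
  then show ?thesis unfolding frechet_derivative_def by simp
qed

lemma differentiable_cong:
  assumes "open V" "x \<in> V" "\<And>y. y \<in> V \<Longrightarrow> f y = g y" "f differentiable (at x)"
  shows "g differentiable (at x)"
  using assms has_derivative_transform_within_open unfolding differentiable_def by blast

lemma pd_cong:
  assumes "open V" "x \<in> V" "\<And>y. y \<in> V \<Longrightarrow> f y = g y"
  shows "pd i f x = pd i g x"
  unfolding pd_def using frechet_derivative_cong[OF assms] by simp

lemma cn_cong:
  assumes "open V" "\<And>y. y \<in> V \<Longrightarrow> f y = g y" "cn n V f"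
  shows "cn n V g"
  using assms(2,3)
proof (induction n arbitrary: f g)
  case 0
  then show ?case using differentiable_cong[OF assms(1)] by (metis cn.simps(1))
next
  case (Suc n)
  have "cn n V (pd i g)" for i
  proof (rule Suc.IH)
    show "pd i f y = pd i g y" if "y \<in> V" for y
      using pd_cong[OF assms(1) that] Suc.prems by blast
    show "cn n V (pd i f)" using Suc.prems by simp
  qed
  then show ?case using Suc.prems differentiable_cong[OF assms(1)] by (metis cn.simps(2))
qed

text \<open>The way to raise the order: an explicit derivative is given, and only its values on the
  coordinate directions have to be of order \<open>n\<close>.\<close>

lemma cn_SucI:
  assumes V: "open V" and d: "\<And>x. x \<in> V \<Longrightarrow> (f has_derivative f' x) (at x)"
    and F: "\<And>i. cn n V (\<lambda>x. f' x (axis i 1))"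
  shows "cn (Suc n) V f"
proof -
  have "f' x (axis i 1) = pd i f x" if "x \<in> V" for i x
    unfolding pd_def using frechet_derivative_at[OF d[OF that]] by metis
  then have "cn n V (pd i f)" for i
    by (rule cn_cong[OF V _ F])
  then show ?thesis using Derivative.differentiableI[OF d] by simp
qed

lemma cn_Suc_has_derivative:
  "cn (Suc n) V f \<Longrightarrow> x \<in> V \<Longrightarrow> (f has_derivative frechet_derivative f (at x)) (at x)"
  using frechet_derivative_works by auto

lemma cn_Suc_pd: "cn (Suc n) V f \<Longrightarrow> cn n V (\<lambda>x. frechet_derivative f (at x) (axis i 1))"
  by (simp add: pd_def)

lemma smooth_on_cong:
  assumes "open V" "\<And>y. y \<in> V \<Longrightarrow> f y = g y" "smooth_on V f"
  shows "smooth_on V g"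
  using assms cn_cong unfolding smooth_on_iff_cn by blast

lemma pderivs_cong:
  assumes "open V" "\<And>y. y \<in> V \<Longrightarrow> f y = g y" "x \<in> V"
  shows "pderivs w f x = pderivs w g x"
  using assms(3)
proof (induction w arbitrary: x)
  case (Cons i w)
  then show ?case using frechet_derivative_cong[OF assms(1), of x "pderivs w f" "pderivs w g"] by simp
qed (simp add: assms(2))

lemma pd_eq: "(f has_derivative f') (at x) \<Longrightarrow> pd i f x = f' (axis i 1)"
  unfolding pd_def using frechet_derivative_at by metis

lemma cn_bounded_linear:
  assumes L: "bounded_linear L" and V: "open V" and f: "cn n V f"
  shows "cn n V (\<lambda>x. L (f x))"
  using f
proof (induction n arbitrary: f)
  case 0
  then show ?case
    by (auto intro!: Derivative.differentiableI[OF bounded_linear.has_derivative[OF L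
            frechet_derivative_works[THEN iffD1]]])
next
  case (Suc n)
  show ?case
    by (rule cn_SucI[OF V bounded_linear.has_derivative[OF L cn_Suc_has_derivative[OF Suc.prems]]])
      (assumption | intro Suc.IH cn_Suc_pd[OF Suc.prems])+
qed

lemma cn_add:
  assumes V: "open V" and "cn n V f" "cn n V g"
  shows "cn n V (\<lambda>x. f x + g x)"
  using assms(2,3)
proof (induction n arbitrary: f g)
  case (Suc n)
  show ?case
    by (rule cn_SucI[OF V has_derivative_add[OF cn_Suc_has_derivative[OF Suc.prems(1)]
            cn_Suc_has_derivative[OF Suc.prems(2)]]])
      (assumption | intro Suc.IH cn_Suc_pd[OF Suc.prems(1)] cn_Suc_pd[OF Suc.prems(2)])+
qed auto

lemma cn_const: "cn n V (\<lambda>x. c)"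
proof (induction n arbitrary: c)
  case (Suc n)
  have "pd i (\<lambda>x. c) = (\<lambda>x. 0)" for i :: 'a unfolding pd_def by simp
  then show ?case using Suc by simp
qed auto

lemma cn_ident: "cn n V (\<lambda>x. x)"
proof (cases n)
  case (Suc m)
  have "pd i (\<lambda>x. x) = (\<lambda>x. axis i 1)" for i :: 'a unfolding pd_def by simp
  then show ?thesis using Suc cn_const by auto
qed auto

lemma cn_bilinear:
  assumes V: "open V" and b: "bounded_bilinear h" and "cn n V f" "cn n V g"
  shows "cn n V (\<lambda>x. h (f x) (g x))"
  using assms(3,4)
proof (induction n arbitrary: f g)
  case 0
  then show ?case
    by (auto intro!: Derivative.differentiableI[OF bounded_bilinear.FDERIV[OF b
            frechet_derivative_works[THEN iffD1] frechet_derivative_works[THEN iffD1]]])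
next
  case (Suc n)
  show ?case
    by (rule cn_SucI[OF V bounded_bilinear.FDERIV[OF b cn_Suc_has_derivative[OF Suc.prems(1)]
            cn_Suc_has_derivative[OF Suc.prems(2)]]])
      (assumption | intro cn_add[OF V] Suc.IH cn_Suc_pd[OF Suc.prems(1)] cn_Suc_pd[OF Suc.prems(2)]
        cn_Suc_imp[OF Suc.prems(1)] cn_Suc_imp[OF Suc.prems(2)])+
qed

lemma cn_sum:
  assumes V: "open V" and "\<And>a. a \<in> A \<Longrightarrow> cn n V (f a)"
  shows "cn n V (\<lambda>x. \<Sum>a\<in>A. f a x)"
proof (cases "finite A")
  case True
  then show ?thesis using assms(2)
    by (induction A rule: finite_induct) (auto intro!: cn_const cn_add[OF V])
qed (auto intro: cn_const)

lemma cn_prod: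
  fixes f :: "'i \<Rightarrow> real^'k::finite \<Rightarrow> real"
  assumes V: "open V" and "\<And>a. a \<in> A \<Longrightarrow> cn n V (f a)"
  shows "cn n V (\<lambda>x. \<Prod>a\<in>A. f a x)"
proof (cases "finite A")
  case True
  then show ?thesis using assms(2)
    by (induction A rule: finite_induct)
      (auto intro!: cn_const cn_bilinear[OF V bounded_bilinear_mult])
qed (auto intro: cn_const)

lemma frechet_derivative_axis_sum:
  assumes "f differentiable (at x)"
  shows "frechet_derivative f (at x) u = (\<Sum>j\<in>UNIV. vec_nth u j *\<^sub>R pd j f x)"
proof -
  have l: "linear (frechet_derivative f (at x))" using linear_frechet_derivative[OF assms] .
  have "u = (\<Sum>j\<in>UNIV. vec_nth u j *\<^sub>R axis j 1)"
    by (simp add: basis_expansion scalar_mult_eq_scaleR[symmetric])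
  then have "frechet_derivative f (at x) u = frechet_derivative f (at x) (\<Sum>j\<in>UNIV. vec_nth u j *\<^sub>R axis j 1)"
    by simp
  also have "\<dots> = (\<Sum>j\<in>UNIV. vec_nth u j *\<^sub>R pd j f x)"
    unfolding pd_def by (simp add: linear_sum[OF l] linear_cmul[OF l])
  finally show ?thesis .
qed

lemma cn_compose:
  fixes f :: "real^'a::finite \<Rightarrow> 'b::real_normed_vector" and h :: "real^'c::finite \<Rightarrow> real^'a"
  assumes V: "open V" and hV: "h ` V \<subseteq> U" and "cn n U f" "cn n V h"
  shows "cn n V (\<lambda>x. f (h x))"
  using assms(3,4)
proof (induction n arbitrary: f)
  case 0
  then show ?case using hV differentiable_chain_at[of h _ f] by (auto simp: o_def image_subset_iff)
next
  case (Suc n)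
  have d: "f differentiable (at (h x))" "h differentiable (at x)" if "x \<in> V" for x
    using that Suc.prems hV by auto
  have hd: "(h has_derivative frechet_derivative h (at x)) (at x)" if "x \<in> V" for x
    using d(2)[OF that] frechet_derivative_works by blast
  \<comment> \<open>The derivative is expanded in coordinates of the inner map, so that the
    induction hypothesis can be applied to each \<open>pd j f\<close> composed with
    \<open>h\<close>.\<close>
  have chain: "((\<lambda>x. f (h x)) has_derivative
      (\<lambda>u. \<Sum>j\<in>UNIV. vec_nth (frechet_derivative h (at x) u) j *\<^sub>R pd j f (h x))) (at x)"
    if "x \<in> V" for x
  proof -
    have "((f \<circ> h) has_derivative (frechet_derivative f (at (h x)) \<circ> frechet_derivative h (at x))) (at x)"
      using d(1)[OF that] frechet_derivative_works by (intro diff_chain_at hd that) blast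
    then show ?thesis
      by (simp add: o_def frechet_derivative_axis_sum[OF d(1)[OF that]])
  qed
  show ?case
  proof (rule cn_SucI[OF V chain], assumption, intro cn_sum[OF V] cn_bilinear[OF V bounded_bilinear_scaleR])
    show "cn n V (\<lambda>x. vec_nth (frechet_derivative h (at x) (axis i 1)) j)" for i j
      by (rule cn_bounded_linear[OF bounded_linear_vec_nth V cn_Suc_pd[OF Suc.prems(2)]])
    show "cn n V (\<lambda>x. pd j f (h x))" for j
      by (rule Suc.IH) (use Suc.prems cn_Suc_imp in auto)
  qed
qed

lemma cn_inverse:
  fixes f :: "real^'k::finite \<Rightarrow> real"
  assumes V: "open V" and nz: "\<And>x. x \<in> V \<Longrightarrow> f x \<noteq> 0" and "cn n V f"
  shows "cn n V (\<lambda>x. inverse (f x))"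
  using assms(3)
proof (induction n)
  case 0
  then show ?case using nz by (auto intro!: differentiable_inverse)
next
  case (Suc n)
  have IH: "cn n V (\<lambda>x. inverse (f x))" using Suc cn_Suc_imp by blast
  show ?case
    by (rule cn_SucI[OF V Deriv.has_derivative_inverse[OF nz cn_Suc_has_derivative[OF Suc.prems]]])
      (intro cn_bounded_linear[OF bounded_linear_minus[OF bounded_linear_ident] V]
        cn_bilinear[OF V bounded_bilinear_mult] IH cn_Suc_pd[OF Suc.prems] nz | assumption)+
qed

lemma smooth_on_bounded_linear:
  "bounded_linear L \<Longrightarrow> open V \<Longrightarrow> smooth_on V f \<Longrightarrow> smooth_on V (\<lambda>x. L (f x))"
  unfolding smooth_on_iff_cn using cn_bounded_linear by blast

lemma smooth_on_add:
  "open V \<Longrightarrow> smooth_on V f \<Longrightarrow> smooth_on V g \<Longrightarrow> smooth_on V (\<lambda>x. f x + g x)"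
  unfolding smooth_on_iff_cn using cn_add by blast

lemma smooth_on_const: "smooth_on V (\<lambda>x. c)"
  unfolding smooth_on_iff_cn using cn_const by blast

lemma smooth_on_ident: "smooth_on V (\<lambda>x. x)"
  unfolding smooth_on_iff_cn using cn_ident by blast

lemma smooth_on_bilinear:
  "bounded_bilinear h \<Longrightarrow> open V \<Longrightarrow> smooth_on V f \<Longrightarrow> smooth_on V g \<Longrightarrow>
    smooth_on V (\<lambda>x. h (f x) (g x))"
  unfolding smooth_on_iff_cn using cn_bilinear by blast

lemmas smooth_on_mult = smooth_on_bilinear[OF bounded_bilinear_mult]
lemmas smooth_on_scaleR = smooth_on_bilinear[OF bounded_bilinear_scaleR]
lemmas smooth_on_inner = smooth_on_bilinear[OF bounded_bilinear_inner]

lemma smooth_on_sum: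
  "open V \<Longrightarrow> (\<And>a. a \<in> A \<Longrightarrow> smooth_on V (f a)) \<Longrightarrow> smooth_on V (\<lambda>x. \<Sum>a\<in>A. f a x)"
  unfolding smooth_on_iff_cn by (blast intro: cn_sum)

lemma smooth_on_prod:
  fixes f :: "'i \<Rightarrow> real^'k::finite \<Rightarrow> real"
  shows "open V \<Longrightarrow> (\<And>a. a \<in> A \<Longrightarrow> smooth_on V (f a)) \<Longrightarrow> smooth_on V (\<lambda>x. \<Prod>a\<in>A. f a x)"
  unfolding smooth_on_iff_cn by (blast intro: cn_prod)

lemma smooth_on_compose:
  fixes f :: "real^'a::finite \<Rightarrow> 'b::real_normed_vector" and h :: "real^'c::finite \<Rightarrow> real^'a"
  shows "open V \<Longrightarrow> h ` V \<subseteq> U \<Longrightarrow> smooth_on U f \<Longrightarrow> smooth_on V h \<Longrightarrow> smooth_on V (\<lambda>x. f (h x))"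
  unfolding smooth_on_iff_cn using cn_compose by blast

lemma smooth_on_inverse:
  fixes f :: "real^'k::finite \<Rightarrow> real"
  shows "open V \<Longrightarrow> (\<And>x. x \<in> V \<Longrightarrow> f x \<noteq> 0) \<Longrightarrow> smooth_on V f \<Longrightarrow> smooth_on V (\<lambda>x. inverse (f x))"
  unfolding smooth_on_iff_cn using cn_inverse by blast

lemma smooth_on_minus: "open V \<Longrightarrow> smooth_on V f \<Longrightarrow> smooth_on V (\<lambda>x. - f x)"
  using smooth_on_bounded_linear[OF bounded_linear_minus[OF bounded_linear_ident]] .

lemma smooth_on_divide:
  fixes f g :: "real^'k::finite \<Rightarrow> real"
  assumes "open V" "\<And>x. x \<in> V \<Longrightarrow> g x \<noteq> 0" "smooth_on V f" "smooth_on V g"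
  shows "smooth_on V (\<lambda>x. f x / g x)"
  unfolding divide_inverse using assms by (intro smooth_on_mult smooth_on_inverse)

lemma smooth_on_vec_nth:
  assumes "open V" "smooth_on V f"
  shows "smooth_on V (\<lambda>x. vec_nth (f x) i)"
  using smooth_on_bounded_linear[OF bounded_linear_vec_nth assms] .

lemma smooth_on_componentwise:
  fixes f :: "real^'a::finite \<Rightarrow> real^'b::finite"
  assumes "open V" "\<And>i. smooth_on V (\<lambda>x. vec_nth (f x) i)"
  shows "smooth_on V f"
proof (rule smooth_on_cong[OF assms(1)])
  show "(\<Sum>i\<in>UNIV. vec_nth (f x) i *\<^sub>R axis i 1) = f x" for x
    by (simp add: basis_expansion scalar_mult_eq_scaleR[symmetric])
  show "smooth_on V (\<lambda>x. \<Sum>i\<in>UNIV. vec_nth (f x) i *\<^sub>R axis i (1::real))"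
    using assms by (intro smooth_on_sum smooth_on_scaleR smooth_on_const)
qed

lemma smooth_on_det:
  fixes F :: "real^'a::finite \<Rightarrow> real^'b^'b::finite"
  assumes "open V" "\<And>i j. smooth_on V (\<lambda>x. vec_nth (vec_nth (F x) i) j)"
  shows "smooth_on V (\<lambda>x. Determinants.det (F x))"
  unfolding Determinants.det_def
  using assms by (intro smooth_on_sum smooth_on_mult smooth_on_const smooth_on_prod)

lemma smooth_on_pderivs_add:
  assumes V: "open V" and f: "smooth_on V f" and g: "smooth_on V g" and x: "x \<in> V"
  shows "pderivs w (\<lambda>x. f x + g x) x = pderivs w f x + pderivs w g x"
  using f g x
proof (induction w arbitrary: f g x rule: rev_induct)
  case (snoc i w)
  have "pd i (\<lambda>x. f x + g x) y = pd i f y + pd i g y" if "y \<in> V" for y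
    using pd_eq[OF has_derivative_add[OF smooth_on_has_derivative[OF snoc.prems(1) that]
          smooth_on_has_derivative[OF snoc.prems(2) that]]] by (simp add: pd_def)
  then have "pderivs w (pd i (\<lambda>x. f x + g x)) x = pderivs w (\<lambda>y. pd i f y + pd i g y) x"
    by (rule pderivs_cong[OF V _ snoc.prems(3)])
  also have "\<dots> = pderivs w (pd i f) x + pderivs w (pd i g) x"
    by (rule snoc.IH) (use snoc.prems smooth_on_pd in auto)
  finally show ?case by (simp add: pderivs_snoc)
qed simp

lemma smooth_on_pderivs_cmult:
  fixes f :: "real^'k::finite \<Rightarrow> real"
  assumes V: "open V" and f: "smooth_on V f" and x: "x \<in> V"
  shows "pderivs w (\<lambda>x. c * f x) x = c * pderivs w f x"
  using f x
proof (induction w arbitrary: f x rule: rev_induct)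
  case (snoc i w)
  have "pd i (\<lambda>x. c * f x) y = c * pd i f y" if "y \<in> V" for y
    using pd_eq[OF has_derivative_mult_right[OF smooth_on_has_derivative[OF snoc.prems(1) that]]]
    by (simp add: pd_def)
  then have "pderivs w (pd i (\<lambda>x. c * f x)) x = pderivs w (\<lambda>y. c * pd i f y) x"
    by (rule pderivs_cong[OF V _ snoc.prems(2)])
  also have "\<dots> = c * pderivs w (pd i f) x"
    by (rule snoc.IH) (use snoc.prems smooth_on_pd in auto)
  finally show ?case by (simp add: pderivs_snoc)
qed simp

text \<open>The inverse function theorem yields a differentiable \<open>g\<close> with the inverse
  derivative. Smoothness is bootstrapped: the partial derivatives of \<open>g\<close> are smooth
  functions of \<open>g\<close> itself, so each order of differentiability gives the next.\<close>

theorem smooth_inverse_function: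
  fixes Q :: "real^'a::finite \<Rightarrow> real^'a"
  assumes U: "open U" and Q: "smooth_on U Q" and x0: "x0 \<in> U"
    and inj: "\<And>u. frechet_derivative Q (at x0) u = 0 \<Longrightarrow> u = 0"
  obtains U' V g where "open U'" "U' \<subseteq> U" "x0 \<in> U'" "open V" "Q x0 \<in> V" "smooth_on V g"
    "\<And>z. z \<in> V \<Longrightarrow> g z \<in> U' \<and> Q (g z) = z" "\<And>y. y \<in> U' \<Longrightarrow> Q y \<in> V \<and> g (Q y) = y"
proof -
  define f' where "f' = (\<lambda>x. Blinfun (frechet_derivative Q (at x)))"
  have f': "blinfun_apply (f' x) = frechet_derivative Q (at x)" if "x \<in> U" for x
    unfolding f'_def
    using bounded_linear_Blinfun_apply has_derivative_bounded_linear[OF smooth_on_has_derivative[OF Q that]] by blast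
  have derf: "(Q has_derivative blinfun_apply (f' x)) (at x)" if "x \<in> U" for x
    using smooth_on_has_derivative[OF Q that] f'[OF that] by simp
  have contf: "continuous_on U f'"
  proof (rule continuous_on_blinfun_componentwise)
    fix i :: "real^'a" assume "i \<in> Basis"
    then obtain j where j: "i = axis j 1" by (auto simp: Basis_vec_def)
    have "continuous_on U (pd j Q)" using smooth_on_continuous_on smooth_on_pd[OF Q] by blast
    then show "continuous_on U (\<lambda>x. blinfun_apply (f' x) i)"
      using f' j by (simp add: pd_def cong: continuous_on_cong)
  qed
  have lin: "linear (frechet_derivative Q (at x0))"
    using linear_frechet_derivative smooth_on_differentiable[OF Q x0] by blast
  \<comment> \<open>Injectivity provides a linear left inverse, the form of invertibility that the
    inverse function theorem asks for.\<close>
  have "inj (frechet_derivative Q (at x0))"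
    using inj linear_injective_0[OF lin] by blast
  then obtain L where L: "linear L" "L \<circ> frechet_derivative Q (at x0) = id"
    using linear_injective_left_inverse[OF lin] by blast
  have "Blinfun L o\<^sub>L f' x0 = id_blinfun"
    by (rule blinfun_eqI) (use L f'[OF x0] in \<open>simp add: bounded_linear_Blinfun_apply
        linear_conv_bounded_linear[symmetric] fun_eq_iff\<close>)
  from inverse_function_theorem[OF U derf contf x0 this]
  obtain U' V g g' where U': "open U'" "U' \<subseteq> U" "x0 \<in> U'" and V: "open V" "Q x0 \<in> V"
    and hom: "homeomorphism U' V Q g"
    and dg: "\<And>y. y \<in> V \<Longrightarrow> (g has_derivative (g' y)) (at y)"
    and g': "\<And>y. y \<in> V \<Longrightarrow> g' y = inv_into UNIV (blinfun_apply (f' (g y)))"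
    and bij: "\<And>y. y \<in> V \<Longrightarrow> bij (blinfun_apply (f' (g y)))" by metis
  have gV: "g z \<in> U'" "Q (g z) = z" if "z \<in> V" for z
    using hom that unfolding homeomorphism_def by auto
  have QU: "Q y \<in> V" "g (Q y) = y" if "y \<in> U'" for y
    using hom that unfolding homeomorphism_def by auto
  define J where "J = (\<lambda>z. \<chi> b a. vec_nth (pd a Q z) b)"
  \<comment> \<open>Cramer's rule: \<open>K i z\<close> is column \<open>i\<close> of the inverse
    Jacobian matrix at \<open>z\<close>, in a form that is visibly smooth.\<close>
  define K where "K = (\<lambda>i z. \<chi> a. Determinants.det (\<chi> b c. if c = a then vec_nth (axis i 1) b
    else vec_nth (vec_nth (J z) b) c) / Determinants.det (J z))"
  have Jv: "J z *v u = frechet_derivative Q (at z) u" if "z \<in> U" for z u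
    using frechet_derivative_axis_sum[OF smooth_on_differentiable[OF Q that], of u]
    unfolding J_def by (simp add: Finite_Cartesian_Product.vec_eq_iff matrix_vector_mult_def mult.commute sum_component)
  have detJ: "Determinants.det (J z) \<noteq> 0" if "z \<in> U'" for z
  proof -
    have zU: "z \<in> U" using that U' by blast
    have "bij (blinfun_apply (f' (g (Q z))))" using bij QU that by blast
    then have "inj ((*v) (J z))"
      using f'[OF zU] Jv[OF zU] QU that by (simp add: bij_def fun_eq_iff inj_def)
    then show ?thesis
      by (metis invertible_det_nz invertible_left_inverse matrix_left_invertible_injective)
  qed
  have Jsm: "smooth_on U' (\<lambda>z. vec_nth (vec_nth (J z) b) a)" for a b
    unfolding J_def vec_lambda_beta
    by (intro smooth_on_vec_nth[OF U'(1)] smooth_on_pd[OF smooth_on_subset[OF Q U'(2)]])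
  have Ksm: "smooth_on U' (K i)" for i
  proof (rule smooth_on_componentwise[OF U'(1)])
    fix a
    have "smooth_on U' (\<lambda>z. if c = a then vec_nth (axis i 1) b else vec_nth (vec_nth (J z) b) c)" for b c
      by (cases "c = a") (auto intro: smooth_on_const Jsm)
    then show "smooth_on U' (\<lambda>x. vec_nth (K i x) a)"
      unfolding K_def vec_lambda_beta
      by (intro smooth_on_divide[OF U'(1) detJ] smooth_on_det[OF U'(1)] Jsm) auto
  qed
  have pdg: "pd i g y = K i (g y)" if "y \<in> V" for i y
  proof -
    have gU: "g y \<in> U" using gV[OF that] U' by blast
    have "J (g y) *v pd i g y = blinfun_apply (f' (g y)) (g' y (axis i 1))"
      using pd_eq[OF dg[OF that]] Jv[OF gU] f'[OF gU] by simp
    also have "\<dots> = axis i 1"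
      using g'[OF that] bij[OF that] by (simp add: bij_is_surj surj_f_inv_f)
    finally show ?thesis
      using cramer[OF detJ[OF gV(1)[OF that]], of "pd i g y" "axis i 1"] unfolding K_def by simp
  qed
  have "cn n V g" for n
  proof (induction n)
    case 0
    show ?case by (auto intro: Derivative.differentiableI[OF dg])
  next
    case (Suc n)
    \<comment> \<open>The bootstrapping step: \<open>K i\<close> is smooth and \<open>g\<close> has
      order \<open>n\<close>, so the composition has order \<open>n\<close>, and it equals the
      partial derivative of \<open>g\<close>.\<close>
    have K: "cn n V (\<lambda>y. K i (g y))" for i
    proof (rule cn_compose[OF V(1) _ _ Suc])
      show "g ` V \<subseteq> U'" using gV by blast
      show "cn n U' (K i)" using Ksm unfolding smooth_on_iff_cn by blast
    qed
    have Kg: "K i (g y) = g' y (axis i 1)" if "y \<in> V" for i y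
      using pdg[OF that] pd_eq[OF dg[OF that]] by simp
    show ?case
    proof (rule cn_SucI[OF V(1) dg])
      show "cn n V (\<lambda>y. g' y (axis i 1))" for i
        by (rule cn_cong[OF V(1) Kg K])
    qed
  qed
  then have g: "smooth_on V g" unfolding smooth_on_iff_cn by blast
  show thesis
  proof (rule that[OF U' V g])
    show "g z \<in> U' \<and> Q (g z) = z" if "z \<in> V" for z using gV[OF that] by simp
    show "Q y \<in> V \<and> g (Q y) = y" if "y \<in> U'" for y using QU[OF that] by simp
  qed
qed

section \<open>Dimension-free vectors as Euclidean vectors\<close>

text \<open>Any enumeration of the index type will do; one is fixed for passing between the two
  kinds of vectors.\<close>

definition eidx :: "'a::finite \<Rightarrow> nat" where
  "eidx = (SOME h. bij_betw h UNIV {..<CARD('a)})"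

definition of_rvec :: "real vec \<Rightarrow> real^'a::finite" where
  "of_rvec v = (\<chi> i. v $ eidx i)"

definition to_rvec :: "real^'a::finite \<Rightarrow> real vec" where
  "to_rvec x = Matrix.vec CARD('a) (\<lambda>i. vec_nth x (inv_into UNIV eidx i))"

text \<open>Transfers the action of matrices to \<open>real^'a\<close>, where derivatives, inner
  products and topology are available.\<close>

definition mact :: "real mat \<Rightarrow> real^'a::finite \<Rightarrow> real^'a" where
  "mact g x = of_rvec (g *\<^sub>v to_rvec x)"

lemma bij_eidx: "bij_betw (eidx :: 'a::finite \<Rightarrow> nat) UNIV {..<CARD('a)}"
proof -
  have "\<exists>h. bij_betw h (UNIV :: 'a set) {..<CARD('a)}"
    by (intro finite_same_card_bij) auto
  then show ?thesis unfolding eidx_def by (rule someI_ex)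
qed

lemma eidx_less [simp]: "eidx (i :: 'a::finite) < CARD('a)"
  using bij_betw_apply[OF bij_eidx, of i] by simp

lemma inv_eidx [simp]: "inv_into UNIV eidx (eidx (i :: 'a::finite)) = i"
  using bij_betw_inv_into_left[OF bij_eidx] by blast

lemma eidx_inv: "j < CARD('a::finite) \<Longrightarrow> eidx (inv_into UNIV (eidx :: 'a \<Rightarrow> nat) j) = j"
  using bij_betw_inv_into_right[OF bij_eidx] by blast

lemma sum_eidx: "(\<Sum>j<CARD('a). f j) = (\<Sum>i\<in>UNIV. f (eidx (i :: 'a::finite)))"
  by (rule sum.reindex_bij_betw[OF bij_eidx, symmetric])

lemma to_rvec_carrier [simp]: "to_rvec (x :: real^'a::finite) \<in> carrier_vec CARD('a)"
  by (simp add: to_rvec_def)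

lemma dim_to_rvec [simp]: "dim_vec (to_rvec (x :: real^'a::finite)) = CARD('a)"
  by (simp add: to_rvec_def)

lemma of_to_rvec [simp]: "of_rvec (to_rvec x) = x"
  by (simp add: of_rvec_def to_rvec_def Finite_Cartesian_Product.vec_eq_iff)

lemma to_of_rvec: "v \<in> carrier_vec CARD('a::finite) \<Longrightarrow> to_rvec (of_rvec v :: real^'a) = v"
  by (intro eq_vecI) (auto simp: of_rvec_def to_rvec_def eidx_inv)

lemma to_rvec_inject [simp]: "to_rvec x = to_rvec y \<longleftrightarrow> x = y"
  by (metis of_to_rvec)

lemma vec_nth_of_rvec [simp]: "vec_nth (of_rvec v) i = v $ eidx i"
  by (simp add: of_rvec_def)

lemma to_rvec_nth: "i < CARD('a) \<Longrightarrow> to_rvec (x :: real^'a::finite) $ i = vec_nth x (inv_into UNIV eidx i)"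
  by (simp add: to_rvec_def)

lemma scalar_prod_to_rvec: "scalar_prod (to_rvec x) (to_rvec y) = inner x (y :: real^'a::finite)"
  unfolding scalar_prod_def by (simp add: atLeast0LessThan sum_eidx inner_vec_def to_rvec_nth)

lemma unit_sphere_eq: "unit_sphere CARD('a) = to_rvec ` {x :: real^'a::finite. norm x = 1}"
proof -
  have "scalar_prod v v = 1 \<longleftrightarrow> norm (of_rvec v :: real^'a) = 1" if "v \<in> carrier_vec CARD('a)" for v
    using scalar_prod_to_rvec[of "of_rvec v :: real^'a" "of_rvec v"] to_of_rvec[OF that]
    by (simp add: norm_eq_1)
  then show ?thesis unfolding unit_sphere_def
    by (force simp: to_of_rvec scalar_prod_to_rvec norm_eq_1 intro!: image_eqI[where x = "of_rvec _"])
qed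

lemma to_rvec_mact:
  "g \<in> carrier_mat CARD('a) CARD('a) \<Longrightarrow> to_rvec (mact g (x :: real^'a::finite)) = g *\<^sub>v to_rvec x"
  unfolding mact_def by (rule to_of_rvec) (auto intro: mult_mat_vec_carrier)

lemma mact_mult:
  assumes "g \<in> carrier_mat CARD('a) CARD('a)" "h \<in> carrier_mat CARD('a) CARD('a)"
  shows "mact (g * h) (x :: real^'a::finite) = mact g (mact h x)"
  using assms by (simp add: mact_def to_rvec_mact[unfolded mact_def])

lemma mact_one [simp]: "mact (1\<^sub>m CARD('a)) (x :: real^'a::finite) = x"
  by (simp add: mact_def)

lemma linear_mact:
  assumes "g \<in> carrier_mat CARD('a) CARD('a)"
  shows "linear (mact g :: real^'a::finite \<Rightarrow> real^'a)"
proof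
  fix x y :: "real^'a" and c :: real
  have a: "to_rvec (x + y) = to_rvec x + to_rvec y"
    by (intro eq_vecI) (auto simp: to_rvec_def)
  have b: "to_rvec (c *\<^sub>R x) = c \<cdot>\<^sub>v to_rvec x"
    by (intro eq_vecI) (auto simp: to_rvec_def)
  show "mact g (x + y) = mact g x + mact g y"
    using assms unfolding mact_def a
    by (simp add: mult_add_distrib_mat_vec[OF assms] of_rvec_def Finite_Cartesian_Product.vec_eq_iff)
  show "mact g (c *\<^sub>R x) = c *\<^sub>R mact g x"
    using assms unfolding mact_def b
    by (simp add: mult_mat_vec[OF assms] of_rvec_def Finite_Cartesian_Product.vec_eq_iff)
qed

lemma orthogonal_group_carrier:
  "g \<in> carrier (orthogonal_group N) \<longleftrightarrow> g \<in> carrier_mat N N \<and> transpose_mat g * g = 1\<^sub>m N"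
  by (simp add: orthogonal_group_def)

lemma orthogonal_group_transpose:
  assumes "g \<in> carrier (orthogonal_group N)"
  shows "transpose_mat g \<in> carrier (orthogonal_group N)" "g * transpose_mat g = 1\<^sub>m N"
proof -
  have g: "g \<in> carrier_mat N N" "transpose_mat g * g = 1\<^sub>m N"
    using assms by (auto simp: orthogonal_group_carrier)
  show "g * transpose_mat g = 1\<^sub>m N"
    using mat_mult_left_right_inverse[of "transpose_mat g" N g] g by simp
  then show "transpose_mat g \<in> carrier (orthogonal_group N)"
    using g by (simp add: orthogonal_group_carrier)
qed

lemma orthogonal_group_mult:
  assumes "g \<in> carrier (orthogonal_group N)" "h \<in> carrier (orthogonal_group N)"
  shows "g * h \<in> carrier (orthogonal_group N)"
proof -
  have g: "g \<in> carrier_mat N N" "transpose_mat g * g = 1\<^sub>m N"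
    "h \<in> carrier_mat N N" "transpose_mat h * h = 1\<^sub>m N"
    using assms by (auto simp: orthogonal_group_carrier)
  have "transpose_mat (g * h) * (g * h) = transpose_mat h * (transpose_mat g * g) * h"
    using g(1,3) by (simp add: transpose_mult[OF g(1,3)] assoc_mult_mat[where n\<^sub>1=N and n\<^sub>2=N and n\<^sub>3=N and n\<^sub>4=N])
  also have "\<dots> = 1\<^sub>m N" using g by simp
  finally show ?thesis using g by (simp add: orthogonal_group_carrier)
qed

lemma orthogonal_group_one [simp]: "1\<^sub>m N \<in> carrier (orthogonal_group N)"
  by (simp add: orthogonal_group_carrier)

lemma inner_mact:
  assumes "g \<in> carrier (orthogonal_group CARD('a))"
  shows "inner (mact g x) (mact g (y :: real^'a::finite)) = inner x y"
proof -
  have g: "g \<in> carrier_mat CARD('a) CARD('a)" "transpose_mat g * g = 1\<^sub>m CARD('a)"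
    using assms by (auto simp: orthogonal_group_carrier)
  have "inner (mact g x) (mact g y) = scalar_prod (g *\<^sub>v to_rvec x) (g *\<^sub>v to_rvec y)"
    by (simp add: scalar_prod_to_rvec[symmetric] to_rvec_mact[OF g(1)])
  also have "\<dots> = scalar_prod (to_rvec x) (transpose_mat g *\<^sub>v (g *\<^sub>v to_rvec y))"
    using transpose_vec_mult_scalar[of "transpose_mat g" "CARD('a)" "CARD('a)" "g *\<^sub>v to_rvec y" "to_rvec x"] g(1)
    by simp
  also have "\<dots> = scalar_prod (to_rvec x) ((transpose_mat g * g) *\<^sub>v to_rvec y)"
    using g(1) by simp
  also have "\<dots> = inner x y" by (simp add: g(2) scalar_prod_to_rvec)
  finally show ?thesis .
qed

lemma norm_mact:
  assumes "g \<in> carrier (orthogonal_group CARD('a))"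
  shows "norm (mact g (x :: real^'a::finite)) = norm x"
  using inner_mact[OF assms] by (simp add: norm_eq_sqrt_inner)

lemma dist_mact:
  assumes "g \<in> carrier (orthogonal_group CARD('a))"
  shows "dist (mact g x) (mact g (y :: real^'a::finite)) = dist x y"
proof -
  have "linear (mact g :: real^'a \<Rightarrow> _)"
    using assms by (intro linear_mact) (simp add: orthogonal_group_carrier)
  from linear_diff[OF this, of x y] show ?thesis
    using norm_mact[OF assms, of "x - y"] by (simp add: dist_norm)
qed

lemma bounded_linear_mact:
  assumes "g \<in> carrier (orthogonal_group CARD('a))"
  shows "bounded_linear (mact g :: real^'a::finite \<Rightarrow> real^'a)"
proof -
  have "linear (mact g :: real^'a \<Rightarrow> _)"
    using assms by (intro linear_mact) (simp add: orthogonal_group_carrier)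
  then show ?thesis by (simp add: linear_conv_bounded_linear)
qed

section \<open>Finite orthogonal groups acting freely on the sphere\<close>

definition free_orth_group :: "nat \<Rightarrow> real mat set \<Rightarrow> bool" where
  "free_orth_group N G \<longleftrightarrow> finite G \<and> G \<subseteq> carrier (orthogonal_group N) \<and> 1\<^sub>m N \<in> G \<and>
     (\<forall>g\<in>G. \<forall>h\<in>G. g * h \<in> G) \<and> (\<forall>g\<in>G. transpose_mat g \<in> G) \<and>
     (\<forall>g\<in>G. \<forall>v\<in>unit_sphere N. g *\<^sub>v v = v \<longrightarrow> g = 1\<^sub>m N)"

abbreviation orb :: "real mat set \<Rightarrow> real^'a::finite \<Rightarrow> real vec set" where
  "orb G x \<equiv> orbit_of G (to_rvec x)"

lemma free_orth_groupD:
  assumes "free_orth_group N G"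
  shows "finite G" "g \<in> G \<Longrightarrow> g \<in> carrier (orthogonal_group N)" "1\<^sub>m N \<in> G"
    "g \<in> G \<Longrightarrow> h \<in> G \<Longrightarrow> g * h \<in> G" "g \<in> G \<Longrightarrow> transpose_mat g \<in> G"
    "g \<in> G \<Longrightarrow> g \<in> carrier_mat N N" "g \<in> G \<Longrightarrow> transpose_mat g * g = 1\<^sub>m N"
    "g \<in> G \<Longrightarrow> g * transpose_mat g = 1\<^sub>m N"
  using assms orthogonal_group_transpose(2)[of g N]
  unfolding free_orth_group_def orthogonal_group_carrier subset_iff by blast+

lemma free_orth_group_fixed:
  assumes "free_orth_group CARD('a) G" "g \<in> G" "norm x = 1" "mact g x = (x :: real^'a::finite)"
  shows "g = 1\<^sub>m CARD('a)"
proof -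
  have "to_rvec x \<in> unit_sphere CARD('a)" using assms(3) by (auto simp: unit_sphere_eq)
  moreover have "g *\<^sub>v to_rvec x = to_rvec x"
    using assms to_rvec_mact[OF free_orth_groupD(6)[OF assms(1,2)]] by metis
  ultimately show ?thesis using assms(1,2) unfolding free_orth_group_def by blast
qed

lemma free_orth_group_trivial: "free_orth_group N {1\<^sub>m N}"
  by (auto simp: free_orth_group_def)

lemma orb_eq_iff:
  assumes G: "free_orth_group CARD('a) G"
  shows "orb G x = orb G (y :: real^'a::finite) \<longleftrightarrow> (\<exists>g\<in>G. x = mact g y)"
proof -
  note c = free_orth_groupD(6)[OF G]
  have orb: "orb G z = to_rvec ` (\<lambda>g. mact g z) ` G" for z :: "real^'a"
    unfolding orbit_of_def image_image by (rule image_cong[OF HOL.refl]) (simp add: to_rvec_mact[OF c])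
  have *: "orb G x = orb G y \<longleftrightarrow> (\<lambda>g. mact g x) ` G = (\<lambda>g. mact g y) ` G"
    unfolding orb by (intro inj_image_eq_iff) (simp add: inj_def)
  show ?thesis
  proof
    assume "orb G x = orb G y"
    moreover have "x = mact (1\<^sub>m CARD('a)) x" by simp
    ultimately show "\<exists>g\<in>G. x = mact g y"
      using * free_orth_groupD(3)[OF G] by (metis (no_types, lifting) imageE image_eqI)
  next
    assume "\<exists>g\<in>G. x = mact g y"
    then obtain g where g: "g \<in> G" "x = mact g y" by blast
    have "mact h x = mact (h * g) y" if "h \<in> G" for h
      using g c that by (simp add: mact_mult)
    moreover have "mact h y = mact (h * transpose_mat g) x" if "h \<in> G" for h
    proof -
      have "mact (transpose_mat g) x = mact (transpose_mat g * g) y"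
        using g c[OF g(1)] by (simp add: mact_mult)
      then have "mact (transpose_mat g) x = y"
        using free_orth_groupD(7)[OF G g(1)] by simp
      then show ?thesis
        using c[OF that] c[OF g(1)] by (simp add: mact_mult)
    qed
    ultimately show "orb G x = orb G y"
      unfolding * using free_orth_groupD(4,5)[OF G] g(1)
      by (intro equalityI image_subsetI) (metis image_eqI)+
  qed
qed

lemma orb_mact:
  assumes "free_orth_group CARD('a) G" "g \<in> G"
  shows "orb G (mact g (x :: real^'a::finite)) = orb G x"
  using orb_eq_iff[OF assms(1)] assms(2) by blast

section \<open>Lifts of parametrisations\<close>

text \<open>\<open>sphere_lift\<close> with values in a Euclidean space. The index type
  \<open>'k option\<close> has one element more than \<open>'k\<close>, so
  \<open>real^'k option\<close> is the ambient space of a sphere whose charts live in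
  \<open>real^'k\<close>.\<close>

definition elift ::
  "real mat set \<Rightarrow> (real^'k::finite \<Rightarrow> real vec set) \<Rightarrow> (real^'k) set \<Rightarrow>
   (real^'k \<Rightarrow> real^'k option) \<Rightarrow> bool" where
  "elift G \<psi> W S \<longleftrightarrow> open W \<and> smooth_on W S \<and> (\<forall>y\<in>W. norm (S y) = 1 \<and> \<psi> y = orb G (S y)) \<and>
     (\<forall>y\<in>W. \<forall>u. frechet_derivative S (at y) u = 0 \<longrightarrow> u = 0)"

lemma eliftD:
  assumes "elift G \<psi> W S"
  shows "open W" "smooth_on W S" "y \<in> W \<Longrightarrow> norm (S y) = 1" "y \<in> W \<Longrightarrow> \<psi> y = orb G (S y)"
    "y \<in> W \<Longrightarrow> frechet_derivative S (at y) u = 0 \<Longrightarrow> u = 0"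
  using assms unfolding elift_def by blast+

lemma elift_subset: "elift G \<psi> W S \<Longrightarrow> W' \<subseteq> W \<Longrightarrow> open W' \<Longrightarrow> elift G \<psi> W' S"
  unfolding elift_def using smooth_on_subset by (metis subsetD)

lemma frechet_derivative_vec_nth:
  assumes "f differentiable (at x)"
  shows "frechet_derivative (\<lambda>y. vec_nth (f y) i) (at x) u = vec_nth (frechet_derivative f (at x) u) i"
proof -
  have "((\<lambda>y. vec_nth (f y) i) has_derivative (\<lambda>u. vec_nth (frechet_derivative f (at x) u) i)) (at x)"
    using assms frechet_derivative_works
    by (intro bounded_linear.has_derivative[OF bounded_linear_vec_nth]) blast
  then show ?thesis using frechet_derivative_at by metis
qed

lemma sphere_lift_imp_elift:
  fixes s :: "real^'k::finite \<Rightarrow> real vec"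
  assumes "sphere_lift CARD('k option) G \<psi> W s"
  shows "elift G \<psi> W (\<lambda>y. of_rvec (s y))"
    and "y \<in> W \<Longrightarrow> frechet_derivative (\<lambda>z. of_rvec (s z) :: real^'k option) (at y) u =
      (\<chi> i. frechet_derivative (\<lambda>z. s z $ eidx i) (at y) u)"
proof -
  let ?S = "\<lambda>y. of_rvec (s y) :: real^'k option"
  have W: "open W" and s: "\<And>y. y \<in> W \<Longrightarrow> s y \<in> unit_sphere CARD('k option)"
    "\<And>y. y \<in> W \<Longrightarrow> \<psi> y = orbit_of G (s y)"
    "\<And>i. i < CARD('k option) \<Longrightarrow> smooth_on W (\<lambda>y. s y $ i)"
    and imm: "\<And>y u. y \<in> W \<Longrightarrow> (\<forall>i<CARD('k option). frechet_derivative (\<lambda>z. s z $ i) (at y) u = 0) \<Longrightarrow> u = 0"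
    using assms unfolding sphere_lift_def by blast+
  have sm: "smooth_on W ?S"
  proof (rule smooth_on_componentwise[OF W])
    show "smooth_on W (\<lambda>x. vec_nth (?S x) i)" for i :: "'k option"
      using s(3)[OF eidx_less, of i] by simp
  qed
  have D: "frechet_derivative ?S (at y) u = (\<chi> i. frechet_derivative (\<lambda>z. s z $ eidx i) (at y) u)"
    if "y \<in> W" for y u
    using frechet_derivative_vec_nth[OF smooth_on_differentiable[OF sm that]]
    by (simp add: Finite_Cartesian_Product.vec_eq_iff)
  show "y \<in> W \<Longrightarrow> frechet_derivative ?S (at y) u = (\<chi> i. frechet_derivative (\<lambda>z. s z $ eidx i) (at y) u)"
    by (rule D)
  have ts: "to_rvec (?S y) = s y" if "y \<in> W" for y
    using s(1)[OF that] by (intro to_of_rvec) (simp add: unit_sphere_def)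
  have "norm (?S y) = 1" if "y \<in> W" for y
    using s(1)[OF that] ts[OF that] unfolding unit_sphere_eq by auto
  moreover have "u = 0" if "y \<in> W" "frechet_derivative ?S (at y) u = 0" for y u
  proof (rule imm[OF that(1)], intro allI impI)
    fix i assume i: "i < CARD('k option)"
    show "frechet_derivative (\<lambda>z. s z $ i) (at y) u = 0"
      using arg_cong[OF D[OF that(1), of u], of "\<lambda>v. vec_nth v (inv_into UNIV eidx i)"] that(2)
      by (simp add: eidx_inv[OF i])
  qed
  ultimately show "elift G \<psi> W ?S"
    unfolding elift_def using W sm s(2) ts by simp
qed

lemma elift_imp_sphere_lift:
  fixes S :: "real^'k::finite \<Rightarrow> real^'k option"
  assumes "elift G \<psi> W S"
  shows "sphere_lift CARD('k option) G \<psi> W (\<lambda>y. to_rvec (S y))"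
  unfolding sphere_lift_def
proof (intro conjI ballI allI impI)
  note S = eliftD[OF assms]
  show "open W" by (rule S)
  fix i assume i: "i < CARD('k option)"
  show "smooth_on W (\<lambda>y. to_rvec (S y) $ i)"
    unfolding to_rvec_nth[OF i] by (rule smooth_on_vec_nth[OF S(1,2)])
next
  note S = eliftD[OF assms]
  fix y assume y: "y \<in> W"
  show "to_rvec (S y) \<in> unit_sphere CARD('k option)" "\<psi> y = orbit_of G (to_rvec (S y))"
    using S(3,4)[OF y] unfolding unit_sphere_eq by auto
  fix u assume u: "\<forall>i<CARD('k option). frechet_derivative (\<lambda>z. to_rvec (S z) $ i) (at y) u = 0"
  have "vec_nth (frechet_derivative S (at y) u) i = 0" for i :: "'k option"
    using u[rule_format, OF eidx_less, of i]
    unfolding to_rvec_nth[OF eidx_less] inv_eidx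
      frechet_derivative_vec_nth[OF smooth_on_differentiable[OF S(2) y]] .
  then show "u = 0" using S(5)[OF y] by (simp add: Finite_Cartesian_Product.vec_eq_iff)
qed

lemma params_sphere_quotient:
  "(V, \<psi>) \<in> params (sphere_quotient CARD('k option) G :: (real vec set, 'k::finite) riem) \<longleftrightarrow>
    open V \<and> inj_on \<psi> V \<and> (\<forall>x\<in>V. \<exists>W S. x \<in> W \<and> W \<subseteq> V \<and> elift G \<psi> W S)"
proof -
  have eq: "(\<exists>s. x \<in> W \<and> W \<subseteq> V \<and> sphere_lift CARD('k option) G \<psi> W s) \<longleftrightarrow>
      (\<exists>S. x \<in> W \<and> W \<subseteq> V \<and> elift G \<psi> W S)" for W x
  proof
    assume "\<exists>s. x \<in> W \<and> W \<subseteq> V \<and> sphere_lift CARD('k option) G \<psi> W s"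
    then obtain s where "x \<in> W \<and> W \<subseteq> V" "sphere_lift CARD('k option) G \<psi> W s" by blast
    then show "\<exists>S. x \<in> W \<and> W \<subseteq> V \<and> elift G \<psi> W S"
      using sphere_lift_imp_elift(1)[of G \<psi> W s] by blast
  next
    assume "\<exists>S. x \<in> W \<and> W \<subseteq> V \<and> elift G \<psi> W S"
    then obtain S where "x \<in> W \<and> W \<subseteq> V" "elift G \<psi> W S" by blast
    then show "\<exists>s. x \<in> W \<and> W \<subseteq> V \<and> sphere_lift CARD('k option) G \<psi> W s"
      using elift_imp_sphere_lift[of G \<psi> W S] by blast
  qed
  show ?thesis
    unfolding sphere_quotient_def riem.select_convs mem_Collect_eq prod.case eq ..
qed

lemma elift_mact:
  assumes G: "free_orth_group CARD('k::finite option) G" and S: "elift G \<psi> W (S :: real^'k \<Rightarrow> _)" and g: "g \<in> G"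
  shows "elift G \<psi> W (\<lambda>y. mact g (S y))"
    and "y \<in> W \<Longrightarrow> frechet_derivative (\<lambda>y. mact g (S y)) (at y) u = mact g (frechet_derivative S (at y) u)"
proof -
  note S = eliftD[OF S] and go = free_orth_groupD(2)[OF G g]
  have D: "frechet_derivative (\<lambda>y. mact g (S y)) (at y) u = mact g (frechet_derivative S (at y) u)"
    if "y \<in> W" for y u
    using frechet_derivative_at[OF bounded_linear.has_derivative[OF bounded_linear_mact[OF go]
          smooth_on_has_derivative[OF S(2) that]]] by metis
  then show "y \<in> W \<Longrightarrow> frechet_derivative (\<lambda>y. mact g (S y)) (at y) u = mact g (frechet_derivative S (at y) u)"
    by blast
  have "u = 0" if "y \<in> W" "mact g (frechet_derivative S (at y) u) = 0" for y u
    using S(5)[OF that(1)] that(2) norm_mact[OF go] by (metis norm_eq_zero)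
  then show "elift G \<psi> W (\<lambda>y. mact g (S y))"
    unfolding elift_def using S smooth_on_bounded_linear[OF bounded_linear_mact[OF go] S(1,2)]
    by (auto simp: norm_mact[OF go] orb_mact[OF G g] D)
qed

lemma sphere_lift_tangent:
  fixes S :: "real^'a::finite \<Rightarrow> 'b::real_inner"
  assumes W: "open W" and S: "smooth_on W S" and n: "\<And>y. y \<in> W \<Longrightarrow> norm (S y) = 1" and y: "y \<in> W"
  shows "inner (S y) (frechet_derivative S (at y) u) = 0"
proof -
  note d = smooth_on_has_derivative[OF S y]
  have "((\<lambda>y. inner (S y) (S y)) has_derivative (\<lambda>u. inner (S y) (frechet_derivative S (at y) u)
      + inner (frechet_derivative S (at y) u) (S y))) (at y)"
    by (rule has_derivative_inner[OF d d])
  moreover have "((\<lambda>y. inner (S y) (S y)) has_derivative (\<lambda>u. 0)) (at y)"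
  proof (rule has_derivative_transform_within_open[OF has_derivative_const W y])
    show "1 = inner (S z) (S z)" if "z \<in> W" for z using n[OF that] by (simp add: norm_eq_1)
  qed
  ultimately have "(\<lambda>u. inner (S y) (frechet_derivative S (at y) u)
      + inner (frechet_derivative S (at y) u) (S y)) = (\<lambda>u. 0)"
    by (rule has_derivative_unique)
  from fun_cong[OF this, of u] show ?thesis by (simp add: inner_commute)
qed

text \<open>
  Near \<open>S y0\<close> the sphere is recovered from its projection to the tangent space there, and this
  projection composed with \<open>S\<close> is a local diffeomorphism by the inverse function theorem.
\<close>

lemma sphere_param_inverse:
  fixes S :: "real^'k::finite \<Rightarrow> real^'k option"
  assumes S: "elift G \<psi> W S" and y0: "y0 \<in> W"
  obtains Q \<rho> where "open Q" "S y0 \<in> Q" "smooth_on Q \<rho>"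
    "\<And>v. v \<in> Q \<Longrightarrow> norm v = 1 \<Longrightarrow> \<rho> v \<in> W \<and> S (\<rho> v) = v"
proof -
  note S = eliftD[OF S]
  define v0 where "v0 = S y0"
  define L where "L = frechet_derivative S (at y0)"
  have n0: "inner v0 v0 = 1" using S(3)[OF y0] by (simp add: v0_def norm_eq_1)
  have linL: "linear L" unfolding L_def
    by (rule linear_frechet_derivative[OF smooth_on_differentiable[OF S(2) y0]])
  have injL: "inj L" using linear_injective_0[OF linL] S(5)[OF y0] unfolding L_def by blast
  have tan: "inner v0 (L u) = 0" for u
    unfolding v0_def L_def by (rule sphere_lift_tangent[OF S(1,2,3) y0])
  \<comment> \<open>The transpose of \<open>L\<close>; up to a linear isomorphism this is the
    orthogonal projection to the tangent space at \<open>v0\<close>.\<close>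
  define q where "q = (\<lambda>v. \<chi> a. inner (L (axis a 1)) v)"
  have linq: "linear q"
    by (rule linearI) (simp_all add: q_def Finite_Cartesian_Product.vec_eq_iff inner_add_right)
  have blq: "bounded_linear q" using linq linear_conv_bounded_linear by blast
  have adj: "inner u (q v) = inner (L u) v" for u v
  proof -
    have L: "L u = (\<Sum>a\<in>UNIV. vec_nth u a *\<^sub>R L (axis a 1))"
      using frechet_derivative_axis_sum[OF smooth_on_differentiable[OF S(2) y0], of u]
      unfolding pd_def L_def .
    have "inner u (q v) = (\<Sum>a\<in>UNIV. vec_nth u a * inner (L (axis a 1)) v)"
      unfolding inner_vec_def[of u] by (simp add: q_def)
    also have "\<dots> = inner (L u) v"
      by (subst L) (simp add: inner_sum_left)
    finally show ?thesis .
  qed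
  \<comment> \<open>The range of \<open>L\<close> is orthogonal to \<open>v0\<close> and has
    codimension 1, so its orthogonal complement, which is the kernel of \<open>q\<close>, is the
    line through \<open>v0\<close>.\<close>
  have kernel: "\<exists>c. v = c *\<^sub>R v0" if "q v = 0" for v
  proof -
    define K where "K = {y \<in> UNIV. \<forall>x\<in>range L. Linear_Algebra.orthogonal x y}"
    have sub: "subspace (range L)" using linL linear_subspace_image subspace_UNIV by blast
    have "dim (range L) = CARD('k)"
      using dim_image_eq[OF linL, of UNIV] injL by simp
    then have "dim K = 1"
      using dim_subspace_orthogonal_to_vectors[OF sub subspace_UNIV] unfolding K_def by simp
    moreover have "subspace K" using subspace_orthogonal_to_vectors[of "range L"] unfolding K_def by simp
    moreover have "span {v0} \<subseteq> K"
      using tan \<open>subspace K\<close> by (intro span_minimal) (auto simp: K_def Linear_Algebra.orthogonal_def inner_commute)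
    moreover have "dim (span {v0}) = 1"
      using n0 by (auto simp: dim_singleton)
    ultimately have "span {v0} = K"
      by (intro subspace_dim_equal) (auto simp: subspace_span)
    moreover have "v \<in> K"
      using adj[of _ v] that by (auto simp: K_def Linear_Algebra.orthogonal_def)
    ultimately show ?thesis by (auto simp: span_singleton)
  qed
  \<comment> \<open>Points of the sphere are determined by their projection only within the open
    hemisphere around \<open>v0\<close>.\<close>
  define W2 where "W2 = W \<inter> (\<lambda>y. inner v0 (S y)) -` {0<..}"
  have W2: "open W2" unfolding W2_def
    by (intro continuous_open_preimage S(1) continuous_intros smooth_on_continuous_on[OF S(2)])
  have y02: "y0 \<in> W2" using y0 n0 by (simp add: W2_def v0_def)
  have SW2: "smooth_on W2 S" using smooth_on_subset[OF S(2)] by (simp add: W2_def)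
  have sm: "smooth_on W2 (\<lambda>y. q (S y))"
    by (rule smooth_on_bounded_linear[OF blq W2 SW2])
  have D: "frechet_derivative (\<lambda>y. q (S y)) (at y0) u = q (L u)" for u
    using frechet_derivative_at[OF bounded_linear.has_derivative[OF blq
          smooth_on_has_derivative[OF SW2 y02]]] unfolding L_def by metis
  have "u = 0" if "frechet_derivative (\<lambda>y. q (S y)) (at y0) u = 0" for u
  proof -
    have "inner (L u) (L u) = 0" using adj[of u "L u"] that by (simp add: D)
    then show ?thesis using S(5)[OF y0] by (simp add: L_def)
  qed
  from smooth_inverse_function[OF W2 sm y02 this]
  obtain U' V g where U': "U' \<subseteq> W2" and V: "open V" "q (S y0) \<in> V" and g: "smooth_on V g"
    and gV: "\<And>z. z \<in> V \<Longrightarrow> g z \<in> U' \<and> q (S (g z)) = z" by metis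
  define Q where "Q = {v. 0 < inner v0 v} \<inter> q -` V"
  have Q: "open Q" unfolding Q_def
    by (intro open_Int open_halfspace_gt[of 0 v0, simplified] open_vimage V
        linear_continuous_on[OF blq])
  show thesis
  proof (rule that[of Q "\<lambda>v. g (q v)"])
    show "open Q" by (rule Q)
    show "S y0 \<in> Q" using V(2) n0 by (simp add: Q_def v0_def)
    show "smooth_on Q (\<lambda>v. g (q v))"
      by (rule smooth_on_compose[OF Q _ g smooth_on_bounded_linear[OF blq Q smooth_on_ident]])
        (auto simp: Q_def)
    fix v assume v: "v \<in> Q" "norm v = 1"
    define y where "y = g (q v)"
    have y: "y \<in> W2" "q (S y) = q v" using gV[of "q v"] v(1) U' by (auto simp: Q_def y_def)
    then have yW: "y \<in> W" "0 < inner v0 (S y)" by (auto simp: W2_def)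
    \<comment> \<open>Two points with the same projection differ by \<open>c *\<^sub>R v0\<close>.
      Both have length 1, so \<open>c = 0\<close> or \<open>c = - 2 * inner v0 v\<close>, and the
      latter would leave the hemisphere.\<close>
    have "q (S y - v) = 0" using y(2) linear_diff[OF linq] by simp
    then obtain c where "S y - v = c *\<^sub>R v0" using kernel by blast
    then have c: "S y = v + c *\<^sub>R v0" by (simp add: algebra_simps)
    have "inner (S y) (S y) = 1" "inner v v = 1"
      using S(3)[OF yW(1)] v(2) by (simp_all add: norm_eq_1)
    then have "c * (c + 2 * inner v0 v) = 0"
      using n0 unfolding c by (simp add: inner_add_left inner_add_right inner_commute algebra_simps)
    moreover have "0 < inner v0 v + c" using yW(2) n0 unfolding c by (simp add: inner_add_right)
    moreover have "0 < inner v0 v" using v(1) by (simp add: Q_def)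
    ultimately have "c = 0" by auto
    then show "g (q v) \<in> W \<and> S (g (q v)) = v" using c yW(1) by (simp add: y_def)
  qed
qed

text \<open>Composing \<open>S\<close> with the local inverse of \<open>S'\<close> gives the
  coordinate change. Here \<open>S\<close> may be any smooth map into the sphere, for instance a
  lift followed by an orthogonal map.\<close>

lemma lift_transition:
  fixes S' :: "real^'k::finite \<Rightarrow> real^'k option" and S :: "real^'k \<Rightarrow> real^'k option"
  assumes S': "elift G \<psi> W' S'" and y0: "y0 \<in> W'"
    and W: "open W" and S: "smooth_on W S" and n: "\<And>x. x \<in> W \<Longrightarrow> norm (S x) = 1"
    and x0: "x0 \<in> W" and eq: "S x0 = S' y0"
  obtains W1 h where "open W1" "x0 \<in> W1" "W1 \<subseteq> W" "smooth_on W1 h"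
    "\<And>x. x \<in> W1 \<Longrightarrow> h x \<in> W' \<and> S x = S' (h x)"
proof -
  obtain Q \<rho> where Q: "open Q" "S' y0 \<in> Q" and \<rho>: "smooth_on Q \<rho>"
    and inv: "\<And>v. v \<in> Q \<Longrightarrow> norm v = 1 \<Longrightarrow> \<rho> v \<in> W' \<and> S' (\<rho> v) = v"
    using sphere_param_inverse[OF S' y0] by metis
  define W1 where "W1 = W \<inter> S -` Q"
  have W1: "open W1" "W1 \<subseteq> W" unfolding W1_def
    using continuous_open_preimage[OF smooth_on_continuous_on[OF S] W Q(1)] by auto
  show thesis
  proof (rule that[of W1 "\<lambda>x. \<rho> (S x)"])
    show "smooth_on W1 (\<lambda>x. \<rho> (S x))"
      by (rule smooth_on_compose[OF W1(1) _ \<rho> smooth_on_subset[OF S W1(2)]]) (auto simp: W1_def)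
    show "\<rho> (S x) \<in> W' \<and> S x = S' (\<rho> (S x))" if "x \<in> W1" for x
      using inv[of "S x"] n[of x] that by (simp add: W1_def)
  qed (use W1 x0 eq Q in \<open>auto simp: W1_def\<close>)
qed

section \<open>Orbit spaces of the sphere as Riemannian manifolds\<close>

abbreviation sq :: "real mat set \<Rightarrow> (real vec set, 'k::finite) riem" where
  "sq G \<equiv> sphere_quotient CARD('k option) G"

text \<open>At \<open>x\<close> the lifts differ by some \<open>g\<close>. The coordinate change
  \<open>h\<close> between \<open>S\<close> and the translate of \<open>S'\<close> by
  \<open>g\<close> preserves the value of \<open>\<psi>\<close>, so it is the identity by
  injectivity.\<close>

lemma lift_unique:
  fixes S S' :: "real^'k::finite \<Rightarrow> real^'k option"
  assumes G: "free_orth_group CARD('k option) G" and inj: "inj_on \<psi> V"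
    and S: "elift G \<psi> W S" "x \<in> W" "W \<subseteq> V" and S': "elift G \<psi> W' S'" "x \<in> W'" "W' \<subseteq> V"
  obtains g W1 where "g \<in> G" "open W1" "x \<in> W1" "W1 \<subseteq> W" "W1 \<subseteq> W'"
    "\<And>y. y \<in> W1 \<Longrightarrow> S y = mact g (S' y)"
proof -
  note D = eliftD[OF S(1)] and D' = eliftD[OF S'(1)]
  have "orb G (S x) = orb G (S' x)" using D(4)[OF S(2)] D'(4)[OF S'(2)] by simp
  then obtain g where g: "g \<in> G" "S x = mact g (S' x)" using orb_eq_iff[OF G] by blast
  note S2 = elift_mact(1)[OF G S'(1) g(1)]
  obtain W1 h where W1: "open W1" "x \<in> W1" "W1 \<subseteq> W"
    and h: "\<And>y. y \<in> W1 \<Longrightarrow> h y \<in> W' \<and> S y = mact g (S' (h y))"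
    using lift_transition[OF S2 S'(2) D(1,2,3) S(2) g(2)] by metis
  have hy: "h y = y" if "y \<in> W1" for y
  proof -
    have "\<psi> y = orb G (S y)" using D(4) W1(3) that by blast
    also have "\<dots> = orb G (S' (h y))" using h[OF that] orb_mact[OF G g(1)] by simp
    also have "\<dots> = \<psi> (h y)" using D'(4) h[OF that] by simp
    finally have "\<psi> (h y) = \<psi> y" by simp
    moreover have "h y \<in> V" "y \<in> V" using h[OF that] that W1(3) S(3) S'(3) by blast+
    ultimately show ?thesis by (rule inj_onD[OF inj])
  qed
  show thesis
  proof (rule that[OF g(1) W1])
    show "W1 \<subseteq> W'" using h hy by force
    show "S y = mact g (S' y)" if "y \<in> W1" for y using h[OF that] hy[OF that] by simp
  qed
qed

text \<open>The definition uses one chosen lift. Any other differs from it near \<open>x\<close> by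
  an orthogonal matrix, which preserves the inner products of partial derivatives.\<close>

lemma gram_elift:
  fixes S :: "real^'k::finite \<Rightarrow> real^'k option"
  assumes G: "free_orth_group CARD('k option) G" and p: "(V, \<psi>) \<in> params (sq G :: (_, 'k) riem)"
    and S: "elift G \<psi> W S" "x \<in> W" "W \<subseteq> V"
  shows "gram (sq G) (V, \<psi>) x = (\<chi> a b. inner (pd a S x) (pd b S x))"
proof -
  define s where "s = (SOME s. \<exists>W. x \<in> W \<and> W \<subseteq> V \<and> sphere_lift CARD('k option) G \<psi> W s)"
  have "\<exists>s. \<exists>W. x \<in> W \<and> W \<subseteq> V \<and> sphere_lift CARD('k option) G \<psi> W s"
    using elift_imp_sphere_lift[OF S(1)] S(2,3) by blast
  then have "\<exists>W. x \<in> W \<and> W \<subseteq> V \<and> sphere_lift CARD('k option) G \<psi> W s"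
    unfolding s_def by (rule someI_ex)
  then obtain W' where W': "x \<in> W'" "W' \<subseteq> V" "sphere_lift CARD('k option) G \<psi> W' s" by blast
  define S' :: "real^'k \<Rightarrow> real^'k option" where "S' = (\<lambda>y. of_rvec (s y))"
  have S': "elift G \<psi> W' S'" unfolding S'_def by (rule sphere_lift_imp_elift(1)[OF W'(3)])
  have DS': "frechet_derivative S' (at x) u = (\<chi> i. frechet_derivative (\<lambda>z. s z $ eidx i) (at x) u)" for u
    unfolding S'_def by (rule sphere_lift_imp_elift(2)[OF W'(3,1)])
  have inj: "inj_on \<psi> V" using p by (simp add: params_sphere_quotient del: card_option)
  obtain g W1 where g: "g \<in> G" and W1: "open W1" "x \<in> W1" "W1 \<subseteq> W" "W1 \<subseteq> W'"
    and eq: "\<And>y. y \<in> W1 \<Longrightarrow> S y = mact g (S' y)"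
    using lift_unique[OF G inj S S' W'(1,2)] by metis
  have DS: "frechet_derivative S (at x) u = mact g (frechet_derivative S' (at x) u)" for u
    using frechet_derivative_cong[OF W1(1,2) eq] elift_mact(2)[OF G S' g W'(1)] by simp
  have "(\<Sum>i<CARD('k option). frechet_derivative (\<lambda>y. s y $ i) (at x) u * frechet_derivative (\<lambda>y. s y $ i) (at x) v)
      = inner (frechet_derivative S (at x) u) (frechet_derivative S (at x) v)" for u v
    unfolding DS inner_mact[OF free_orth_groupD(2)[OF G g]]
    by (simp only: DS' sum_eidx inner_vec_def vec_lambda_beta inner_real_def)
  then show ?thesis
    unfolding sphere_quotient_def riem.select_convs prod.case Let_def s_def[symmetric]
    by (simp add: pd_def del: card_option)
qed

lemma inner_gram_elift:
  fixes S :: "real^'k::finite \<Rightarrow> real^'k option"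
  assumes G: "free_orth_group CARD('k option) G" and p: "(V, \<psi>) \<in> params (sq G :: (_, 'k) riem)"
    and S: "elift G \<psi> W S" "x \<in> W" "W \<subseteq> V"
  shows "inner u (gram (sq G) (V, \<psi>) x *v v) =
    inner (frechet_derivative S (at x) u) (frechet_derivative S (at x) v)"
proof -
  note d = smooth_on_differentiable[OF eliftD(2)[OF S(1)] S(2)]
  have "inner u (gram (sq G) (V, \<psi>) x *v v) =
      (\<Sum>a\<in>UNIV. vec_nth u a * (\<Sum>b\<in>UNIV. inner (pd a S x) (pd b S x) * vec_nth v b))"
    unfolding gram_elift[OF assms] by (simp add: inner_vec_def[of u] matrix_vector_mult_def)
  also have "\<dots> = inner (frechet_derivative S (at x) u) (frechet_derivative S (at x) v)"
    unfolding frechet_derivative_axis_sum[OF d, of u] frechet_derivative_axis_sum[OF d, of v]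
    by (simp add: inner_sum_left inner_sum_right sum_distrib_left mult.commute mult.left_commute)
      (rule sum.swap)
  finally show ?thesis .
qed

section \<open>Stereographic charts of the orbit spaces\<close>

lemma frechet_derivative_has_zero:
  assumes "(f has_derivative f') (at x)" "frechet_derivative f (at x) u = 0"
  shows "f' u = 0"
  using frechet_derivative_at[OF assms(1)] assms(2) by simp

text \<open>Inverse stereographic projection
  \<open>y \<mapsto> (2 y, 1 - |y|^2) / (1 + |y|^2)\<close>, with \<open>None\<close> as the last
  coordinate, followed by an orthogonal map that takes the image of 0 to \<open>v0\<close>.\<close>

lemma stereographic_param:
  fixes v0 :: "real^'k::finite option"
  assumes v0: "norm v0 = 1"
  obtains S :: "real^'k \<Rightarrow> real^'k option" where "S 0 = v0" "smooth_on UNIV S" "inj S"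
    "\<And>y. norm (S y) = 1" "\<And>y u. frechet_derivative S (at y) u = 0 \<Longrightarrow> u = 0"
proof -
  obtain f :: "real^'k option \<Rightarrow> real^'k option" where f: "orthogonal_transformation f"
      and f0: "f (axis None 1) = v0"
    using orthogonal_transformation_exists[of "axis None 1" v0] v0 by (auto simp: norm_axis_1)
  define e where "e = (\<lambda>(y :: real^'k) s t. \<chi> i. case i of None \<Rightarrow> t | Some a \<Rightarrow> s * vec_nth y a)"
  define P where "P = (\<lambda>y :: real^'k. e y 2 (1 - inner y y))"
  define c where "c = (\<lambda>y :: real^'k. inverse (1 + inner y y))"
  define R where "R = (\<lambda>y. c y *\<^sub>R P y)"
  define S where "S = (\<lambda>y. f (R y))"
  have pos: "0 < 1 + inner y y" for y :: "real^'k"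
    by (simp add: add_pos_nonneg)
  have blf: "bounded_linear f"
    using f orthogonal_transformation_linear linear_conv_bounded_linear by blast
  have inner_sm: "smooth_on UNIV (\<lambda>y :: real^'k. inner y y)"
    by (rule smooth_on_inner[OF open_UNIV smooth_on_ident smooth_on_ident])
  have csm: "smooth_on UNIV c" unfolding c_def
  proof (rule smooth_on_inverse[OF open_UNIV])
    show "1 + inner x x \<noteq> 0" for x :: "real^'k" using pos[of x] by simp
    show "smooth_on UNIV (\<lambda>y :: real^'k. 1 + inner y y)"
      by (rule smooth_on_add[OF open_UNIV smooth_on_const inner_sm])
  qed
  have Psm: "smooth_on UNIV P"
  proof (rule smooth_on_componentwise[OF open_UNIV])
    fix i :: "'k option"
    show "smooth_on UNIV (\<lambda>y. vec_nth (P y) i)"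
    proof (cases i)
      case None
      have "smooth_on UNIV (\<lambda>y :: real^'k. 1 + - inner y y)"
        by (rule smooth_on_add[OF open_UNIV smooth_on_const smooth_on_minus[OF open_UNIV inner_sm]])
      then show ?thesis using None by (simp add: P_def e_def)
    next
      case (Some a)
      have "smooth_on UNIV (\<lambda>y :: real^'k. 2 * vec_nth y a)"
        by (rule smooth_on_mult[OF open_UNIV smooth_on_const smooth_on_vec_nth[OF open_UNIV smooth_on_ident]])
      then show ?thesis using Some by (simp add: P_def e_def)
    qed
  qed
  have Rsm: "smooth_on UNIV R" unfolding R_def by (rule smooth_on_scaleR[OF open_UNIV csm Psm])
  have Ssm: "smooth_on UNIV S" unfolding S_def by (rule smooth_on_bounded_linear[OF blf open_UNIV Rsm])
  have option_sum: "(\<Sum>i\<in>UNIV. F i) = F None + (\<Sum>a\<in>UNIV. F (Some a))" for F :: "'k option \<Rightarrow> real"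
    by (simp add: UNIV_option_conv sum.reindex)
  have "inner (P y) (P y) = (1 + inner y y)\<^sup>2" for y
  proof -
    have "inner (P y) (P y) = (\<Sum>i\<in>UNIV. vec_nth (P y) i * vec_nth (P y) i)"
      by (simp add: inner_vec_def)
    also have "\<dots> = (1 - inner y y)\<^sup>2 + (\<Sum>a\<in>UNIV. 4 * (vec_nth y a * vec_nth y a))"
      unfolding option_sum by (simp add: P_def e_def power2_eq_square)
    also have "\<dots> = (1 - inner y y)\<^sup>2 + 4 * inner y y"
      by (simp add: sum_distrib_left[symmetric] inner_vec_def)
    finally show ?thesis by (simp add: power2_eq_square algebra_simps)
  qed
  then have "inner (R y) (R y) = 1" for y
  proof -
    have "inverse a * (inverse a * a\<^sup>2) = 1" if "0 < a" for a :: real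
      using that by (simp add: field_simps power2_eq_square)
    from this[OF pos] \<open>\<And>y. inner (P y) (P y) = (1 + inner y y)\<^sup>2\<close> show ?thesis
      by (simp add: R_def c_def)
  qed
  then have n: "norm (S y) = 1" for y
    using f by (simp add: S_def orthogonal_transformation norm_eq_1)
  have RN: "vec_nth (R y) None = (1 - inner y y) * c y" for y
    by (simp add: R_def P_def e_def mult.commute)
  have N1: "1 + vec_nth (R y) None = 2 * c y" for y
    unfolding RN c_def using pos[of y] by (simp add: field_simps)
  \<comment> \<open>This identity recovers \<open>y\<close> from \<open>R y\<close>, as
    \<open>1 + R None\<close> is positive. It gives injectivity directly, and the immersion property
    after differentiation.\<close>
  have RS: "vec_nth (R y) (Some a) = vec_nth y a * (1 + vec_nth (R y) None)" for y a
    unfolding N1 by (simp add: R_def P_def e_def mult.commute mult.left_commute)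
  have cpos: "0 < c y" for y unfolding c_def using pos[of y] by simp
  show thesis
  proof (rule that[OF _ Ssm _ n])
    have "R 0 = axis None 1"
      by (simp add: Finite_Cartesian_Product.vec_eq_iff R_def P_def e_def c_def axis_def split: option.splits)
    then show "S 0 = v0" using f0 by (simp add: S_def)
    show "inj S"
    proof (rule injI)
      fix y z assume "S y = S z"
      then have Ryz: "R y = R z"
        using orthogonal_transformation_inj[OF f] by (simp add: S_def inj_eq)
      have "vec_nth y a * (2 * c y) = vec_nth z a * (2 * c y)" for a
        using RS[of y a] RS[of z a] N1[of y] N1[of z] Ryz by metis
      then show "y = z" using cpos[of y] by (simp add: Finite_Cartesian_Product.vec_eq_iff)
    qed
    fix y u assume u: "frechet_derivative S (at y) u = 0"
    define D where "D = frechet_derivative R (at y) u"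
    have dR: "(R has_derivative frechet_derivative R (at y)) (at y)"
      by (rule smooth_on_has_derivative[OF Rsm UNIV_I])
    have "f D = 0"
      unfolding D_def using u unfolding S_def
      by (rule frechet_derivative_has_zero[OF bounded_linear.has_derivative[OF blf dR]])
    then have D: "D = 0"
      using f orthogonal_transformation_norm[OF f, of D] by simp
    have "vec_nth u a = 0" for a
    proof -
      have dn: "((\<lambda>y. vec_nth (R y) i) has_derivative (\<lambda>u. vec_nth (frechet_derivative R (at y) u) i)) (at y)" for i
        by (rule bounded_linear.has_derivative[OF bounded_linear_vec_nth dR])
      have "((\<lambda>y. vec_nth y a * (1 + vec_nth (R y) None)) has_derivative
          (\<lambda>u. vec_nth y a * (0 + vec_nth (frechet_derivative R (at y) u) None)
            + vec_nth u a * (1 + vec_nth (R y) None))) (at y)"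
        by (intro has_derivative_mult has_derivative_add has_derivative_const dn
            bounded_linear.has_derivative[OF bounded_linear_vec_nth] has_derivative_ident)
      then have "((\<lambda>y. vec_nth (R y) (Some a)) has_derivative
          (\<lambda>u. vec_nth y a * (0 + vec_nth (frechet_derivative R (at y) u) None)
            + vec_nth u a * (1 + vec_nth (R y) None))) (at y)"
        by (simp only: RS)
      from has_derivative_unique[OF this dn] have "vec_nth y a * (0 + vec_nth D None)
            + vec_nth u a * (1 + vec_nth (R y) None) = vec_nth D (Some a)"
        unfolding D_def by (rule fun_cong)
      then show ?thesis using D N1[of y] cpos[of y] by simp
    qed
    then show "u = 0" by (simp add: Finite_Cartesian_Product.vec_eq_iff)
  qed
qed

lemma free_orth_group_displacement:
  fixes v0 :: "real^'a::finite"
  assumes G: "free_orth_group CARD('a) G" and v0: "norm v0 = 1"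
  obtains \<delta> where "0 < \<delta>" "\<And>g. g \<in> G \<Longrightarrow> dist (mact g v0) v0 < \<delta> \<Longrightarrow> g = 1\<^sub>m CARD('a)"
proof -
  define A where "A = (\<lambda>g. dist (mact g v0) v0) ` (G - {1\<^sub>m CARD('a)})"
  have fin: "finite A" unfolding A_def using free_orth_groupD(1)[OF G] by simp
  have pos: "0 < a" if "a \<in> A" for a
    using that free_orth_group_fixed[OF G _ v0] unfolding A_def by fastforce
  show thesis
  proof (cases "A = {}")
    case True
    then show thesis using that[of 1] unfolding A_def by auto
  next
    case False
    show thesis
    proof (rule that)
      show "0 < Min A" using pos Min_in[OF fin False] by blast
      fix g assume g: "g \<in> G" "dist (mact g v0) v0 < Min A"
      show "g = 1\<^sub>m CARD('a)"
      proof (rule ccontr)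
        assume "g \<noteq> 1\<^sub>m CARD('a)"
        then have "dist (mact g v0) v0 \<in> A" using g(1) unfolding A_def by blast
        then show False using Min_le[OF fin] g(2) by fastforce
      qed
    qed
  qed
qed

lemma chart_at:
  fixes v0 :: "real^'k::finite option"
  assumes G: "free_orth_group CARD('k option) G" and v0: "norm v0 = 1"
  obtains V and S :: "real^'k \<Rightarrow> real^'k option" where
    "(V, \<lambda>y. orb G (S y)) \<in> params (sq G :: (_, 'k) riem)" "elift G (\<lambda>y. orb G (S y)) V S" "0 \<in> V" "S 0 = v0"
proof -
  obtain S :: "real^'k \<Rightarrow> real^'k option" where S: "S 0 = v0" "smooth_on UNIV S" "inj S"
    "\<And>y. norm (S y) = 1" "\<And>y u. frechet_derivative S (at y) u = 0 \<Longrightarrow> u = 0"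
    using stereographic_param[OF v0] by metis
  obtain \<delta> where \<delta>: "0 < \<delta>" "\<And>g. g \<in> G \<Longrightarrow> dist (mact g v0) v0 < \<delta> \<Longrightarrow> g = 1\<^sub>m CARD('k option)"
    using free_orth_group_displacement[OF G v0] by metis
  \<comment> \<open>Half of \<open>\<delta>\<close>: if \<open>S y\<close> and \<open>S z\<close>
    lie in the ball and \<open>S y = g (S z)\<close>, then \<open>g\<close> moves \<open>v0\<close>
    by less than \<open>\<delta>\<close>, hence \<open>g\<close> is the identity.\<close>
  define V where "V = S -` ball v0 (\<delta> / 2)"
  have V: "open V" unfolding V_def
    by (rule open_vimage[OF open_ball smooth_on_continuous_on[OF S(2)]])
  have lift: "elift G (\<lambda>y. orb G (S y)) V S"
    unfolding elift_def using V S(4,5) smooth_on_subset[OF S(2)] by simp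
  have inj: "inj_on (\<lambda>y. orb G (S y)) V"
  proof (rule inj_onI)
    fix y z assume y: "y \<in> V" and z: "z \<in> V" and eq: "orb G (S y) = orb G (S z)"
    then obtain g where g: "g \<in> G" "S y = mact g (S z)" using orb_eq_iff[OF G] by blast
    have "dist (mact g v0) v0 \<le> dist (mact g v0) (mact g (S z)) + dist (S y) v0"
      using dist_triangle[of "mact g v0" v0 "mact g (S z)"] g(2) by simp
    also have "\<dots> < \<delta>"
      unfolding dist_mact[OF free_orth_groupD(2)[OF G g(1)]]
      using y z by (simp add: V_def dist_commute)
    finally have "g = 1\<^sub>m CARD('k option)" using \<delta>(2)[OF g(1)] by blast
    then have "S y = S z" using g(2) mact_one by metis
    then show "y = z" using S(3) by (simp add: inj_eq)
  qed
  show thesis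
  proof (rule that[OF _ lift])
    show "(V, \<lambda>y. orb G (S y)) \<in> params (sq G :: (_, 'k) riem)"
      unfolding params_sphere_quotient using V inj lift by blast
  qed (use S(1) \<delta>(1) in \<open>auto simp: V_def\<close>)
qed

lemma params_liftE:
  assumes "(V, \<psi>) \<in> params (sq G :: (_, 'k::finite) riem)" "x \<in> V"
  obtains W and S :: "real^'k \<Rightarrow> real^'k option" where "x \<in> W" "W \<subseteq> V" "elift G \<psi> W S"
  using assms unfolding params_sphere_quotient by blast

lemma points_sq:
  assumes G: "free_orth_group CARD('k option) G"
  shows "points (sq G :: (_, 'k::finite) riem) = orb G ` {x :: real^'k option. norm x = 1}"
proof
  show "points (sq G :: (_, 'k) riem) \<subseteq> orb G ` {x :: real^'k option. norm x = 1}"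
  proof
    fix X assume "X \<in> points (sq G :: (_, 'k) riem)"
    then obtain V \<psi> x where p: "(V, \<psi>) \<in> params (sq G :: (_, 'k) riem)" "x \<in> V" "X = \<psi> x"
      unfolding points_def by blast
    obtain W and S :: "real^'k \<Rightarrow> real^'k option" where "x \<in> W" "W \<subseteq> V" "elift G \<psi> W S"
      using params_liftE[OF p(1,2)] by metis
    then show "X \<in> orb G ` {x :: real^'k option. norm x = 1}"
      using p(3) eliftD(3,4)[of G \<psi> W S x] by blast
  qed
  show "orb G ` {x :: real^'k option. norm x = 1} \<subseteq> points (sq G :: (_, 'k) riem)"
  proof (rule image_subsetI)
    fix v :: "real^'k option" assume "v \<in> {x. norm x = 1}"
    then obtain V S where c: "(V, \<lambda>y. orb G (S y)) \<in> params (sq G :: (_, 'k) riem)" "0 \<in> V" "S 0 = v"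
      using chart_at[OF G, of v] by blast
    show "orb G v \<in> points (sq G :: (_, 'k) riem)"
      unfolding points_def
    proof (rule UN_I[OF c(1)], unfold prod.case)
      show "orb G v \<in> (\<lambda>y. orb G (S y)) ` V" using c(2,3) by blast
    qed
  qed
qed

text \<open>Everything about \<open>f\<close> in charts follows from a local representation \<open>h\<close> with \<open>T S = S2 h\<close>.\<close>

lemma orbit_map_local:
  fixes f :: "real vec set \<Rightarrow> real vec set" and S :: "real^'k::finite \<Rightarrow> real^'k option"
  assumes G': "free_orth_group CARD('k option) G'"
    and T: "T \<in> carrier (orthogonal_group CARD('k option))"
    and f: "\<And>x :: real^'k option. norm x = 1 \<Longrightarrow> f (orb G x) = orb G' (mact T x)"
    and S: "elift G \<psi> W S" "x0 \<in> W"
    and p': "(V', \<psi>') \<in> params (sq G' :: (_, 'k) riem)" and x0: "f (\<psi> x0) \<in> \<psi>' ` V'"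
  obtains W1 h W' and S2 :: "real^'k \<Rightarrow> real^'k option" where
    "open W1" "x0 \<in> W1" "W1 \<subseteq> W" "smooth_on W1 h" "elift G' \<psi>' W' S2" "W' \<subseteq> V'"
    "\<And>x. x \<in> W1 \<Longrightarrow> h x \<in> W' \<and> mact T (S x) = S2 (h x) \<and> f (\<psi> x) = \<psi>' (h x) \<and>
      inv_into V' \<psi>' (f (\<psi> x)) = h x"
proof -
  note D = eliftD[OF S(1)]
  obtain y0 where y0: "y0 \<in> V'" "f (\<psi> x0) = \<psi>' y0" using x0 by blast
  obtain W' and S' :: "real^'k \<Rightarrow> real^'k option" where W': "y0 \<in> W'" "W' \<subseteq> V'" and S': "elift G' \<psi>' W' S'"
    using params_liftE[OF p' y0(1)] by metis
  have f\<psi>: "f (\<psi> x) = orb G' (mact T (S x))" if "x \<in> W" for x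
    using D(3,4)[OF that] f by simp
  have "orb G' (mact T (S x0)) = orb G' (S' y0)"
    using f\<psi>[OF S(2)] y0(2) eliftD(4)[OF S' W'(1)] by simp
  \<comment> \<open>Translating the lift by \<open>g\<close> makes it agree with \<open>T S\<close>
    at \<open>x0\<close>, as \<open>lift_transition\<close> requires.\<close>
  then obtain g where g: "g \<in> G'" "mact T (S x0) = mact g (S' y0)" using orb_eq_iff[OF G'] by blast
  note S2 = elift_mact(1)[OF G' S' g(1)]
  have TS: "smooth_on W (\<lambda>x. mact T (S x))"
    by (rule smooth_on_bounded_linear[OF bounded_linear_mact[OF T] D(1,2)])
  have nTS: "norm (mact T (S x)) = 1" if "x \<in> W" for x
    using norm_mact[OF T] D(3)[OF that] by simp
  obtain W1 h where W1: "open W1" "x0 \<in> W1" "W1 \<subseteq> W" "smooth_on W1 h"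
    and h: "\<And>x. x \<in> W1 \<Longrightarrow> h x \<in> W' \<and> mact T (S x) = mact g (S' (h x))"
    using lift_transition[OF S2 W'(1) D(1) TS nTS S(2) g(2)] by metis
  have inj: "inj_on \<psi>' V'" using p' unfolding params_sphere_quotient by blast
  show thesis
  proof (rule that[OF W1 S2 W'(2)])
    fix x assume x: "x \<in> W1"
    have "f (\<psi> x) = \<psi>' (h x)"
      using f\<psi>[of x] h[OF x] x W1(3) eliftD(4)[OF S2, of "h x"] by auto
    moreover have "inv_into V' \<psi>' (\<psi>' (h x)) = h x"
      using h[OF x] W'(2) by (intro inv_into_f_f[OF inj]) blast
    ultimately show "h x \<in> W' \<and> mact T (S x) = mact g (S' (h x)) \<and> f (\<psi> x) = \<psi>' (h x) \<and>
        inv_into V' \<psi>' (f (\<psi> x)) = h x"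
      using h[OF x] by simp
  qed
qed

text \<open>Serves three purposes: coordinate changes of one quotient (\<open>T\<close> the
  identity), isometries of the sphere, and the projections of the sphere to its quotients.\<close>

lemma local_isometry_orbit_map:
  fixes f :: "real vec set \<Rightarrow> real vec set"
  assumes G: "free_orth_group CARD('k::finite option) G" and G': "free_orth_group CARD('k option) G'"
    and T: "T \<in> carrier (orthogonal_group CARD('k option))"
    and f: "\<And>x :: real^'k option. norm x = 1 \<Longrightarrow> f (orb G x) = orb G' (mact T x)"
  shows "local_isometry (sq G :: (_, 'k) riem) (sq G') f"
  unfolding local_isometry_def Let_def
proof (intro conjI ballI, goal_cases)
  case 1
  show ?case unfolding points_sq[OF G] points_sq[OF G']
  proof (clarify)
    fix x :: "real^'k option" assume "norm x = 1"
    then show "f (orb G x) \<in> orb G' ` {x :: real^'k option. norm x = 1}"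
      using f norm_mact[OF T] by simp
  qed
next
  case (2 a)
  obtain V \<psi> where a: "a = (V, \<psi>)" by (meson surj_pair)
  have p: "(V, \<psi>) \<in> params (sq G :: (_, 'k) riem)"
    using 2 a by simp
  show ?case unfolding a prod.case
  proof (rule ballI)
  fix b assume b': "b \<in> params (sq G' :: (_, 'k) riem)"
  obtain V' \<psi>' where b: "b = (V', \<psi>')" by (meson surj_pair)
  have p': "(V', \<psi>') \<in> params (sq G' :: (_, 'k) riem)" using b' b by simp
  define O1 where "O1 = {x \<in> V. f (\<psi> x) \<in> \<psi>' ` V'}"
  define h where "h = (\<lambda>x. inv_into V' \<psi>' (f (\<psi> x)))"
  have main: "\<exists>W1. open W1 \<and> x0 \<in> W1 \<and> W1 \<subseteq> O1 \<and> smooth_on W1 h \<and>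
      (\<forall>u v. inner (frechet_derivative h (at x0) u) (gram (sq G') (V', \<psi>') (h x0) *v frechet_derivative h (at x0) v)
              = inner u (gram (sq G) (V, \<psi>) x0 *v v))" if x0: "x0 \<in> O1" for x0
  proof -
    have x0V: "x0 \<in> V" "f (\<psi> x0) \<in> \<psi>' ` V'" using x0 by (auto simp: O1_def)
    obtain W and S :: "real^'k \<Rightarrow> real^'k option" where W: "x0 \<in> W" "W \<subseteq> V" and S: "elift G \<psi> W S"
      using params_liftE[OF p x0V(1)] by metis
    obtain W1 h1 W' S2 where W1: "open W1" "x0 \<in> W1" "W1 \<subseteq> W" and h1: "smooth_on W1 h1"
      and S2: "elift G' \<psi>' W' S2" "W' \<subseteq> V'"
      and h1h: "\<And>x. x \<in> W1 \<Longrightarrow> h1 x \<in> W' \<and> mact T (S x) = S2 (h1 x) \<and> f (\<psi> x) = \<psi>' (h1 x) \<and>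
        inv_into V' \<psi>' (f (\<psi> x)) = h1 x"
      using orbit_map_local[OF G' T f S W(1) p' x0V(2)] by metis
    have hh: "h1 x = h x" if "x \<in> W1" for x using h1h[OF that] unfolding h_def by metis
    have hsm: "smooth_on W1 h" by (rule smooth_on_cong[OF W1(1) hh h1])
    have S2': "x \<in> W1 \<Longrightarrow> h x \<in> W'" "x \<in> W1 \<Longrightarrow> mact T (S x) = S2 (h x)" for x
      using h1h hh by auto
    have sub: "W1 \<subseteq> O1"
      using h1h W1(3) W(2) S2(2) by (fastforce simp: O1_def)
    have dS: "(S has_derivative frechet_derivative S (at x0)) (at x0)"
      by (rule smooth_on_has_derivative[OF eliftD(2)[OF S] W(1)])
    have dh: "(h has_derivative frechet_derivative h (at x0)) (at x0)"
      by (rule smooth_on_has_derivative[OF hsm W1(2)])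
    have dS2: "(S2 has_derivative frechet_derivative S2 (at (h x0))) (at (h x0))"
      by (rule smooth_on_has_derivative[OF eliftD(2)[OF S2(1)] S2'(1)[OF W1(2)]])
    \<comment> \<open>The equation \<open>T S = S2 h\<close> is differentiated in two ways;
      orthogonality of \<open>T\<close> then makes the two metrics correspond.\<close>
    have "((\<lambda>x. S2 (h x)) has_derivative (\<lambda>u. mact T (frechet_derivative S (at x0) u))) (at x0)"
      by (rule has_derivative_transform_within_open[OF
            bounded_linear.has_derivative[OF bounded_linear_mact[OF T] dS] W1(1,2) S2'(2)])
    moreover have "((\<lambda>x. S2 (h x)) has_derivative
        (\<lambda>u. frechet_derivative S2 (at (h x0)) (frechet_derivative h (at x0) u))) (at x0)"
      using diff_chain_at[OF dh dS2] by (simp add: o_def)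
    ultimately have D: "mact T (frechet_derivative S (at x0) u) =
        frechet_derivative S2 (at (h x0)) (frechet_derivative h (at x0) u)" for u
      by (rule has_derivative_unique[THEN fun_cong])
    have "inner (frechet_derivative h (at x0) u) (gram (sq G') (V', \<psi>') (h x0) *v frechet_derivative h (at x0) v)
        = inner u (gram (sq G) (V, \<psi>) x0 *v v)" for u v
      unfolding inner_gram_elift[OF G p S W] inner_gram_elift[OF G' p' S2(1) S2'(1)[OF W1(2)] S2(2)]
        D[symmetric] inner_mact[OF T] ..
    then show ?thesis using W1 sub hsm by blast
  qed
  have "open O1"
    unfolding open_subopen[of O1] using main by meson
  moreover have "smooth_on O1 h"
    by (rule smooth_on_locally) (use main in meson)
  moreover have "\<forall>x\<in>O1. \<forall>u v. inner (frechet_derivative h (at x) u)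
      (gram (sq G') (V', \<psi>') (h x) *v frechet_derivative h (at x) v) = inner u (gram (sq G) (V, \<psi>) x *v v)"
  proof
    fix x assume "x \<in> O1"
    from main[OF this] show "\<forall>u v. inner (frechet_derivative h (at x) u)
      (gram (sq G') (V', \<psi>') (h x) *v frechet_derivative h (at x) v) = inner u (gram (sq G) (V, \<psi>) x *v v)"
      by (elim exE conjE)
  qed
  ultimately show "case b of (V', \<psi>') \<Rightarrow> open {x \<in> V. f (\<psi> x) \<in> \<psi>' ` V'} \<and>
      smooth_on {x \<in> V. f (\<psi> x) \<in> \<psi>' ` V'} (\<lambda>x. inv_into V' \<psi>' (f (\<psi> x))) \<and>
      (\<forall>x\<in>{x \<in> V. f (\<psi> x) \<in> \<psi>' ` V'}. \<forall>u v.
        inner (frechet_derivative (\<lambda>x. inv_into V' \<psi>' (f (\<psi> x))) (at x) u)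
          (gram (sq G') (V', \<psi>') (inv_into V' \<psi>' (f (\<psi> x))) *v
            frechet_derivative (\<lambda>x. inv_into V' \<psi>' (f (\<psi> x))) (at x) v)
        = inner u (gram (sq G) (V, \<psi>) x *v v))"
    unfolding b prod.case O1_def h_def by (intro conjI)
  qed
qed

declare card_option [simp del]

section \<open>Topology of the orbit spaces\<close>

lemma openin_mtop:
  "openin (mtop M) W \<longleftrightarrow> W \<subseteq> points M \<and> (\<forall>(V, \<psi>)\<in>params M. open {x \<in> V. \<psi> x \<in> W})"
proof -
  have "istopology (\<lambda>W. W \<subseteq> points M \<and> (\<forall>(V, \<psi>)\<in>params M. open {x \<in> V. \<psi> x \<in> W}))"
    unfolding istopology_def
  proof (rule conjI; intro allI impI)
    fix S T assume S: "S \<subseteq> points M \<and> (\<forall>(V, \<psi>)\<in>params M. open {x \<in> V. \<psi> x \<in> S})"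
      and T: "T \<subseteq> points M \<and> (\<forall>(V, \<psi>)\<in>params M. open {x \<in> V. \<psi> x \<in> T})"
    have "open {x \<in> V. \<psi> x \<in> S \<inter> T}" if "(V, \<psi>) \<in> params M" for V \<psi>
    proof -
      have "{x \<in> V. \<psi> x \<in> S \<inter> T} = {x \<in> V. \<psi> x \<in> S} \<inter> {x \<in> V. \<psi> x \<in> T}" by blast
      then show ?thesis using S T that by auto
    qed
    then show "S \<inter> T \<subseteq> points M \<and> (\<forall>(V, \<psi>)\<in>params M. open {x \<in> V. \<psi> x \<in> S \<inter> T})"
      using S by blast
  next
    fix K assume K: "\<forall>S\<in>K. S \<subseteq> points M \<and> (\<forall>(V, \<psi>)\<in>params M. open {x \<in> V. \<psi> x \<in> S})"
    have "open {x \<in> V. \<psi> x \<in> \<Union>K}" if "(V, \<psi>) \<in> params M" for V \<psi>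
    proof -
      have "{x \<in> V. \<psi> x \<in> \<Union>K} = (\<Union>S\<in>K. {x \<in> V. \<psi> x \<in> S})" by blast
      moreover have "open {x \<in> V. \<psi> x \<in> S}" if "S \<in> K" for S
        using K that \<open>(V, \<psi>) \<in> params M\<close> by blast
      ultimately show ?thesis by auto
    qed
    then show "\<Union>K \<subseteq> points M \<and> (\<forall>(V, \<psi>)\<in>params M. open {x \<in> V. \<psi> x \<in> \<Union>K})"
      using K by blast
  qed
  then show ?thesis unfolding mtop_def by (simp only: topology_inverse')
qed

lemma openin_mtopD: "openin (mtop M) W \<Longrightarrow> (V, \<psi>) \<in> params M \<Longrightarrow> open {x \<in> V. \<psi> x \<in> W}"
  unfolding openin_mtop by fast

lemma topspace_mtop:
  assumes "\<And>V \<psi>. (V, \<psi>) \<in> params M \<Longrightarrow> open V"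
  shows "topspace (mtop M) = points M"
proof
  show "topspace (mtop M) \<subseteq> points M"
    using openin_topspace[of "mtop M"] unfolding openin_mtop by blast
  have "{x \<in> V. \<psi> x \<in> points M} = V" if "(V, \<psi>) \<in> params M" for V \<psi>
    using that unfolding points_def by blast
  then have "openin (mtop M) (points M)"
    unfolding openin_mtop using assms by auto
  then show "points M \<subseteq> topspace (mtop M)" by (rule openin_subset)
qed

lemma topspace_sq: "topspace (mtop (sq G :: (_, 'k::finite) riem)) = points (sq G :: (_, 'k) riem)"
  by (rule topspace_mtop) (simp add: params_sphere_quotient del: card_option)

lemma continuous_map_orb:
  assumes G: "free_orth_group CARD('k::finite option) G"
  shows "continuous_map (top_of_set (sphere 0 1)) (mtop (sq G :: (_, 'k) riem)) (orb G :: real^'k option \<Rightarrow> _)"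
  unfolding continuous_map_def topspace_sq points_sq[OF G] topspace_euclidean_subtopology
proof (intro conjI allI impI)
  show "orb G \<in> sphere (0 :: real^'k option) 1 \<rightarrow> orb G ` {x :: real^'k option. norm x = 1}" by auto
  fix U assume U: "openin (mtop (sq G :: (_, 'k) riem)) U"
  show "openin (top_of_set (sphere 0 1)) {x \<in> sphere 0 1. orb G (x :: real^'k option) \<in> U}"
  proof (subst openin_subopen, intro ballI)
    fix v0 :: "real^'k option" assume v0: "v0 \<in> {x \<in> sphere 0 1. orb G x \<in> U}"
    obtain V and S :: "real^'k \<Rightarrow> real^'k option" where
      c: "(V, \<lambda>y. orb G (S y)) \<in> params (sq G :: (_, 'k) riem)" "elift G (\<lambda>y. orb G (S y)) V S" "0 \<in> V" "S 0 = v0"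
      using chart_at[OF G, of v0] v0 by auto
    \<comment> \<open>With the chart restricted to the preimage of \<open>U\<close>, the local
      inverse of \<open>S\<close> yields a neighbourhood of \<open>v0\<close> on the sphere whose
      orbits all lie in \<open>U\<close>.\<close>
    define V2 where "V2 = {y \<in> V. orb G (S y) \<in> U}"
    have V2: "open V2" unfolding V2_def by (rule openin_mtopD[OF U c(1)])
    have lift: "elift G (\<lambda>y. orb G (S y)) V2 S"
      by (rule elift_subset[OF c(2) _ V2]) (simp add: V2_def)
    have "0 \<in> V2" using c v0 by (simp add: V2_def)
    from sphere_param_inverse[OF lift this] c(4)
    obtain Q \<rho> where Q: "open Q" "v0 \<in> Q" "\<And>v. v \<in> Q \<Longrightarrow> norm v = 1 \<Longrightarrow> \<rho> v \<in> V2 \<and> S (\<rho> v) = v"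
      by metis
    have "sphere 0 1 \<inter> Q \<subseteq> {x \<in> sphere 0 1. orb G x \<in> U}"
    proof
      fix v assume "v \<in> sphere 0 1 \<inter> Q"
      then have "norm v = 1" "\<rho> v \<in> V2" "S (\<rho> v) = v" using Q(3)[of v] by auto
      then show "v \<in> {x \<in> sphere 0 1. orb G x \<in> U}" by (auto simp: V2_def)
    qed
    moreover have "openin (top_of_set (sphere 0 1)) (sphere 0 1 \<inter> Q)"
      using Q(1) by (rule openin_open_Int)
    moreover have "v0 \<in> sphere 0 1 \<inter> Q" using v0 Q(2) by simp
    ultimately show "\<exists>T. openin (top_of_set (sphere 0 1)) T \<and> v0 \<in> T \<and> T \<subseteq> {x \<in> sphere 0 1. orb G x \<in> U}"
      by blast
  qed
qed

lemma open_map_orb: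
  assumes G: "free_orth_group CARD('k::finite option) G"
  shows "open_map (top_of_set (sphere 0 1)) (mtop (sq G :: (_, 'k) riem)) (orb G :: real^'k option \<Rightarrow> _)"
  unfolding open_map_def
proof (intro allI impI)
  fix U :: "(real^'k option) set" assume "openin (top_of_set (sphere 0 1)) U"
  then obtain T where T: "open T" "U = sphere 0 1 \<inter> T" by (auto simp: openin_open)
  show "openin (mtop (sq G :: (_, 'k) riem)) (orb G ` U)"
    unfolding openin_mtop
  proof (intro conjI ballI)
    show "orb G ` U \<subseteq> points (sq G :: (_, 'k) riem)"
      unfolding points_sq[OF G] using T(2) by auto
    fix c assume "c \<in> params (sq G :: (_, 'k) riem)"
    moreover obtain V \<psi> where c: "c = (V, \<psi>)" by (meson surj_pair)
    ultimately have p: "(V, \<psi>) \<in> params (sq G :: (_, 'k) riem)" by simp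
    have "open {x \<in> V. \<psi> x \<in> orb G ` U}"
    proof (subst open_subopen, intro ballI)
      fix x assume x: "x \<in> {x \<in> V. \<psi> x \<in> orb G ` U}"
      then have xV: "x \<in> V" by simp
      obtain W and S :: "real^'k \<Rightarrow> real^'k option" where W: "x \<in> W" "W \<subseteq> V" and S: "elift G \<psi> W S"
        using params_liftE[OF p xV] by metis
      note D = eliftD[OF S]
      obtain u where u: "u \<in> U" "\<psi> x = orb G u" using x by blast
      have "orb G u = orb G (S x)" using u(2) D(4)[OF W(1)] by simp
      then obtain g where g: "g \<in> G" "u = mact g (S x)"
        using orb_eq_iff[OF G] by blast
      \<comment> \<open>The lift translated by \<open>g\<close> passes through the representative
        \<open>u\<close> that lies in \<open>U\<close>, so near \<open>x\<close> it stays in the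
        open set \<open>T\<close>.\<close>
      define W2 where "W2 = W \<inter> (\<lambda>y. mact g (S y)) -` T"
      have "continuous_on W (\<lambda>y. mact g (S y))"
        by (rule smooth_on_continuous_on[OF smooth_on_bounded_linear[OF
                bounded_linear_mact[OF free_orth_groupD(2)[OF G g(1)]] D(1,2)]])
      then have "open W2" unfolding W2_def
        using D(1) T(1) by (rule continuous_open_preimage)
      moreover have "x \<in> W2" using W(1) g(2) u(1) T(2) by (simp add: W2_def)
      moreover have "W2 \<subseteq> {x \<in> V. \<psi> x \<in> orb G ` U}"
      proof
        fix y assume y: "y \<in> W2"
        then have yW: "y \<in> W" by (simp add: W2_def)
        have "mact g (S y) \<in> U"
          using y D(3)[OF yW] norm_mact[OF free_orth_groupD(2)[OF G g(1)], of "S y"] T(2)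
          by (simp add: W2_def)
        moreover have "\<psi> y = orb G (mact g (S y))"
          using D(4)[OF yW] orb_mact[OF G g(1)] by simp
        ultimately show "y \<in> {x \<in> V. \<psi> x \<in> orb G ` U}" using yW W(2) by blast
      qed
      ultimately show "\<exists>T. open T \<and> x \<in> T \<and> T \<subseteq> {x \<in> V. \<psi> x \<in> orb G ` U}" by blast
    qed
    then show "case c of (V, \<psi>) \<Rightarrow> open {x \<in> V. \<psi> x \<in> orb G ` U}" using c by simp
  qed
qed

lemma compact_space_sq:
  assumes G: "free_orth_group CARD('k::finite option) G"
  shows "compact_space (mtop (sq G :: (_, 'k) riem))"
proof -
  have "compactin (top_of_set (sphere 0 1)) (sphere 0 (1::real) :: (real^'k option) set)"
    by (simp add: compactin_subtopology)
  from image_compactin[OF this continuous_map_orb[OF G]]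
  have "compactin (mtop (sq G :: (_, 'k) riem)) (points (sq G :: (_, 'k) riem))"
    unfolding points_sq[OF G] by (simp add: sphere_def)
  then show ?thesis by (simp add: compact_space_def topspace_sq)
qed

lemma second_countable_top_of_set: "second_countable (top_of_set (S :: 'a::second_countable_topology set))"
proof (rule second_countable_subtopology)
  obtain B :: "'a set set" where B: "countable B" "topological_basis B"
    using ex_countable_basis by blast
  show "second_countable (euclidean :: 'a topology)"
    unfolding second_countable_def
    using B topological_basis_open[OF B(2)] topological_basisE[OF B(2)] by (metis open_openin)
qed

lemma second_countable_sq:
  assumes G: "free_orth_group CARD('k::finite option) G"
  shows "second_countable (mtop (sq G :: (_, 'k) riem))"
proof (rule second_countable_open_map_image[OF continuous_map_orb[OF G] open_map_orb[OF G]])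
  show "orb G ` topspace (top_of_set (sphere (0 :: real^'k option) 1)) = topspace (mtop (sq G :: (_, 'k) riem))"
    unfolding topspace_sq points_sq[OF G] by (simp add: sphere_def)
qed (rule second_countable_top_of_set)

text \<open>Orbits are finite, so \<open>b\<close> has positive distance from the orbit of
  \<open>a\<close>. Balls of half that radius have disjoint images because \<open>G\<close> acts by
  isometries.\<close>

lemma Hausdorff_space_sq:
  assumes G: "free_orth_group CARD('k::finite option) G"
  shows "Hausdorff_space (mtop (sq G :: (_, 'k) riem))"
  unfolding Hausdorff_space_def topspace_sq points_sq[OF G]
proof (intro allI impI, elim conjE imageE)
  fix X Y and a b :: "real^'k option"
  assume ne: "X \<noteq> Y" and X: "X = orb G a" "a \<in> {x. norm x = 1}" and Y: "Y = orb G b" "b \<in> {x. norm x = 1}"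
  define A where "A = (\<lambda>g. dist (mact g a) b) ` G"
  have fin: "finite A" "A \<noteq> {}" unfolding A_def using free_orth_groupD(1,3)[OF G] by auto
  define \<epsilon> where "\<epsilon> = Min A / 2"
  have "mact g a \<noteq> b" if "g \<in> G" for g using orb_mact[OF G that, of a] ne X Y by auto
  then have "0 < x" if "x \<in> A" for x using that unfolding A_def by auto
  then have \<epsilon>: "0 < \<epsilon>" using Min_in[OF fin] by (simp add: \<epsilon>_def)
  have far: "2 * \<epsilon> \<le> dist (mact g a) b" if "g \<in> G" for g
    unfolding \<epsilon>_def using Min_le[OF fin(1)] that by (simp add: A_def)
  define B where "B = (\<lambda>c. sphere 0 1 \<inter> ball c \<epsilon> :: (real^'k option) set)"
  have "openin (mtop (sq G :: (_, 'k) riem)) (orb G ` B c)" for c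
    using open_map_orb[OF G] unfolding open_map_def B_def by (simp add: openin_open_Int)
  moreover have "X \<in> orb G ` B a" "Y \<in> orb G ` B b" using X Y \<epsilon> by (auto simp: B_def)
  moreover have "disjnt (orb G ` B a) (orb G ` B b)"
    unfolding disjnt_iff
  proof (intro allI notI)
    fix Z assume "Z \<in> orb G ` B a \<and> Z \<in> orb G ` B b"
    then obtain x y where xy: "x \<in> B a" "y \<in> B b" "orb G y = orb G x" by auto
    then obtain g where g: "g \<in> G" "y = mact g x" using orb_eq_iff[OF G] by blast
    have "dist (mact g a) b \<le> dist (mact g a) (mact g x) + dist y b"
      using dist_triangle[of "mact g a" b y] g(2) by simp
    also have "\<dots> < 2 * \<epsilon>"
      using xy(1,2) unfolding dist_mact[OF free_orth_groupD(2)[OF G g(1)]]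
      by (simp add: B_def dist_commute)
    finally show False using far[OF g(1)] by simp
  qed
  ultimately show "\<exists>U V. openin (mtop (sq G :: (_, 'k) riem)) U \<and> openin (mtop (sq G :: (_, 'k) riem)) V \<and>
      X \<in> U \<and> Y \<in> V \<and> disjnt U V" by blast
qed

lemma riemannian_manifold_sq:
  assumes G: "free_orth_group CARD('k::finite option) G"
  shows "riemannian_manifold (sq G :: (_, 'k) riem)"
  unfolding riemannian_manifold_def
proof (intro conjI ballI)
  fix c assume "c \<in> params (sq G :: (_, 'k) riem)"
  moreover obtain V \<psi> where c: "c = (V, \<psi>)" by (meson surj_pair)
  ultimately have p: "(V, \<psi>) \<in> params (sq G :: (_, 'k) riem)" by simp
  have V: "open V" "inj_on \<psi> V" using p unfolding params_sphere_quotient by blast+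
  have sm: "smooth_on V (\<lambda>x. vec_nth (vec_nth (gram (sq G) (V, \<psi>) x) i) j)" for i j
  proof (rule smooth_on_locally)
    fix x assume x: "x \<in> V"
    obtain W and S :: "real^'k \<Rightarrow> real^'k option" where W: "x \<in> W" "W \<subseteq> V" and S: "elift G \<psi> W S"
      using params_liftE[OF p x] by metis
    note D = eliftD(1,2)[OF S]
    have "smooth_on W (\<lambda>x. vec_nth (vec_nth (gram (sq G) (V, \<psi>) x) i) j)"
    proof (rule smooth_on_cong[OF D(1)])
      show "inner (pd i S y) (pd j S y) = vec_nth (vec_nth (gram (sq G) (V, \<psi>) y) i) j" if "y \<in> W" for y
        unfolding gram_elift[OF G p S that W(2)] by simp
      show "smooth_on W (\<lambda>y. inner (pd i S y) (pd j S y))"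
        by (intro smooth_on_inner smooth_on_pd D)
    qed
    then show "\<exists>W. x \<in> W \<and> smooth_on W (\<lambda>x. vec_nth (vec_nth (gram (sq G) (V, \<psi>) x) i) j)"
      using W(1) by blast
  qed
  have "transpose (gram (sq G) (V, \<psi>) x) = gram (sq G) (V, \<psi>) x \<and>
      (\<forall>u. u \<noteq> 0 \<longrightarrow> inner u (gram (sq G) (V, \<psi>) x *v u) > 0)" if x: "x \<in> V" for x
  proof -
    obtain W and S :: "real^'k \<Rightarrow> real^'k option" where W: "x \<in> W" "W \<subseteq> V" and S: "elift G \<psi> W S"
      using params_liftE[OF p x] by metis
    have "transpose (gram (sq G) (V, \<psi>) x) = gram (sq G) (V, \<psi>) x"
      unfolding gram_elift[OF G p S W] by (simp add: transpose_def inner_commute)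
    moreover have "inner u (gram (sq G) (V, \<psi>) x *v u) > 0" if "u \<noteq> 0" for u
      unfolding inner_gram_elift[OF G p S W] using eliftD(5)[OF S W(1), of u] that
      by (simp only: inner_gt_zero_iff) blast
    ultimately show ?thesis by blast
  qed
  then show "case c of (V, \<psi>) \<Rightarrow> open V \<and> inj_on \<psi> V \<and>
        (\<forall>i j. smooth_on V (\<lambda>x. vec_nth (vec_nth (gram (sq G) (V, \<psi>) x) i) j)) \<and>
        (\<forall>x\<in>V. transpose (gram (sq G) (V, \<psi>) x) = gram (sq G) (V, \<psi>) x \<and>
                (\<forall>u. u \<noteq> 0 \<longrightarrow> inner u (gram (sq G) (V, \<psi>) x *v u) > 0))"
    unfolding c prod.case using V sm by blast
next
  show "local_isometry (sq G :: (_, 'k) riem) (sq G) id"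
  proof (rule local_isometry_orbit_map[OF G G orthogonal_group_one])
    show "id (orb G x) = orb G (mact (1\<^sub>m CARD('k option)) x)" for x :: "real^'k option"
      by (simp only: mact_one id_apply)
  qed
qed (rule Hausdorff_space_sq[OF G] second_countable_sq[OF G])+

section \<open>Smooth functions on manifolds\<close>

lemma smooth_fun_subset: "smooth_fun M W f \<Longrightarrow> W' \<subseteq> W \<Longrightarrow> smooth_fun M W' f"
  unfolding smooth_fun_def by (fast intro: smooth_on_subset)

lemma smooth_funD: "smooth_fun M W f \<Longrightarrow> (V, \<psi>) \<in> params M \<Longrightarrow> smooth_on {x \<in> V. \<psi> x \<in> W} (\<lambda>x. f (\<psi> x))"
  unfolding smooth_fun_def o_def by fast

lemma smooth_funI:
  "(\<And>V \<psi>. (V, \<psi>) \<in> params M \<Longrightarrow> smooth_on {x \<in> V. \<psi> x \<in> W} (\<lambda>x. f (\<psi> x))) \<Longrightarrow> smooth_fun M W f"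
  unfolding smooth_fun_def o_def by fast

lemma smooth_fun_cong:
  assumes W: "openin (mtop M) W" and eq: "\<And>x. x \<in> W \<Longrightarrow> f x = g x" and f: "smooth_fun M W f"
  shows "smooth_fun M W g"
proof (rule smooth_funI)
  fix V \<psi> assume p: "(V, \<psi>) \<in> params M"
  show "smooth_on {x \<in> V. \<psi> x \<in> W} (\<lambda>x. g (\<psi> x))"
    by (rule smooth_on_cong[OF openin_mtopD[OF W p] _ smooth_funD[OF f p]]) (simp add: eq)
qed

lemma smooth_fun_const: "smooth_fun M W (\<lambda>x. c)"
  by (rule smooth_funI) (rule smooth_on_const)

lemma smooth_fun_mult:
  assumes W: "openin (mtop M) W" and f: "smooth_fun M W f" and g: "smooth_fun M W g"
  shows "smooth_fun M W (\<lambda>x. f x * g x)"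
  by (rule smooth_funI) (rule smooth_on_mult[OF openin_mtopD[OF W] smooth_funD[OF f] smooth_funD[OF g]])

lemma smooth_fun_add:
  assumes W: "openin (mtop M) W" and f: "smooth_fun M W f" and g: "smooth_fun M W g"
  shows "smooth_fun M W (\<lambda>x. f x + g x)"
  by (rule smooth_funI) (rule smooth_on_add[OF openin_mtopD[OF W] smooth_funD[OF f] smooth_funD[OF g]])

lemma smooth_fun_sum:
  assumes W: "openin (mtop M) W" and f: "\<And>a. a \<in> A \<Longrightarrow> smooth_fun M W (f a)"
  shows "smooth_fun M W (\<lambda>x. \<Sum>a\<in>A. f a x)"
  by (rule smooth_funI) (rule smooth_on_sum[OF openin_mtopD[OF W] smooth_funD[OF f]])

lemma smooth_fun_prod:
  assumes W: "openin (mtop M) W" and f: "\<And>a. a \<in> A \<Longrightarrow> smooth_fun M W (f a)"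
  shows "smooth_fun M W (\<lambda>x. \<Prod>a\<in>A. f a x)"
  by (rule smooth_funI) (rule smooth_on_prod[OF openin_mtopD[OF W] smooth_funD[OF f]])

lemma smooth_fun_inverse:
  assumes W: "openin (mtop M) W" and nz: "\<And>x. x \<in> W \<Longrightarrow> f x \<noteq> 0" and f: "smooth_fun M W f"
  shows "smooth_fun M W (\<lambda>x. inverse (f x))"
proof (rule smooth_funI)
  fix V \<psi> assume p: "(V, \<psi>) \<in> params M"
  show "smooth_on {x \<in> V. \<psi> x \<in> W} (\<lambda>x. inverse (f (\<psi> x)))"
    by (rule smooth_on_inverse[OF openin_mtopD[OF W p] _ smooth_funD[OF f p]]) (simp add: nz)
qed

lemma smooth_fun_locally:
  assumes "\<And>x. x \<in> W \<Longrightarrow> x \<in> points M \<Longrightarrow> \<exists>W'. x \<in> W' \<and> smooth_fun M W' f"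
  shows "smooth_fun M W f"
proof (rule smooth_funI, rule smooth_on_locally)
  fix V \<psi> x assume p: "(V, \<psi>) \<in> params M" and x: "x \<in> {x \<in> V. \<psi> x \<in> W}"
  have "\<psi> x \<in> points M" unfolding points_def using p x by blast
  then obtain W' where W': "\<psi> x \<in> W'" "smooth_fun M W' f" using assms x by blast
  show "\<exists>W. x \<in> W \<and> smooth_on W (\<lambda>x. f (\<psi> x))"
    using smooth_funD[OF W'(2) p] x W'(1) by (intro exI[of _ "{x \<in> V. \<psi> x \<in> W'}"]) simp
qed

lemma local_isometry_chart:
  assumes f: "local_isometry M N f" and p: "(V, \<psi>) \<in> params M" and p': "(V', \<psi>') \<in> params N"
  shows "open {x \<in> V. f (\<psi> x) \<in> \<psi>' ` V'}"
    and "smooth_on {x \<in> V. f (\<psi> x) \<in> \<psi>' ` V'} (\<lambda>x. inv_into V' \<psi>' (f (\<psi> x)))"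
  using f p p' unfolding local_isometry_def Let_def by fast+

lemma local_isometry_points: "local_isometry M N f \<Longrightarrow> x \<in> points M \<Longrightarrow> f x \<in> points N"
  unfolding local_isometry_def by blast

lemma local_isometry_chart_open:
  assumes f: "local_isometry M N f" and p: "(V, \<psi>) \<in> params M" and p': "(V', \<psi>') \<in> params N"
    and W: "openin (mtop N) W"
  shows "open {x \<in> V. f (\<psi> x) \<in> \<psi>' ` V' \<and> f (\<psi> x) \<in> W}"
proof -
  let ?O = "{x \<in> V. f (\<psi> x) \<in> \<psi>' ` V'}" and ?h = "\<lambda>x. inv_into V' \<psi>' (f (\<psi> x))"
  have "open (?O \<inter> ?h -` {y \<in> V'. \<psi>' y \<in> W})"
    by (rule continuous_open_preimage[OF smooth_on_continuous_on[OF local_isometry_chart(2)[OF f p p']]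
          local_isometry_chart(1)[OF f p p'] openin_mtopD[OF W p']])
  moreover have "?O \<inter> ?h -` {y \<in> V'. \<psi>' y \<in> W} = {x \<in> V. f (\<psi> x) \<in> \<psi>' ` V' \<and> f (\<psi> x) \<in> W}"
    using inv_into_into[of _ \<psi>' V'] f_inv_into_f[of _ \<psi>' V'] by auto
  ultimately show ?thesis by simp
qed

lemma local_isometry_openin:
  assumes f: "local_isometry M N f" and W: "openin (mtop N) W"
  shows "openin (mtop M) {x \<in> points M. f x \<in> W}"
  unfolding openin_mtop
proof (intro conjI ballI)
  fix c assume "c \<in> params M"
  moreover obtain V \<psi> where c: "c = (V, \<psi>)" by (meson surj_pair)
  ultimately have p: "(V, \<psi>) \<in> params M" by simp
  have pt: "\<psi> x \<in> points M" if "x \<in> V" for x unfolding points_def using p that by blast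
  have "{x \<in> V. \<psi> x \<in> {x \<in> points M. f x \<in> W}} =
      (\<Union>(V', \<psi>')\<in>params N. {x \<in> V. f (\<psi> x) \<in> \<psi>' ` V' \<and> f (\<psi> x) \<in> W})"
    using pt local_isometry_points[OF f pt] unfolding points_def[of N] by fast
  moreover have "open (\<Union>(V', \<psi>')\<in>params N. {x \<in> V. f (\<psi> x) \<in> \<psi>' ` V' \<and> f (\<psi> x) \<in> W})"
    using local_isometry_chart_open[OF f p _ W] by (intro open_UN ballI) auto
  ultimately show "case c of (V, \<psi>) \<Rightarrow> open {x \<in> V. \<psi> x \<in> {x \<in> points M. f x \<in> W}}"
    unfolding c by simp
qed blast

lemma smooth_fun_compose:
  assumes f: "local_isometry M N f" and W: "openin (mtop N) W" and h: "smooth_fun N W h"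
  shows "smooth_fun M {x. f x \<in> W} (\<lambda>x. h (f x))"
proof (rule smooth_funI, rule smooth_on_locally)
  fix V \<psi> x assume p: "(V, \<psi>) \<in> params M" and x: "x \<in> {x \<in> V. \<psi> x \<in> {x. f x \<in> W}}"
  have "\<psi> x \<in> points M" unfolding points_def using p x by blast
  then have "f (\<psi> x) \<in> points N" by (rule local_isometry_points[OF f])
  then obtain V' \<psi>' where p': "(V', \<psi>') \<in> params N" and fx: "f (\<psi> x) \<in> \<psi>' ` V'"
    unfolding points_def by blast
  let ?Q = "{x \<in> V. f (\<psi> x) \<in> \<psi>' ` V' \<and> f (\<psi> x) \<in> W}" and ?h = "\<lambda>x. inv_into V' \<psi>' (f (\<psi> x))"
  have Q: "open ?Q" by (rule local_isometry_chart_open[OF f p p' W])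
  have h1: "?h x \<in> V' \<and> \<psi>' (?h x) = f (\<psi> x)" if "x \<in> ?Q" for x
    using inv_into_into[of "f (\<psi> x)" \<psi>' V'] f_inv_into_f[of "f (\<psi> x)" \<psi>' V'] that by blast
  have "smooth_on ?Q (\<lambda>x. h (f (\<psi> x)))"
  proof (rule smooth_on_cong[OF Q])
    show "h (\<psi>' (?h x)) = h (f (\<psi> x))" if "x \<in> ?Q" for x using h1[OF that] by simp
    show "smooth_on ?Q (\<lambda>x. h (\<psi>' (?h x)))"
    proof (rule smooth_on_compose[OF Q _ smooth_funD[OF h p']])
      show "?h ` ?Q \<subseteq> {y \<in> V'. \<psi>' y \<in> W}" using h1 by fastforce
      show "smooth_on ?Q ?h"
        by (rule smooth_on_subset[OF local_isometry_chart(2)[OF f p p']]) blast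
    qed
  qed
  then show "\<exists>W. x \<in> W \<and> smooth_on W (\<lambda>x. h (f (\<psi> x)))" using x fx by (intro exI[of _ ?Q]) simp
qed

section \<open>Matrices with smooth entries and their inverses\<close>

lemma smooth_matD:
  "smooth_mat M W n c \<Longrightarrow> x \<in> W \<Longrightarrow> c x \<in> carrier_mat n n"
  "smooth_mat M W n c \<Longrightarrow> i < n \<Longrightarrow> j < n \<Longrightarrow> smooth_fun M W (\<lambda>x. c x $$ (i, j))"
  unfolding smooth_mat_def by blast+

lemma smooth_fun_det:
  assumes W: "openin (mtop M) W" and c: "smooth_mat M W n c"
  shows "smooth_fun M W (\<lambda>x. Determinant.det (c x))"
proof (rule smooth_fun_cong[OF W])
  let ?D = "\<lambda>x. \<Sum>p | p permutes {0..<n}. signof p * (\<Prod>i = 0..<n. c x $$ (i, p i))"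
  show "?D x = Determinant.det (c x)" if "x \<in> W" for x
    using det_def'[OF smooth_matD(1)[OF c that]] by simp
  show "smooth_fun M W ?D"
  proof (intro smooth_fun_sum smooth_fun_mult smooth_fun_prod smooth_fun_const W)
    fix p i assume "p \<in> {p. p permutes {0..<n}}" "i \<in> {0..<n}"
    then show "smooth_fun M W (\<lambda>x. c x $$ (i, p i))"
      using permutes_in_image[of p "{0..<n}" i] by (intro smooth_matD(2)[OF c]) auto
  qed
qed

text \<open>Inverse by the adjugate formula, whose entries depend smoothly on those of
  \<open>A\<close> as long as the determinant does not vanish; for a singular \<open>A\<close> it is
  the zero matrix.\<close>

definition minv :: "real mat \<Rightarrow> real mat" where
  "minv A = inverse (Determinant.det A) \<cdot>\<^sub>m adj_mat A"

lemma invertible_mat_det: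
  assumes A: "A \<in> carrier_mat n n" "invertible_mat A"
  shows "Determinant.det (A :: real mat) \<noteq> 0"
proof -
  obtain B where B: "A * B = 1\<^sub>m n" "B * A = 1\<^sub>m (dim_row B)"
    using A unfolding invertible_mat_def inverts_mat_def by auto
  have "dim_col (A * B) = n" "dim_col (B * A) = dim_row B" unfolding B by simp_all
  then have "B \<in> carrier_mat n n" using A by auto
  then have "Determinant.det A * Determinant.det B = 1"
    using det_mult[OF A(1), of B] B(1) by simp
  then show ?thesis by auto
qed

lemma minv:
  assumes A: "A \<in> carrier_mat n n" "Determinant.det A \<noteq> 0"
  shows "minv A \<in> carrier_mat n n" "A * minv A = 1\<^sub>m n" "minv A * A = 1\<^sub>m n"
  using A adj_mat[OF A(1)] unfolding minv_def
  by (auto simp: mult_smult_distrib[OF A(1) adj_mat(1)[OF A(1)]] mult_smult_assoc_mat[OF adj_mat(1)[OF A(1)] A(1)])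

lemma smooth_mat_minv:
  assumes W: "openin (mtop M) W" and c: "smooth_mat M W n c"
    and nz: "\<And>x. x \<in> W \<Longrightarrow> Determinant.det (c x) \<noteq> 0"
  shows "smooth_mat M W n (\<lambda>x. minv (c x))"
  unfolding smooth_mat_def
proof (intro conjI ballI allI impI)
  show "minv (c x) \<in> carrier_mat n n" if "x \<in> W" for x
    using minv(1)[OF smooth_matD(1)[OF c that] nz[OF that]] .
  fix i j assume ij: "i < n" "j < n"
  have del: "smooth_mat M W (n - 1) (\<lambda>x. mat_delete (c x) j i)"
    unfolding smooth_mat_def
  proof (intro conjI ballI allI impI)
    show "mat_delete (c x) j i \<in> carrier_mat (n - 1) (n - 1)" if "x \<in> W" for x
      using smooth_matD(1)[OF c that] by (rule mat_delete_carrier)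
    fix i' j' assume i'j': "i' < n - 1" "j' < n - 1"
    show "smooth_fun M W (\<lambda>x. mat_delete (c x) j i $$ (i', j'))"
    proof (rule smooth_fun_cong[OF W])
      let ?a = "if i' < j then i' else Suc i'" and ?b = "if j' < i then j' else Suc j'"
      show "c x $$ (?a, ?b) = mat_delete (c x) j i $$ (i', j')" if "x \<in> W" for x
        using smooth_matD(1)[OF c that] i'j' by (simp add: mat_delete_def)
      show "smooth_fun M W (\<lambda>x. c x $$ (?a, ?b))"
        using i'j' by (intro smooth_matD(2)[OF c]) auto
    qed
  qed
  show "smooth_fun M W (\<lambda>x. minv (c x) $$ (i, j))"
  proof (rule smooth_fun_cong[OF W])
    show "inverse (Determinant.det (c x)) * ((-1) ^ (j + i) * Determinant.det (mat_delete (c x) j i)) = minv (c x) $$ (i, j)"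
      if "x \<in> W" for x
      using smooth_matD(1)[OF c that] ij by (simp add: minv_def adj_mat_def cofactor_def)
    show "smooth_fun M W (\<lambda>x. inverse (Determinant.det (c x)) * ((-1) ^ (j + i) * Determinant.det (mat_delete (c x) j i)))"
      by (intro smooth_fun_mult smooth_fun_inverse smooth_fun_const smooth_fun_det[OF W del]
          smooth_fun_det[OF W c] W nz)
  qed
qed

lemma smooth_fun_mult_mat_vec:
  assumes W: "openin (mtop M) W" and c: "smooth_mat M W n c"
    and v: "\<And>x. x \<in> W \<Longrightarrow> v x \<in> carrier_vec n" and sv: "\<And>j. j < n \<Longrightarrow> smooth_fun M W (\<lambda>x. v x $ j)"
    and i: "i < n"
  shows "smooth_fun M W (\<lambda>x. (c x *\<^sub>v v x) $ i)"
proof (rule smooth_fun_cong[OF W])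
  show "(\<Sum>j\<in>{0..<n}. c x $$ (i, j) * v x $ j) = (c x *\<^sub>v v x) $ i" if "x \<in> W" for x
    using smooth_matD(1)[OF c that] v[OF that] i by (auto simp: scalar_prod_def)
  show "smooth_fun M W (\<lambda>x. \<Sum>j\<in>{0..<n}. c x $$ (i, j) * v x $ j)"
    using i by (intro smooth_fun_sum smooth_fun_mult W smooth_matD(2)[OF c] sv) auto
qed

section \<open>Pulling back sections of natural bundles\<close>

lemma vector_bundleD:
  assumes "vector_bundle M E"
  shows "x \<in> points M \<Longrightarrow> \<exists>U \<tau>. (U, \<tau>) \<in> trivs E \<and> x \<in> U"
    "(U, \<tau>) \<in> trivs E \<Longrightarrow> openin (mtop M) U"
    "(U, \<tau>) \<in> trivs E \<Longrightarrow> U \<subseteq> points M"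
    "(U, \<tau>) \<in> trivs E \<Longrightarrow> x \<in> U \<Longrightarrow> \<tau> x \<in> carrier_mat (rk E) (rk E)"
    "(U, \<tau>) \<in> trivs E \<Longrightarrow> x \<in> U \<Longrightarrow> Determinant.det (\<tau> x) \<noteq> 0"
proof -
  have cover: "(\<Union>(U, \<tau>)\<in>trivs E. U) = points M"
    and tr: "\<And>U \<tau>. (U, \<tau>) \<in> trivs E \<Longrightarrow> openin (mtop M) U \<and>
      (\<forall>x\<in>U. \<tau> x \<in> carrier_mat (rk E) (rk E) \<and> invertible_mat (\<tau> x))"
    using assms unfolding vector_bundle_def by fast+
  show "x \<in> points M \<Longrightarrow> \<exists>U \<tau>. (U, \<tau>) \<in> trivs E \<and> x \<in> U" using cover by blast
  show "(U, \<tau>) \<in> trivs E \<Longrightarrow> openin (mtop M) U" using tr by blast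
  show "(U, \<tau>) \<in> trivs E \<Longrightarrow> U \<subseteq> points M" using cover by blast
  show "(U, \<tau>) \<in> trivs E \<Longrightarrow> x \<in> U \<Longrightarrow> \<tau> x \<in> carrier_mat (rk E) (rk E)" using tr by blast
  show "(U, \<tau>) \<in> trivs E \<Longrightarrow> x \<in> U \<Longrightarrow> Determinant.det (\<tau> x) \<noteq> 0"
    using tr invertible_mat_det by blast
qed

lemma smooth_sectionD:
  assumes "smooth_section M E s"
  shows "x \<in> points M \<Longrightarrow> s x \<in> carrier_vec (rk E)"
    "(U, \<tau>) \<in> trivs E \<Longrightarrow> i < rk E \<Longrightarrow> smooth_fun M U (\<lambda>x. (\<tau> x *\<^sub>v s x) $ i)"
  using assms unfolding smooth_section_def by fast+

lemma smooth_sectionI: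
  assumes "\<And>x. x \<in> points M \<Longrightarrow> s x \<in> carrier_vec (rk E)"
    and "\<And>U \<tau> i. (U, \<tau>) \<in> trivs E \<Longrightarrow> i < rk E \<Longrightarrow> smooth_fun M U (\<lambda>x. (\<tau> x *\<^sub>v s x) $ i)"
  shows "smooth_section M E s"
  using assms unfolding smooth_section_def by fast

lemma mult_mat_vec_cancel:
  fixes A :: "real mat"
  assumes A: "A \<in> carrier_mat n n" "Determinant.det A \<noteq> 0"
    and v: "v \<in> carrier_vec n" "w \<in> carrier_vec n" and eq: "A *\<^sub>v v = A *\<^sub>v w"
  shows "v = w"
proof -
  have "u = minv A *\<^sub>v (A *\<^sub>v u)" if "u \<in> carrier_vec n" for u
    using assoc_mult_mat_vec[OF minv(1)[OF A] A(1) that] minv(3)[OF A] that by simp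
  then show ?thesis using v eq by metis
qed

lemma smooth_section_lincomb:
  assumes E: "vector_bundle M E" and s: "smooth_section M E s" and t: "smooth_section M E t"
  shows "smooth_section M E (\<lambda>x. s x + c \<cdot>\<^sub>v t x)"
    and "(U, \<tau>) \<in> trivs E \<Longrightarrow> x \<in> U \<Longrightarrow> i < rk E \<Longrightarrow>
      (\<tau> x *\<^sub>v (s x + c \<cdot>\<^sub>v t x)) $ i = (\<tau> x *\<^sub>v s x) $ i + c * (\<tau> x *\<^sub>v t x) $ i"
proof -
  have eq: "(\<tau> x *\<^sub>v (s x + c \<cdot>\<^sub>v t x)) $ i = (\<tau> x *\<^sub>v s x) $ i + c * (\<tau> x *\<^sub>v t x) $ i"
    if U: "(U, \<tau>) \<in> trivs E" "x \<in> U" "i < rk E" for U \<tau> x i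
  proof -
    note \<tau> = vector_bundleD(4)[OF E U(1,2)]
    have x: "x \<in> points M" using vector_bundleD(3)[OF E U(1)] U(2) by blast
    note sc = smooth_sectionD(1)[OF s x] and tc = smooth_sectionD(1)[OF t x]
    have "\<tau> x *\<^sub>v (s x + c \<cdot>\<^sub>v t x) = \<tau> x *\<^sub>v s x + c \<cdot>\<^sub>v (\<tau> x *\<^sub>v t x)"
      using mult_add_distrib_mat_vec[OF \<tau> sc, of "c \<cdot>\<^sub>v t x"] mult_mat_vec[OF \<tau> tc] tc by simp
    then show ?thesis using \<tau> U(3) by simp
  qed
  then show "(U, \<tau>) \<in> trivs E \<Longrightarrow> x \<in> U \<Longrightarrow> i < rk E \<Longrightarrow>
      (\<tau> x *\<^sub>v (s x + c \<cdot>\<^sub>v t x)) $ i = (\<tau> x *\<^sub>v s x) $ i + c * (\<tau> x *\<^sub>v t x) $ i" .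
  show "smooth_section M E (\<lambda>x. s x + c \<cdot>\<^sub>v t x)"
  proof (rule smooth_sectionI)
    show "s x + c \<cdot>\<^sub>v t x \<in> carrier_vec (rk E)" if "x \<in> points M" for x
      using smooth_sectionD(1)[OF s that] smooth_sectionD(1)[OF t that] by simp
    fix U \<tau> i assume U: "(U, \<tau>) \<in> trivs E" "i < rk E"
    show "smooth_fun M U (\<lambda>x. (\<tau> x *\<^sub>v (s x + c \<cdot>\<^sub>v t x)) $ i)"
    proof (rule smooth_fun_cong[OF vector_bundleD(2)[OF E U(1)]])
      show "(\<tau> x *\<^sub>v s x) $ i + c * (\<tau> x *\<^sub>v t x) $ i = (\<tau> x *\<^sub>v (s x + c \<cdot>\<^sub>v t x)) $ i" if "x \<in> U" for x
        using eq[OF U(1) that U(2)] by simp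
      show "smooth_fun M U (\<lambda>x. (\<tau> x *\<^sub>v s x) $ i + c * (\<tau> x *\<^sub>v t x) $ i)"
        by (intro smooth_fun_add smooth_fun_mult smooth_fun_const vector_bundleD(2)[OF E U(1)]
            smooth_sectionD(2)[OF s U] smooth_sectionD(2)[OF t U])
    qed
  qed
qed

text \<open>Linearity is not demanded of an operator by definition. It follows from the local
  formula with coefficients, read through an invertible trivialisation.\<close>

lemma diff_op_lincomb:
  assumes E: "vector_bundle M E" and D: "elliptic_diff_op M E D"
    and s: "smooth_section M E s" and t: "smooth_section M E t" and x: "x \<in> points M"
  shows "D (\<lambda>x. s x + c \<cdot>\<^sub>v t x) x = D s x + c \<cdot>\<^sub>v D t x"
proof -
  note st = smooth_section_lincomb(1)[OF E s t, of c]
  obtain V \<psi> y where p: "(V, \<psi>) \<in> params M" and y: "y \<in> V" "x = \<psi> y"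
    using x unfolding points_def by blast
  obtain U \<tau> where U: "(U, \<tau>) \<in> trivs E" "x \<in> U" using vector_bundleD(1)[OF E x] by blast
  have Dsm: "smooth_section M E (D s')" if "smooth_section M E s'" for s'
    using D that unfolding elliptic_diff_op_def by blast
  obtain r where r: "\<forall>(V, \<psi>)\<in>params M. \<forall>(U, \<tau>)\<in>trivs E. \<exists>a.
        represents_diff_op M E D r (V, \<psi>) (U, \<tau>) a \<and>
        (\<forall>x\<in>V. \<psi> x \<in> U \<longrightarrow> (\<forall>\<xi>. \<xi> \<noteq> 0 \<longrightarrow> invertible_mat (principal_symbol (rk E) r a x \<xi>)))"
    using D unfolding elliptic_diff_op_def by blast
  have "\<exists>a. represents_diff_op M E D r (V, \<psi>) (U, \<tau>) a" using r p U(1) by fast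
  then obtain a where a: "represents_diff_op M E D r (V, \<psi>) (U, \<tau>) a" by blast
  have rep: "(\<tau> x *\<^sub>v D s' x) $ i = (\<Sum>w | length w \<le> r. \<Sum>j<rk E.
           a w i j y * pderivs w (\<lambda>y. (\<tau> (\<psi> y) *\<^sub>v s' (\<psi> y)) $ j) y)"
    if "smooth_section M E s'" "i < rk E" for s' i
    using a that y U(2) unfolding represents_diff_op_def prod.case by blast
  have op: "open {y \<in> V. \<psi> y \<in> U}" by (rule openin_mtopD[OF vector_bundleD(2)[OF E U(1)] p])
  have yO: "y \<in> {y \<in> V. \<psi> y \<in> U}" using y U(2) by simp
  have pdl: "pderivs w (\<lambda>y. (\<tau> (\<psi> y) *\<^sub>v (s (\<psi> y) + c \<cdot>\<^sub>v t (\<psi> y))) $ j) y =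
      pderivs w (\<lambda>y. (\<tau> (\<psi> y) *\<^sub>v s (\<psi> y)) $ j) y + c * pderivs w (\<lambda>y. (\<tau> (\<psi> y) *\<^sub>v t (\<psi> y)) $ j) y"
    if j: "j < rk E" for w j
  proof -
    note sj = smooth_funD[OF smooth_sectionD(2)[OF s U(1) j] p]
      and tj = smooth_funD[OF smooth_sectionD(2)[OF t U(1) j] p]
    have ctj: "smooth_on {y \<in> V. \<psi> y \<in> U} (\<lambda>y. c * (\<tau> (\<psi> y) *\<^sub>v t (\<psi> y)) $ j)"
      by (rule smooth_on_mult[OF op smooth_on_const tj])
    have "pderivs w (\<lambda>y. (\<tau> (\<psi> y) *\<^sub>v (s (\<psi> y) + c \<cdot>\<^sub>v t (\<psi> y))) $ j) y =
        pderivs w (\<lambda>y. (\<tau> (\<psi> y) *\<^sub>v s (\<psi> y)) $ j + c * (\<tau> (\<psi> y) *\<^sub>v t (\<psi> y)) $ j) y"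
      by (rule pderivs_cong[OF op _ yO]) (use smooth_section_lincomb(2)[OF E s t U(1) _ j] in simp)
    also have "\<dots> = pderivs w (\<lambda>y. (\<tau> (\<psi> y) *\<^sub>v s (\<psi> y)) $ j) y
        + pderivs w (\<lambda>y. c * (\<tau> (\<psi> y) *\<^sub>v t (\<psi> y)) $ j) y"
      by (rule smooth_on_pderivs_add[OF op sj ctj yO])
    finally show ?thesis unfolding smooth_on_pderivs_cmult[OF op tj yO] .
  qed
  note \<tau> = vector_bundleD(4,5)[OF E U]
  note Dc = smooth_sectionD(1)[OF Dsm[OF s] x] smooth_sectionD(1)[OF Dsm[OF t] x]
    smooth_sectionD(1)[OF Dsm[OF st] x]
  have "\<tau> x *\<^sub>v D (\<lambda>x. s x + c \<cdot>\<^sub>v t x) x = \<tau> x *\<^sub>v (D s x + c \<cdot>\<^sub>v D t x)"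
  proof (rule eq_vecI)
    show "dim_vec (\<tau> x *\<^sub>v D (\<lambda>x. s x + c \<cdot>\<^sub>v t x) x) = dim_vec (\<tau> x *\<^sub>v (D s x + c \<cdot>\<^sub>v D t x))"
      by simp
    fix i assume "i < dim_vec (\<tau> x *\<^sub>v (D s x + c \<cdot>\<^sub>v D t x))"
    then have i: "i < rk E" using \<tau>(1) by simp
    have "(\<tau> x *\<^sub>v D (\<lambda>x. s x + c \<cdot>\<^sub>v t x) x) $ i = (\<tau> x *\<^sub>v D s x) $ i + c * (\<tau> x *\<^sub>v D t x) $ i"
      unfolding rep[OF st i] rep[OF s i] rep[OF t i]
      by (simp add: pdl sum_distrib_left sum.distrib[symmetric] algebra_simps)
    then show "(\<tau> x *\<^sub>v D (\<lambda>x. s x + c \<cdot>\<^sub>v t x) x) $ i = (\<tau> x *\<^sub>v (D s x + c \<cdot>\<^sub>v D t x)) $ i"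
      using smooth_section_lincomb(2)[OF E Dsm[OF s] Dsm[OF t] U i] by simp
  qed
  from mult_mat_vec_cancel[OF \<tau> Dc(3) _ this] show ?thesis
    using Dc(1,2) by simp
qed

text \<open>Bundle maps are isomorphisms on fibres, so a section over the target can be transported
  back along any local isometry.\<close>

definition pull_back ::
  "(('a, 'k::finite) riem \<Rightarrow> ('a, 'k) riem \<Rightarrow> ('a \<Rightarrow> 'a) \<Rightarrow> 'a \<Rightarrow> real mat) \<Rightarrow>
   ('a, 'k) riem \<Rightarrow> ('a, 'k) riem \<Rightarrow> ('a \<Rightarrow> 'a) \<Rightarrow> 'a sect \<Rightarrow> 'a sect" where
  "pull_back L M N f s x = minv (L M N f x) *\<^sub>v s (f x)"

section \<open>Naturality of eigensections under local isometries\<close>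

locale natural_op =
  fixes E :: "('a, 'k::finite) riem \<Rightarrow> 'a vbundle"
    and L :: "('a, 'k) riem \<Rightarrow> ('a, 'k) riem \<Rightarrow> ('a \<Rightarrow> 'a) \<Rightarrow> 'a \<Rightarrow> real mat"
    and D :: "('a, 'k) riem \<Rightarrow> 'a sect \<Rightarrow> 'a sect"
  assumes natural_bundle: "natural_bundle E L"
    and natural_operator: "natural_operator E L D"
begin

lemma bundle_of: "riemannian_manifold M \<Longrightarrow> vector_bundle M (E M)"
  using natural_bundle unfolding natural_bundle_def by blast

lemma elliptic: "riemannian_manifold M \<Longrightarrow> elliptic_diff_op M (E M) (D M)"
  using natural_operator unfolding natural_operator_def by blast

lemma D_smooth:
  "riemannian_manifold M \<Longrightarrow> smooth_section M (E M) s \<Longrightarrow> smooth_section M (E M) (D M s)"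
  using elliptic unfolding elliptic_diff_op_def by blast

lemma eigensection_lincomb:
  assumes M: "riemannian_manifold M"
    and s: "eigensection M (E M) (D M) ev s" and t: "eigensection M (E M) (D M) ev t"
  shows "eigensection M (E M) (D M) ev (\<lambda>x. s x + c \<cdot>\<^sub>v t x)"
proof -
  have sm: "smooth_section M (E M) s" "smooth_section M (E M) t"
    and ev: "\<And>x. x \<in> points M \<Longrightarrow> D M s x = ev \<cdot>\<^sub>v s x" "\<And>x. x \<in> points M \<Longrightarrow> D M t x = ev \<cdot>\<^sub>v t x"
    using s t unfolding eigensection_def by blast+
  have "D M (\<lambda>x. s x + c \<cdot>\<^sub>v t x) x = ev \<cdot>\<^sub>v (s x + c \<cdot>\<^sub>v t x)" if x: "x \<in> points M" for x
    unfolding diff_op_lincomb[OF bundle_of[OF M] elliptic[OF M] sm x] ev[OF x]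
    using smooth_sectionD(1)[OF sm(1) x] smooth_sectionD(1)[OF sm(2) x]
    by (intro eq_vecI) (auto simp: algebra_simps)
  then show ?thesis
    unfolding eigensection_def using smooth_section_lincomb(1)[OF bundle_of[OF M] sm] by blast
qed

context
  fixes M N :: "('a, 'k) riem" and f :: "'a \<Rightarrow> 'a"
  assumes M: "riemannian_manifold M" and N: "riemannian_manifold N" and f: "local_isometry M N f"
begin

lemma L_bundle_map: "bundle_map M (E M) (E N) f (L M N f)"
  using natural_bundle M N f unfolding natural_bundle_def by blast

lemma L_carrier:
  assumes "x \<in> points M"
  shows "rk (E N) = rk (E M)" "L M N f x \<in> carrier_mat (rk (E M)) (rk (E M))"
    "Determinant.det (L M N f x) \<noteq> 0"
proof -
  have L: "L M N f x \<in> carrier_mat (rk (E N)) (rk (E M))" "invertible_mat (L M N f x)"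
    using L_bundle_map assms unfolding bundle_map_def by blast+
  then show eq: "rk (E N) = rk (E M)" unfolding invertible_mat_def by auto
  show "L M N f x \<in> carrier_mat (rk (E M)) (rk (E M))" using L(1) eq by simp
  then show "Determinant.det (L M N f x) \<noteq> 0" using L(2) by (rule invertible_mat_det)
qed

lemma pull_back:
  assumes x: "x \<in> points M" and s: "s (f x) \<in> carrier_vec (rk (E N))"
  shows "L M N f x *\<^sub>v pull_back L M N f s x = s (f x)"
    "pull_back L M N f s x \<in> carrier_vec (rk (E M))"
    "v \<in> carrier_vec (rk (E M)) \<Longrightarrow> L M N f x *\<^sub>v v = s (f x) \<Longrightarrow> v = pull_back L M N f s x"
proof -
  note c = L_carrier[OF x]
  note i = minv[OF c(2,3)]
  have s': "s (f x) \<in> carrier_vec (rk (E M))" using s c(1) by simp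
  show 1: "L M N f x *\<^sub>v pull_back L M N f s x = s (f x)"
    unfolding pull_back_def using assoc_mult_mat_vec[OF c(2) i(1) s'] i(2) s' by simp
  show 2: "pull_back L M N f s x \<in> carrier_vec (rk (E M))"
    unfolding pull_back_def using i(1) s' by simp
  show "v \<in> carrier_vec (rk (E M)) \<Longrightarrow> L M N f x *\<^sub>v v = s (f x) \<Longrightarrow> v = pull_back L M N f s x"
    using mult_mat_vec_cancel[OF c(2,3) _ 2] 1 by simp
qed

lemma L_triv:
  assumes U: "(U, \<tau>) \<in> trivs (E M)" and U': "(U', \<tau>') \<in> trivs (E N)"
  obtains c where "smooth_mat M {x \<in> U. f x \<in> U'} (rk (E M)) c"
    "\<And>x. x \<in> U \<Longrightarrow> f x \<in> U' \<Longrightarrow> \<tau>' (f x) * L M N f x = c x * \<tau> x"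
proof -
  have "\<exists>c. smooth_mat M {x \<in> U. f x \<in> U'} (rk (E M)) c \<and>
      (\<forall>x\<in>U. f x \<in> U' \<longrightarrow> \<tau>' (f x) * L M N f x = c x * \<tau> x)"
    using L_bundle_map U U' unfolding bundle_map_def by fast
  then show thesis using that by blast
qed

text \<open>In trivialisations the pull-back is the inverse of \<open>c\<close> applied to the
  components of \<open>s\<close>, where \<open>c\<close> is the smooth matrix of the bundle map;
  comparing determinants shows that \<open>c\<close> is invertible.\<close>

lemma smooth_section_pull_back:
  assumes s: "smooth_section N (E N) s"
  shows "smooth_section M (E M) (pull_back L M N f s)"
proof (rule smooth_sectionI)
  have sc: "s (f x) \<in> carrier_vec (rk (E N))" if "x \<in> points M" for x
    using smooth_sectionD(1)[OF s local_isometry_points[OF f that]] .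
  show "pull_back L M N f s x \<in> carrier_vec (rk (E M))" if "x \<in> points M" for x
    by (rule pull_back(2)[of x s, OF that sc[OF that]])
  fix U \<tau> i assume U: "(U, \<tau>) \<in> trivs (E M)" and i: "i < rk (E M)"
  note VM = vector_bundleD[OF bundle_of[OF M]] and VN = vector_bundleD[OF bundle_of[OF N]]
  show "smooth_fun M U (\<lambda>x. (\<tau> x *\<^sub>v pull_back L M N f s x) $ i)"
  proof (rule smooth_fun_locally)
    fix x0 assume x0: "x0 \<in> U" "x0 \<in> points M"
    obtain U' \<tau>' where U': "(U', \<tau>') \<in> trivs (E N)" "f x0 \<in> U'"
      using VN(1)[OF local_isometry_points[OF f x0(2)]] by blast
    define W where "W = {x \<in> U. f x \<in> U'}"
    obtain c where c: "smooth_mat M W (rk (E M)) c"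
      and cx: "\<And>x. x \<in> U \<Longrightarrow> f x \<in> U' \<Longrightarrow> \<tau>' (f x) * L M N f x = c x * \<tau> x"
      using L_triv[OF U U'(1)] unfolding W_def by metis
    have "W = U \<inter> {x \<in> points M. f x \<in> U'}" unfolding W_def using VM(3)[OF U] by blast
    then have W: "openin (mtop M) W"
      using openin_Int[OF VM(2)[OF U] local_isometry_openin[OF f VN(2)[OF U'(1)]]] by simp
    have facts: "x \<in> points M" "\<tau> x \<in> carrier_mat (rk (E M)) (rk (E M))" "Determinant.det (\<tau> x) \<noteq> 0"
      "\<tau>' (f x) \<in> carrier_mat (rk (E M)) (rk (E M))" "Determinant.det (\<tau>' (f x)) \<noteq> 0"
      "c x \<in> carrier_mat (rk (E M)) (rk (E M))" "\<tau>' (f x) * L M N f x = c x * \<tau> x" if "x \<in> W" for x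
    proof -
      have xU: "x \<in> U" "f x \<in> U'" using that by (simp_all add: W_def)
      show x: "x \<in> points M" using VM(3)[OF U] xU by blast
      show "\<tau> x \<in> carrier_mat (rk (E M)) (rk (E M))" "Determinant.det (\<tau> x) \<noteq> 0"
        using VM(4,5)[OF U xU(1)] .
      show "\<tau>' (f x) \<in> carrier_mat (rk (E M)) (rk (E M))" "Determinant.det (\<tau>' (f x)) \<noteq> 0"
        using VN(4,5)[OF U'(1) xU(2)] L_carrier(1)[OF x] by simp_all
      show "c x \<in> carrier_mat (rk (E M)) (rk (E M))" by (rule smooth_matD(1)[OF c that])
      show "\<tau>' (f x) * L M N f x = c x * \<tau> x" by (rule cx[OF xU])
    qed
    have detc: "Determinant.det (c x) \<noteq> 0" if "x \<in> W" for x
    proof -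
      note F = facts[OF that]
      have "Determinant.det (\<tau>' (f x)) * Determinant.det (L M N f x) = Determinant.det (c x) * Determinant.det (\<tau> x)"
        using F(7) det_mult[OF F(4) L_carrier(2)[OF F(1)]] det_mult[OF F(6,2)] by simp
      then show ?thesis using F(5) L_carrier(3)[OF F(1)] by auto
    qed
    have "smooth_fun M W (\<lambda>x. (\<tau> x *\<^sub>v pull_back L M N f s x) $ i)"
    proof (rule smooth_fun_cong[OF W])
      show "(minv (c x) *\<^sub>v (\<tau>' (f x) *\<^sub>v s (f x))) $ i = (\<tau> x *\<^sub>v pull_back L M N f s x) $ i"
        if "x \<in> W" for x
      proof -
        note F = facts[OF that]
        note P = pull_back[of x s, OF F(1) sc[OF F(1)]] and Lc = L_carrier(2)[OF F(1)]
          and m = minv[OF F(6) detc[OF that]]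
        let ?p = "pull_back L M N f s x"
        have \<tau>p: "\<tau> x *\<^sub>v ?p \<in> carrier_vec (rk (E M))" using F(2) P(2) by simp
        have "\<tau>' (f x) *\<^sub>v s (f x) = (\<tau>' (f x) * L M N f x) *\<^sub>v ?p"
          using assoc_mult_mat_vec[OF F(4) Lc P(2)] P(1) by simp
        also have "\<dots> = c x *\<^sub>v (\<tau> x *\<^sub>v ?p)"
          unfolding F(7) by (rule assoc_mult_mat_vec[OF F(6,2) P(2)])
        finally have "minv (c x) *\<^sub>v (\<tau>' (f x) *\<^sub>v s (f x)) = minv (c x) *\<^sub>v (c x *\<^sub>v (\<tau> x *\<^sub>v ?p))"
          by simp
        also have "\<dots> = (minv (c x) * c x) *\<^sub>v (\<tau> x *\<^sub>v ?p)"
          by (rule assoc_mult_mat_vec[OF m(1) F(6) \<tau>p, symmetric])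
        also have "\<dots> = \<tau> x *\<^sub>v ?p" unfolding m(3) using \<tau>p by simp
        finally show ?thesis by simp
      qed
      show "smooth_fun M W (\<lambda>x. (minv (c x) *\<^sub>v (\<tau>' (f x) *\<^sub>v s (f x))) $ i)"
      proof (rule smooth_fun_mult_mat_vec[OF W smooth_mat_minv[OF W c detc] _ _ i])
        show "\<tau>' (f x) *\<^sub>v s (f x) \<in> carrier_vec (rk (E M))" if "x \<in> W" for x
          using facts(4)[OF that] sc[OF facts(1)[OF that]] L_carrier(1)[OF facts(1)[OF that]] by simp
        fix j assume "j < rk (E M)"
        then have j: "j < rk (E N)" using L_carrier(1)[OF x0(2)] by simp
        show "smooth_fun M W (\<lambda>x. (\<tau>' (f x) *\<^sub>v s (f x)) $ j)"
          by (rule smooth_fun_subset[OF smooth_fun_compose[OF f VN(2)[OF U'(1)]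
                  smooth_sectionD(2)[OF s U'(1) j]]]) (auto simp: W_def)
      qed
    qed
    then show "\<exists>W'. x0 \<in> W' \<and> smooth_fun M W' (\<lambda>x. (\<tau> x *\<^sub>v pull_back L M N f s x) $ i)"
      using x0(1) U'(2) by (intro exI[of _ W]) (simp add: W_def)
  qed
qed

lemma D_natural:
  assumes "smooth_section N (E N) s" "smooth_section M (E M) t"
    and "\<And>x. x \<in> points M \<Longrightarrow> L M N f x *\<^sub>v t x = s (f x)" and "x \<in> points M"
  shows "L M N f x *\<^sub>v D M t x = D N s (f x)"
  using natural_operator M N f assms unfolding natural_operator_def by blast

text \<open>Naturality applies to any \<open>t\<close> that \<open>L\<close> maps to
  \<open>s\<close> along \<open>f\<close>. The pull-back is such a \<open>t\<close>, and cancelling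
  \<open>L\<close> leaves the eigenvalue equation.\<close>

lemma eigensection_pull_back:
  assumes s: "eigensection N (E N) (D N) ev s"
  shows "eigensection M (E M) (D M) ev (pull_back L M N f s)"
  unfolding eigensection_def
proof (intro conjI ballI)
  have sm: "smooth_section N (E N) s" and Ds: "\<And>x. x \<in> points N \<Longrightarrow> D N s x = ev \<cdot>\<^sub>v s x"
    using s unfolding eigensection_def by blast+
  let ?t = "pull_back L M N f s"
  show tm: "smooth_section M (E M) ?t" by (rule smooth_section_pull_back[OF sm])
  have sc: "s (f x) \<in> carrier_vec (rk (E N))" if "x \<in> points M" for x
    using smooth_sectionD(1)[OF sm local_isometry_points[OF f that]] .
  fix x assume x: "x \<in> points M"
  note P = pull_back[of x s, OF x sc[OF x]] and c = L_carrier[OF x]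
  have "L M N f x *\<^sub>v D M ?t x = ev \<cdot>\<^sub>v s (f x)"
    using D_natural[OF sm tm pull_back(1)[of _ s, OF _ sc] x] Ds[OF local_isometry_points[OF f x]] by simp
  also have "\<dots> = L M N f x *\<^sub>v (ev \<cdot>\<^sub>v ?t x)"
    using mult_mat_vec[OF c(2) P(2)] P(1) by simp
  finally show "D M ?t x = ev \<cdot>\<^sub>v ?t x"
    by (rule mult_mat_vec_cancel[OF c(2,3) smooth_sectionD(1)[OF D_smooth[OF M tm] x]
          smult_carrier_vec[THEN iffD2, OF P(2)]])
qed

end

lemma L_cong:
  assumes M: "riemannian_manifold M" "riemannian_manifold N"
    and f: "local_isometry M N f" "local_isometry M N f'"
    and eq: "\<And>x. x \<in> points M \<Longrightarrow> f x = f' x" and x: "x \<in> points M"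
  shows "L M N f x = L M N f' x"
proof -
  have "\<forall>M N f f'. riemannian_manifold M \<longrightarrow> riemannian_manifold N \<longrightarrow>
        local_isometry M N f \<longrightarrow> local_isometry M N f' \<longrightarrow> (\<forall>x\<in>points M. f x = f' x) \<longrightarrow>
        (\<forall>x\<in>points M. L M N f x = L M N f' x)"
    using natural_bundle unfolding natural_bundle_def by (elim conjE)
  from this[rule_format, OF M f eq x] show ?thesis .
qed

lemma L_comp:
  assumes M: "riemannian_manifold M" "riemannian_manifold N" "riemannian_manifold P"
    and f: "local_isometry M N f" "local_isometry N P h" and x: "x \<in> points M"
  shows "L M P (h \<circ> f) x = L N P h (f x) * L M N f x"
proof -
  have "\<forall>M N P f h. riemannian_manifold M \<longrightarrow> riemannian_manifold N \<longrightarrow> riemannian_manifold P \<longrightarrow>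
        local_isometry M N f \<longrightarrow> local_isometry N P h \<longrightarrow>
        (\<forall>x\<in>points M. L M P (h \<circ> f) x = L N P h (f x) * L M N f x)"
    using natural_bundle unfolding natural_bundle_def by (elim conjE)
  from this[rule_format, OF M f x] show ?thesis .
qed

text \<open>Compositions of maps between orbit spaces are known only on the points of the manifold,
  so equality of maps is available only there.\<close>

lemma pull_back_cong:
  assumes "riemannian_manifold M" "riemannian_manifold N" "local_isometry M N f" "local_isometry M N f'"
    and eq: "\<And>x. x \<in> points M \<Longrightarrow> f x = f' x" and x: "x \<in> points M"
  shows "pull_back L M N f s x = pull_back L M N f' s x"
  unfolding pull_back_def using L_cong[OF assms] eq[OF x] by simp

lemma pull_back_id:
  assumes M: "riemannian_manifold M" and x: "x \<in> points M" and s: "s x \<in> carrier_vec (rk (E M))"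
  shows "pull_back L M M id s x = s x"
proof -
  have li: "local_isometry M M id" using M unfolding riemannian_manifold_def by blast
  have "L M M id x = 1\<^sub>m (rk (E M))"
    using natural_bundle M x unfolding natural_bundle_def by blast
  then show ?thesis
    using pull_back(3)[OF M M li x, of s "s x"] s by simp
qed

lemma pull_back_comp:
  assumes M: "riemannian_manifold M" and N: "riemannian_manifold N" and P: "riemannian_manifold P"
    and f: "local_isometry M N f" and h: "local_isometry N P h" and hf: "local_isometry M P (h \<circ> f)"
    and x: "x \<in> points M" and s: "s (h (f x)) \<in> carrier_vec (rk (E P))"
  shows "pull_back L M N f (pull_back L N P h s) x = pull_back L M P (h \<circ> f) s x"
proof -
  note fx = local_isometry_points[OF f x]
  note comp = L_comp[OF M N P f h x]
  note B = pull_back[of N P h "f x" s, OF N P h fx s]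
  note A = pull_back[of M N f x "pull_back L N P h s", OF M N f x B(2)]
  note Lh = L_carrier[OF N P h fx] and Lf = L_carrier[OF M N f x]
  have Lh': "L N P h (f x) \<in> carrier_mat (rk (E M)) (rk (E M))" using Lh(2) Lf(1) by simp
  have "L M P (h \<circ> f) x *\<^sub>v pull_back L M N f (pull_back L N P h s) x = s ((h \<circ> f) x)"
    unfolding comp using assoc_mult_mat_vec[OF Lh' Lf(2) A(2)] A(1) B(1) by simp
  then show ?thesis
    using pull_back(3)[OF M P hf x _ A(2)] s by simp
qed

end

section \<open>Eigensections on a quotient of the sphere as invariant eigensections on the sphere\<close>

text \<open>Eigenspaces have to be subspaces of a \<open>real_vector\<close> type. Sections have
  values in \<open>real vec\<close>, where the dimension is not part of the type, so they will be
  encoded as real functions of a point and an index.\<close>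

instantiation "fun" :: (type, real_vector) real_vector
begin

definition scaleR_fun :: "real \<Rightarrow> ('a \<Rightarrow> 'b) \<Rightarrow> 'a \<Rightarrow> 'b" where
  "scaleR_fun c f = (\<lambda>x. c *\<^sub>R f x)"

instance
  by standard (simp_all add: scaleR_fun_def fun_eq_iff plus_fun_def scaleR_add_right scaleR_add_left)

end

lemma scaleR_fun_apply: "(c *\<^sub>R f) x = c *\<^sub>R f x"
  by (simp add: scaleR_fun_def)

lemma sum_fun_apply: "(\<Sum>i\<in>A. f i) x = (\<Sum>i\<in>A. f i x)"
  by (induction A rule: infinite_finite_induct) (auto simp: zero_fun_def plus_fun_def)

lemma orthogonal_group_carrierD: "g \<in> carrier (orthogonal_group N) \<Longrightarrow> g \<in> carrier_mat N N"
  by (simp add: orthogonal_group_carrier)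

text \<open>The sphere is taken as the quotient by the trivial group, with singletons as points. It
  thus has the same type as all quotients, and one natural bundle covers both.\<close>

abbreviation SS :: "(real vec set, 'k::finite) riem" where
  "SS \<equiv> sq {1\<^sub>m CARD('k option)}"

text \<open>The map from the sphere to an orbit space induced by \<open>T\<close>: the projection if
  \<open>T\<close> is the identity, an isometry of the sphere if \<open>G\<close> is trivial.
  \<open>the_elem\<close> takes the vector out of its one-point orbit.\<close>

definition om :: "real mat set \<Rightarrow> real mat \<Rightarrow> real vec set \<Rightarrow> real vec set" where
  "om G T X = orbit_of G (T *\<^sub>v the_elem X)"

lemma orb_trivial: "orb {1\<^sub>m CARD('a)} (x :: real^'a::finite) = {to_rvec x}"
  by (simp add: orbit_of_def)

lemma om_orb:
  assumes "T \<in> carrier (orthogonal_group CARD('a))"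
  shows "om G T (orb {1\<^sub>m CARD('a)} (x :: real^'a::finite)) = orb G (mact T x)"
  using assms unfolding om_def orb_trivial by (simp add: to_rvec_mact orthogonal_group_carrier)

lemma local_isometry_om:
  assumes G: "free_orth_group CARD('k::finite option) G"
    and T: "T \<in> carrier (orthogonal_group CARD('k option))"
  shows "local_isometry (SS :: (_, 'k) riem) (sq G) (om G T)"
  by (rule local_isometry_orbit_map[OF free_orth_group_trivial G T om_orb[OF T]])

lemma riemannian_SS: "riemannian_manifold (SS :: (_, 'k::finite) riem)"
  by (rule riemannian_manifold_sq[OF free_orth_group_trivial])

lemma points_SS: "points (SS :: (_, 'k::finite) riem) =
    orb {1\<^sub>m CARD('k option)} ` {x :: real^'k option. norm x = 1}"
  by (rule points_sq[OF free_orth_group_trivial])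

locale sphere_op = natural_op E L D
  for E :: "(real vec set, 'k::finite) riem \<Rightarrow> real vec set vbundle" and L D
begin

abbreviation S0 :: "(real vec set, 'k) riem" where "S0 \<equiv> SS"

abbreviation rk0 :: nat where "rk0 \<equiv> rk (E S0)"

abbreviation eig0 :: "real \<Rightarrow> real vec set sect \<Rightarrow> bool" where
  "eig0 ev t \<equiv> eigensection S0 (E S0) (D S0) ev t"

text \<open>Values off the manifold and beyond the rank are set to 0, so that sections agreeing on
  the manifold have the same code.\<close>

definition enc :: "real vec set sect \<Rightarrow> real vec set \<Rightarrow> nat \<Rightarrow> real" where
  "enc t X j = (if X \<in> points S0 \<and> j < rk0 then t X $ j else 0)"

definition dec :: "(real vec set \<Rightarrow> nat \<Rightarrow> real) \<Rightarrow> real vec set sect" where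
  "dec \<phi> X = Matrix.vec rk0 (\<phi> X)"

text \<open>Pull-back is contravariant; pulling back along the inverse of \<open>g\<close>, which is
  its transpose, makes this a left action.\<close>

definition act :: "real mat \<Rightarrow> (real vec set \<Rightarrow> nat \<Rightarrow> real) \<Rightarrow> real vec set \<Rightarrow> nat \<Rightarrow> real" where
  "act g \<phi> = enc (pull_back L S0 S0 (om {1\<^sub>m CARD('k option)} (transpose_mat g)) (dec \<phi>))"

definition eigs :: "real \<Rightarrow> (real vec set \<Rightarrow> nat \<Rightarrow> real) set" where
  "eigs ev = enc ` {t. eig0 ev t}"

lemma enc_cong: "(\<And>X. X \<in> points S0 \<Longrightarrow> t X = t' X) \<Longrightarrow> enc t = enc t'"
  by (auto simp: enc_def fun_eq_iff)

lemma dec_enc: "X \<in> points S0 \<Longrightarrow> t X \<in> carrier_vec rk0 \<Longrightarrow> dec (enc t) X = t X"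
  by (intro eq_vecI) (auto simp: dec_def enc_def)

lemma eig0_carrier: "eig0 ev t \<Longrightarrow> X \<in> points S0 \<Longrightarrow> t X \<in> carrier_vec rk0"
  unfolding eigensection_def by (blast intro: smooth_sectionD(1))

lemma li_om0: "g \<in> carrier (orthogonal_group CARD('k option)) \<Longrightarrow> local_isometry S0 S0 (om {1\<^sub>m CARD('k option)} g)"
  by (rule local_isometry_om[OF free_orth_group_trivial])

lemma om0_points: "g \<in> carrier (orthogonal_group CARD('k option)) \<Longrightarrow> X \<in> points S0 \<Longrightarrow> om {1\<^sub>m CARD('k option)} g X \<in> points S0"
  by (rule local_isometry_points[OF li_om0])

lemma enc_lincomb:
  assumes "\<And>X. X \<in> points S0 \<Longrightarrow> s X \<in> carrier_vec rk0" "\<And>X. X \<in> points S0 \<Longrightarrow> t X \<in> carrier_vec rk0"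
  shows "enc (\<lambda>X. s X + c \<cdot>\<^sub>v t X) = enc s + c *\<^sub>R enc t"
proof (intro ext)
  fix X j
  show "enc (\<lambda>X. s X + c \<cdot>\<^sub>v t X) X j = (enc s + c *\<^sub>R enc t) X j"
    using assms[of X] by (auto simp: enc_def plus_fun_def scaleR_fun_def)
qed

lemma subspace_eigs: "subspace (eigs ev)"
proof -
  note M = riemannian_SS and V = bundle_of[OF riemannian_SS]
  have comb: "\<phi> + c *\<^sub>R \<eta> \<in> eigs ev" if mem: "\<phi> \<in> eigs ev" "\<eta> \<in> eigs ev" for \<phi> \<eta> c
  proof -
    obtain s t where st: "eig0 ev s" "\<phi> = enc s" "eig0 ev t" "\<eta> = enc t"
      using mem unfolding eigs_def by blast
    have "\<phi> + c *\<^sub>R \<eta> = enc (\<lambda>X. s X + c \<cdot>\<^sub>v t X)"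
      unfolding st(2,4) by (rule enc_lincomb[symmetric]) (rule eig0_carrier[OF st(1)] eig0_carrier[OF st(3)], assumption)+
    then show ?thesis unfolding eigs_def using eigensection_lincomb[OF M st(1,3)] by blast
  qed
  define z :: "real vec set sect" where "z = (\<lambda>X. 0\<^sub>v rk0)"
  have zsm: "smooth_section S0 (E S0) z"
  proof (rule smooth_sectionI)
    fix U \<tau> i assume U: "(U, \<tau>) \<in> trivs (E S0)" "i < rk0"
    show "smooth_fun S0 U (\<lambda>x. (\<tau> x *\<^sub>v z x) $ i)"
    proof (rule smooth_fun_cong[OF vector_bundleD(2)[OF V U(1)] _ smooth_fun_const])
      show "0 = (\<tau> x *\<^sub>v z x) $ i" if "x \<in> U" for x
        using vector_bundleD(4)[OF V U(1) that] U(2) by (simp add: z_def)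
    qed
  qed (simp add: z_def)
  have "D S0 z x = ev \<cdot>\<^sub>v z x" if x: "x \<in> points S0" for x
  proof -
    \<comment> \<open>The zero section equals \<open>z - z\<close>, so linearity of the operator
      gives \<open>D z = D z - D z = 0\<close>.\<close>
    have "(\<lambda>x. z x + (-1) \<cdot>\<^sub>v z x) = z"
      unfolding z_def by (intro ext eq_vecI) simp_all
    then have "D S0 z x = D S0 z x + (-1) \<cdot>\<^sub>v D S0 z x"
      using diff_op_lincomb[OF V elliptic[OF M] zsm zsm x, of "-1"] by simp
    moreover have "D S0 z x \<in> carrier_vec rk0" by (rule smooth_sectionD(1)[OF D_smooth[OF M zsm] x])
    then have "D S0 z x + (-1) \<cdot>\<^sub>v D S0 z x = 0\<^sub>v rk0" by (intro eq_vecI) auto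
    ultimately have "D S0 z x = 0\<^sub>v rk0" by simp
    moreover have "ev \<cdot>\<^sub>v 0\<^sub>v rk0 = 0\<^sub>v rk0" by (intro eq_vecI) simp_all
    ultimately show ?thesis by (simp add: z_def)
  qed
  then have "eig0 ev z" unfolding eigensection_def using zsm by blast
  moreover have "enc z = 0" by (auto simp: enc_def z_def fun_eq_iff zero_fun_def)
  ultimately have 0: "0 \<in> eigs ev" unfolding eigs_def by (metis (mono_tags) image_eqI mem_Collect_eq)
  show ?thesis
    unfolding subspace_def using 0 comb[of _ _ 1] comb[OF 0] by simp
qed

lemma act_enc:
  assumes g: "g \<in> carrier (orthogonal_group CARD('k option))" and t: "eig0 ev t"
  shows "act g (enc t) = enc (pull_back L S0 S0 (om {1\<^sub>m CARD('k option)} (transpose_mat g)) t)"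
    and "eig0 ev (pull_back L S0 S0 (om {1\<^sub>m CARD('k option)} (transpose_mat g)) t)"
proof -
  note g' = orthogonal_group_transpose(1)[OF g]
  show "act g (enc t) = enc (pull_back L S0 S0 (om {1\<^sub>m CARD('k option)} (transpose_mat g)) t)"
    unfolding act_def
  proof (rule enc_cong)
    fix X assume X: "X \<in> points S0"
    note oX = om0_points[OF g' X]
    show "pull_back L S0 S0 (om {1\<^sub>m CARD('k option)} (transpose_mat g)) (dec (enc t)) X =
        pull_back L S0 S0 (om {1\<^sub>m CARD('k option)} (transpose_mat g)) t X"
      unfolding pull_back_def dec_enc[of _ t, OF oX eig0_carrier[OF t oX]] ..
  qed
  show "eig0 ev (pull_back L S0 S0 (om {1\<^sub>m CARD('k option)} (transpose_mat g)) t)"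
    by (rule eigensection_pull_back[OF riemannian_SS riemannian_SS li_om0[OF g'] t])
qed

lemma act_eigs: "g \<in> carrier (orthogonal_group CARD('k option)) \<Longrightarrow> \<phi> \<in> eigs ev \<Longrightarrow> act g \<phi> \<in> eigs ev"
  unfolding eigs_def using act_enc by auto

lemma linear_act:
  assumes g: "g \<in> carrier (orthogonal_group CARD('k option))"
  shows "linear (act g)"
proof -
  let ?p = "pull_back L S0 S0 (om {1\<^sub>m CARD('k option)} (transpose_mat g))"
  note g' = orthogonal_group_transpose(1)[OF g]
  have m: "minv (L S0 S0 (om {1\<^sub>m CARD('k option)} (transpose_mat g)) X) \<in> carrier_mat rk0 rk0" if X: "X \<in> points S0" for X
    using minv(1)[OF L_carrier(2,3)[OF riemannian_SS riemannian_SS li_om0[OF g'] X]] .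
  have comb: "act g (\<phi> + c *\<^sub>R \<eta>) = act g \<phi> + c *\<^sub>R act g \<eta>" for \<phi> \<eta> c
  proof -
    have "act g (\<phi> + c *\<^sub>R \<eta>) = enc (\<lambda>X. ?p (dec \<phi>) X + c \<cdot>\<^sub>v ?p (dec \<eta>) X)"
      unfolding act_def
    proof (rule enc_cong)
      fix X assume X: "X \<in> points S0"
      let ?Y = "om {1\<^sub>m CARD('k option)} (transpose_mat g) X"
      have d: "dec \<psi> Y \<in> carrier_vec rk0" for \<psi> Y by (simp add: dec_def)
      have "dec (\<phi> + c *\<^sub>R \<eta>) ?Y = dec \<phi> ?Y + c \<cdot>\<^sub>v dec \<eta> ?Y"
        by (intro eq_vecI) (auto simp: dec_def plus_fun_def scaleR_fun_def)
      then show "?p (dec (\<phi> + c *\<^sub>R \<eta>)) X = ?p (dec \<phi>) X + c \<cdot>\<^sub>v ?p (dec \<eta>) X"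
        unfolding pull_back_def
        using mult_add_distrib_mat_vec[OF m[OF X] d smult_carrier_vec[THEN iffD2, OF d], of \<phi> ?Y c \<eta> ?Y]
          mult_mat_vec[OF m[OF X] d, of c \<eta> ?Y] by simp
    qed
    also have "\<dots> = act g \<phi> + c *\<^sub>R act g \<eta>"
      unfolding act_def using m
      by (intro enc_lincomb) (auto simp: pull_back_def dec_def intro!: mult_mat_vec_carrier)
    finally show ?thesis .
  qed
  have z: "act g 0 = 0" using comb[of 0 "-1" 0] by simp
  show ?thesis
  proof (rule linearI)
    show "act g (\<phi> + \<eta>) = act g \<phi> + act g \<eta>" for \<phi> \<eta> using comb[of \<phi> 1 \<eta>] by simp
    show "act g (c *\<^sub>R \<eta>) = c *\<^sub>R act g \<eta>" for c \<eta> using comb[of 0 c \<eta>] z by simp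
  qed
qed

lemma act_one: "\<phi> \<in> eigs ev \<Longrightarrow> act (1\<^sub>m CARD('k option)) \<phi> = \<phi>"
proof -
  assume "\<phi> \<in> eigs ev"
  then obtain t where t: "eig0 ev t" "\<phi> = enc t" unfolding eigs_def by blast
  have li: "local_isometry S0 S0 id" using riemannian_SS unfolding riemannian_manifold_def by blast
  have e: "om {1\<^sub>m CARD('k option)} (1\<^sub>m CARD('k option)) X = id X" if "X \<in> points S0" for X
    using that unfolding points_SS by (auto simp: om_orb)
  have "act (1\<^sub>m CARD('k option)) \<phi> = enc (pull_back L S0 S0 (om {1\<^sub>m CARD('k option)} (1\<^sub>m CARD('k option))) t)"
    unfolding t(2) using act_enc(1)[OF orthogonal_group_one t(1)] by simp
  also have "\<dots> = enc t"
  proof (rule enc_cong)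
    fix X assume X: "X \<in> points S0"
    have "pull_back L S0 S0 (om {1\<^sub>m CARD('k option)} (1\<^sub>m CARD('k option))) t X = pull_back L S0 S0 id t X"
      by (rule pull_back_cong[OF riemannian_SS riemannian_SS li_om0[OF orthogonal_group_one] li e X])
    also have "\<dots> = t X"
      by (rule pull_back_id[of S0 X t, OF riemannian_SS X eig0_carrier[OF t(1) X]])
    finally show "pull_back L S0 S0 (om {1\<^sub>m CARD('k option)} (1\<^sub>m CARD('k option))) t X = t X" .
  qed
  finally show ?thesis using t by simp
qed

lemma om_comp_points:
  assumes "g \<in> carrier (orthogonal_group CARD('k option))" "h \<in> carrier (orthogonal_group CARD('k option))" "X \<in> points S0"
  shows "om G h (om {1\<^sub>m CARD('k option)} g X) = om G (h * g) X"
proof -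
  obtain x :: "real^'k option" where x: "X = orb {1\<^sub>m CARD('k option)} x" using assms(3) unfolding points_SS by blast
  have c: "g \<in> carrier_mat CARD('k option) CARD('k option)" "h \<in> carrier_mat CARD('k option) CARD('k option)"
    using assms(1,2) by (auto simp: orthogonal_group_carrier)
  show ?thesis
    unfolding x om_orb[OF assms(1)] om_orb[OF assms(2)] om_orb[OF orthogonal_group_mult[OF assms(2,1)]]
      mact_mult[OF c(2,1)] ..
qed

lemma local_isometry_om_comp:
  assumes "g \<in> carrier (orthogonal_group CARD('k option))" "h \<in> carrier (orthogonal_group CARD('k option))"
    and G: "free_orth_group CARD('k option) G"
  shows "local_isometry S0 (sq G) (om G h \<circ> om {1\<^sub>m CARD('k option)} g)"
proof (rule local_isometry_orbit_map[OF free_orth_group_trivial G orthogonal_group_mult[OF assms(2,1)]])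
  fix x :: "real^'k option" assume "norm x = 1"
  then have "orb {1\<^sub>m CARD('k option)} x \<in> points S0" unfolding points_SS by blast
  from om_comp_points[OF assms(1,2) this]
  show "(om G h \<circ> om {1\<^sub>m CARD('k option)} g) (orb {1\<^sub>m CARD('k option)} x) = orb G (mact (h * g) x)"
    by (simp add: om_orb[OF orthogonal_group_mult[OF assms(2,1)]])
qed

lemma pull_back_om_comp:
  assumes g: "g \<in> carrier (orthogonal_group CARD('k option))" and h: "h \<in> carrier (orthogonal_group CARD('k option))"
    and G: "free_orth_group CARD('k option) G" and X: "X \<in> points S0"
    and s: "\<And>Y. Y \<in> points (sq G :: (_, 'k) riem) \<Longrightarrow> s Y \<in> carrier_vec (rk (E (sq G)))"
  shows "pull_back L S0 S0 (om {1\<^sub>m CARD('k option)} g) (pull_back L S0 (sq G) (om G h) s) X =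
    pull_back L S0 (sq G) (om G (h * g)) s X"
proof -
  note R = riemannian_SS riemannian_manifold_sq[OF G]
  note lh = local_isometry_om[OF G h] and lhg = local_isometry_om_comp[OF g h G]
  have "pull_back L S0 S0 (om {1\<^sub>m CARD('k option)} g) (pull_back L S0 (sq G) (om G h) s) X =
      pull_back L S0 (sq G) (om G h \<circ> om {1\<^sub>m CARD('k option)} g) s X"
    by (rule pull_back_comp[of S0 S0 "sq G" "om {1\<^sub>m CARD('k option)} g" "om G h" X s, OF R(1,1,2) li_om0[OF g] lh lhg X s[OF local_isometry_points[OF lh om0_points[OF g X]]]])
  also have "\<dots> = pull_back L S0 (sq G) (om G (h * g)) s X"
    by (rule pull_back_cong[OF R lhg local_isometry_om[OF G orthogonal_group_mult[OF h g]] _ X])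
      (simp add: om_comp_points[OF g h])
  finally show ?thesis .
qed

lemma act_mult:
  assumes g: "g \<in> carrier (orthogonal_group CARD('k option))" and h: "h \<in> carrier (orthogonal_group CARD('k option))" and \<phi>: "\<phi> \<in> eigs ev"
  shows "act (g * h) \<phi> = act g (act h \<phi>)"
proof -
  obtain t where t: "eig0 ev t" "\<phi> = enc t" using \<phi> unfolding eigs_def by blast
  note g' = orthogonal_group_transpose(1)[OF g] and h' = orthogonal_group_transpose(1)[OF h]
  have tr: "transpose_mat (g * h) = transpose_mat h * transpose_mat g"
    using g h by (intro transpose_mult) (auto simp: orthogonal_group_carrier)
  have "act g (act h \<phi>) = enc (pull_back L S0 S0 (om {1\<^sub>m CARD('k option)} (transpose_mat g))
      (pull_back L S0 S0 (om {1\<^sub>m CARD('k option)} (transpose_mat h)) t))"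
    unfolding t(2) act_enc(1)[OF h t(1)] by (rule act_enc(1)[OF g act_enc(2)[OF h t(1)]])
  also have "\<dots> = enc (pull_back L S0 S0 (om {1\<^sub>m CARD('k option)} (transpose_mat (g * h))) t)"
    unfolding tr
    by (rule enc_cong, rule pull_back_om_comp[OF g' h' free_orth_group_trivial])
      (auto intro: eig0_carrier[OF t(1)])
  also have "\<dots> = act (g * h) \<phi>"
    unfolding t(2) by (rule act_enc(1)[OF orthogonal_group_mult[OF g h] t(1), symmetric])
  finally show ?thesis by simp
qed

section \<open>Descent of invariant eigensections to the quotient\<close>

definition invs :: "real mat set \<Rightarrow> real \<Rightarrow> (real vec set \<Rightarrow> nat \<Rightarrow> real) set" where
  "invs G ev = {\<phi> \<in> eigs ev. \<forall>g\<in>G. act g \<phi> = \<phi>}"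

lemma proj_onto:
  assumes G: "free_orth_group CARD('k option) G"
  shows "om G (1\<^sub>m CARD('k option)) ` points S0 = points (sq G :: (_, 'k) riem)"
  unfolding points_SS points_sq[OF G] image_image by (simp add: om_orb)

lemma proj_ontoE:
  assumes "free_orth_group CARD('k option) G" and "y \<in> points (sq G :: (_, 'k) riem)"
  obtains X where "X \<in> points S0" "y = om G (1\<^sub>m CARD('k option)) X"
  using assms(2) unfolding proj_onto[OF assms(1), symmetric] by (elim imageE)

text \<open>The projection is unchanged when preceded by an element of \<open>G\<close>, so by
  functoriality everything pulled back along it is invariant.\<close>

lemma invs_of_quotient:
  assumes G: "free_orth_group CARD('k option) G"
    and s: "eigensection (sq G :: (_, 'k) riem) (E (sq G)) (D (sq G)) ev s"
  shows "enc (pull_back L S0 (sq G) (om G (1\<^sub>m CARD('k option))) s) \<in> invs G ev"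
proof -
  note R = riemannian_SS riemannian_manifold_sq[OF G] and lp = local_isometry_om[OF G orthogonal_group_one]
  let ?t = "pull_back L S0 (sq G) (om G (1\<^sub>m CARD('k option))) s"
  have t: "eig0 ev ?t" by (rule eigensection_pull_back[OF R lp s])
  have sc: "s Y \<in> carrier_vec (rk (E (sq G)))" if "Y \<in> points (sq G :: (_, 'k) riem)" for Y
    using s that unfolding eigensection_def by (blast intro: smooth_sectionD(1))
  have "act g (enc ?t) = enc ?t" if "g \<in> G" for g
  proof -
    note g = free_orth_groupD(2)[OF G that]
    note g' = orthogonal_group_transpose(1)[OF g] and g'G = free_orth_groupD(5)[OF G that]
    have gc: "1\<^sub>m CARD('k option) * transpose_mat g = transpose_mat g" by (rule left_mult_one_mat[OF orthogonal_group_carrierD[OF g']])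
    show ?thesis unfolding act_enc(1)[OF g t]
    proof (rule enc_cong)
      fix X assume X: "X \<in> points S0"
      have eq: "om G (transpose_mat g) Y = om G (1\<^sub>m CARD('k option)) Y" if "Y \<in> points S0" for Y
        using that unfolding points_SS by (auto simp: om_orb g' orb_mact[OF G g'G])
      have "pull_back L S0 S0 (om {1\<^sub>m CARD('k option)} (transpose_mat g)) ?t X = pull_back L S0 (sq G) (om G (transpose_mat g)) s X"
        using pull_back_om_comp[OF g' orthogonal_group_one G X sc] unfolding gc .
      also have "\<dots> = ?t X"
        by (rule pull_back_cong[OF R local_isometry_om[OF G g'] lp eq X])
      finally show "pull_back L S0 S0 (om {1\<^sub>m CARD('k option)} (transpose_mat g)) ?t X = ?t X" .
    qed
  qed
  then show ?thesis unfolding invs_def eigs_def using t by blast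
qed

text \<open>If \<open>X\<close> is the image of \<open>Y\<close> under \<open>g\<close>, invariance
  says that \<open>L\<close> of \<open>g\<close> maps \<open>t Y\<close> to \<open>t X\<close>.
  Functoriality writes \<open>L\<close> of the projection at \<open>Y\<close> as \<open>L\<close> of
  the projection at \<open>X\<close> times \<open>L\<close> of \<open>g\<close>.\<close>

lemma invariant_proj:
  assumes G: "free_orth_group CARD('k option) G" and t: "eig0 ev t" and inv: "\<forall>g\<in>G. act g (enc t) = enc t"
    and X: "X \<in> points S0" and Y: "Y \<in> points S0" and eq: "om G (1\<^sub>m CARD('k option)) X = om G (1\<^sub>m CARD('k option)) Y"
  shows "L S0 (sq G) (om G (1\<^sub>m CARD('k option))) X *\<^sub>v t X = L S0 (sq G) (om G (1\<^sub>m CARD('k option))) Y *\<^sub>v t Y"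
proof -
  note R = riemannian_SS riemannian_manifold_sq[OF G] and lp = local_isometry_om[OF G orthogonal_group_one]
  obtain x y :: "real^'k option" where xy: "X = orb {1\<^sub>m CARD('k option)} x" "Y = orb {1\<^sub>m CARD('k option)} y"
    using X Y unfolding points_SS by blast
  have "orb G x = orb G y" using eq unfolding xy by (simp add: om_orb)
  then obtain g where gG: "g \<in> G" and g: "x = mact g y" using orb_eq_iff[OF G] by blast
  note go = free_orth_groupD(2)[OF G gG]
  note go' = orthogonal_group_transpose(1)[OF go]
  have XY: "X = om {1\<^sub>m CARD('k option)} g Y" unfolding xy g by (rule om_orb[OF go, symmetric])
  note tc = eig0_carrier[OF t]
  have "t Y = pull_back L S0 S0 (om {1\<^sub>m CARD('k option)} g) t Y"
  proof -
    have "enc t = enc (pull_back L S0 S0 (om {1\<^sub>m CARD('k option)} g) t)"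
      using act_enc(1)[OF go' t] inv free_orth_groupD(5)[OF G gG] by simp
    then have "dec (enc t) Y = dec (enc (pull_back L S0 S0 (om {1\<^sub>m CARD('k option)} g) t)) Y" by simp
    then show ?thesis
      using dec_enc[of Y t, OF Y tc[OF Y]]
        dec_enc[of Y "pull_back L S0 S0 (om {1\<^sub>m CARD('k option)} g) t", OF Y] eig0_carrier[OF act_enc(2)[OF go' t] Y] by simp
  qed
  then have Lg: "L S0 S0 (om {1\<^sub>m CARD('k option)} g) Y *\<^sub>v t Y = t X"
    using pull_back(1)[of S0 S0 "om {1\<^sub>m CARD('k option)} g" Y t, OF R(1,1) li_om0[OF go] Y] tc[OF X] unfolding XY by simp
  have pg: "(om G (1\<^sub>m CARD('k option)) \<circ> om {1\<^sub>m CARD('k option)} g) Z = om G (1\<^sub>m CARD('k option)) Z" if "Z \<in> points S0" for Z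
  proof -
    have "1\<^sub>m CARD('k option) * g = g" by (rule left_mult_one_mat[OF orthogonal_group_carrierD[OF go]])
    then have "(om G (1\<^sub>m CARD('k option)) \<circ> om {1\<^sub>m CARD('k option)} g) Z = om G g Z"
      using om_comp_points[OF go orthogonal_group_one that, of G] by simp
    also have "\<dots> = om G (1\<^sub>m CARD('k option)) Z"
      using that unfolding points_SS by (auto simp: om_orb go orb_mact[OF G gG])
    finally show ?thesis .
  qed
  have "L S0 (sq G) (om G (1\<^sub>m CARD('k option))) Y = L S0 (sq G) (om G (1\<^sub>m CARD('k option)) \<circ> om {1\<^sub>m CARD('k option)} g) Y"
    by (rule L_cong[OF R lp local_isometry_om_comp[OF go orthogonal_group_one G] _ Y]) (rule pg[symmetric])
  also have "\<dots> = L S0 (sq G) (om G (1\<^sub>m CARD('k option))) X * L S0 S0 (om {1\<^sub>m CARD('k option)} g) Y"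
    unfolding XY by (rule L_comp[OF R(1,1,2) li_om0[OF go] lp Y])
  finally have LY: "L S0 (sq G) (om G (1\<^sub>m CARD('k option))) Y = L S0 (sq G) (om G (1\<^sub>m CARD('k option))) X * L S0 S0 (om {1\<^sub>m CARD('k option)} g) Y" .
  show ?thesis
    unfolding LY using assoc_mult_mat_vec[OF L_carrier(2)[OF R lp X] L_carrier(2)[OF R(1,1) li_om0[OF go] Y] tc[OF Y]] Lg
    by simp
qed

text \<open>The section is pushed down through an arbitrary point of each fibre, which is legitimate
  by \<open>invariant_proj\<close>; smoothness is tested where a chart of the quotient lifts to the
  sphere.\<close>

lemma quotient_of_invs:
  assumes G: "free_orth_group CARD('k option) G" and \<phi>: "\<phi> \<in> invs G ev"
  obtains s where "eigensection (sq G :: (_, 'k) riem) (E (sq G)) (D (sq G)) ev s"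
    "\<phi> = enc (pull_back L S0 (sq G) (om G (1\<^sub>m CARD('k option))) s)"
proof -
  note R = riemannian_SS riemannian_manifold_sq[OF G] and lp = local_isometry_om[OF G orthogonal_group_one]
  let ?M = "sq G :: (_, 'k) riem" and ?L = "L S0 (sq G) (om G (1\<^sub>m CARD('k option)))"
  obtain t where t: "eig0 ev t" "\<phi> = enc t" and inv: "\<forall>g\<in>G. act g (enc t) = enc t"
    using \<phi> unfolding invs_def eigs_def by blast
  note tc = eig0_carrier[OF t(1)]
  define s where "s = (\<lambda>y. ?L (SOME X. X \<in> points S0 \<and> om G (1\<^sub>m CARD('k option)) X = y) *\<^sub>v
      t (SOME X. X \<in> points S0 \<and> om G (1\<^sub>m CARD('k option)) X = y))"
  have Lt: "?L X *\<^sub>v t X = s (om G (1\<^sub>m CARD('k option)) X)" if X: "X \<in> points S0" for X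
  proof -
    have "\<exists>Y. Y \<in> points S0 \<and> om G (1\<^sub>m CARD('k option)) Y = om G (1\<^sub>m CARD('k option)) X" using X by blast
    from someI_ex[OF this] have Y: "(SOME Y. Y \<in> points S0 \<and> om G (1\<^sub>m CARD('k option)) Y = om G (1\<^sub>m CARD('k option)) X) \<in> points S0"
      "om G (1\<^sub>m CARD('k option)) X = om G (1\<^sub>m CARD('k option)) (SOME Y. Y \<in> points S0 \<and> om G (1\<^sub>m CARD('k option)) Y = om G (1\<^sub>m CARD('k option)) X)"
      by simp_all
    show ?thesis unfolding s_def by (rule invariant_proj[OF G t(1) inv X Y])
  qed
  have rkM: "rk (E ?M) = rk0" if "X \<in> points S0" for X by (rule L_carrier(1)[OF R lp that])
  have sc: "s y \<in> carrier_vec (rk (E ?M))" if y: "y \<in> points ?M" for y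
  proof -
    obtain X where X: "X \<in> points S0" "y = om G (1\<^sub>m CARD('k option)) X" by (rule proj_ontoE[OF G y])
    have "?L X *\<^sub>v t X \<in> carrier_vec rk0"
      using L_carrier(2)[OF R lp X(1)] tc[OF X(1)] by simp
    then show ?thesis using Lt[OF X(1)] rkM[OF X(1)] X(2) by simp
  qed
  note VM = vector_bundleD[OF bundle_of[OF R(2)]] and V0 = vector_bundleD[OF bundle_of[OF R(1)]]
  have tsm: "smooth_section S0 (E S0) t" using t(1) unfolding eigensection_def by blast
  have ssm: "smooth_section ?M (E ?M) s"
  proof (rule smooth_sectionI[OF sc], assumption, rule smooth_funI, rule smooth_on_locally)
    fix U' \<tau>' i V \<psi> x0
    assume U': "(U', \<tau>') \<in> trivs (E ?M)" and i: "i < rk (E ?M)" and p: "(V, \<psi>) \<in> params ?M"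
      and x0: "x0 \<in> {x \<in> V. \<psi> x \<in> U'}"
    then have x0V: "x0 \<in> V" "\<psi> x0 \<in> U'" by simp_all
    obtain W and S :: "real^'k \<Rightarrow> real^'k option" where W: "x0 \<in> W" "W \<subseteq> V" and S: "elift G \<psi> W S"
      using params_liftE[OF p x0V(1)] by metis
    note dS = eliftD[OF S]
    \<comment> \<open>The local lift, read as a chart of the sphere. In the charts
      \<open>\<psi>0\<close> and \<open>\<psi>\<close> the projection is the identity.\<close>
    define \<psi>0 where "\<psi>0 = (\<lambda>y. orb {1\<^sub>m CARD('k option)} (S y))"
    have inj: "inj_on \<psi> V" using p unfolding params_sphere_quotient by blast
    have p0: "(W, \<psi>0) \<in> params S0"
      unfolding params_sphere_quotient
    proof (intro conjI ballI exI)
      show "open W" by (rule dS(1))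
      show "inj_on \<psi>0 W"
      proof (rule inj_onI)
        fix y z assume yz: "y \<in> W" "z \<in> W" "\<psi>0 y = \<psi>0 z"
        then have "S y = S z" by (simp add: \<psi>0_def orb_trivial)
        then have "\<psi> y = \<psi> z" using dS(4) yz by simp
        then show "y = z" using inj_onD[OF inj] yz W(2) by blast
      qed
      show "elift {1\<^sub>m CARD('k option)} \<psi>0 W S" unfolding elift_def \<psi>0_def using dS by blast
    qed auto
    have \<psi>0S0: "\<psi>0 y \<in> points S0" if "y \<in> W" for y unfolding points_def using p0 that by blast
    have \<psi>\<psi>0: "om G (1\<^sub>m CARD('k option)) (\<psi>0 y) = \<psi> y" if "y \<in> W" for y
      using dS(4)[OF that] by (simp add: \<psi>0_def om_orb)
    obtain U \<tau> where U: "(U, \<tau>) \<in> trivs (E S0)" "\<psi>0 x0 \<in> U"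
      using V0(1)[OF \<psi>0S0[OF W(1)]] by blast
    obtain c where c: "smooth_mat S0 {X \<in> U. om G (1\<^sub>m CARD('k option)) X \<in> U'} rk0 c"
      and cX: "\<And>X. X \<in> U \<Longrightarrow> om G (1\<^sub>m CARD('k option)) X \<in> U' \<Longrightarrow> \<tau>' (om G (1\<^sub>m CARD('k option)) X) * ?L X = c X * \<tau> X"
      by (rule L_triv[OF R lp U(1) U'], rule that)
    define W2 where "W2 = {y \<in> W. \<psi>0 y \<in> {X \<in> U. om G (1\<^sub>m CARD('k option)) X \<in> U'}}"
    have "{X \<in> U. om G (1\<^sub>m CARD('k option)) X \<in> U'} = U \<inter> {X \<in> points S0. om G (1\<^sub>m CARD('k option)) X \<in> U'}" using V0(3)[OF U(1)] by blast
    then have opW: "openin (mtop S0) {X \<in> U. om G (1\<^sub>m CARD('k option)) X \<in> U'}"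
      using openin_Int[OF V0(2)[OF U(1)] local_isometry_openin[OF lp VM(2)[OF U']]] by simp
    then have W2: "open W2" unfolding W2_def by (rule openin_mtopD[OF _ p0])
    have i0: "i < rk0" using i rkM[OF \<psi>0S0[OF W(1)]] by simp
    have sm0: "smooth_fun S0 {X \<in> U. om G (1\<^sub>m CARD('k option)) X \<in> U'} (\<lambda>X. (c X *\<^sub>v (\<tau> X *\<^sub>v t X)) $ i)"
    proof (rule smooth_fun_mult_mat_vec[OF opW c _ _ i0])
      show "\<tau> X *\<^sub>v t X \<in> carrier_vec rk0" if "X \<in> {X \<in> U. om G (1\<^sub>m CARD('k option)) X \<in> U'}" for X
        using V0(4)[OF U(1), of X] tc[of X] V0(3)[OF U(1)] that by auto
      show "smooth_fun S0 {X \<in> U. om G (1\<^sub>m CARD('k option)) X \<in> U'} (\<lambda>X. (\<tau> X *\<^sub>v t X) $ j)" if "j < rk0" for j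
        by (rule smooth_fun_subset[OF smooth_sectionD(2)[OF tsm U(1) that]]) blast
    qed
    have "smooth_on W2 (\<lambda>x. (\<tau>' (\<psi> x) *\<^sub>v s (\<psi> x)) $ i)"
    proof (rule smooth_on_cong[OF W2])
      show "smooth_on W2 (\<lambda>y. (c (\<psi>0 y) *\<^sub>v (\<tau> (\<psi>0 y) *\<^sub>v t (\<psi>0 y))) $ i)"
        unfolding W2_def by (rule smooth_funD[OF sm0 p0])
      fix y assume y: "y \<in> W2"
      then have yW: "y \<in> W" and X: "\<psi>0 y \<in> U" "om G (1\<^sub>m CARD('k option)) (\<psi>0 y) \<in> U'" by (simp_all add: W2_def)
      note XS = \<psi>0S0[OF yW]
      have cm: "c (\<psi>0 y) \<in> carrier_mat rk0 rk0" using smooth_matD(1)[OF c] X by simp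
      have \<tau>'m: "\<tau>' (om G (1\<^sub>m CARD('k option)) (\<psi>0 y)) \<in> carrier_mat rk0 rk0"
        using VM(4)[OF U' X(2)] rkM[OF XS] by simp
      have "\<tau>' (\<psi> y) *\<^sub>v s (\<psi> y) = \<tau>' (om G (1\<^sub>m CARD('k option)) (\<psi>0 y)) *\<^sub>v (?L (\<psi>0 y) *\<^sub>v t (\<psi>0 y))"
        using Lt[OF XS] \<psi>\<psi>0[OF yW] by simp
      also have "\<dots> = (\<tau>' (om G (1\<^sub>m CARD('k option)) (\<psi>0 y)) * ?L (\<psi>0 y)) *\<^sub>v t (\<psi>0 y)"
        by (rule assoc_mult_mat_vec[OF \<tau>'m L_carrier(2)[OF R lp XS] tc[OF XS], symmetric])
      also have "\<dots> = c (\<psi>0 y) *\<^sub>v (\<tau> (\<psi>0 y) *\<^sub>v t (\<psi>0 y))"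
        unfolding cX[OF X] by (rule assoc_mult_mat_vec[OF cm V0(4)[OF U(1) X(1)] tc[OF XS]])
      finally show "(c (\<psi>0 y) *\<^sub>v (\<tau> (\<psi>0 y) *\<^sub>v t (\<psi>0 y))) $ i = (\<tau>' (\<psi> y) *\<^sub>v s (\<psi> y)) $ i"
        by simp
    qed
    moreover have "x0 \<in> W2" using W(1) U(2) x0V(2) \<psi>\<psi>0[OF W(1)] by (simp add: W2_def)
    ultimately show "\<exists>W. x0 \<in> W \<and> smooth_on W (\<lambda>x. (\<tau>' (\<psi> x) *\<^sub>v s (\<psi> x)) $ i)" by blast
  qed
  have "D ?M s y = ev \<cdot>\<^sub>v s y" if y: "y \<in> points ?M" for y
  proof -
    obtain X where X: "X \<in> points S0" "y = om G (1\<^sub>m CARD('k option)) X" by (rule proj_ontoE[OF G y])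
    have "D ?M s y = ?L X *\<^sub>v D S0 t X"
      unfolding X(2) by (rule D_natural[OF R lp ssm tsm Lt X(1), symmetric])
    also have "\<dots> = ?L X *\<^sub>v (ev \<cdot>\<^sub>v t X)" using t(1) X(1) unfolding eigensection_def by simp
    also have "\<dots> = ev \<cdot>\<^sub>v s y"
      using mult_mat_vec[OF L_carrier(2)[OF R lp X(1)] tc[OF X(1)]] Lt[OF X(1)] X(2) by simp
    finally show ?thesis .
  qed
  then have es: "eigensection ?M (E ?M) (D ?M) ev s" unfolding eigensection_def using ssm by blast
  have "\<phi> = enc (pull_back L S0 (sq G) (om G (1\<^sub>m CARD('k option))) s)"
    unfolding t(2)
  proof (rule enc_cong)
    fix X assume X: "X \<in> points S0"
    show "t X = pull_back L S0 (sq G) (om G (1\<^sub>m CARD('k option))) s X"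
      by (rule pull_back(3)[of S0 "sq G" "om G (1\<^sub>m CARD('k option))" X s, OF R lp X sc[OF local_isometry_points[OF lp X]] tc[OF X] Lt[OF X]])
  qed
  then show thesis using that es by blast
qed

end

section \<open>Monomial block matrices\<close>

definition m22 :: "real \<Rightarrow> real \<Rightarrow> real \<Rightarrow> real \<Rightarrow> real mat" where
  "m22 a b c d = Matrix.mat 2 2 (\<lambda>(i, j). if i = 0 then (if j = 0 then a else b) else (if j = 0 then c else d))"

definition refl22 :: "real mat" where
  "refl22 = m22 1 0 0 (- 1)"

lemma m22_carrier [simp]: "m22 a b c d \<in> carrier_mat 2 2"
  by (simp add: m22_def)

lemma m22_mult: "m22 a b c d * m22 a' b' c' d' =
    m22 (a * a' + b * c') (a * b' + b * d') (c * a' + d * c') (c * b' + d * d')"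
  by (rule eq_matI) (auto simp: m22_def scalar_prod_def numeral_2_eq_2 less_Suc_eq)

lemma m22_transpose: "transpose_mat (m22 a b c d) = m22 a c b d"
  by (rule eq_matI) (auto simp: m22_def numeral_2_eq_2 less_Suc_eq)

lemma m22_one: "1\<^sub>m 2 = m22 1 0 0 1"
  by (rule eq_matI) (auto simp: m22_def numeral_2_eq_2 less_Suc_eq)

lemma rot_m22: "rot \<theta> = m22 (cos (2 * pi * \<theta>)) (sin (2 * pi * \<theta>)) (- sin (2 * pi * \<theta>)) (cos (2 * pi * \<theta>))"
  by (rule eq_matI) (auto simp: rot_def m22_def mat_of_rows_list_def numeral_2_eq_2 less_Suc_eq)

lemma rot_carrier [simp]: "rot \<theta> \<in> carrier_mat 2 2"
  by (simp add: rot_m22)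

lemma refl22_carrier [simp]: "refl22 \<in> carrier_mat 2 2"
  by (simp add: refl22_def)

lemma rot_mult: "rot \<alpha> * rot \<beta> = rot (\<alpha> + \<beta>)"
  unfolding rot_m22 m22_mult by (simp add: distrib_left cos_add sin_add algebra_simps)

lemma rot_transpose: "transpose_mat (rot \<theta>) = rot (- \<theta>)"
  unfolding rot_m22 m22_transpose by simp

lemma refl22_refl22: "refl22 * refl22 = 1\<^sub>m 2"
  unfolding refl22_def m22_mult m22_one by simp

lemma refl22_transpose: "transpose_mat refl22 = refl22"
  unfolding refl22_def m22_transpose ..

lemma refl22_rot: "refl22 * rot \<theta> = rot (- \<theta>) * refl22"
  unfolding refl22_def rot_m22 m22_mult by simp

lemma rot_of_int: "rot (of_int z) = 1\<^sub>m 2"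
proof -
  have "cos (2 * pi * of_int z) = 1" "sin (2 * pi * of_int z) = 0"
    using cos_int_2pin[of z] sin_int_2pin[of z] by (simp_all add: mult.commute mult.left_commute)
  then show ?thesis unfolding rot_m22 m22_one by simp
qed

lemma rot_0 [simp]: "rot 0 = 1\<^sub>m 2"
  using rot_of_int[of 0] by simp

lemma rot_cong:
  assumes "\<theta> - \<theta>' = of_int z"
  shows "rot \<theta> = rot \<theta>'"
proof -
  have "rot \<theta> = rot (\<theta>' + of_int z)" using assms by (simp add: algebra_simps)
  also have "\<dots> = rot \<theta>' * rot (of_int z)" by (simp only: rot_mult)
  also have "\<dots> = rot \<theta>'" unfolding rot_of_int by (rule right_mult_one_mat[OF rot_carrier])
  finally show ?thesis .
qed

lemma rot_frac_cong:
  assumes m: "m > 0" and xy: "int m dvd x - y"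
  shows "rot (of_int x / of_nat m) = rot (of_int y / of_nat m)"
proof -
  obtain z where z: "x - y = int m * z" using xy by blast
  have "of_int x / of_nat m - of_int y / of_nat m = (of_int (x - y) / of_nat m :: real)"
    by (simp add: diff_divide_distrib)
  also have "\<dots> = of_int z" unfolding z using m by simp
  finally show ?thesis by (rule rot_cong)
qed

text \<open>Minus the identity, written as a half turn so that \<open>rot_mult\<close> covers
  it.\<close>

abbreviation neg22 :: "real mat" where "neg22 \<equiv> rot (1 / 2)"

lemma neg22_neg22: "neg22 * neg22 = 1\<^sub>m 2"
  using rot_of_int[of 1] by (simp add: rot_mult)

lemma rot_orthogonal: "rot \<theta> \<in> carrier (orthogonal_group 2)"
  by (simp add: orthogonal_group_carrier rot_transpose rot_mult)

lemma refl22_orthogonal: "refl22 \<in> carrier (orthogonal_group 2)"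
  by (simp add: orthogonal_group_carrier refl22_transpose refl22_refl22)

text \<open>Each matrix of the construction has a single possibly nonzero block in every block row.
  Products of such matrices compose the maps \<open>\<pi>\<close>, which reduces all relations to 2
  by 2 blocks.\<close>

definition mono_mat :: "nat \<Rightarrow> (nat \<Rightarrow> nat) \<Rightarrow> (nat \<Rightarrow> real mat) \<Rightarrow> real mat" where
  "mono_mat d \<pi> F = block_array d (\<lambda>a b. if b = \<pi> a then F a else 0\<^sub>m 2 2)"

lemma mono_mat_carrier [simp]: "mono_mat d \<pi> F \<in> carrier_mat (2 * d) (2 * d)"
  by (simp add: mono_mat_def block_array_def)

lemma mono_mat_index:
  "i < 2 * d \<Longrightarrow> j < 2 * d \<Longrightarrow> mono_mat d \<pi> F $$ (i, j) =
    (if j div 2 = \<pi> (i div 2) then F (i div 2) $$ (i mod 2, j mod 2) else 0)"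
  by (simp add: mono_mat_def block_array_def)

lemma mono_mat_cong:
  assumes "\<And>a. a < d \<Longrightarrow> \<pi> a = \<pi>' a" "\<And>a. a < d \<Longrightarrow> F a = F' a"
  shows "mono_mat d \<pi> F = mono_mat d \<pi>' F'"
proof (rule eq_matI)
  fix i j assume "i < dim_row (mono_mat d \<pi>' F')" "j < dim_col (mono_mat d \<pi>' F')"
  then have ij: "i < 2 * d" "j < 2 * d" by (simp_all add: mono_mat_def block_array_def)
  then have "i div 2 < d" by simp
  then show "mono_mat d \<pi> F $$ (i, j) = mono_mat d \<pi>' F' $$ (i, j)"
    unfolding mono_mat_index[OF ij] using assms by simp
qed (simp_all add: mono_mat_def block_array_def)

lemma sum_pairs: "(\<Sum>t\<in>{0..<2 * d}. g t) = (\<Sum>b\<in>{0..<d}. g (2 * b) + g (2 * b + 1 :: nat) :: real)"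
  by (induction d) (simp_all add: add.assoc)

lemma mat22_mult_index:
  fixes A B :: "real mat" and i j :: nat
  assumes "A \<in> carrier_mat 2 2" "B \<in> carrier_mat 2 2" "i < 2" "j < 2"
  shows "(A * B) $$ (i, j) = A $$ (i, 0) * B $$ (0, j) + A $$ (i, 1) * B $$ (1, j)"
  using assms by (simp add: scalar_prod_def numeral_2_eq_2)

lemma mono_mat_mult:
  assumes \<pi>: "\<And>a. a < d \<Longrightarrow> \<pi> a < d" and F: "\<And>a. a < d \<Longrightarrow> F a \<in> carrier_mat 2 2"
    and F': "\<And>a. a < d \<Longrightarrow> F' a \<in> carrier_mat 2 2"
  shows "mono_mat d \<pi> F * mono_mat d \<pi>' F' = mono_mat d (\<lambda>a. \<pi>' (\<pi> a)) (\<lambda>a. F a * F' (\<pi> a))"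
proof (rule eq_matI)
  fix i j
  assume "i < dim_row (mono_mat d (\<lambda>a. \<pi>' (\<pi> a)) (\<lambda>a. F a * F' (\<pi> a)))"
    "j < dim_col (mono_mat d (\<lambda>a. \<pi>' (\<pi> a)) (\<lambda>a. F a * F' (\<pi> a)))"
  then have ij: "i < 2 * d" "j < 2 * d" by (simp_all add: mono_mat_def block_array_def)
  define a where "a = i div 2"
  have a: "a < d" using ij by (simp add: a_def)
  let ?g = "\<lambda>t. mono_mat d \<pi> F $$ (i, t) * mono_mat d \<pi>' F' $$ (t, j)"
  have "(mono_mat d \<pi> F * mono_mat d \<pi>' F') $$ (i, j) = (\<Sum>t\<in>{0..<2 * d}. ?g t)"
    using ij by (simp add: scalar_prod_def mono_mat_def block_array_def)
  also have "\<dots> = (\<Sum>b\<in>{0..<d}. if b = \<pi> a then ?g (2 * b) + ?g (2 * b + 1) else 0)"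
    unfolding sum_pairs using ij by (intro sum.cong HOL.refl) (simp add: mono_mat_index a_def)
  also have "\<dots> = ?g (2 * \<pi> a) + ?g (2 * \<pi> a + 1)"
    using \<pi>[OF a] by simp
  also have "\<dots> = mono_mat d (\<lambda>a. \<pi>' (\<pi> a)) (\<lambda>a. F a * F' (\<pi> a)) $$ (i, j)"
    using \<pi>[OF a] ij mat22_mult_index[OF F[OF a] F'[OF \<pi>[OF a]], of "i mod 2" "j mod 2"]
    by (simp add: mono_mat_index a_def[symmetric])
  finally show "(mono_mat d \<pi> F * mono_mat d \<pi>' F') $$ (i, j) =
      mono_mat d (\<lambda>a. \<pi>' (\<pi> a)) (\<lambda>a. F a * F' (\<pi> a)) $$ (i, j)" .
qed (simp_all add: mono_mat_def block_array_def)

lemma mono_mat_one: "mono_mat d (\<lambda>a. a) (\<lambda>a. 1\<^sub>m 2) = 1\<^sub>m (2 * d)"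
proof (rule eq_matI)
  fix i j assume "i < dim_row (1\<^sub>m (2 * d) :: real mat)" "j < dim_col (1\<^sub>m (2 * d) :: real mat)"
  then have ij: "i < 2 * d" "j < 2 * d" by simp_all
  have "i = j \<longleftrightarrow> j div 2 = i div 2 \<and> i mod 2 = j mod 2" by (metis div_mult_mod_eq)
  then show "mono_mat d (\<lambda>a. a) (\<lambda>a. 1\<^sub>m 2) $$ (i, j) = 1\<^sub>m (2 * d) $$ (i, j)"
    unfolding mono_mat_index[OF ij] using ij by auto
qed (simp_all add: mono_mat_def block_array_def)

lemma mono_mat_transpose:
  assumes F: "\<And>a. a < d \<Longrightarrow> F a \<in> carrier_mat 2 2"
    and \<pi>': "\<And>b. b < d \<Longrightarrow> \<pi>' b < d" "\<And>b. b < d \<Longrightarrow> \<pi> (\<pi>' b) = b" "\<And>a. a < d \<Longrightarrow> \<pi>' (\<pi> a) = a"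
  shows "transpose_mat (mono_mat d \<pi> F) = mono_mat d \<pi>' (\<lambda>b. transpose_mat (F (\<pi>' b)))"
proof (rule eq_matI)
  fix i j
  assume "i < dim_row (mono_mat d \<pi>' (\<lambda>b. transpose_mat (F (\<pi>' b))))"
    "j < dim_col (mono_mat d \<pi>' (\<lambda>b. transpose_mat (F (\<pi>' b))))"
  then have ij: "i < 2 * d" "j < 2 * d" by (simp_all add: mono_mat_def block_array_def)
  then have ab: "i div 2 < d" "j div 2 < d" by simp_all
  have "i div 2 = \<pi> (j div 2) \<longleftrightarrow> j div 2 = \<pi>' (i div 2)" using \<pi>' ab by metis
  then show "transpose_mat (mono_mat d \<pi> F) $$ (i, j) = mono_mat d \<pi>' (\<lambda>b. transpose_mat (F (\<pi>' b))) $$ (i, j)"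
    using ij F[of "\<pi>' (i div 2)"] \<pi>'(1)[OF ab(1)]
    by (auto simp: mono_mat_index mono_mat_def[of d \<pi>] block_array_def)
qed (simp_all add: mono_mat_def block_array_def)

lemma mono_mat_orthogonal:
  assumes F: "\<And>a. a < d \<Longrightarrow> F a \<in> carrier (orthogonal_group 2)"
    and \<pi>': "\<And>b. b < d \<Longrightarrow> \<pi>' b < d" "\<And>b. b < d \<Longrightarrow> \<pi> (\<pi>' b) = b" "\<And>a. a < d \<Longrightarrow> \<pi>' (\<pi> a) = a"
  shows "mono_mat d \<pi> F \<in> carrier (orthogonal_group (2 * d))"
proof -
  have Fc: "F a \<in> carrier_mat 2 2" "transpose_mat (F a) * F a = 1\<^sub>m 2" if "a < d" for a
    using F[OF that] by (auto simp: orthogonal_group_carrier)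
  have "transpose_mat (mono_mat d \<pi> F) * mono_mat d \<pi> F =
      mono_mat d (\<lambda>b. \<pi> (\<pi>' b)) (\<lambda>b. transpose_mat (F (\<pi>' b)) * F (\<pi>' b))"
    unfolding mono_mat_transpose[where F=F, OF Fc(1) \<pi>', simplified]
    by (rule mono_mat_mult) (use \<pi>' Fc in auto)
  also have "\<dots> = mono_mat d (\<lambda>a. a) (\<lambda>a. 1\<^sub>m 2)"
    by (rule mono_mat_cong) (use \<pi>' Fc in auto)
  finally show ?thesis by (simp add: orthogonal_group_carrier mono_mat_one)
qed

section \<open>Block diagonal sums\<close>

definition bsum :: "nat \<Rightarrow> (nat \<Rightarrow> real mat) \<Rightarrow> real mat" where
  "bsum p M = diag_block_mat (map M [1..<p + 1])"

lemma bsum_0: "bsum 0 M = 0\<^sub>m 0 0"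
  by (simp add: bsum_def)

lemma bsum_Suc: "bsum (Suc p) M = four_block_mat (bsum p M)
    (0\<^sub>m (dim_row (bsum p M)) (dim_col (M (Suc p)))) (0\<^sub>m (dim_row (M (Suc p))) (dim_col (bsum p M))) (M (Suc p))"
  unfolding bsum_def by (simp add: diag_block_mat_last Let_def)

lemma bsum_carrier:
  assumes "\<And>j. j \<in> {1..p} \<Longrightarrow> M j \<in> carrier_mat s s"
  shows "bsum p M \<in> carrier_mat (s * p) (s * p)"
  using assms
proof (induction p)
  case (Suc p)
  have "bsum p M \<in> carrier_mat (s * p) (s * p)" "M (Suc p) \<in> carrier_mat s s" using Suc by auto
  then show ?case unfolding bsum_Suc by (auto simp: add.commute)
qed (simp add: bsum_0)

lemma bsum_cong: "(\<And>j. j \<in> {1..p} \<Longrightarrow> M j = M' j) \<Longrightarrow> bsum p M = bsum p M'"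
  unfolding bsum_def by (intro arg_cong[where f = diag_block_mat] map_cong) auto

lemma bsum_mult:
  assumes "\<And>j. j \<in> {1..p} \<Longrightarrow> M j \<in> carrier_mat s s" "\<And>j. j \<in> {1..p} \<Longrightarrow> M' j \<in> carrier_mat s s"
  shows "bsum p M * bsum p M' = bsum p (\<lambda>j. M j * M' j)"
  using assms
proof (induction p)
  case (Suc p)
  have c: "bsum p M \<in> carrier_mat (s * p) (s * p)" "M (Suc p) \<in> carrier_mat s s"
    "bsum p M' \<in> carrier_mat (s * p) (s * p)" "M' (Suc p) \<in> carrier_mat s s"
    using Suc.prems by (auto intro!: bsum_carrier)
  have c': "bsum p (\<lambda>j. M j * M' j) \<in> carrier_mat (s * p) (s * p)"
    by (rule bsum_carrier, rule mult_carrier_mat[OF Suc.prems(1) Suc.prems(2)]) auto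
  have IH: "bsum p M * bsum p M' = bsum p (\<lambda>j. M j * M' j)" using Suc by auto
  have "bsum (Suc p) M * bsum (Suc p) M' =
    four_block_mat (bsum p M) (0\<^sub>m (s * p) s) (0\<^sub>m s (s * p)) (M (Suc p)) *
    four_block_mat (bsum p M') (0\<^sub>m (s * p) s) (0\<^sub>m s (s * p)) (M' (Suc p))"
    unfolding bsum_Suc using c by simp
  also have "\<dots> = four_block_mat (bsum p M * bsum p M') (0\<^sub>m (s * p) s) (0\<^sub>m s (s * p)) (M (Suc p) * M' (Suc p))"
    using c by (subst mult_four_block_mat[where ?nr1.0="s * p" and ?n1.0="s * p" and ?n2.0=s and ?nr2.0=s and ?nc1.0="s * p" and ?nc2.0=s]) auto
  finally show ?case unfolding IH bsum_Suc using c c' by simp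
qed (simp add: bsum_0)

lemma bsum_transpose:
  assumes "\<And>j. j \<in> {1..p} \<Longrightarrow> M j \<in> carrier_mat s s"
  shows "transpose_mat (bsum p M) = bsum p (\<lambda>j. transpose_mat (M j))"
  using assms
proof (induction p)
  case (Suc p)
  have c: "bsum p M \<in> carrier_mat (s * p) (s * p)" "M (Suc p) \<in> carrier_mat s s"
    using Suc.prems by (auto intro!: bsum_carrier)
  have IH: "transpose_mat (bsum p M) = bsum p (\<lambda>j. transpose_mat (M j))" using Suc by auto
  have "dim_row (transpose_mat (bsum p M)) = s * p" "dim_col (transpose_mat (bsum p M)) = s * p" using c by auto
  then have dims: "dim_row (bsum p (\<lambda>j. transpose_mat (M j))) = s * p" "dim_col (bsum p (\<lambda>j. transpose_mat (M j))) = s * p"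
    unfolding IH by auto
  have "transpose_mat (bsum (Suc p) M) = four_block_mat (transpose_mat (bsum p M)) (0\<^sub>m (s * p) s) (0\<^sub>m s (s * p)) (transpose_mat (M (Suc p)))"
    unfolding bsum_Suc using c
    by (subst transpose_four_block_mat[where ?nr1.0="s * p" and ?nc1.0="s * p" and ?nc2.0=s and ?nr2.0=s]) auto
  then show ?case unfolding IH bsum_Suc dims using c by simp
qed (simp add: bsum_0)

lemma bsum_one: "bsum p (\<lambda>j. 1\<^sub>m s) = 1\<^sub>m (s * p)"
proof (induction p)
  case (Suc p)
  show ?case unfolding bsum_Suc Suc by (rule eq_matI) auto
next
  case 0
  show ?case unfolding bsum_0 by (rule eq_matI) auto
qed

lemma bsum_orthogonal:
  assumes "\<And>j. j \<in> {1..p} \<Longrightarrow> M j \<in> carrier (orthogonal_group s)"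
  shows "bsum p M \<in> carrier (orthogonal_group (s * p))"
proof -
  have c: "M j \<in> carrier_mat s s" "transpose_mat (M j) * M j = 1\<^sub>m s" if "j \<in> {1..p}" for j
    using assms[OF that] by (auto simp: orthogonal_group_carrier)
  have tr: "transpose_mat (bsum p M) = bsum p (\<lambda>j. transpose_mat (M j))"
    by (rule bsum_transpose) (rule c(1))
  have "transpose_mat (bsum p M) * bsum p M = bsum p (\<lambda>j. transpose_mat (M j) * M j)"
    unfolding tr by (rule bsum_mult[where s = s]) (use c in auto)
  also have "\<dots> = bsum p (\<lambda>j. 1\<^sub>m s)" by (rule bsum_cong) (rule c(2))
  finally show ?thesis using bsum_carrier[OF c(1)] by (simp add: orthogonal_group_carrier bsum_one)
qed

definition no_fixed :: "nat \<Rightarrow> real mat \<Rightarrow> bool" where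
  "no_fixed s M \<longleftrightarrow> (\<forall>v\<in>carrier_vec s. M *\<^sub>v v = v \<longrightarrow> v = 0\<^sub>v s)"

lemma bsum_no_fixed:
  assumes "\<And>j. j \<in> {1..p} \<Longrightarrow> M j \<in> carrier_mat s s" "\<And>j. j \<in> {1..p} \<Longrightarrow> no_fixed s (M j)"
  shows "no_fixed (s * p) (bsum p M)"
  using assms
proof (induction p)
  case (Suc p)
  have c: "bsum p M \<in> carrier_mat (s * p) (s * p)" "M (Suc p) \<in> carrier_mat s s"
    using Suc.prems by (auto intro!: bsum_carrier)
  have nf: "no_fixed (s * p) (bsum p M)" "no_fixed s (M (Suc p))" using Suc by auto
  show ?case unfolding no_fixed_def
  proof (intro ballI impI)
    fix v assume v: "v \<in> carrier_vec (s * Suc p)" and fx: "bsum (Suc p) M *\<^sub>v v = v"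
    define v1 v2 where "v1 = vec_first v (s * p)" and "v2 = vec_last v s"
    have v12: "v1 \<in> carrier_vec (s * p)" "v2 \<in> carrier_vec s" by (simp_all add: v1_def v2_def)
    have v': "v \<in> carrier_vec (s * p + s)" using v by (simp add: add.commute)
    have vv: "v = v1 @\<^sub>v v2"
      unfolding v1_def v2_def by (rule vec_first_last_append[OF v', symmetric])
    have "bsum (Suc p) M *\<^sub>v (v1 @\<^sub>v v2) = (bsum p M *\<^sub>v v1) @\<^sub>v (M (Suc p) *\<^sub>v v2)"
      unfolding bsum_Suc using c v12 by (subst four_block_mat_mult_vec[where ?nr1.0="s * p" and ?nc1.0="s * p" and ?nr2.0=s and ?nc2.0=s]) auto
    then have "(bsum p M *\<^sub>v v1) @\<^sub>v (M (Suc p) *\<^sub>v v2) = v1 @\<^sub>v v2" using fx vv by simp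
    then have "bsum p M *\<^sub>v v1 = v1" "M (Suc p) *\<^sub>v v2 = v2"
      using append_vec_eq[of "bsum p M *\<^sub>v v1" "s * p" v1] c v12 by auto
    then have "v1 = 0\<^sub>v (s * p)" "v2 = 0\<^sub>v s" using nf v12 unfolding no_fixed_def by blast+
    then show "v = 0\<^sub>v (s * Suc p)" unfolding vv by (intro eq_vecI) (auto simp: add.commute)
  qed
next
  case 0
  show ?case unfolding no_fixed_def by (intro ballI impI eq_vecI) auto
qed

lemma mono_mat_diag_no_fixed:
  assumes F: "\<And>a. a < d \<Longrightarrow> F a \<in> carrier_mat 2 2" "\<And>a. a < d \<Longrightarrow> no_fixed 2 (F a)"
  shows "no_fixed (2 * d) (mono_mat d (\<lambda>a. a) F)"
  unfolding no_fixed_def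
proof (intro ballI impI)
  fix v :: "real vec" assume v: "v \<in> carrier_vec (2 * d)" and fx: "mono_mat d (\<lambda>a. a) F *\<^sub>v v = v"
  have "v $ i = 0" if i: "i < 2 * d" for i
  proof -
    define a where "a = i div 2"
    have a: "a < d" using i by (simp add: a_def)
    define w where "w = Matrix.vec 2 (\<lambda>e. v $ (2 * a + e))"
    have row: "v $ (2 * a + e) = F a $$ (e, 0) * v $ (2 * a) + F a $$ (e, 1) * v $ (2 * a + 1)" if e: "e < 2" for e
    proof -
      have ie: "2 * a + e < 2 * d" using a e by simp
      let ?g = "\<lambda>t. mono_mat d (\<lambda>a. a) F $$ (2 * a + e, t) * v $ t"
      have "v $ (2 * a + e) = (mono_mat d (\<lambda>a. a) F *\<^sub>v v) $ (2 * a + e)" by (simp only: fx)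
      also have "\<dots> = (\<Sum>t\<in>{0..<2 * d}. ?g t)"
        using ie v by (simp add: scalar_prod_def mono_mat_def block_array_def)
      also have "\<dots> = (\<Sum>b\<in>{0..<d}. if b = a then ?g (2 * b) + ?g (2 * b + 1) else 0)"
        unfolding sum_pairs using ie e by (intro sum.cong HOL.refl) (simp add: mono_mat_index)
      also have "\<dots> = ?g (2 * a) + ?g (2 * a + 1)" using a by simp
      finally show ?thesis using ie a e by (simp add: mono_mat_index)
    qed
    have "F a *\<^sub>v w = w"
    proof (rule eq_vecI)
      fix e assume "e < dim_vec w"
      then have e: "e < 2" by (simp add: w_def)
      have "(F a *\<^sub>v w) $ e = F a $$ (e, 0) * v $ (2 * a) + F a $$ (e, 1) * v $ (2 * a + 1)"
        using F(1)[OF a] e by (simp add: scalar_prod_def w_def numeral_2_eq_2)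
      then show "(F a *\<^sub>v w) $ e = w $ e" using row[OF e] e by (simp add: w_def)
    qed (use F(1)[OF a] in \<open>simp add: w_def\<close>)
    then have "w = 0\<^sub>v 2" using F(2)[OF a] unfolding no_fixed_def by (simp add: w_def)
    then have "w $ (i mod 2) = 0" by simp
    then show ?thesis by (simp add: w_def a_def)
  qed
  then show "v = 0\<^sub>v (2 * d)" using v by (intro eq_vecI) auto
qed

lemma rot_no_fixed:
  assumes "\<theta> \<notin> \<int>"
  shows "no_fixed 2 (rot \<theta>)"
  unfolding no_fixed_def
proof (intro ballI impI)
  fix v :: "real vec" assume v: "v \<in> carrier_vec 2" and fx: "rot \<theta> *\<^sub>v v = v"
  let ?c = "cos (2 * pi * \<theta>)" and ?s = "sin (2 * pi * \<theta>)"
  have e: "?c * v $ 0 + ?s * v $ 1 = v $ 0" "- ?s * v $ 0 + ?c * v $ 1 = v $ 1"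
    using arg_cong[OF fx, of "\<lambda>v. v $ 0"] arg_cong[OF fx, of "\<lambda>v. v $ 1"] v
    by (simp_all add: rot_m22 m22_def scalar_prod_def numeral_2_eq_2)
  have "?c \<noteq> 1"
  proof
    assume "?c = 1"
    then obtain z :: int where "2 * pi * \<theta> = of_int z * 2 * pi" using cos_one_2pi_int by blast
    then have "\<theta> = of_int z" by simp
    then show False using assms by simp
  qed
  \<comment> \<open>Both sides are the inner product of \<open>v\<close> with
    \<open>rot \<theta> *\<^sub>v v - v\<close>, which is 0 for a fixed vector.\<close>
  have "(?c - 1) * (v $ 0 * v $ 0 + v $ 1 * v $ 1) =
      v $ 0 * (?c * v $ 0 + ?s * v $ 1 - v $ 0) + v $ 1 * (- ?s * v $ 0 + ?c * v $ 1 - v $ 1)"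
    by (simp add: algebra_simps)
  also have "\<dots> = 0" unfolding e by simp
  finally have "v $ 0 * v $ 0 + v $ 1 * v $ 1 = 0" using \<open>?c \<noteq> 1\<close> by simp
  then have "v $ 0 = 0" "v $ 1 = 0" by (simp_all add: sum_squares_eq_zero_iff)
  then show "v = 0\<^sub>v 2" using v by (intro eq_vecI) (auto simp: numeral_2_eq_2 less_Suc_eq)
qed

section \<open>Representations of presented groups\<close>

text \<open>Inverse letters become transposes, which are inverses as long as the generators are
  mapped to orthogonal matrices.\<close>

definition wev :: "nat \<Rightarrow> ('g \<Rightarrow> real mat) \<Rightarrow> 'g gword \<Rightarrow> real mat" where
  "wev N \<phi> w = foldr (\<lambda>(x, b) M. (if b then \<phi> x else transpose_mat (\<phi> x)) * M) w (1\<^sub>m N)"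

lemma wev_Nil [simp]: "wev N \<phi> [] = 1\<^sub>m N"
  and wev_Cons: "wev N \<phi> ((x, b) # w) = (if b then \<phi> x else transpose_mat (\<phi> x)) * wev N \<phi> w"
  by (simp_all add: wev_def)

context
  fixes N :: nat and \<phi> :: "'g \<Rightarrow> real mat"
  assumes \<phi>: "\<And>x. \<phi> x \<in> carrier (orthogonal_group N)"
begin

lemma letter_orthogonal: "(if b then \<phi> x else transpose_mat (\<phi> x)) \<in> carrier (orthogonal_group N)"
  using \<phi> orthogonal_group_transpose(1)[OF \<phi>] by simp

lemma wev_orthogonal: "wev N \<phi> w \<in> carrier (orthogonal_group N)"
  by (induction w) (auto simp: wev_Cons simp del: if_split intro!: orthogonal_group_mult letter_orthogonal \<phi> orthogonal_group_transpose(1))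

lemma wev_carrier: "wev N \<phi> w \<in> carrier_mat N N"
  by (rule orthogonal_group_carrierD[OF wev_orthogonal])

lemma wev_append: "wev N \<phi> (u @ v) = wev N \<phi> u * wev N \<phi> v"
proof (induction u)
  case (Cons a u)
  obtain x b where a: "a = (x, b)" by fastforce
  show ?case unfolding a append_Cons wev_Cons Cons
    by (rule assoc_mult_mat[OF orthogonal_group_carrierD[OF letter_orthogonal] wev_carrier wev_carrier, symmetric])
qed (simp add: left_mult_one_mat[OF wev_carrier])

lemma wev_cancel: "wev N \<phi> [(x, b), (x, \<not> b)] = 1\<^sub>m N"
proof -
  note c = orthogonal_group_carrierD[OF \<phi>[of x]]
  have "transpose_mat (\<phi> x) * \<phi> x = 1\<^sub>m N" using \<phi>[of x] by (simp add: orthogonal_group_carrier)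
  then show ?thesis
    using orthogonal_group_transpose(2)[OF \<phi>[of x]] c
    by (cases b) (simp_all add: wev_Cons)
qed

lemma wev_word_eq:
  assumes R: "\<And>r. r \<in> R \<Longrightarrow> wev N \<phi> r = 1\<^sub>m N" and eq: "word_eq R v w"
  shows "wev N \<phi> v = wev N \<phi> w"
  using eq
proof induction
  case (cancel u x b v)
  show ?case
    unfolding wev_append wev_cancel by (simp add: left_mult_one_mat[OF wev_carrier])
next
  case (relator r u v)
  show ?case
    unfolding wev_append R[OF relator] by (simp add: left_mult_one_mat[OF wev_carrier])
qed simp_all

lemma wev_inverse: "transpose_mat (wev N \<phi> w) = wev N \<phi> (rev (map (\<lambda>(x, b). (x, \<not> b)) w))"
proof (induction w)
  case (Cons a w)
  obtain x b where a: "a = (x, b)" by fastforce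
  note c = orthogonal_group_carrierD[OF letter_orthogonal[of b x]]
  have l: "wev N \<phi> [(x, \<not> b)] = transpose_mat (if b then \<phi> x else transpose_mat (\<phi> x))"
    using orthogonal_group_carrierD[OF \<phi>[of x]] by (auto simp: wev_Cons)
  have "transpose_mat (wev N \<phi> (a # w)) = transpose_mat (wev N \<phi> w) * transpose_mat (if b then \<phi> x else transpose_mat (\<phi> x))"
    unfolding a wev_Cons by (rule transpose_mult[OF c wev_carrier])
  then show ?case unfolding Cons l[symmetric] by (simp add: a wev_append)
qed simp

end

lemma word_eq_append:
  assumes "word_eq R v w"
  shows "word_eq R (u @ v @ z) (u @ w @ z)"
  using assms
proof induction
  case (refl w)
  show ?case by (rule word_eq.refl)
next
  case (sym v w)
  then show ?case by (blast intro: word_eq.sym)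
next
  case (trans u v w)
  then show ?case by (blast intro: word_eq.trans)
next
  case (cancel u' x b v)
  have "word_eq R ((u @ u') @ [(x, b), (x, \<not> b)] @ (v @ z)) ((u @ u') @ (v @ z))"
    by (rule word_eq.cancel)
  then show ?case by simp
next
  case (relator r u' v)
  have "word_eq R ((u @ u') @ r @ (v @ z)) ((u @ u') @ (v @ z))"
    by (rule word_eq.relator[OF relator])
  then show ?case by simp
qed

lemma word_class_eq: "word_class R v = word_class R w \<longleftrightarrow> word_eq R v w"
proof
  assume "word_class R v = word_class R w"
  moreover have "v \<in> word_class R v" unfolding word_class_def by (simp add: word_eq.refl)
  ultimately show "word_eq R v w" unfolding word_class_def by blast
next
  assume "word_eq R v w"
  then show "word_class R v = word_class R w"
    unfolding word_class_def by (blast intro: word_eq.trans word_eq.sym)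
qed

lemma presented_carrier: "carrier (presented_group R) = range (word_class R)"
  and presented_one: "\<one>\<^bsub>presented_group R\<^esub> = word_class R []"
  by (simp_all add: presented_group_def)

lemma presented_mult:
  "word_class R u \<otimes>\<^bsub>presented_group R\<^esub> word_class R v = word_class R (u @ v)"
proof -
  have "{w. \<exists>u'\<in>word_class R u. \<exists>v'\<in>word_class R v. word_eq R w (u' @ v')} = word_class R (u @ v)"
  proof (intro equalityI subsetI)
    fix w assume "w \<in> {w. \<exists>u'\<in>word_class R u. \<exists>v'\<in>word_class R v. word_eq R w (u' @ v')}"
    then obtain u' v' where "word_eq R u' u" "word_eq R v' v" and w: "word_eq R w (u' @ v')"
      unfolding word_class_def by blast
    then have "word_eq R (u' @ v') (u @ v')" "word_eq R (u @ v') (u @ v)"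
      using word_eq_append[of R u' u "[]" v'] word_eq_append[of R v' v u "[]"] by simp_all
    then show "w \<in> word_class R (u @ v)"
      unfolding word_class_def mem_Collect_eq by (rule word_eq.trans[OF w word_eq.trans])
  next
    fix w assume "w \<in> word_class R (u @ v)"
    then show "w \<in> {w. \<exists>u'\<in>word_class R u. \<exists>v'\<in>word_class R v. word_eq R w (u' @ v')}"
      unfolding word_class_def using word_eq.refl by blast
  qed
  then show ?thesis by (simp add: presented_group_def)
qed

text \<open>Membership in \<open>hom\<close> gives multiplicativity only; the values at the unit and
  at inverse letters are recovered by cancelling orthogonal matrices.\<close>

lemma hom_presented_wev:
  assumes \<rho>: "\<rho> \<in> hom (presented_group R) (orthogonal_group N)"
  shows "\<rho> (word_class R [(x, True)]) \<in> carrier (orthogonal_group N)"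
    and "\<rho> (word_class R w) = wev N (\<lambda>x. \<rho> (word_class R [(x, True)])) w"
proof -
  have car: "\<rho> (word_class R w) \<in> carrier (orthogonal_group N)" for w
    using \<rho> unfolding hom_def presented_carrier by blast
  then show "\<rho> (word_class R [(x, True)]) \<in> carrier (orthogonal_group N)" .
  have mult: "\<rho> (word_class R (u @ v)) = \<rho> (word_class R u) * \<rho> (word_class R v)" for u v
    using \<rho> unfolding hom_def presented_carrier presented_mult[symmetric]
    by (simp add: orthogonal_group_def)
  have cancel_left: "Y = Z"
    if X: "X \<in> carrier (orthogonal_group N)" and Y: "Y \<in> carrier (orthogonal_group N)"
      and Z: "Z \<in> carrier (orthogonal_group N)" and eq: "X * Y = X * Z" for X Y Z
  proof -
    note c = orthogonal_group_carrierD
    have "transpose_mat X * (X * W) = W" if W: "W \<in> carrier (orthogonal_group N)" for W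
    proof -
      have "transpose_mat X * (X * W) = (transpose_mat X * X) * W"
        using c[OF X] by (intro assoc_mult_mat[OF _ c[OF X] c[OF W], symmetric]) simp
      also have "\<dots> = W"
        using X left_mult_one_mat[OF c[OF W]] by (simp add: orthogonal_group_carrier)
      finally show ?thesis .
    qed
    then show ?thesis using Y Z eq by metis
  qed
  have one: "\<rho> (word_class R []) = 1\<^sub>m N"
  proof (rule cancel_left[OF car car orthogonal_group_one])
    show "\<rho> (word_class R []) * \<rho> (word_class R []) = \<rho> (word_class R []) * 1\<^sub>m N"
      using mult[of "[]" "[]"] right_mult_one_mat[OF orthogonal_group_carrierD[OF car[of "[]"]]] by simp
  qed
  have inv: "\<rho> (word_class R [(x, False)]) = transpose_mat (\<rho> (word_class R [(x, True)]))" for x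
  proof (rule cancel_left[OF car car orthogonal_group_transpose(1)[OF car]])
    have "word_eq R [(x, True), (x, False)] []" using word_eq.cancel[of R "[]" x True "[]"] by simp
    then have "\<rho> (word_class R [(x, True), (x, False)]) = 1\<^sub>m N"
      using one by (simp add: word_class_eq[symmetric])
    then show "\<rho> (word_class R [(x, True)]) * \<rho> (word_class R [(x, False)]) =
        \<rho> (word_class R [(x, True)]) * transpose_mat (\<rho> (word_class R [(x, True)]))"
      using mult[of "[(x, True)]" "[(x, False)]"] orthogonal_group_transpose(2)[OF car] by simp
  qed
  show "\<rho> (word_class R w) = wev N (\<lambda>x. \<rho> (word_class R [(x, True)])) w"
  proof (induction w)
    case (Cons a w)
    obtain x b where a: "a = (x, b)" by fastforce
    show ?case using mult[of "[a]" w] Cons inv[of x] by (cases b) (simp_all add: a wev_Cons)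
  qed (simp add: one)
qed

text \<open>Universal property of a presentation, in the form needed for the \<open>THE\<close> in
  \<open>rho\<close>: \<open>extensional\<close> makes the homomorphism unique as a total
  function.\<close>

lemma presented_hom_the:
  assumes \<phi>: "\<And>x. \<phi> x \<in> carrier (orthogonal_group N)"
    and R: "\<And>r. r \<in> R \<Longrightarrow> wev N \<phi> r = 1\<^sub>m N"
  shows "\<exists>!\<rho>. \<rho> \<in> hom (presented_group R) (orthogonal_group N) \<and>
      \<rho> \<in> extensional (carrier (presented_group R)) \<and> (\<forall>x. \<rho> (word_class R [(x, True)]) = \<phi> x)"
proof (rule ex1I)
  define \<rho>0 where "\<rho>0 = (\<lambda>C\<in>range (word_class R). wev N \<phi> (SOME w. word_class R w = C))"
  have \<rho>0: "\<rho>0 (word_class R w) = wev N \<phi> w" for w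
  proof -
    have "word_class R (SOME v. word_class R v = word_class R w) = word_class R w"
      by (rule someI[of _ w]) simp
    then show ?thesis
      unfolding \<rho>0_def using wev_word_eq[OF \<phi> R] rangeI[of "word_class R" w] by (simp add: word_class_eq)
  qed
  show "\<rho>0 \<in> hom (presented_group R) (orthogonal_group N) \<and>
      \<rho>0 \<in> extensional (carrier (presented_group R)) \<and> (\<forall>x. \<rho>0 (word_class R [(x, True)]) = \<phi> x)"
  proof (intro conjI allI)
    have "\<rho>0 C \<in> carrier (orthogonal_group N)" if "C \<in> range (word_class R)" for C
      using that \<rho>0 wev_orthogonal[OF \<phi>] by auto
    moreover have "\<rho>0 (C \<otimes>\<^bsub>presented_group R\<^esub> C') = \<rho>0 C * \<rho>0 C'"
      if "C \<in> range (word_class R)" "C' \<in> range (word_class R)" for C C'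
      using that by (auto simp: presented_mult \<rho>0 wev_append[OF \<phi>])
    ultimately show "\<rho>0 \<in> hom (presented_group R) (orthogonal_group N)"
      unfolding hom_def presented_carrier by (auto simp: orthogonal_group_def)
    show "\<rho>0 \<in> extensional (carrier (presented_group R))"
      unfolding presented_carrier \<rho>0_def by (rule restrict_extensional)
    show "\<rho>0 (word_class R [(x, True)]) = \<phi> x" for x
      using orthogonal_group_carrierD[OF \<phi>[of x]] by (simp add: \<rho>0 wev_Cons)
  qed
  fix \<rho> assume \<rho>: "\<rho> \<in> hom (presented_group R) (orthogonal_group N) \<and>
      \<rho> \<in> extensional (carrier (presented_group R)) \<and> (\<forall>x. \<rho> (word_class R [(x, True)]) = \<phi> x)"
  have "\<rho> (word_class R w) = \<rho>0 (word_class R w)" for w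
    using hom_presented_wev(2)[of \<rho> R N w] \<rho> by (simp add: \<rho>0)
  moreover have "\<rho>0 \<in> extensional (carrier (presented_group R))"
    unfolding presented_carrier \<rho>0_def by (rule restrict_extensional)
  ultimately show "\<rho> = \<rho>0"
    using \<rho> by (intro extensionalityI[of \<rho> "carrier (presented_group R)"]) (auto simp: presented_carrier)
qed

section \<open>Powers of matrices\<close>

primrec mpow :: "nat \<Rightarrow> real mat \<Rightarrow> nat \<Rightarrow> real mat" where
  "mpow N A 0 = 1\<^sub>m N"
| "mpow N A (Suc i) = A * mpow N A i"

lemma wev_replicate: "wev N \<phi> (replicate i (x, b)) = mpow N (if b then \<phi> x else transpose_mat (\<phi> x)) i"
  by (induction i) (simp_all add: wev_Cons)

lemma mpow_orthogonal: "A \<in> carrier (orthogonal_group N) \<Longrightarrow> mpow N A i \<in> carrier (orthogonal_group N)"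
  by (induction i) (auto intro: orthogonal_group_mult)

lemma mpow_carrier: "A \<in> carrier_mat N N \<Longrightarrow> mpow N A i \<in> carrier_mat N N"
  by (induction i) auto

lemma mpow_add: "A \<in> carrier_mat N N \<Longrightarrow> mpow N A (i + j) = mpow N A i * mpow N A j"
proof (induction i)
  case (Suc i)
  then show ?case
    using assoc_mult_mat[OF Suc.prems mpow_carrier[OF Suc.prems, of i] mpow_carrier[OF Suc.prems, of j]] by simp
next
  case 0
  then show ?case by (simp add: left_mult_one_mat[OF mpow_carrier[OF 0]])
qed

lemma mpow_mult: "A \<in> carrier_mat N N \<Longrightarrow> mpow N A (i * j) = mpow N (mpow N A i) j"
  by (induction j) (simp_all add: mpow_add)

lemma mpow_one: "mpow N (1\<^sub>m N) i = 1\<^sub>m N"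
  by (induction i) simp_all

lemma mpow_commute:
  assumes A: "A \<in> carrier_mat N N" and B: "B \<in> carrier_mat N N" and BA: "B * A = mpow N A r * B"
  shows "B * mpow N A i = mpow N A (r * i) * B"
proof (induction i)
  case (Suc i)
  note c = mpow_carrier[OF A]
  have "B * mpow N A (Suc i) = (B * A) * mpow N A i"
    using assoc_mult_mat[OF B A c] by simp
  also have "\<dots> = mpow N A r * (B * mpow N A i)"
    unfolding BA by (rule assoc_mult_mat[OF c B c])
  also have "\<dots> = mpow N A r * mpow N A (r * i) * B"
    unfolding Suc by (rule assoc_mult_mat[OF c c B, symmetric])
  also have "\<dots> = mpow N A (r * Suc i) * B"
    by (simp add: mpow_add[OF A])
  finally show ?case .
qed (use B in simp)

lemma mpow_commute_mpow:
  assumes A: "A \<in> carrier_mat N N" and B: "B \<in> carrier_mat N N" and BA: "B * A = mpow N A r * B"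
  shows "mpow N B j * mpow N A i = mpow N A (r ^ j * i) * mpow N B j"
proof (induction j)
  case (Suc j)
  note c = mpow_carrier[OF A] mpow_carrier[OF B]
  have "mpow N B (Suc j) * mpow N A i = B * (mpow N B j * mpow N A i)"
    using assoc_mult_mat[OF B c(2) c(1)] by simp
  also have "\<dots> = (B * mpow N A (r ^ j * i)) * mpow N B j"
    unfolding Suc by (rule assoc_mult_mat[OF B c, symmetric])
  also have "\<dots> = mpow N A (r * (r ^ j * i)) * (B * mpow N B j)"
    unfolding mpow_commute[OF A B BA] by (rule assoc_mult_mat[OF c(1) B c(2)])
  finally show ?case by (simp add: mult.assoc)
next
  case 0
  show ?case using mpow_carrier[OF A, of i] by simp
qed

text \<open>
  In a fixed point free representation the elements of each cyclic subgroup of a Frobenius group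
  \<open>\<langle>a\<rangle> \<rtimes> \<langle>b\<rangle>\<close> sum to zero; adding up the sums over all conjugates of \<open>\<langle>b\<rangle>\<close> leaves \<open>m\<close> times the identity.
\<close>

lemma frobenius_not_fixed_point_free:
  fixes a b :: "'v::real_vector \<Rightarrow> 'v"
  assumes m: "m > 0" and q: "q > 0" and lin: "linear a" "linear b" and V: "subspace V"
    and closed: "\<And>v. v \<in> V \<Longrightarrow> a v \<in> V" "\<And>v. v \<in> V \<Longrightarrow> b v \<in> V"
    and am: "\<And>v. v \<in> V \<Longrightarrow> (a ^^ m) v = v" and bq: "\<And>v. v \<in> V \<Longrightarrow> (b ^^ q) v = v"
    and ba: "\<And>v. v \<in> V \<Longrightarrow> b (a v) = (a ^^ u) (b v)"
    and fa: "\<And>y v. \<not> m dvd y \<Longrightarrow> v \<in> V \<Longrightarrow> (a ^^ y) v = v \<Longrightarrow> v = 0"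
    and fb: "\<And>v. v \<in> V \<Longrightarrow> b v = v \<Longrightarrow> v = 0"
    and u: "\<And>t. 0 < t \<Longrightarrow> t < q \<Longrightarrow> \<not> [u ^ t = 1] (mod m)"
    and v: "v \<in> V"
  shows "v = 0"
proof -
  have linp: "linear (a ^^ i)" "linear (b ^^ i)" for i
    by (induction i) (use lin in \<open>auto simp: linear_iff\<close>)
  have pV: "(a ^^ i) w \<in> V" "(b ^^ i) w \<in> V" if "w \<in> V" for i w
    by (induction i) (use closed that in auto)
  have shift: "(\<Sum>i<n. f (Suc i)) = (\<Sum>i<n. f i)" if "f n = f 0" for f :: "nat \<Rightarrow> 'v" and n
  proof -
    have "(\<Sum>i<n. f (Suc i)) + f 0 = (\<Sum>i<n. f i) + f n"
      using sum.lessThan_Suc_shift[of f n] sum.lessThan_Suc[of f n] by (simp add: add.commute)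
    then show ?thesis using that by simp
  qed
  \<comment> \<open>A sum over the powers of \<open>b\<close> is fixed by \<open>b\<close>, hence it
    vanishes.\<close>
  have Z: "(\<Sum>t<q. (b ^^ t) w) = 0" if w: "w \<in> V" for w
  proof (rule fb)
    show "(\<Sum>t<q. (b ^^ t) w) \<in> V" using w pV V by (auto intro: subspace_sum)
    have "b (\<Sum>t<q. (b ^^ t) w) = (\<Sum>t<q. (b ^^ Suc t) w)" by (simp add: linear_sum[OF lin(2)])
    also have "\<dots> = (\<Sum>t<q. (b ^^ t) w)" by (rule shift) (simp add: bq[OF w])
    finally show "b (\<Sum>t<q. (b ^^ t) w) = (\<Sum>t<q. (b ^^ t) w)" .
  qed
  have amm: "(a ^^ (m * i)) w = w" if w: "w \<in> V" for i w
    by (induction i) (simp_all add: funpow_add am[OF w])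
  have Y: "(\<Sum>x<m. (a ^^ (y * x)) w) = 0" if w: "w \<in> V" and y: "\<not> m dvd y" for w y
  proof (rule fa[OF y])
    show "(\<Sum>x<m. (a ^^ (y * x)) w) \<in> V" using w pV V by (auto intro: subspace_sum)
    have "(a ^^ y) (\<Sum>x<m. (a ^^ (y * x)) w) = (\<Sum>x<m. (a ^^ (y * Suc x)) w)"
      by (simp add: linear_sum[OF linp(1)] funpow_add)
    also have "\<dots> = (\<Sum>x<m. (a ^^ (y * x)) w)"
      by (rule shift[of "\<lambda>x. (a ^^ (y * x)) w"]) (use amm[OF w, of y] in \<open>simp add: mult.commute\<close>)
    finally show "(a ^^ y) (\<Sum>x<m. (a ^^ (y * x)) w) = (\<Sum>x<m. (a ^^ (y * x)) w)" .
  qed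
  have bai: "b ((a ^^ i) w) = (a ^^ (u * i)) (b w)" if w: "w \<in> V" for i w
    by (induction i) (simp_all add: ba[OF pV(1)[OF w]] funpow_add)
  have btai: "(b ^^ t) ((a ^^ i) w) = (a ^^ (u ^ t * i)) ((b ^^ t) w)" if w: "w \<in> V" for t i w
    by (induction t) (simp_all add: bai[OF pV(2)[OF w]] mult.assoc)
  \<comment> \<open>\<open>a^x b^t a^(- x) = a^(x (1 - u^t)) b^t\<close>; with \<open>m - 1\<close>
    in place of \<open>- 1\<close> the factor \<open>1 - u^t\<close> becomes
    \<open>?y t\<close>.\<close>
  let ?y = "\<lambda>t. 1 + u ^ t * (m - 1)"
  have "(a ^^ x) ((b ^^ t) ((a ^^ ((m - 1) * x)) v)) = (a ^^ (?y t * x)) ((b ^^ t) v)" for x t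
    unfolding btai[OF v] by (simp add: funpow_add[symmetric] o_def[symmetric] algebra_simps flip: comp_apply[of "a ^^ _" "a ^^ _"])
  then have "(\<Sum>t<q. \<Sum>x<m. (a ^^ (?y t * x)) ((b ^^ t) v)) =
      (\<Sum>x<m. (a ^^ x) (\<Sum>t<q. (b ^^ t) ((a ^^ ((m - 1) * x)) v)))"
    by (subst sum.swap) (simp add: linear_sum[OF linp(1)])
  also have "\<dots> = 0" by (simp add: Z[OF pV(1)[OF v]] linear_0[OF linp(1)])
  finally have "(\<Sum>t<q. \<Sum>x<m. (a ^^ (?y t * x)) ((b ^^ t) v)) = 0" .
  \<comment> \<open>For \<open>t = 0\<close> all \<open>m\<close> summands equal \<open>v\<close>.
    For the other \<open>t\<close> the exponent, which is \<open>1 - u^t\<close> modulo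
    \<open>m\<close>, is not divisible by \<open>m\<close>, and \<open>Y\<close> applies.\<close>
  moreover have "(\<Sum>x<m. (a ^^ (?y t * x)) ((b ^^ t) v)) = (if t = 0 then real m *\<^sub>R v else 0)" if t: "t < q" for t
  proof (cases "t = 0")
    case True
    have "?y 0 = m" using m by simp
    then show ?thesis using True amm[OF v] by (simp add: sum_constant_scaleR)
  next
    case False
    have "\<not> m dvd ?y t"
    proof
      assume "m dvd ?y t"
      then have "[?y t + u ^ t = 0 + u ^ t] (mod m)" by (intro cong_add) (simp_all add: cong_0_iff)
      moreover have "?y t + u ^ t = 1 + u ^ t * m" using m by (simp add: algebra_simps diff_mult_distrib2)
      ultimately have "[1 + u ^ t * m = u ^ t] (mod m)" by simp
      then have "[u ^ t = 1] (mod m)" unfolding cong_def by (metis mod_mult_self1)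
      then show False using u[of t] t False by simp
    qed
    then have "(\<Sum>x<m. (a ^^ (?y t * x)) ((b ^^ t) v)) = 0" by (rule Y[OF pV(2)[OF v]])
    then show ?thesis using False by (simp only: if_False)
  qed
  ultimately have "(\<Sum>t<q. if t = 0 then real m *\<^sub>R v else 0) = 0" by simp
  then show ?thesis using q m by (simp add: sum.delta)
qed

section \<open>Relations between the block matrices\<close>

abbreviation RB :: "nat \<Rightarrow> int \<Rightarrow> real mat" where
  "RB m x \<equiv> rot (of_int x / of_nat m)"

definition dg :: "nat \<Rightarrow> nat \<Rightarrow> (nat \<Rightarrow> int) \<Rightarrow> real mat" where
  "dg d m x = mono_mat d (\<lambda>a. a) (\<lambda>a. RB m (x a))"

definition MA :: "nat \<Rightarrow> nat \<Rightarrow> nat \<Rightarrow> int \<Rightarrow> real mat" where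
  "MA d m r \<kappa> = dg d m (\<lambda>a. \<kappa> * int r ^ a)"

definition ME :: "nat \<Rightarrow> nat \<Rightarrow> nat \<Rightarrow> int \<Rightarrow> real mat" where
  "ME d m r \<kappa> = dg d m (\<lambda>a. if even a then \<kappa> * int r ^ a else 0)"

definition MO :: "nat \<Rightarrow> nat \<Rightarrow> nat \<Rightarrow> int \<Rightarrow> real mat" where
  "MO d m r \<kappa> = dg d m (\<lambda>a. if odd a then \<kappa> * int r ^ a else 0)"

definition shift :: "nat \<Rightarrow> nat \<Rightarrow> nat" where
  "shift d a = (if a + 1 < d then a + 1 else 0)"

text \<open>The matrix \<open>rho_B\<close> for \<open>n = 2 d\<close> and odd \<open>l\<close>: its
  corner block is a rotation by \<open>l / 2\<close> turns, hence a half turn.\<close>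

definition MB :: "nat \<Rightarrow> real mat" where
  "MB d = mono_mat d (shift d) (\<lambda>a. if a + 1 < d then 1\<^sub>m 2 else neg22)"

definition MS :: "nat \<Rightarrow> real mat" where
  "MS d = mono_mat d (\<lambda>a. a) (\<lambda>a. refl22)"

definition MD :: "nat \<Rightarrow> real mat" where
  "MD d = mono_mat d (\<lambda>a. a) (\<lambda>a. if odd a then refl22 else 1\<^sub>m 2)"

text \<open>Modulo \<open>m\<close>, \<open>r2\<close> is minus the inverse of \<open>r1\<close>.
  Reversing the blocks inverts the powers of \<open>r1\<close>, the reflections in odd blocks
  account for the minus sign, and \<open>neg22\<close> in block 0 compensates the corner block of
  \<open>MB\<close>.\<close>

definition MJ :: "nat \<Rightarrow> real mat" where
  "MJ d = mono_mat d (\<lambda>a. if a = 0 then 0 else d - a)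
     (\<lambda>a. if a = 0 then neg22 else if odd a then refl22 else 1\<^sub>m 2)"

definition MN :: "nat \<Rightarrow> real mat" where
  "MN d = mono_mat d (\<lambda>a. a) (\<lambda>a. neg22)"

section \<open>Orthogonality and commutation relations of the block matrices\<close>

lemma dg_orthogonal: "dg d m x \<in> carrier (orthogonal_group (2 * d))"
  unfolding dg_def by (rule mono_mat_orthogonal) (auto intro: rot_orthogonal)

lemma MA_orthogonal: "MA d m r \<kappa> \<in> carrier (orthogonal_group (2 * d))"
  and ME_orthogonal: "ME d m r \<kappa> \<in> carrier (orthogonal_group (2 * d))"
  and MO_orthogonal: "MO d m r \<kappa> \<in> carrier (orthogonal_group (2 * d))"
  unfolding MA_def ME_def MO_def by (rule dg_orthogonal)+

lemma MS_orthogonal: "MS d \<in> carrier (orthogonal_group (2 * d))"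
  unfolding MS_def by (rule mono_mat_orthogonal) (auto intro: refl22_orthogonal)

lemma MD_orthogonal: "MD d \<in> carrier (orthogonal_group (2 * d))"
  unfolding MD_def by (rule mono_mat_orthogonal) (auto intro: refl22_orthogonal)

lemma MN_orthogonal: "MN d \<in> carrier (orthogonal_group (2 * d))"
  unfolding MN_def by (rule mono_mat_orthogonal) (auto intro: rot_orthogonal)

lemma MJ_orthogonal: "MJ d \<in> carrier (orthogonal_group (2 * d))"
  unfolding MJ_def
  by (rule mono_mat_orthogonal[where \<pi>' = "\<lambda>a. if a = 0 then 0 else d - a"])
    (auto intro: rot_orthogonal refl22_orthogonal)

lemma MB_orthogonal: "MB d \<in> carrier (orthogonal_group (2 * d))"
  unfolding MB_def
  by (rule mono_mat_orthogonal[where \<pi>' = "\<lambda>b. if b = 0 then d - 1 else b - 1"])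
    (auto intro: rot_orthogonal simp: shift_def)

lemma dg_mult: "dg d m x * dg d m y = dg d m (\<lambda>a. x a + y a)"
  unfolding dg_def by (subst mono_mat_mult) (auto simp: rot_mult add_divide_distrib)

lemma dg_cong:
  assumes "m > 0" "\<And>a. a < d \<Longrightarrow> int m dvd x a - y a"
  shows "dg d m x = dg d m y"
  unfolding dg_def by (rule mono_mat_cong[OF HOL.refl]) (rule rot_frac_cong[OF assms])

lemma dg_0: "dg d m (\<lambda>a. 0) = 1\<^sub>m (2 * d)"
  unfolding dg_def by (simp add: mono_mat_one)

lemma mpow_dg: "mpow (2 * d) (dg d m x) i = dg d m (\<lambda>a. int i * x a)"
  by (induction i) (simp_all add: dg_0 dg_mult algebra_simps)

lemma mpow_dg_one:
  assumes "m > 0"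
  shows "mpow (2 * d) (dg d m x) m = 1\<^sub>m (2 * d)"
proof -
  have "mpow (2 * d) (dg d m x) m = dg d m (\<lambda>a. 0)"
    unfolding mpow_dg by (rule dg_cong[OF assms]) simp
  then show ?thesis by (simp add: dg_0)
qed

lemma ME_MO: "ME d m r \<kappa> * MO d m r \<kappa> = MA d m r \<kappa>"
  unfolding ME_def MO_def MA_def dg_mult
  by (rule arg_cong[where f = "dg d m"]) auto

lemma MO_ME: "MO d m r \<kappa> * ME d m r \<kappa> = ME d m r \<kappa> * MO d m r \<kappa>"
  unfolding ME_def MO_def dg_mult by (rule arg_cong[where f = "dg d m"]) auto

lemma MS_MS: "MS d * MS d = 1\<^sub>m (2 * d)"
  unfolding MS_def by (subst mono_mat_mult) (auto simp: refl22_refl22 mono_mat_one)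

lemma MD_MD: "MD d * MD d = 1\<^sub>m (2 * d)"
proof -
  have "MD d * MD d = mono_mat d (\<lambda>a. a) (\<lambda>a. 1\<^sub>m 2)"
    unfolding MD_def by (subst mono_mat_mult) (auto simp: refl22_refl22 intro!: mono_mat_cong)
  then show ?thesis by (simp add: mono_mat_one)
qed

lemma rot_refl22_rot: "rot \<theta> * (refl22 * rot \<theta>) = refl22"
proof -
  have "rot \<theta> * (refl22 * rot \<theta>) = (rot \<theta> * rot (- \<theta>)) * refl22"
    unfolding refl22_rot by (rule assoc_mult_mat[symmetric]) (rule rot_carrier rot_carrier refl22_carrier)+
  then show ?thesis unfolding rot_mult by (simp add: left_mult_one_mat[OF refl22_carrier])
qed

lemma mat22_mult_carrier:
  assumes "A \<in> carrier_mat 2 2" "B \<in> carrier_mat 2 2"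
  shows "A * B \<in> carrier_mat 2 2"
  using assms by (rule mult_carrier_mat)

lemma dg_MS_dg: "dg d m x * (MS d * dg d m x) = MS d"
  unfolding dg_def MS_def
  by (subst mono_mat_mult, simp, simp, simp)
    (subst mono_mat_mult, simp, simp, simp add: mat22_mult_carrier, simp add: rot_refl22_rot)

lemma ME_MS_ME: "ME d m r \<kappa> * (MS d * ME d m r \<kappa>) = MS d"
  and MO_MS_MO: "MO d m r \<kappa> * (MS d * MO d m r \<kappa>) = MS d"
  unfolding ME_def MO_def by (rule dg_MS_dg)+

lemma MD_ME: "MD d * ME d m r \<kappa> = ME d m r \<kappa> * MD d"
proof -
  have "MD d * ME d m r \<kappa> = mono_mat d (\<lambda>a. a) (\<lambda>a. (if odd a then refl22 else 1\<^sub>m 2) * RB m (if even a then \<kappa> * int r ^ a else 0))"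
    unfolding MD_def ME_def dg_def by (subst mono_mat_mult) auto
  also have "\<dots> = mono_mat d (\<lambda>a. a) (\<lambda>a. RB m (if even a then \<kappa> * int r ^ a else 0) * (if odd a then refl22 else 1\<^sub>m 2))"
    by (rule mono_mat_cong)
      (auto simp: left_mult_one_mat[OF rot_carrier] right_mult_one_mat[OF rot_carrier]
        left_mult_one_mat[OF refl22_carrier] right_mult_one_mat[OF refl22_carrier])
  also have "\<dots> = ME d m r \<kappa> * MD d"
    unfolding MD_def ME_def dg_def by (subst mono_mat_mult) auto
  finally show ?thesis .
qed

lemma MO_MD_MO: "MO d m r \<kappa> * (MD d * MO d m r \<kappa>) = MD d"
proof -
  let ?F = "\<lambda>a. RB m (if odd a then \<kappa> * int r ^ a else 0)" and ?G = "\<lambda>a. if odd a then refl22 else 1\<^sub>m 2"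
  have "MO d m r \<kappa> * (MD d * MO d m r \<kappa>) = mono_mat d (\<lambda>a. a) (\<lambda>a. ?F a * (?G a * ?F a))"
    unfolding MD_def MO_def dg_def
    by (subst mono_mat_mult, simp, simp, simp)
      (subst mono_mat_mult, simp, simp, simp add: mat22_mult_carrier, simp)
  also have "\<dots> = MD d"
    unfolding MD_def by (rule mono_mat_cong) (auto simp: rot_refl22_rot)
  finally show ?thesis .
qed

lemma neg22_refl22: "neg22 * refl22 = refl22 * neg22"
  unfolding refl22_rot by (rule arg_cong[where f = "\<lambda>M. M * refl22"], rule rot_cong[where z = 1]) simp

lemma MS_MD: "MS d * MD d = MD d * MS d"
  unfolding MS_def MD_def
  by (subst mono_mat_mult, simp, simp, simp, subst mono_mat_mult, simp, simp, simp)
    (rule mono_mat_cong, auto simp: left_mult_one_mat[OF refl22_carrier] right_mult_one_mat[OF refl22_carrier])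

lemma shift_less: "0 < d \<Longrightarrow> shift d a < d"
  by (simp add: shift_def)

lemma MS_MB:
  assumes d: "d > 0"
  shows "MS d * MB d = MB d * MS d"
proof -
  have "MS d * MB d = mono_mat d (shift d) (\<lambda>a. refl22 * (if a + 1 < d then 1\<^sub>m 2 else neg22))"
    unfolding MS_def MB_def by (subst mono_mat_mult) auto
  also have "\<dots> = mono_mat d (shift d) (\<lambda>a. (if a + 1 < d then 1\<^sub>m 2 else neg22) * refl22)"
    by (rule mono_mat_cong) (auto simp: neg22_refl22 left_mult_one_mat[OF refl22_carrier] right_mult_one_mat[OF refl22_carrier])
  also have "\<dots> = MB d * MS d"
    unfolding MS_def MB_def by (subst mono_mat_mult) (auto simp: shift_less[OF d])
  finally show ?thesis .
qed

text \<open>\<open>B\<close> moves blocks to the other parity, across the corner too since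
  \<open>d\<close> is even. So the reflections of \<open>D\<close> in odd blocks turn into
  reflections in even blocks, and these form \<open>D S\<close>.\<close>

lemma MB_MD:
  assumes d: "d > 0" "even d"
  shows "MB d * MD d = MD d * (MB d * MS d)"
proof -
  let ?B = "\<lambda>a. if a + 1 < d then 1\<^sub>m 2 else neg22" and ?G = "\<lambda>a. if odd a then refl22 else 1\<^sub>m 2"
  have "MB d * MD d = mono_mat d (shift d) (\<lambda>a. ?B a * ?G (shift d a))"
    unfolding MD_def MB_def by (subst mono_mat_mult) (auto simp: shift_less[OF d(1)])
  also have "\<dots> = mono_mat d (shift d) (\<lambda>a. ?G a * (?B a * refl22))"
  proof (rule mono_mat_cong[OF HOL.refl])
    fix a assume a: "a < d"
    note one = left_mult_one_mat[OF refl22_carrier] right_mult_one_mat[OF refl22_carrier]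
      left_mult_one_mat[OF rot_carrier] right_mult_one_mat[OF rot_carrier]
    show "?B a * ?G (shift d a) = ?G a * (?B a * refl22)"
    proof (cases "a + 1 < d")
      case True
      then show ?thesis by (auto simp: shift_def one refl22_refl22)
    next
      case False
      then have "a = d - 1" using a by simp
      then have "odd a" using d by simp
      have "refl22 * (neg22 * refl22) = (refl22 * refl22) * neg22"
        unfolding neg22_refl22 by (rule assoc_mult_mat[symmetric]) (rule refl22_carrier rot_carrier)+
      then have "refl22 * (neg22 * refl22) = neg22" by (simp add: refl22_refl22 one)
      then show ?thesis using False \<open>odd a\<close> by (simp add: shift_def one)
    qed
  qed
  also have "\<dots> = MD d * (MB d * MS d)"
    unfolding MD_def MB_def MS_def
    by (subst mono_mat_mult, simp add: shift_less[OF d(1)], simp, simp)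
      (subst mono_mat_mult, simp, simp, simp add: mat22_mult_carrier, simp)
  finally show ?thesis .
qed

lemma MB_dg:
  assumes d: "d > 0"
  shows "MB d * dg d m x = dg d m (\<lambda>a. x (shift d a)) * MB d"
proof -
  let ?B = "\<lambda>a. if a + 1 < d then 1\<^sub>m 2 else neg22"
  have "MB d * dg d m x = mono_mat d (shift d) (\<lambda>a. ?B a * RB m (x (shift d a)))"
    unfolding dg_def MB_def by (subst mono_mat_mult) (auto simp: shift_less[OF d])
  also have "\<dots> = mono_mat d (shift d) (\<lambda>a. RB m (x (shift d a)) * ?B a)"
    by (rule mono_mat_cong)
      (auto simp: left_mult_one_mat[OF rot_carrier] right_mult_one_mat[OF rot_carrier] rot_mult add.commute)
  also have "\<dots> = dg d m (\<lambda>a. x (shift d a)) * MB d"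
    unfolding dg_def MB_def by (subst mono_mat_mult) auto
  finally show ?thesis .
qed

text \<open>Only the last block needs an argument: there the exponent falls from \<open>d\<close> to
  0, and \<open>r^d\<close> is 1 modulo \<open>m\<close>.\<close>

lemma shift_power:
  assumes rd: "[r ^ d = 1] (mod m)" and a: "a < d"
  shows "int m dvd \<kappa> * int r ^ shift d a - int r * (\<kappa> * int r ^ a)"
proof (cases "a + 1 < d")
  case True
  then show ?thesis by (simp add: shift_def mult.left_commute)
next
  case False
  then have ad: "Suc a = d" using a by simp
  have "int m dvd int r ^ d - 1"
    using rd by (metis cong_iff_dvd_diff cong_int_iff of_nat_1 of_nat_power)
  then have "int m dvd - \<kappa> * (int r ^ d - 1)" by (rule dvd_mult)
  moreover have "\<kappa> * int r ^ shift d a - int r * (\<kappa> * int r ^ a) = - \<kappa> * (int r ^ d - 1)"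
    using False unfolding ad[symmetric] by (simp add: shift_def algebra_simps)
  ultimately show ?thesis by (simp only:)
qed

lemma MB_MA:
  assumes d: "d > 0" and m: "m > 0" and rd: "[r ^ d = 1] (mod m)"
  shows "MB d * MA d m r \<kappa> = mpow (2 * d) (MA d m r \<kappa>) r * MB d"
  unfolding MA_def MB_dg[OF d] mpow_dg
  by (rule arg_cong[where f = "\<lambda>M. M * MB d"], rule dg_cong[OF m]) (rule shift_power[OF rd])

text \<open>The change of parity under the shift is what exchanges the even and the odd part of
  \<open>A\<close>; the factor \<open>r\<close> comes from neighbouring blocks.\<close>

lemma MB_ME:
  assumes d: "d > 0" "even d" and m: "m > 0" and rd: "[r ^ d = 1] (mod m)"
  shows "MB d * ME d m r \<kappa> = mpow (2 * d) (MO d m r \<kappa>) r * MB d"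
  unfolding ME_def MO_def MB_dg[OF d(1)] mpow_dg
proof (rule arg_cong[where f = "\<lambda>M. M * MB d"], rule dg_cong[OF m])
  fix a assume a: "a < d"
  have "even (shift d a) \<longleftrightarrow> odd a"
  proof (cases "a + 1 < d")
    case False
    then have "a = d - 1" using a by simp
    then show ?thesis using d False by (simp add: shift_def)
  qed (simp add: shift_def)
  then show "int m dvd (if even (shift d a) then \<kappa> * int r ^ shift d a else 0) -
      int r * (if odd a then \<kappa> * int r ^ a else 0)"
    using shift_power[OF rd a, of \<kappa>] by simp
qed

text \<open>Up to the power \<open>d\<close> each block row passes the corner at most once, so at
  most one factor \<open>neg22\<close> arises.\<close>

lemma mpow_MB:
  assumes d: "d > 0"
  shows "t \<le> d \<Longrightarrow> mpow (2 * d) (MB d) t = mono_mat d (\<lambda>a. (a + t) mod d) (\<lambda>a. if a + t < d then 1\<^sub>m 2 else neg22)"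
proof (induction t)
  case 0
  have "mono_mat d (\<lambda>a. (a + 0) mod d) (\<lambda>a. if a + 0 < d then 1\<^sub>m 2 else neg22) = mono_mat d (\<lambda>a. a) (\<lambda>a. 1\<^sub>m 2)"
    by (rule mono_mat_cong) auto
  then show ?case by (simp add: mono_mat_one)
next
  case (Suc t)
  let ?B = "\<lambda>t a. if a + t < d then 1\<^sub>m 2 else neg22"
  have "mpow (2 * d) (MB d) (Suc t) = MB d * mono_mat d (\<lambda>a. (a + t) mod d) (?B t)"
    using Suc by simp
  also have "\<dots> = mono_mat d (\<lambda>a. (shift d a + t) mod d) (\<lambda>a. ?B 1 a * ?B t (shift d a))"
    unfolding MB_def by (rule mono_mat_mult) (auto simp: shift_less[OF d])
  also have "\<dots> = mono_mat d (\<lambda>a. (a + Suc t) mod d) (?B (Suc t))"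
  proof (rule mono_mat_cong)
    fix a assume a: "a < d"
    show "(shift d a + t) mod d = (a + Suc t) mod d"
    proof (cases "a + 1 < d")
      case False
      then have "a + Suc t = t + d" using a by simp
      then have "(a + Suc t) mod d = t mod d" by (simp only: mod_add_self2)
      then show ?thesis using False by (simp add: shift_def)
    qed (simp add: shift_def)
    show "?B 1 a * ?B t (shift d a) = ?B (Suc t) a"
      using Suc.prems a by (auto simp: shift_def left_mult_one_mat[OF rot_carrier] right_mult_one_mat[OF rot_carrier])
  qed
  finally show ?case .
qed

lemma mpow_MB_d:
  assumes d: "d > 0"
  shows "mpow (2 * d) (MB d) d = MN d"
  unfolding mpow_MB[OF d le_refl] MN_def by (rule mono_mat_cong) auto

lemma MN_MN: "MN d * MN d = 1\<^sub>m (2 * d)"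
  unfolding MN_def by (subst mono_mat_mult) (auto simp: neg22_neg22 mono_mat_one)

lemma mpow_MB_2d:
  assumes d: "d > 0"
  shows "mpow (2 * d) (MB d) (2 * d) = 1\<^sub>m (2 * d)"
proof -
  have "mpow (2 * d) (MB d) (d + d) = 1\<^sub>m (2 * d)"
    unfolding mpow_add[OF orthogonal_group_carrierD[OF MB_orthogonal]] mpow_MB_d[OF d] by (rule MN_MN)
  then show ?thesis by (simp add: mult_2)
qed

lemma MJ_MA:
  assumes d: "d > 0" "even d" and m: "m > 0" and rd: "[r1 ^ d = 1] (mod m)"
    and rr: "[int r1 * int r2 = - 1] (mod int m)"
  shows "MJ d * MA d m r1 \<kappa> = MA d m r2 \<kappa> * MJ d"
proof -
  let ?\<pi> = "\<lambda>a. if a = 0 then 0 else d - a"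
  let ?J = "\<lambda>a. if a = 0 then neg22 else if odd a then refl22 else 1\<^sub>m 2"
  have "MJ d * MA d m r1 \<kappa> = mono_mat d ?\<pi> (\<lambda>a. ?J a * RB m (\<kappa> * int r1 ^ ?\<pi> a))"
    unfolding MJ_def MA_def dg_def by (subst mono_mat_mult) auto
  also have "\<dots> = mono_mat d ?\<pi> (\<lambda>a. RB m (\<kappa> * int r2 ^ a) * ?J a)"
  proof (rule mono_mat_cong[OF HOL.refl])
    fix a assume a: "a < d"
    note one = left_mult_one_mat[OF refl22_carrier] right_mult_one_mat[OF refl22_carrier]
      left_mult_one_mat[OF rot_carrier] right_mult_one_mat[OF rot_carrier]
    \<comment> \<open>\<open>r2^a\<close> is \<open>(-1)^a\<close> times the inverse of
      \<open>r1^a\<close> modulo \<open>m\<close>, and this inverse is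
      \<open>r1^(d - a)\<close>.\<close>
    have pw: "RB m ((-1) ^ a * (\<kappa> * int r1 ^ (d - a))) = RB m (\<kappa> * int r2 ^ a)"
    proof (rule rot_frac_cong[OF m], unfold cong_iff_dvd_diff[symmetric])
      have "[int r1 ^ d = 1] (mod int m)" using rd by (metis cong_int_iff of_nat_1 of_nat_power)
      then have "[int r1 ^ d * (\<kappa> * int r2 ^ a) = 1 * (\<kappa> * int r2 ^ a)] (mod int m)" by (rule cong_mult[OF _ cong_refl])
      moreover have "int r1 ^ d * (\<kappa> * int r2 ^ a) = (int r1 * int r2) ^ a * (\<kappa> * int r1 ^ (d - a))"
      proof -
        have "int r1 ^ d = int r1 ^ a * int r1 ^ (d - a)" using a by (simp add: power_add[symmetric])
        then show ?thesis by (simp add: power_mult_distrib mult_ac)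
      qed
      moreover have "[(int r1 * int r2) ^ a * (\<kappa> * int r1 ^ (d - a)) = (- 1) ^ a * (\<kappa> * int r1 ^ (d - a))] (mod int m)"
        by (rule cong_mult[OF cong_pow[OF rr] cong_refl])
      ultimately show "[(- 1) ^ a * (\<kappa> * int r1 ^ (d - a)) = \<kappa> * int r2 ^ a] (mod int m)"
        by (metis cong_sym cong_trans mult_1)
    qed
    show "?J a * RB m (\<kappa> * int r1 ^ ?\<pi> a) = RB m (\<kappa> * int r2 ^ a) * ?J a"
    proof (cases "a = 0")
      case True
      then show ?thesis by (simp add: rot_mult add.commute)
    next
      case False
      then show ?thesis using pw by (cases "odd a") (simp_all add: one refl22_rot)
    qed
  qed
  also have "\<dots> = MA d m r2 \<kappa> * MJ d"
    unfolding MJ_def MA_def dg_def by (subst mono_mat_mult) auto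
  finally show ?thesis .
qed

text \<open>In other words, \<open>J\<close> conjugates \<open>B S\<close> to the inverse of
  \<open>B\<close>.\<close>

lemma MB_MJ_MB_MS:
  assumes d: "d > 1" "even d"
  shows "MB d * (MJ d * (MB d * MS d)) = MJ d"
proof -
  let ?\<pi> = "\<lambda>a. if a = 0 then 0 else d - a"
  let ?J = "\<lambda>a. if a = 0 then neg22 else if odd a then refl22 else 1\<^sub>m 2"
  let ?B = "\<lambda>a. if a + 1 < d then 1\<^sub>m 2 else neg22"
  have d0: "d > 0" using d by simp
  have \<pi>: "?\<pi> a < d" if "a < d" for a using that d0 by simp
  have "MB d * MS d = mono_mat d (shift d) (\<lambda>a. ?B a * refl22)"
    unfolding MB_def MS_def by (subst mono_mat_mult) (auto simp: shift_less[OF d0])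
  then have "MB d * (MJ d * (MB d * MS d)) =
      MB d * (MJ d * mono_mat d (shift d) (\<lambda>a. ?B a * refl22))" by (simp only:)
  also have "MJ d * mono_mat d (shift d) (\<lambda>a. ?B a * refl22) =
      mono_mat d (\<lambda>a. shift d (?\<pi> a)) (\<lambda>a. ?J a * (?B (?\<pi> a) * refl22))"
    unfolding MJ_def by (rule mono_mat_mult) (auto simp: d0 intro: mat22_mult_carrier)
  also have "MB d * \<dots> = mono_mat d (\<lambda>a. shift d (?\<pi> (shift d a)))
      (\<lambda>a. ?B a * (?J (shift d a) * (?B (?\<pi> (shift d a)) * refl22)))"
    unfolding MB_def by (rule mono_mat_mult) (auto simp: shift_less[OF d0] intro!: mat22_mult_carrier)
  also have "\<dots> = MJ d"
    unfolding MJ_def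
  proof (rule mono_mat_cong)
    fix a assume a: "a < d"
    note one = left_mult_one_mat[OF refl22_carrier] right_mult_one_mat[OF refl22_carrier]
      left_mult_one_mat[OF rot_carrier] right_mult_one_mat[OF rot_carrier]
    show "shift d (?\<pi> (shift d a)) = ?\<pi> a" using a d by (auto simp: shift_def)
    have nnr: "neg22 * (neg22 * refl22) = refl22"
    proof -
      have "neg22 * (neg22 * refl22) = (neg22 * neg22) * refl22"
        by (rule assoc_mult_mat[symmetric]) (rule refl22_carrier rot_carrier)+
      then show ?thesis by (simp add: neg22_neg22 one)
    qed
    have rnr: "refl22 * (neg22 * refl22) = neg22"
    proof -
      have "refl22 * (neg22 * refl22) = (refl22 * refl22) * neg22"
        unfolding neg22_refl22 by (rule assoc_mult_mat[symmetric]) (rule refl22_carrier rot_carrier)+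
      then show ?thesis by (simp add: refl22_refl22 one)
    qed
    consider "a = 0" | "a = d - 1" "a \<noteq> 0" | "a \<noteq> 0" "a + 1 < d" using a by linarith
    then show "?B a * (?J (shift d a) * (?B (?\<pi> (shift d a)) * refl22)) = ?J a"
    proof cases
      case 1
      then show ?thesis using d by (simp add: shift_def rnr one)
    next
      case 2
      then have "odd a" using d by simp
      then show ?thesis using 2 d by (simp add: shift_def nnr one)
    next
      case 3
      then have "Suc (d - Suc a) < d" by linarith
      then have "?B (?\<pi> (shift d a)) = 1\<^sub>m 2" using 3 by (simp add: shift_def)
      then show ?thesis using 3 by (auto simp: shift_def one refl22_refl22)
    qed
  qed
  finally show ?thesis .
qed

section \<open>Identification with the given representations, and absence of fixed vectors\<close>

lemma rho_A_eq: "rho_A d m r \<kappa> = MA d m r \<kappa>"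
proof -
  have "of_int \<kappa> * of_nat r ^ a / of_nat m = (of_int (\<kappa> * int r ^ a) / of_nat m :: real)" for a by simp
  then show ?thesis unfolding rho_A_def MA_def dg_def mono_mat_def
    by (intro arg_cong[where f = "block_array d"] ext) auto
qed

lemma rho_B_eq:
  assumes d: "d > 0" and l: "odd l"
  shows "rho_B d (2 * d) l = MB d"
proof -
  obtain z where z: "l = 2 * z + 1" using l by (elim oddE)
  have "rot (of_int l / (of_nat (2 * d) / of_nat d)) = neg22"
    by (rule rot_cong[where z = z]) (use d z in \<open>simp add: field_simps\<close>)
  then show ?thesis
    unfolding rho_B_def MB_def mono_mat_def block_array_def
    by (intro cong_mat) (auto simp: shift_def)
qed

lemma no_fixed_dg:
  assumes m: "m > 0" and x: "\<And>a. a < d \<Longrightarrow> \<not> int m dvd x a"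
  shows "no_fixed (2 * d) (dg d m x)"
  unfolding dg_def
proof (rule mono_mat_diag_no_fixed[OF rot_carrier], rule rot_no_fixed, rule notI)
  fix a assume a: "a < d" and "of_int (x a) / of_nat m \<in> (\<int> :: real set)"
  then obtain z where "of_int (x a) / of_nat m = (of_int z :: real)" by (elim Ints_cases)
  then have "real_of_int (x a) = real_of_int (z * int m)" using m by (simp add: field_simps)
  then have "x a = z * int m" by (simp only: of_int_eq_iff)
  then show False using x[OF a] by simp
qed

text \<open>A fixed vector would make \<open>x a / m + 1 / 2\<close> an integer for some block
  \<open>a\<close>. After clearing denominators \<open>2 * x a + m\<close> would be even, although
  \<open>m\<close> is odd.\<close>

lemma no_fixed_dg_MN:
  assumes m: "m > 0" "odd m"
  shows "no_fixed (2 * d) (dg d m x * MN d)"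
proof -
  have "dg d m x * MN d = mono_mat d (\<lambda>a. a) (\<lambda>a. rot (of_int (x a) / of_nat m + 1 / 2))"
    unfolding dg_def MN_def by (subst mono_mat_mult) (auto simp: rot_mult)
  moreover have "no_fixed (2 * d) \<dots>"
  proof (rule mono_mat_diag_no_fixed[OF rot_carrier], rule rot_no_fixed, rule notI)
    fix a assume "of_int (x a) / of_nat m + 1 / 2 \<in> (\<int> :: real set)"
    then obtain z where "of_int (x a) / of_nat m + 1 / 2 = (of_int z :: real)" by (elim Ints_cases)
    then have "real_of_int (2 * x a + int m) = real_of_int (2 * z * int m)" using m(1) by (simp add: field_simps)
    then have "2 * x a + int m = 2 * z * int m" by (simp only: of_int_eq_iff)
    then have "even (2 * x a + int m)" by simp
    then show False using m(2) by simp
  qed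
  ultimately show ?thesis by simp
qed

section \<open>Free actions of the groups\<close>

lemma mpow_mod:
  assumes A: "A \<in> carrier_mat N N" and n: "mpow N A n = 1\<^sub>m N"
  shows "mpow N A i = mpow N A (i mod n)"
proof -
  have "mpow N A (n * (i div n) + i mod n) = mpow N A (i mod n)"
    unfolding mpow_add[OF A] mpow_mult[OF A] n mpow_one by (rule left_mult_one_mat[OF mpow_carrier[OF A]])
  then show ?thesis by simp
qed

lemma orthogonal_transpose_eq:
  assumes A: "A \<in> carrier (orthogonal_group N)" and B: "B \<in> carrier_mat N N" and AB: "A * B = 1\<^sub>m N"
  shows "transpose_mat A = B"
proof -
  note c = orthogonal_group_carrierD[OF A]
  have "transpose_mat A = transpose_mat A * (A * B)" unfolding AB using c by simp
  also have "\<dots> = (transpose_mat A * A) * B"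
    by (rule assoc_mult_mat[symmetric]) (use c B in auto)
  also have "\<dots> = B" using A B by (simp add: orthogonal_group_carrier)
  finally show ?thesis .
qed

lemma exists_two_power_odd:
  fixes j :: nat
  assumes "j > 0"
  shows "\<exists>s q. j = 2 ^ s * q \<and> odd q"
  using assms
proof (induction j rule: less_induct)
  case (less j)
  show ?case
  proof (cases "odd j")
    case True
    then show ?thesis by (intro exI[of _ 0] exI[of _ j]) simp
  next
    case False
    then obtain i where i: "j = 2 * i" by blast
    then obtain s q where "i = 2 ^ s * q" "odd q" using less.IH[of i] less.prems by auto
    then show ?thesis using i by (intro exI[of _ "Suc s"] exI[of _ q]) simp
  qed
qed

definition gen_mat :: "real mat \<Rightarrow> real mat \<Rightarrow> gen \<Rightarrow> real mat" where
  "gen_mat A B x = (case x of GenA \<Rightarrow> A | GenB \<Rightarrow> B)"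

lemma gen_mat_simps [simp]: "gen_mat A B GenA = A" "gen_mat A B GenB = B"
  by (simp_all add: gen_mat_def)

lemma gen_mat_orthogonal:
  "A \<in> carrier (orthogonal_group N) \<Longrightarrow> B \<in> carrier (orthogonal_group N) \<Longrightarrow>
    gen_mat A B x \<in> carrier (orthogonal_group N)"
  by (cases x) simp_all

text \<open>Abstracts the image of one group, with \<open>Z\<close> for the image of
  \<open>B^d\<close>. Absence of fixed vectors is assumed for powers of \<open>A\<close> and for
  products \<open>A^i Z\<close>; as \<open>d\<close> is a power of 2, every other element can be
  reduced to these.\<close>

locale metacyclic_mats =
  fixes N m d r t :: nat and A B Z :: "real mat"
  assumes A: "A \<in> carrier (orthogonal_group N)" and B: "B \<in> carrier (orthogonal_group N)"
    and m: "m > 0" and d: "d = 2 ^ t"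
    and Am: "mpow N A m = 1\<^sub>m N" and BA: "B * A = mpow N A r * B"
    and Bd: "mpow N B d = Z" and ZZ: "Z * Z = 1\<^sub>m N"
    and nfA: "\<And>i. \<not> m dvd i \<Longrightarrow> no_fixed N (mpow N A i)"
    and nfZ: "\<And>i. no_fixed N (mpow N A i * Z)"
begin

lemma Ac: "A \<in> carrier_mat N N" and Bc: "B \<in> carrier_mat N N"
  using A B by (simp_all add: orthogonal_group_carrierD)

lemma Zc: "Z \<in> carrier_mat N N"
  unfolding Bd[symmetric] by (rule mpow_carrier[OF Bc])

lemma d_pos: "d > 0"
  by (simp add: d)

lemma B2d: "mpow N B (2 * d) = 1\<^sub>m N"
proof -
  have "mpow N B (d + d) = 1\<^sub>m N" unfolding mpow_add[OF Bc] Bd by (rule ZZ)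
  then show ?thesis by (simp add: mult_2)
qed

lemma transpose_A: "transpose_mat A = mpow N A (m - 1)"
proof (rule orthogonal_transpose_eq[OF A mpow_carrier[OF Ac]])
  have "A * mpow N A (m - 1) = mpow N A m" using m by (cases m) simp_all
  then show "A * mpow N A (m - 1) = 1\<^sub>m N" using Am by simp
qed

lemma transpose_B: "transpose_mat B = mpow N B (2 * d - 1)"
proof (rule orthogonal_transpose_eq[OF B mpow_carrier[OF Bc]])
  have "B * mpow N B (2 * d - 1) = mpow N B (2 * d)" using d_pos by (cases "2 * d") simp_all
  then show "B * mpow N B (2 * d - 1) = 1\<^sub>m N" using B2d by simp
qed

lemma normal_form_mult:
  "(mpow N A i * mpow N B j) * (mpow N A i' * mpow N B j') = mpow N A (i + r ^ j * i') * mpow N B (j + j')"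
proof -
  note a = mpow_carrier[OF Ac] and b = mpow_carrier[OF Bc]
  have "(mpow N A i * mpow N B j) * (mpow N A i' * mpow N B j') =
      mpow N A i * ((mpow N B j * mpow N A i') * mpow N B j')"
    using assoc_mult_mat[OF a b mult_carrier_mat[OF a b], of i j i' j'] assoc_mult_mat[OF b a b, of j i' j'] by simp
  also have "\<dots> = mpow N A i * (mpow N A (r ^ j * i') * (mpow N B j * mpow N B j'))"
    unfolding mpow_commute_mpow[OF Ac Bc BA] using assoc_mult_mat[OF a b b] by simp
  also have "\<dots> = mpow N A (i + r ^ j * i') * mpow N B (j + j')"
    unfolding mpow_add[OF Ac] mpow_add[OF Bc] by (rule assoc_mult_mat[OF a a mult_carrier_mat[OF b b], symmetric])
  finally show ?thesis .
qed

lemma normal_form: "\<exists>i j. wev N (gen_mat A B) w = mpow N A i * mpow N B j"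
proof (induction w)
  case Nil
  show ?case by (intro exI[of _ 0]) simp
next
  case (Cons c w)
  obtain x b where c: "c = (x, b)" by fastforce
  obtain i j where ij: "wev N (gen_mat A B) w = mpow N A i * mpow N B j" using Cons by blast
  have "\<exists>i' j'. (if b then gen_mat A B x else transpose_mat (gen_mat A B x)) = mpow N A i' * mpow N B j'"
  proof (cases x)
    case GenA
    have "A = mpow N A 1 * mpow N B 0" "transpose_mat A = mpow N A (m - 1) * mpow N B 0"
      unfolding transpose_A using Ac mpow_carrier[OF Ac, of "m - 1"] by simp_all
    then have "\<exists>i j. A = mpow N A i * mpow N B j" "\<exists>i j. transpose_mat A = mpow N A i * mpow N B j" by blast+
    then show ?thesis unfolding GenA gen_mat_simps by (cases b) (simp_all only: if_True if_False)
  next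
    case GenB
    have "B = mpow N A 0 * mpow N B 1" "transpose_mat B = mpow N A 0 * mpow N B (2 * d - 1)"
      unfolding transpose_B using Bc mpow_carrier[OF Bc, of "2 * d - 1"] by simp_all
    then have "\<exists>i j. B = mpow N A i * mpow N B j" "\<exists>i j. transpose_mat B = mpow N A i * mpow N B j" by blast+
    then show ?thesis unfolding GenB gen_mat_simps by (cases b) (simp_all only: if_True if_False)
  qed
  then obtain i' j' where "(if b then gen_mat A B x else transpose_mat (gen_mat A B x)) = mpow N A i' * mpow N B j'"
    by blast
  then show ?case unfolding c wev_Cons ij by (simp only: normal_form_mult) blast
qed

lemma normal_form_power: "\<exists>e. mpow N (mpow N A i * mpow N B j) c = mpow N A e * mpow N B (j * c)"
proof (induction c)
  case 0
  show ?case by (intro exI[of _ 0]) simp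
next
  case (Suc c)
  then show ?case using normal_form_mult by (auto simp: mult.commute)
qed

lemma mpow_Z: "odd q \<Longrightarrow> mpow N Z q = Z"
proof -
  assume "odd q"
  then obtain h where q: "q = 2 * h + 1" by (elim oddE)
  have "mpow N Z 2 = 1\<^sub>m N" using ZZ Zc by (simp add: numeral_2_eq_2)
  then have "mpow N Z (2 * h) = 1\<^sub>m N" unfolding mpow_mult[OF Zc] by (simp add: mpow_one)
  then show ?thesis unfolding q mpow_add[OF Zc] using Zc by simp
qed

lemma mpow_fixed: "M \<in> carrier_mat N N \<Longrightarrow> v \<in> carrier_vec N \<Longrightarrow> M *\<^sub>v v = v \<Longrightarrow> mpow N M c *\<^sub>v v = v"
proof (induction c)
  case (Suc c)
  then show ?case
    using assoc_mult_mat_vec[OF Suc.prems(1) mpow_carrier[OF Suc.prems(1)] Suc.prems(2), of c] by simp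
qed simp

text \<open>Unless \<open>2 d\<close> divides \<open>j\<close>, some power of \<open>A^i B^j\<close>
  has the form \<open>A^e Z\<close>. An element with a fixed unit vector is therefore a power of
  \<open>A\<close>, hence the identity.\<close>

lemma free_orth_group_range: "free_orth_group N (range (wev N (gen_mat A B)))"
proof -
  note orth = gen_mat_orthogonal[OF A B]
  show ?thesis unfolding free_orth_group_def
  proof (intro conjI ballI impI)
    have "range (wev N (gen_mat A B)) \<subseteq> (\<lambda>(i, j). mpow N A i * mpow N B j) ` ({..<m} \<times> {..<2 * d})"
    proof
      fix M assume "M \<in> range (wev N (gen_mat A B))"
      then obtain i j where "M = mpow N A i * mpow N B j" using normal_form by blast
      then have "M = mpow N A (i mod m) * mpow N B (j mod (2 * d))"
        using mpow_mod[OF Ac Am, of i] mpow_mod[OF Bc B2d, of j] by simp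
      then show "M \<in> (\<lambda>(i, j). mpow N A i * mpow N B j) ` ({..<m} \<times> {..<2 * d})"
        using m d_pos by (intro image_eqI[of _ _ "(i mod m, j mod (2 * d))"]) auto
    qed
    then show "finite (range (wev N (gen_mat A B)))" by (rule finite_subset) auto
    show "range (wev N (gen_mat A B)) \<subseteq> carrier (orthogonal_group N)"
      using wev_orthogonal[OF orth] by auto
    show "1\<^sub>m N \<in> range (wev N (gen_mat A B))"
      using rangeI[of "wev N (gen_mat A B)" "[]"] by simp
  next
    fix g h assume "g \<in> range (wev N (gen_mat A B))" "h \<in> range (wev N (gen_mat A B))"
    then obtain v w where "g = wev N (gen_mat A B) v" "h = wev N (gen_mat A B) w" by blast
    then show "g * h \<in> range (wev N (gen_mat A B))"
      using rangeI[of "wev N (gen_mat A B)" "v @ w"] wev_append[where \<phi> = "gen_mat A B" and u = v and v = w, OF orth] by simp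
  next
    fix g assume "g \<in> range (wev N (gen_mat A B))"
    then show "transpose_mat g \<in> range (wev N (gen_mat A B))"
      using wev_inverse[where \<phi> = "gen_mat A B", OF orth] by auto
  next
    fix M v assume M: "M \<in> range (wev N (gen_mat A B))" and v: "v \<in> unit_sphere N" and fx: "M *\<^sub>v v = v"
    have vc: "v \<in> carrier_vec N" and "scalar_prod v v = 1" using v by (auto simp: unit_sphere_def)
    then have v0: "v \<noteq> 0\<^sub>v N" by auto
    obtain i j where Mij: "M = mpow N A i * mpow N B j" using M normal_form by blast
    have Mc: "M \<in> carrier_mat N N"
      unfolding Mij by (rule mult_carrier_mat[OF mpow_carrier[OF Ac] mpow_carrier[OF Bc]])
    show "M = 1\<^sub>m N"
    proof (cases "2 * d dvd j")
      case True
      then have "mpow N B j = 1\<^sub>m N" using mpow_mod[OF Bc B2d, of j] by simp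
      then have MA: "M = mpow N A i" unfolding Mij using right_mult_one_mat[OF mpow_carrier[OF Ac]] by simp
      have "m dvd i"
        using nfA[of i] fx vc v0 unfolding MA no_fixed_def by blast
      then show ?thesis using mpow_mod[OF Ac Am, of i] unfolding MA by simp
    next
      case False
      then have "j > 0" by (cases j) auto
      then obtain s q where sq: "j = 2 ^ s * q" "odd q" using exists_two_power_odd by blast
      have "s \<le> t"
      proof (rule ccontr)
        assume "\<not> s \<le> t"
        then have "(2 ^ Suc t :: nat) dvd 2 ^ s" by (intro le_imp_power_dvd) simp
        then have "2 * d dvd j" unfolding sq d by simp
        then show False using False by blast
      qed
      then have jd: "j * 2 ^ (t - s) = d * q" unfolding sq d by (simp add: power_add[symmetric])
      obtain e where "mpow N M (2 ^ (t - s)) = mpow N A e * mpow N B (j * 2 ^ (t - s))"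
        unfolding Mij using normal_form_power by blast
      \<comment> \<open>The exponent of \<open>B\<close> is \<open>d q\<close>, so this factor is
        \<open>Z^q\<close>, and \<open>Z^q = Z\<close> for odd \<open>q\<close>.\<close>
      then have "mpow N M (2 ^ (t - s)) = mpow N A e * Z"
        unfolding jd mpow_mult[OF Bc] Bd mpow_Z[OF sq(2)] .
      then have "(mpow N A e * Z) *\<^sub>v v = v" using mpow_fixed[OF Mc vc fx, of "2 ^ (t - s)"] by simp
      then have "v = 0\<^sub>v N" using nfZ[of e] vc unfolding no_fixed_def by blast
      then show ?thesis using v0 by blast
    qed
  qed
qed

end

text \<open>The last relator is replaced by the inverse-free relation \<open>B A = A^r B\<close>,
  which can be checked on blocks.\<close>

lemma wev_Gamma_relators:
  assumes A: "A \<in> carrier (orthogonal_group N)" and B: "B \<in> carrier (orthogonal_group N)"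
  shows "(\<forall>w\<in>Gamma_relators m n r. wev N (gen_mat A B) w = 1\<^sub>m N) \<longleftrightarrow>
    mpow N A m = 1\<^sub>m N \<and> mpow N B n = 1\<^sub>m N \<and> B * A = mpow N A r * B"
proof -
  note orth = gen_mat_orthogonal[OF A B] and Ac = orthogonal_group_carrierD[OF A] and Bc = orthogonal_group_carrierD[OF B]
  let ?P = "mpow N A r" and ?X = "B * (A * transpose_mat B)"
  have Po: "?P \<in> carrier (orthogonal_group N)" by (rule mpow_orthogonal[OF A])
  note Pc = orthogonal_group_carrierD[OF Po]
  have tP: "mpow N (transpose_mat A) r = transpose_mat ?P"
    using wev_inverse[where \<phi> = "gen_mat A B" and w = "replicate r (GenA, True)", OF orth] by (simp add: wev_replicate)
  have BB: "transpose_mat B * B = 1\<^sub>m N" "B * transpose_mat B = 1\<^sub>m N"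
    using B orthogonal_group_transpose(2)[OF B] by (simp_all add: orthogonal_group_carrier)
  have PP: "transpose_mat ?P * ?P = 1\<^sub>m N" "?P * transpose_mat ?P = 1\<^sub>m N"
    using Po orthogonal_group_transpose(2)[OF Po] by (simp_all add: orthogonal_group_carrier)
  have tc: "transpose_mat B \<in> carrier_mat N N" "transpose_mat ?P \<in> carrier_mat N N" using Bc Pc by simp_all
  have Xc: "?X \<in> carrier_mat N N" using Ac Bc tc by (meson mult_carrier_mat)
  have XB: "?X * B = B * A"
  proof -
    have "?X * B = B * ((A * transpose_mat B) * B)" by (rule assoc_mult_mat[OF Bc mult_carrier_mat[OF Ac tc(1)] Bc])
    also have "(A * transpose_mat B) * B = A * (transpose_mat B * B)" by (rule assoc_mult_mat[OF Ac tc(1) Bc])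
    finally show ?thesis using BB Ac by simp
  qed
  have ev: "wev N (gen_mat A B) ([(GenB, True), (GenA, True), (GenB, False)] @ replicate r (GenA, False)) = ?X * transpose_mat ?P"
    unfolding wev_append[OF orth] using tc(1) Ac Bc
    by (simp add: wev_Cons wev_replicate tP)
  have iff: "?X * transpose_mat ?P = 1\<^sub>m N \<longleftrightarrow> B * A = ?P * B"
  proof
    assume e: "?X * transpose_mat ?P = 1\<^sub>m N"
    have "?X = ?X * (transpose_mat ?P * ?P)" unfolding PP by (rule right_mult_one_mat[OF Xc, symmetric])
    also have "\<dots> = (?X * transpose_mat ?P) * ?P" by (rule assoc_mult_mat[OF Xc tc(2) Pc, symmetric])
    also have "\<dots> = ?P" unfolding e using Pc by simp
    finally show "B * A = ?P * B" using XB by simp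
  next
    assume e: "B * A = ?P * B"
    have "?X = (B * A) * transpose_mat B" by (rule assoc_mult_mat[OF Bc Ac tc(1), symmetric])
    also have "\<dots> = ?P * (B * transpose_mat B)" unfolding e by (rule assoc_mult_mat[OF Pc Bc tc(1)])
    finally have "?X = ?P" unfolding BB using Pc by simp
    then show "?X * transpose_mat ?P = 1\<^sub>m N" using PP by simp
  qed
  show ?thesis
    unfolding Gamma_relators_def ball_simps ev iff by (simp add: wev_replicate)
qed

section \<open>The images of the representations as groups of matrices\<close>

lemma gen_all: "(\<forall>x. P x) \<longleftrightarrow> P GenA \<and> P GenB"
  by (metis gen.exhaust)

text \<open>The block matrices satisfy the relators, so \<open>presented_hom_the\<close> resolves
  the \<open>THE\<close> in \<open>rho\<close>.\<close>

lemma rho_word_class: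
  assumes d: "d > 0" and m: "m > 0" and rd: "[r ^ d = 1] (mod m)" and l: "odd l"
  shows "rho d m (2 * d) r \<kappa> l (word_class (Gamma_relators m (2 * d) r) w) =
    wev (2 * d) (gen_mat (MA d m r \<kappa>) (MB d)) w"
proof -
  let ?R = "Gamma_relators m (2 * d) r" and ?\<phi> = "gen_mat (MA d m r \<kappa>) (MB d)"
  note orth = gen_mat_orthogonal[OF MA_orthogonal MB_orthogonal]
  have rel: "wev (2 * d) ?\<phi> w = 1\<^sub>m (2 * d)" if "w \<in> ?R" for w
    using wev_Gamma_relators[of "MA d m r \<kappa>" "2 * d" "MB d" m "2 * d" r, OF MA_orthogonal MB_orthogonal]
      mpow_MB_2d[OF d] MB_MA[OF d m rd, of \<kappa>] mpow_dg_one[OF m] that unfolding MA_def by blast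
  let ?Q = "\<lambda>\<rho>. \<rho> \<in> hom (presented_group ?R) (orthogonal_group (2 * d)) \<and>
      \<rho> \<in> extensional (carrier (presented_group ?R)) \<and> (\<forall>x. \<rho> (word_class ?R [(x, True)]) = ?\<phi> x)"
  have eq: "rho d m (2 * d) r \<kappa> l = (THE \<rho>. ?Q \<rho>)"
    unfolding rho_def Gamma_group_def Gamma_gen_def rho_A_eq rho_B_eq[OF d l] gen_all gen_mat_simps ..
  have Q: "?Q (rho d m (2 * d) r \<kappa> l)"
    unfolding eq by (rule theI'[OF presented_hom_the[where \<phi> = ?\<phi> and R = ?R, OF orth rel]])
  then have "(\<lambda>x. rho d m (2 * d) r \<kappa> l (word_class ?R [(x, True)])) = ?\<phi>" by auto
  then show ?thesis using hom_presented_wev(2)[of "rho d m (2 * d) r \<kappa> l" ?R "2 * d" w] Q by simp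
qed

lemma wev_bsum:
  assumes A: "\<And>j. A j \<in> carrier (orthogonal_group s)" and B: "\<And>j. B j \<in> carrier (orthogonal_group s)"
  shows "bsum p (\<lambda>j. wev s (gen_mat (A j) (B j)) w) = wev (s * p) (gen_mat (bsum p A) (bsum p B)) w"
proof (induction w)
  case (Cons c w)
  obtain x b where c: "c = (x, b)" by fastforce
  note orth = gen_mat_orthogonal[OF A B]
  have gm: "bsum p (\<lambda>j. gen_mat (A j) (B j) x) = gen_mat (bsum p A) (bsum p B) x" by (cases x) simp_all
  let ?l = "\<lambda>j. if b then gen_mat (A j) (B j) x else transpose_mat (gen_mat (A j) (B j) x)"
  have "bsum p ?l = (if b then gen_mat (bsum p A) (bsum p B) x else transpose_mat (gen_mat (bsum p A) (bsum p B) x))"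
    using bsum_transpose[of p "\<lambda>j. gen_mat (A j) (B j) x" s] orthogonal_group_carrierD[OF orth] gm by (cases b) simp_all
  moreover have "bsum p ?l * bsum p (\<lambda>j. wev s (gen_mat (A j) (B j)) w) = bsum p (\<lambda>j. ?l j * wev s (gen_mat (A j) (B j)) w)"
    by (rule bsum_mult[where s = s]; rule orthogonal_group_carrierD[OF letter_orthogonal[OF orth]] wev_carrier[OF orth])
  ultimately show ?case
    unfolding c wev_Cons Cons[symmetric] by (simp only:)
qed (simp add: bsum_one)

definition BA :: "nat \<Rightarrow> nat \<Rightarrow> nat \<Rightarrow> nat \<Rightarrow> (nat \<Rightarrow> int) \<Rightarrow> real mat" where
  "BA d m r p k = bsum p (\<lambda>j. MA d m r (k j))"

definition BB :: "nat \<Rightarrow> nat \<Rightarrow> real mat" where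
  "BB d p = bsum p (\<lambda>j. MB d)"

lemma BA_orthogonal: "BA d m r p k \<in> carrier (orthogonal_group (2 * d * p))"
  and BB_orthogonal: "BB d p \<in> carrier (orthogonal_group (2 * d * p))"
  unfolding BA_def BB_def by (rule bsum_orthogonal, rule MA_orthogonal MB_orthogonal)+

lemma rho_sum_image:
  assumes d: "d > 0" and m: "m > 0" and rd: "[r ^ d = 1] (mod m)" and l: "\<And>j. j \<in> {1..p} \<Longrightarrow> odd (l j)"
  shows "rho_sum d m (2 * d) r p k l ` carrier (Gamma_group m (2 * d) r) =
    range (wev (2 * d * p) (gen_mat (BA d m r p k) (BB d p)))"
proof -
  have "rho_sum d m (2 * d) r p k l (word_class (Gamma_relators m (2 * d) r) w) =
      wev (2 * d * p) (gen_mat (BA d m r p k) (BB d p)) w" for w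
  proof -
    have "rho_sum d m (2 * d) r p k l (word_class (Gamma_relators m (2 * d) r) w) =
        bsum p (\<lambda>j. wev (2 * d) (gen_mat (MA d m r (k j)) (MB d)) w)"
      unfolding rho_sum_def bsum_def
      by (intro arg_cong[where f = diag_block_mat] map_cong HOL.refl rho_word_class[OF d m rd] l) auto
    then show ?thesis
      unfolding BA_def BB_def wev_bsum[OF MA_orthogonal MB_orthogonal] .
  qed
  then show ?thesis
    unfolding Gamma_group_def presented_carrier image_image by simp
qed

lemma mpow_bsum:
  assumes "\<And>j. M j \<in> carrier_mat s s"
  shows "mpow (s * p) (bsum p M) i = bsum p (\<lambda>j. mpow s (M j) i)"
proof (induction i)
  case (Suc i)
  show ?case
    using bsum_mult[of p M s "\<lambda>j. mpow s (M j) i"] assms mpow_carrier[OF assms] Suc by simp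
qed (simp add: bsum_one)

text \<open>In all summands \<open>B^d\<close> is minus the identity, so their direct sum is again
  an instance of \<open>metacyclic_mats\<close>, with the same \<open>Z\<close> in every
  summand.\<close>

lemma free_orth_group_rho_sum:
  assumes d: "d = 2 ^ t" and m: "m > 0" "odd m" and rd: "[r ^ d = 1] (mod m)" and co: "coprime r m"
    and k: "\<And>j. j \<in> {1..p} \<Longrightarrow> coprime (k j) (int m)"
  shows "free_orth_group (2 * d * p) (range (wev (2 * d * p) (gen_mat (BA d m r p k) (BB d p))))"
proof -
  have d0: "d > 0" by (simp add: d)
  note c = orthogonal_group_carrierD[OF MA_orthogonal] orthogonal_group_carrierD[OF MB_orthogonal]
    orthogonal_group_carrierD[OF MN_orthogonal] orthogonal_group_carrierD[OF dg_orthogonal]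
  interpret metacyclic_mats "2 * d * p" m d r t "BA d m r p k" "BB d p" "bsum p (\<lambda>j. MN d)"
  proof
    show "BA d m r p k \<in> carrier (orthogonal_group (2 * d * p))" "BB d p \<in> carrier (orthogonal_group (2 * d * p))"
      by (rule BA_orthogonal BB_orthogonal)+
    show "m > 0" "d = 2 ^ t" by fact+
    have pA: "mpow (2 * d * p) (BA d m r p k) i = bsum p (\<lambda>j. mpow (2 * d) (MA d m r (k j)) i)" for i
      unfolding BA_def by (rule mpow_bsum[OF c(1)])
    show "mpow (2 * d * p) (BA d m r p k) m = 1\<^sub>m (2 * d * p)"
      unfolding pA MA_def mpow_dg_one[OF m(1)] by (rule bsum_one)
    show "BB d p * BA d m r p k = mpow (2 * d * p) (BA d m r p k) r * BB d p"
      unfolding pA unfolding BA_def BB_def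
      using bsum_mult[of p "\<lambda>j. MB d" "2 * d" "\<lambda>j. MA d m r (k j)"]
        bsum_mult[of p "\<lambda>j. mpow (2 * d) (MA d m r (k j)) r" "2 * d" "\<lambda>j. MB d"]
        c mpow_carrier[OF c(1)] MB_MA[OF d0 m(1) rd] by simp
    show "mpow (2 * d * p) (BB d p) d = bsum p (\<lambda>j. MN d)"
      unfolding BB_def mpow_bsum[OF c(2)] mpow_MB_d[OF d0] ..
    show "bsum p (\<lambda>j. MN d) * bsum p (\<lambda>j. MN d) = 1\<^sub>m (2 * d * p)"
      using bsum_mult[of p "\<lambda>j. MN d" "2 * d" "\<lambda>j. MN d"] c(3) by (simp add: MN_MN bsum_one)
    show "no_fixed (2 * d * p) (mpow (2 * d * p) (BA d m r p k) i)" if i: "\<not> m dvd i" for i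
      unfolding pA MA_def mpow_dg
    proof (rule bsum_no_fixed[OF c(4) no_fixed_dg[OF m(1)]], rule notI)
      fix j a assume j: "j \<in> {1..p}" and "int m dvd int i * (k j * int r ^ a)"
      moreover have "coprime (k j * int r ^ a) (int m)" using k[OF j] co by simp
      ultimately have "int m dvd int i" by (metis coprime_commute coprime_dvd_mult_left_iff)
      then show False using i by simp
    qed
    show "no_fixed (2 * d * p) (mpow (2 * d * p) (BA d m r p k) i * bsum p (\<lambda>j. MN d))" for i
    proof -
      have "mpow (2 * d * p) (BA d m r p k) i * bsum p (\<lambda>j. MN d) =
          bsum p (\<lambda>j. dg d m (\<lambda>a. int i * (k j * int r ^ a)) * MN d)"
        unfolding pA MA_def mpow_dg by (rule bsum_mult[where s = "2 * d"]) (use c in auto)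
      also have "no_fixed (2 * d * p) \<dots>"
        by (rule bsum_no_fixed[OF mult_carrier_mat[OF c(4) c(3)] no_fixed_dg_MN[OF m]])
      finally show ?thesis .
    qed
  qed
  show ?thesis by (rule free_orth_group_range)
qed

section \<open>The exponent is a power of two\<close>

text \<open>The gcd condition makes \<open>r - 1\<close> a unit modulo \<open>m\<close>, which is
  the last item, and makes \<open>m\<close> odd because 2 divides \<open>n\<close>.\<close>

lemma Gamma_paramsD:
  assumes "Gamma_params d m (2 * d) r"
  shows "m > 0" "d > 0" "coprime r m" "[r ^ d = 1] (mod m)" "odd m" "d = ord m r"
    "\<And>x. int m dvd (int r - 1) * x \<Longrightarrow> int m dvd x"
proof -
  have m: "m > 0" and d: "2 * d > 0" and r: "r > 0" and g: "gcd ((r - 1) * (2 * d)) m = 1"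
    and rn: "[r ^ (2 * d) = 1] (mod m)" and o: "d = ord m r"
    using assms unfolding Gamma_params_def by blast+
  show "m > 0" "d > 0" "d = ord m r" using m d o by simp_all
  have "r * r ^ (2 * d - 1) = r ^ (2 * d)" using d by (metis power_eq_if neq0_conv)
  moreover have "coprime (r ^ (2 * d)) m" by (rule cong_imp_coprime[OF cong_sym[OF rn]]) simp
  ultimately show "coprime r m" by (metis coprime_mult_left_iff)
  show "[r ^ d = 1] (mod m)" using ord[of r m] unfolding o .
  have co: "coprime ((r - 1) * (2 * d)) m" using g unfolding coprime_iff_gcd_eq_1 .
  then show "odd m" by simp
  have "coprime (r - 1) m" using co by simp
  then have "coprime (int (r - 1)) (int m)" by simp
  then show "int m dvd x" if "int m dvd (int r - 1) * x" for x
    using that r by (simp add: of_nat_diff coprime_dvd_mult_right_iff coprime_commute)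
qed

text \<open>Carries matrices over to real sequences, which form a vector space type as
  \<open>frobenius_not_fixed_point_free\<close> requires; vectors become sequences vanishing from
  \<open>N\<close> on.\<close>

definition vact :: "nat \<Rightarrow> real mat \<Rightarrow> (nat \<Rightarrow> real) \<Rightarrow> nat \<Rightarrow> real" where
  "vact N M f = (\<lambda>i. if i < N then (M *\<^sub>v Matrix.vec N f) $ i else 0)"

lemma linear_vact:
  assumes M: "M \<in> carrier_mat N N"
  shows "linear (vact N M)"
proof (rule linearI)
  have "Matrix.vec N (f + g) = Matrix.vec N f + Matrix.vec N g" for f g :: "nat \<Rightarrow> real"
    by (intro eq_vecI) (auto simp: plus_fun_def)
  then show "vact N M (f + g) = vact N M f + vact N M g" for f g
    unfolding vact_def using mult_add_distrib_mat_vec[OF M, of "Matrix.vec N f" "Matrix.vec N g"] M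
    by (auto simp: fun_eq_iff)
  have "Matrix.vec N (c *\<^sub>R f) = c \<cdot>\<^sub>v Matrix.vec N f" for c and f :: "nat \<Rightarrow> real"
    by (intro eq_vecI) (auto simp: scaleR_fun_apply)
  then show "vact N M (c *\<^sub>R f) = c *\<^sub>R vact N M f" for c f
    unfolding vact_def using mult_mat_vec[OF M, of "Matrix.vec N f" c] M
    by (auto simp: fun_eq_iff scaleR_fun_apply)
qed

lemma vec_vact: "M \<in> carrier_mat N N \<Longrightarrow> Matrix.vec N (vact N M f) = M *\<^sub>v Matrix.vec N f"
  by (intro eq_vecI) (auto simp: vact_def)

lemma vact_vact:
  assumes A: "A \<in> carrier_mat N N" and B: "B \<in> carrier_mat N N"
  shows "vact N A (vact N B f) = vact N (A * B) f"
  unfolding vact_def[of N A] vec_vact[OF B] unfolding vact_def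
  using assoc_mult_mat_vec[OF A B, of "Matrix.vec N f"] by auto

lemma vact_one: "(\<And>i. i \<ge> N \<Longrightarrow> f i = 0) \<Longrightarrow> vact N (1\<^sub>m N) f = f"
  unfolding vact_def by (auto simp: fun_eq_iff)

lemma vact_pow:
  assumes A: "A \<in> carrier_mat N N" and f: "\<And>i. i \<ge> N \<Longrightarrow> f i = 0"
  shows "(vact N A ^^ i) f = vact N (mpow N A i) f"
  by (induction i) (simp_all add: vact_one f vact_vact[OF A mpow_carrier[OF A]])

lemma vact_fixed:
  assumes M: "M \<in> carrier_mat N N" and fx: "vact N M f = f"
  shows "M *\<^sub>v Matrix.vec N f = Matrix.vec N f"
  using vec_vact[OF M, of f] fx by simp

text \<open>The explicit representation is faithful on the powers of \<open>A\<close>: if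
  \<open>m\<close> does not divide the exponent, there is no fixed vector at all.\<close>

lemma mpow_dg_eq_one:
  assumes m: "m > 0" and d: "d > 0" and co: "coprime r m" and e: "mpow (2 * d) (MA d m r 1) y = 1\<^sub>m (2 * d)"
  shows "m dvd y"
proof (rule ccontr)
  assume y: "\<not> m dvd y"
  have "no_fixed (2 * d) (mpow (2 * d) (MA d m r 1) y)"
    unfolding MA_def mpow_dg
  proof (rule no_fixed_dg[OF m], rule notI)
    fix a assume "int m dvd int y * (1 * int r ^ a)"
    then have "int m dvd int (y * r ^ a)" by simp
    then have "m dvd y * r ^ a" by (simp only: of_nat_dvd_iff)
    moreover have "coprime m (r ^ a)" using co by (simp add: coprime_commute)
    ultimately show False using y by (simp add: coprime_dvd_mult_left_iff)
  qed
  then have "unit_vec (2 * d) 0 = (0\<^sub>v (2 * d) :: real vec)"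
    unfolding no_fixed_def e by (auto dest: bspec[of _ _ "unit_vec (2 * d) 0"])
  then have "unit_vec (2 * d) 0 $ 0 = (0\<^sub>v (2 * d) :: real vec) $ 0" by simp
  then show False using d by simp
qed

text \<open>The elements \<open>A\<close> and \<open>B^(2 d / q)\<close> satisfy the hypotheses of
  \<open>frobenius_not_fixed_point_free\<close>: since \<open>r\<close> has order \<open>d\<close>
  and \<open>q\<close> is odd, \<open>r^(2 d / q)\<close> has order exactly \<open>q\<close> modulo
  \<open>m\<close>.\<close>

lemma fixed_point_free_no_odd_prime:
  assumes par: "Gamma_params d m (2 * d) r" and fpf: "fixed_point_free (Gamma_group m (2 * d) r)"
    and q: "Factorial_Ring.prime q" "odd q" "q dvd d"
  shows False
proof -
  note par = Gamma_paramsD[OF par]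
  note m = par(1) and d = par(2)
  let ?R = "Gamma_relators m (2 * d) r"
  obtain q0 \<sigma> where hom: "\<sigma> \<in> hom (presented_group ?R) (orthogonal_group (q0 + 1))"
    and free: "\<forall>g\<in>carrier (presented_group ?R). \<forall>v\<in>unit_sphere (q0 + 1). \<sigma> g *\<^sub>v v = v \<longrightarrow> g = \<one>\<^bsub>presented_group ?R\<^esub>"
    using fpf unfolding fixed_point_free_def Gamma_group_def by blast
  define N where "N = q0 + 1"
  note hom = hom[folded N_def] and free = free[folded N_def]
  define A B where "A = \<sigma> (word_class ?R [(GenA, True)])" and "B = \<sigma> (word_class ?R [(GenB, True)])"
  have A: "A \<in> carrier (orthogonal_group N)" and B: "B \<in> carrier (orthogonal_group N)"
    unfolding A_def B_def by (rule hom_presented_wev(1)[OF hom])+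
  note Ac = orthogonal_group_carrierD[OF A] and Bc = orthogonal_group_carrierD[OF B]
  have gm: "(\<lambda>x. \<sigma> (word_class ?R [(x, True)])) = gen_mat A B"
  proof
    show "\<sigma> (word_class ?R [(x, True)]) = gen_mat A B x" for x by (cases x) (simp_all add: A_def B_def)
  qed
  have \<sigma>: "\<sigma> (word_class ?R w) = wev N (gen_mat A B) w" for w
    using hom_presented_wev(2)[OF hom, of w] unfolding gm .
  have "wev N (gen_mat A B) w = 1\<^sub>m N" if "w \<in> ?R" for w
  proof -
    have "word_class ?R w = word_class ?R []"
      unfolding word_class_eq using word_eq.relator[OF that, of "[]" "[]"] by simp
    then show ?thesis using \<sigma>[of w] \<sigma>[of "[]"] by simp
  qed
  then have rel: "mpow N A m = 1\<^sub>m N" "mpow N B (2 * d) = 1\<^sub>m N" "B * A = mpow N A r * B"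
    using wev_Gamma_relators[OF A B, of m "2 * d" r] by blast+
  have relM: "wev (2 * d) (gen_mat (MA d m r 1) (MB d)) w = 1\<^sub>m (2 * d)" if "w \<in> ?R" for w
    using wev_Gamma_relators[of "MA d m r 1" "2 * d" "MB d" m "2 * d" r, OF MA_orthogonal MB_orthogonal]
      mpow_MB_2d[OF d] MB_MA[OF d m par(4), of 1] mpow_dg_one[OF m] that unfolding MA_def by blast
  \<comment> \<open>A word that fixes a nonzero vector is trivial in the presented group by
    freeness, hence trivial in the explicit representation too, where this can be read off. This
    takes the place of a normal form for the presented group.\<close>
  have key: "wev (2 * d) (gen_mat (MA d m r 1) (MB d)) w = 1\<^sub>m (2 * d)"
    if v: "v \<in> carrier_vec N" "v \<noteq> 0\<^sub>v N" and fx: "wev N (gen_mat A B) w *\<^sub>v v = v" for w v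
  proof -
    have "(\<Sum>i<N. v $ i * v $ i) \<noteq> 0"
    proof
      assume "(\<Sum>i<N. v $ i * v $ i) = 0"
      then have "\<forall>i\<in>{..<N}. v $ i * v $ i = 0" by (subst (asm) sum_nonneg_eq_0_iff) auto
      then have "v = 0\<^sub>v N" using v(1) by (intro eq_vecI) auto
      then show False using v(2) by blast
    qed
    moreover have "(\<Sum>i<N. v $ i * v $ i) \<ge> 0" by (intro sum_nonneg) simp
    moreover have "scalar_prod v v = (\<Sum>i<N. v $ i * v $ i)" using v(1) by (simp add: scalar_prod_def lessThan_atLeast0)
    ultimately have vv: "scalar_prod v v > 0" by linarith
    define u where "u = (1 / sqrt (scalar_prod v v)) \<cdot>\<^sub>v v"
    have "u \<in> unit_sphere N" unfolding unit_sphere_def u_def using v(1) vv by simp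
    moreover have "\<sigma> (word_class ?R w) *\<^sub>v u = u"
      unfolding \<sigma> u_def using mult_mat_vec[OF wev_carrier[where \<phi> = "gen_mat A B", OF gen_mat_orthogonal[OF A B]] v(1)] fx by simp
    ultimately have "word_class ?R w = word_class ?R []"
      using free unfolding presented_carrier presented_one by blast
    then show ?thesis
      using wev_word_eq[where \<phi> = "gen_mat (MA d m r 1) (MB d)" and R = ?R and v = w and w = "[]" and N = "2 * d",
          OF gen_mat_orthogonal[OF MA_orthogonal MB_orthogonal] relM]
      unfolding word_class_eq by simp
  qed
  define e where "e = 2 * d div q"
  have eq: "e * q = 2 * d" unfolding e_def using q(3) by simp
  have q0: "q > 0" using q(1) prime_gt_0_nat by blast
  have q2: "q > 2" using q prime_ge_2_nat[of q] by (cases "q = 2") auto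
  let ?V = "{f. \<forall>i\<ge>N. f i = (0::real)}"
  let ?b = "mpow N B e"
  have bc: "?b \<in> carrier_mat N N" by (rule mpow_carrier[OF Bc])
  have van: "\<And>i. i \<ge> N \<Longrightarrow> f i = 0" if "f \<in> ?V" for f using that by blast
  have zero: "f = 0" if "f \<in> ?V" "Matrix.vec N f = 0\<^sub>v N" for f
  proof
    fix i show "f i = 0 i"
      using that(1) arg_cong[OF that(2), of "\<lambda>v. v $ i"] by (cases "i < N") auto
  qed
  have ordd: "[r ^ j = 1] (mod m) \<longleftrightarrow> d dvd j" for j
    unfolding par(6) by (rule ord_divides)
  \<comment> \<open>The lemma makes every vector zero; applied to the first unit vector it gives the
    contradiction.\<close>
  have "(\<lambda>i. if i = 0 then 1 else 0) = (0 :: nat \<Rightarrow> real)"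
  proof (rule frobenius_not_fixed_point_free[where a = "vact N A" and b = "vact N ?b" and m = m and q = q and u = "r ^ e" and V = ?V, OF m q0])
    show "linear (vact N A)" "linear (vact N ?b)" by (rule linear_vact[OF Ac] linear_vact[OF bc])+
    show "subspace ?V" by (auto simp: subspace_def scaleR_fun_apply)
    show "vact N A f \<in> ?V" "vact N ?b f \<in> ?V" for f by (auto simp: vact_def)
    show "(vact N A ^^ m) f = f" if "f \<in> ?V" for f
      using vact_pow[where i = m, OF Ac van[OF that]] vact_one[OF van[OF that]] rel(1) by simp
    show "(vact N ?b ^^ q) f = f" if "f \<in> ?V" for f
      using vact_pow[where i = q, OF bc van[OF that]] vact_one[OF van[OF that]] rel(2)
      unfolding mpow_mult[OF Bc, symmetric] eq by simp
    show "vact N ?b (vact N A f) = (vact N A ^^ (r ^ e)) (vact N ?b f)" if f: "f \<in> ?V" for f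
    proof -
      have "?b * A = mpow N A (r ^ e) * ?b"
        using mpow_commute_mpow[where j = e and i = 1, OF Ac Bc rel(3)] Ac by simp
      moreover have "(vact N A ^^ (r ^ e)) (vact N ?b f) = vact N (mpow N A (r ^ e)) (vact N ?b f)"
        by (rule vact_pow[OF Ac]) (simp add: vact_def)
      ultimately show ?thesis by (simp add: vact_vact Ac bc mpow_carrier[OF Ac])
    qed
    show "f = 0" if y: "\<not> m dvd y" and f: "f \<in> ?V" and fx: "(vact N A ^^ y) f = f" for y f
    proof (rule ccontr)
      assume "f \<noteq> 0"
      then have nz: "Matrix.vec N f \<noteq> 0\<^sub>v N" using zero[OF f] by blast
      have "vact N (mpow N A y) f = f" using vact_pow[where i = y, OF Ac van[OF f]] fx by simp
      then have "mpow N A y *\<^sub>v Matrix.vec N f = Matrix.vec N f" by (rule vact_fixed[OF mpow_carrier[OF Ac]])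
      then have "wev (2 * d) (gen_mat (MA d m r 1) (MB d)) (replicate y (GenA, True)) = 1\<^sub>m (2 * d)"
        by (intro key[OF _ nz]) (simp_all add: wev_replicate)
      then have "m dvd y" by (intro mpow_dg_eq_one[OF m d par(3)]) (simp add: wev_replicate)
      then show False using y by blast
    qed
    show "f = 0" if f: "f \<in> ?V" and fx: "vact N ?b f = f" for f
    proof (rule ccontr)
      assume "f \<noteq> 0"
      then have nz: "Matrix.vec N f \<noteq> 0\<^sub>v N" using zero[OF f] by blast
      have "?b *\<^sub>v Matrix.vec N f = Matrix.vec N f" by (rule vact_fixed[OF bc fx])
      then have "wev (2 * d) (gen_mat (MA d m r 1) (MB d)) (replicate e (GenB, True)) = 1\<^sub>m (2 * d)"
        by (intro key[OF _ nz]) (simp_all add: wev_replicate)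
      \<comment> \<open>If \<open>B^e\<close> is trivial, \<open>A\<close> commutes with it, so
        \<open>r^e\<close> is 1 modulo \<open>m\<close> and \<open>d\<close> divides
        \<open>e = 2 d / q\<close>; then \<open>q\<close> would divide 2.\<close>
      then have Be: "mpow (2 * d) (MB d) e = 1\<^sub>m (2 * d)" by (simp add: wev_replicate)
      note Mc = orthogonal_group_carrierD[OF MA_orthogonal, of d m r 1]
      have "mpow (2 * d) (MA d m r 1) (r ^ e) = mpow (2 * d) (MA d m r 1) 1"
        using mpow_commute_mpow[OF Mc orthogonal_group_carrierD[OF MB_orthogonal] MB_MA[OF d m par(4)], of e 1]
        unfolding Be mult_1_right right_mult_one_mat[OF mpow_carrier[OF Mc]] left_mult_one_mat[OF mpow_carrier[OF Mc]]
        by (rule HOL.sym)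
      then have "mpow (2 * d) (MA d m r 1) (r ^ e + (m - 1)) = mpow (2 * d) (MA d m r 1) (1 + (m - 1))"
        unfolding mpow_add[OF Mc] by simp
      also have "1 + (m - 1) = m" using m by simp
      also have "mpow (2 * d) (MA d m r 1) m = 1\<^sub>m (2 * d)" unfolding MA_def by (rule mpow_dg_one[OF m])
      finally have "m dvd r ^ e + (m - 1)" by (rule mpow_dg_eq_one[OF m d par(3)])
      then have "[r ^ e + (m - 1) = 1 + (m - 1)] (mod m)" using m by (simp add: cong_def)
      then have "[r ^ e = 1] (mod m)" using cong_add_rcancel_nat by blast
      then obtain h where "e = d * h" unfolding ordd by blast
      then have "d * (h * q) = d * 2" using eq by (metis mult.assoc mult.commute)
      then have "h * q = 2" using d by simp
      then show False using q2 by (cases h) auto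
    qed
    show "\<not> [(r ^ e) ^ t = 1] (mod m)" if t: "0 < t" "t < q" for t
    proof
      assume "[(r ^ e) ^ t = 1] (mod m)"
      then obtain h where "e * t = d * h" unfolding power_mult[symmetric] ordd by blast
      then have "e * q * t = d * (h * q)" by (metis mult.assoc mult.commute)
      then have "2 * t = h * q" unfolding eq using d by simp
      then have "q dvd 2 * t" by simp
      then have "q dvd t" using q by (metis prime_dvd_mult_iff primes_dvd_imp_eq two_is_prime_nat dvd_refl)
      then show False using t dvd_imp_le by fastforce
    qed
    show "(\<lambda>i. if i = 0 then 1 else 0) \<in> ?V" by (auto simp: N_def)
  qed
  from fun_cong[OF this, of 0] have "(1::real) = 0" by (simp add: zero_fun_def)
  then show False by simp
qed

lemma fixed_point_free_two_power:
  assumes par: "Gamma_params d m (2 * d) r" and fpf: "fixed_point_free (Gamma_group m (2 * d) r)"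
  shows "\<exists>t. d = 2 ^ t"
proof -
  obtain t q where tq: "d = 2 ^ t * q" "odd q" using exists_two_power_odd[OF Gamma_paramsD(2)[OF par]] by blast
  have "q = 1"
  proof (rule ccontr)
    assume "q \<noteq> 1"
    then obtain p where "Factorial_Ring.prime p" "p dvd q" using prime_factor_nat by blast
    moreover from this have "odd p" "p dvd d" using tq by auto
    ultimately show False using fixed_point_free_no_odd_prime[OF par fpf] by blast
  qed
  then show ?thesis using tq by simp
qed

text \<open>An odd \<open>n\<close> is invertible modulo \<open>d\<close>, a power of 2. So
  \<open>r\<close> is a power of \<open>r^n\<close> modulo \<open>m\<close> and fixes whatever
  \<open>r^n\<close> fixes.\<close>

lemma odd_power_fixed:
  fixes x :: int
  assumes d: "d = 2 ^ t" and rd: "[r ^ d = 1] (mod m)" and n: "odd n" and x: "int m dvd int r ^ n * x - x"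
  shows "int m dvd (int r - 1) * x"
proof -
  have "coprime n d" using n unfolding d by simp
  then obtain k where k: "[n * k = 1] (mod d)" using cong_solve_coprime_nat by auto
  have red: "[r ^ j = r ^ (j mod d)] (mod m)" for j
  proof -
    have "[(r ^ d) ^ (j div d) * r ^ (j mod d) = 1 ^ (j div d) * r ^ (j mod d)] (mod m)"
      by (intro cong_mult cong_pow rd cong_refl)
    then show ?thesis by (simp add: power_mult[symmetric] power_add[symmetric])
  qed
  have "[r ^ (n * k) = r ^ 1] (mod m)"
    using red[of "n * k"] red[of 1] k unfolding cong_def by simp
  then have "[int (r ^ (n * k)) = int (r ^ 1)] (mod int m)" by (simp only: cong_int_iff)
  then have "[int (r ^ (n * k)) * x = int (r ^ 1) * x] (mod int m)" by (rule cong_mult[OF _ cong_refl])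
  moreover have "[int (r ^ (n * k)) * x = x] (mod int m)"
  proof (induction k)
    case (Suc k)
    have "[int (r ^ (n * k)) * (int r ^ n * x) = int (r ^ (n * k)) * x] (mod int m)"
      using x by (intro cong_mult cong_refl) (simp add: cong_iff_dvd_diff)
    also note Suc
    finally show ?case by (simp add: power_add ac_simps)
  qed simp
  ultimately have "[int r * x = x] (mod int m)" by (metis cong_sym cong_trans power_one_right)
  then show ?thesis by (simp add: cong_iff_dvd_diff algebra_simps)
qed

text \<open>For the eigenvalue 1, \<open>r1 - 1\<close> is a unit modulo \<open>m\<close>. The
  eigenvalue \<open>- 1\<close> of \<open>r1^n\<close> becomes the eigenvalue 1 of
  \<open>r2^n\<close>, as the product of the two powers is \<open>- 1\<close> for odd
  \<open>n\<close>.\<close>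

lemma no_odd_power_eigenvalue:
  fixes x :: int
  assumes d: "d = 2 ^ t" and r1: "Gamma_params d m (2 * d) r1" and r2: "Gamma_params d m (2 * d) r2"
    and rr: "[int r1 * int r2 = - 1] (mod int m)" and n: "odd n" and x: "\<not> int m dvd x"
  shows "\<not> int m dvd int r1 ^ n * x - x \<and> \<not> int m dvd int r1 ^ n * x + x"
proof -
  note r1 = Gamma_paramsD[OF r1] and r2 = Gamma_paramsD[OF r2]
  have "\<not> int m dvd int r1 ^ n * x - x"
    using r1(7)[OF odd_power_fixed[OF d r1(4) n]] x by blast
  moreover have "\<not> int m dvd int r1 ^ n * x + x"
  proof
    assume "int m dvd int r1 ^ n * x + x"
    then have a: "int m dvd int r2 ^ n * (int r1 ^ n * x + x)" by simp
    have "[(int r1 * int r2) ^ n = (- 1) ^ n] (mod int m)" by (rule cong_pow[OF rr])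
    then have "[int r1 ^ n * int r2 ^ n = - 1] (mod int m)" using n by (simp add: power_mult_distrib)
    then have "int m dvd (int r1 ^ n * int r2 ^ n + 1) * x" by (simp add: cong_iff_dvd_diff)
    from dvd_diff[OF a this] have "int m dvd int r2 ^ n * x - x" by (simp add: algebra_simps)
    then show False using r2(7)[OF odd_power_fixed[OF d r2(4) n]] x by blast
  qed
  ultimately show ?thesis by blast
qed

text \<open>For \<open>d = 1\<close> the unit \<open>r - 1\<close> would vanish modulo
  \<open>m\<close>, which forces \<open>m = 1\<close>.\<close>

lemma Gamma_params_even:
  assumes d: "d = 2 ^ t" and r: "Gamma_params d m (2 * d) r" and m: "m \<noteq> 1"
  shows "even d" "d > 1"
proof -
  have "d \<noteq> 1"
  proof
    assume "d = 1"
    then have "[int r = 1] (mod int m)" using Gamma_paramsD(4)[OF r] by (metis cong_int_iff of_nat_1 power_one_right)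
    then have "int m dvd (int r - 1) * 1" by (simp add: cong_iff_dvd_diff)
    from Gamma_paramsD(7)[OF r this] show False using m by simp
  qed
  then have "t > 0" using d by (cases t) simp_all
  then show "even d" "d > 1" using d by (simp_all add: one_less_power del: One_nat_def)
qed

section \<open>Isospectrality\<close>

lemma mult_mat_vec_lincomb_zero:
  fixes M :: "real mat"
  assumes M: "M \<in> carrier_mat r r" and v: "\<And>i. i < n \<Longrightarrow> v i \<in> carrier_vec r"
    and z: "\<And>k. k < r \<Longrightarrow> (\<Sum>i<n. c i * v i $ k) = 0" and j: "j < r"
  shows "(\<Sum>i<n. c i * (M *\<^sub>v v i) $ j) = 0"
proof -
  have "(\<Sum>i<n. c i * (M *\<^sub>v v i) $ j) = (\<Sum>i<n. \<Sum>k<r. M $$ (j, k) * (c i * v i $ k))"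
  proof (rule sum.cong[OF HOL.refl])
    fix i assume "i \<in> {..<n}"
    then have "v i \<in> carrier_vec r" using v by simp
    then have "(M *\<^sub>v v i) $ j = (\<Sum>k<r. M $$ (j, k) * v i $ k)"
      using M j by (simp add: scalar_prod_def lessThan_atLeast0)
    then show "c i * (M *\<^sub>v v i) $ j = (\<Sum>k<r. M $$ (j, k) * (c i * v i $ k))"
      by (simp add: sum_distrib_left ac_simps)
  qed
  also have "\<dots> = (\<Sum>k<r. M $$ (j, k) * (\<Sum>i<n. c i * v i $ k))"
    by (subst sum.swap) (simp add: sum_distrib_left)
  also have "\<dots> = 0" by (simp add: z)
  finally show ?thesis .
qed

context sphere_op
begin

lemma subspace_invs:
  assumes G: "free_orth_group CARD('k option) G"
  shows "subspace (invs G ev)"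
proof -
  note lin = linear_act[OF free_orth_groupD(2)[OF G]]
  show ?thesis
    using subspace_eigs[of ev] unfolding subspace_def invs_def
    by (simp add: linear_0[OF lin] linear_add[OF lin] linear_cmul[OF lin])
qed

text \<open>The bundle map over the projection is invertible on fibres, so a linear relation at a
  point of the quotient is the same as the relation between the pull-backs at any point above
  it.\<close>

lemma independent_sections_quotient:
  assumes G: "free_orth_group CARD('k option) G"
    and s: "\<And>i. i < n \<Longrightarrow> eigensection (sq G :: (_, 'k) riem) (E (sq G)) (D (sq G)) ev (s i)"
  shows "independent_sections (sq G :: (_, 'k) riem) (E (sq G)) n s \<longleftrightarrow>
    (\<forall>c. (\<Sum>i<n. c i *\<^sub>R enc (pull_back L S0 (sq G) (om G (1\<^sub>m CARD('k option))) (s i))) = 0 \<longrightarrow> (\<forall>i<n. c i = 0))"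
proof -
  let ?M = "sq G :: (_, 'k) riem"
  let ?\<pi> = "om G (1\<^sub>m CARD('k option))"
  let ?t = "\<lambda>i. pull_back L S0 ?M ?\<pi> (s i)"
  note R = riemannian_SS riemannian_manifold_sq[OF G] and lp = local_isometry_om[OF G orthogonal_group_one]
  have sc: "s i y \<in> carrier_vec (rk (E ?M))" if "i < n" "y \<in> points ?M" for i y
    using s[OF that(1)] that(2) unfolding eigensection_def by (blast intro: smooth_sectionD(1))
  have eq: "(\<forall>y\<in>points ?M. \<forall>j<rk (E ?M). (\<Sum>i<n. c i * s i y $ j) = 0) \<longleftrightarrow> (\<Sum>i<n. c i *\<^sub>R enc (?t i)) = 0" for c
  proof
    assume 0: "\<forall>y\<in>points ?M. \<forall>j<rk (E ?M). (\<Sum>i<n. c i * s i y $ j) = 0"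
    show "(\<Sum>i<n. c i *\<^sub>R enc (?t i)) = 0"
    proof (intro ext)
      fix X j
      show "(\<Sum>i<n. c i *\<^sub>R enc (?t i)) X j = 0 X j"
      proof (cases "X \<in> points S0 \<and> j < rk0")
        case True
        then have X: "X \<in> points S0" and j: "j < rk0" by blast+
        note y = local_isometry_points[OF lp X] and LX = L_carrier[OF R lp X]
        have "(\<Sum>i<n. c i * (minv (L S0 ?M ?\<pi> X) *\<^sub>v s i (?\<pi> X)) $ j) = 0"
          by (rule mult_mat_vec_lincomb_zero[OF minv(1)[OF LX(2,3)] _ _ j])
            (use sc[OF _ y] 0 y LX(1) in auto)
        then show ?thesis using X j by (simp add: sum_fun_apply scaleR_fun_apply enc_def pull_back_def zero_fun_def)
      next
        case False
        then show ?thesis by (auto simp: sum_fun_apply scaleR_fun_apply enc_def zero_fun_def)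
      qed
    qed
  next
    assume 0: "(\<Sum>i<n. c i *\<^sub>R enc (?t i)) = 0"
    show "\<forall>y\<in>points ?M. \<forall>j<rk (E ?M). (\<Sum>i<n. c i * s i y $ j) = 0"
    proof (intro ballI allI impI)
      fix y j assume y: "y \<in> points ?M" and j: "j < rk (E ?M)"
      obtain X where X: "X \<in> points S0" "y = ?\<pi> X" by (rule proj_ontoE[OF G y])
      note LX = L_carrier[OF R lp X(1)]
      have st: "s i y = L S0 ?M ?\<pi> X *\<^sub>v ?t i X" "?t i X \<in> carrier_vec rk0" if i: "i < n" for i
        using pull_back(1,2)[of S0 ?M ?\<pi> X "s i", OF R lp X(1)] sc[OF i y] unfolding X(2) by simp_all
      have "(\<Sum>i<n. c i * ?t i X $ k) = 0" if k: "k < rk0" for k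
      proof -
        have "(\<Sum>i<n. c i *\<^sub>R enc (?t i)) X k = 0" unfolding 0 by (simp add: zero_fun_def)
        then show ?thesis using X(1) k by (simp add: sum_fun_apply scaleR_fun_apply enc_def)
      qed
      then have "(\<Sum>i<n. c i * (L S0 ?M ?\<pi> X *\<^sub>v ?t i X) $ j) = 0"
        by (intro mult_mat_vec_lincomb_zero[OF LX(2)]) (use st(2) j LX(1) in auto)
      then show "(\<Sum>i<n. c i * s i y $ j) = 0" using st(1) by simp
    qed
  qed
  show ?thesis unfolding independent_sections_def eq ..
qed

text \<open>Independent families are carried over one by one, so the inequality also covers an
  infinite supremum.\<close>

lemma eigen_multiplicity_mono:
  assumes G: "free_orth_group CARD('k option) G" and G': "free_orth_group CARD('k option) G'"
    and lin: "linear \<Psi>" and map: "\<And>\<phi>. \<phi> \<in> invs G ev \<Longrightarrow> \<Psi> \<phi> \<in> invs G' ev"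
    and inj: "\<And>\<phi>. \<phi> \<in> invs G ev \<Longrightarrow> \<Psi> \<phi> = 0 \<Longrightarrow> \<phi> = 0"
  shows "eigen_multiplicity (sq G :: (_, 'k) riem) (E (sq G)) (D (sq G)) ev \<le>
    eigen_multiplicity (sq G' :: (_, 'k) riem) (E (sq G')) (D (sq G')) ev"
  unfolding eigen_multiplicity_def
proof (rule SUP_subset_mono)
  let ?e = "\<lambda>G t. enc (pull_back L S0 (sq G) (om G (1\<^sub>m CARD('k option))) t)"
  let ?eig = "\<lambda>G. eigensection (sq G :: (_, 'k) riem) (E (sq G)) (D (sq G)) ev"
  let ?ind = "\<lambda>G. independent_sections (sq G :: (_, 'k) riem) (E (sq G))"
  show "{n. \<exists>t. (\<forall>i<n. ?eig G (t i)) \<and> ?ind G n t} \<subseteq> {n. \<exists>t. (\<forall>i<n. ?eig G' (t i)) \<and> ?ind G' n t}"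
  proof
    fix n assume "n \<in> {n. \<exists>t. (\<forall>i<n. ?eig G (t i)) \<and> ?ind G n t}"
    then obtain t where t: "\<And>i. i < n \<Longrightarrow> ?eig G (t i)" and ind: "?ind G n t" by blast
    have et: "?e G (t i) \<in> invs G ev" if "i < n" for i by (rule invs_of_quotient[OF G t[OF that]])
    have "\<exists>s. ?eig G' s \<and> \<Psi> (?e G (t i)) = ?e G' s" if i: "i < n" for i
      using quotient_of_invs[OF G' map[OF et[OF i]]] by blast
    then obtain s where s: "\<And>i. i < n \<Longrightarrow> ?eig G' (s i)" "\<And>i. i < n \<Longrightarrow> \<Psi> (?e G (t i)) = ?e G' (s i)" by metis
    have "\<forall>i<n. c i = 0" if 0: "(\<Sum>i<n. c i *\<^sub>R ?e G' (s i)) = 0" for c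
    proof -
      have "\<Psi> (\<Sum>i<n. c i *\<^sub>R ?e G (t i)) = (\<Sum>i<n. c i *\<^sub>R ?e G' (s i))"
        unfolding linear_sum[OF lin] by (rule sum.cong[OF HOL.refl]) (simp add: linear_cmul[OF lin] s(2))
      moreover have "(\<Sum>i<n. c i *\<^sub>R ?e G (t i)) \<in> invs G ev"
        by (intro subspace_sum[OF subspace_invs[OF G]] subspace_scale[OF subspace_invs[OF G]] et) simp
      ultimately have "(\<Sum>i<n. c i *\<^sub>R ?e G (t i)) = 0" using inj 0 by simp
      then show ?thesis using ind independent_sections_quotient[where s = t and n = n, OF G t] by blast
    qed
    then have "?ind G' n s" using independent_sections_quotient[where s = s and n = n, OF G' s(1)] by blast
    then show "n \<in> {n. \<exists>t. (\<forall>i<n. ?eig G' (t i)) \<and> ?ind G' n t}" using s(1) by blast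
  qed
qed simp

lemma act_act:
  "X \<in> carrier (orthogonal_group CARD('k option)) \<Longrightarrow> Y \<in> carrier (orthogonal_group CARD('k option)) \<Longrightarrow> \<phi> \<in> eigs ev \<Longrightarrow>
    act X (act Y \<phi>) = act (X * Y) \<phi>"
  by (rule act_mult[symmetric])

lemma act_pow:
  assumes X: "X \<in> carrier (orthogonal_group CARD('k option))" and \<phi>: "\<phi> \<in> eigs ev"
  shows "(act X ^^ i) \<phi> = act (mpow CARD('k option) X i) \<phi>"
  by (induction i) (simp_all add: act_one[OF \<phi>] act_act[OF X mpow_orthogonal[OF X] \<phi>])

lemma act_transpose:
  assumes X: "X \<in> carrier (orthogonal_group CARD('k option))" and \<phi>: "\<phi> \<in> eigs ev"
  shows "act (transpose_mat X) (act X \<phi>) = \<phi>"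
proof -
  have "transpose_mat X * X = 1\<^sub>m CARD('k option)" using X by (simp add: orthogonal_group_carrier)
  then show ?thesis using act_act[OF orthogonal_group_transpose(1)[OF X] X \<phi>] act_one[OF \<phi>] by simp
qed

lemma invs_range:
  assumes A: "A \<in> carrier (orthogonal_group CARD('k option))" and B: "B \<in> carrier (orthogonal_group CARD('k option))"
  shows "invs (range (wev CARD('k option) (gen_mat A B))) ev = {\<phi> \<in> eigs ev. act A \<phi> = \<phi> \<and> act B \<phi> = \<phi>}"
proof -
  note orth = gen_mat_orthogonal[OF A B]
  have "act A \<phi> = \<phi> \<and> act B \<phi> = \<phi>" if "\<forall>g\<in>range (wev CARD('k option) (gen_mat A B)). act g \<phi> = \<phi>" for \<phi>
  proof -
    have "wev CARD('k option) (gen_mat A B) [(GenA, True)] = A" "wev CARD('k option) (gen_mat A B) [(GenB, True)] = B"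
      using orthogonal_group_carrierD[OF A] orthogonal_group_carrierD[OF B] by (simp_all add: wev_Cons)
    then show ?thesis using that by (metis rangeI)
  qed
  moreover have "act (wev CARD('k option) (gen_mat A B) w) \<phi> = \<phi>"
    if \<phi>: "\<phi> \<in> eigs ev" and AB: "act A \<phi> = \<phi>" "act B \<phi> = \<phi>" for \<phi> w
  proof (induction w)
    case Nil
    show ?case by (simp add: act_one[OF \<phi>])
  next
    case (Cons a w)
    obtain x b where a: "a = (x, b)" by fastforce
    have gx: "act (gen_mat A B x) \<phi> = \<phi>" using AB by (cases x) simp_all
    then have "act (transpose_mat (gen_mat A B x)) \<phi> = \<phi>" using act_transpose[OF orth[of x] \<phi>] by simp
    then have "act (if b then gen_mat A B x else transpose_mat (gen_mat A B x)) \<phi> = \<phi>" using gx by simp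
    then show ?case
      unfolding a wev_Cons
      using act_mult[OF letter_orthogonal[where \<phi> = "gen_mat A B", OF orth, of b x] wev_orthogonal[where \<phi> = "gen_mat A B" and w = w, OF orth] \<phi>] Cons by simp
  qed
  ultimately show ?thesis unfolding invs_def by blast
qed

text \<open>One inequality suffices, because the assumptions are symmetric in \<open>r1\<close> and
  \<open>r2\<close>.\<close>

lemma eigen_multiplicity_le:
  assumes N: "2 * d * p = CARD('k option)" and d: "d = 2 ^ t" and m: "m \<noteq> 1"
    and r1: "Gamma_params d m (2 * d) r1" and r2: "Gamma_params d m (2 * d) r2"
    and rr: "[int r1 * int r2 = - 1] (mod int m)"
    and k: "\<And>j. j \<in> {1..p} \<Longrightarrow> coprime (k j) (int m)"
  defines "G1 \<equiv> range (wev (2 * d * p) (gen_mat (BA d m r1 p k) (BB d p)))"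
    and "G2 \<equiv> range (wev (2 * d * p) (gen_mat (BA d m r2 p k) (BB d p)))"
  shows "eigen_multiplicity (sq G1 :: (_, 'k) riem) (E (sq G1)) (D (sq G1)) ev \<le>
    eigen_multiplicity (sq G2 :: (_, 'k) riem) (E (sq G2)) (D (sq G2)) ev"
proof -
  note p1 = Gamma_paramsD[OF r1] and p2 = Gamma_paramsD[OF r2]
  note m0 = p1(1) and d0 = p1(2) and ev = Gamma_params_even[OF d r1 m]
  define Em where "Em = bsum p (\<lambda>j. ME d m r1 (k j))"
  define Om where "Om = bsum p (\<lambda>j. MO d m r1 (k j))"
  define Sm where "Sm = bsum p (\<lambda>j. MS d)"
  define Dm where "Dm = bsum p (\<lambda>j. MD d)"
  define Jm where "Jm = bsum p (\<lambda>j. MJ d)"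
  define Am where "Am = BA d m r1 p k"
  define Am' where "Am' = BA d m r2 p k"
  define Bm where "Bm = BB d p"
  note bdefs = Em_def Om_def Sm_def Dm_def Jm_def Am_def Am'_def Bm_def BA_def BB_def
  have orth: "Em \<in> carrier (orthogonal_group CARD('k option))" "Om \<in> carrier (orthogonal_group CARD('k option))"
    "Sm \<in> carrier (orthogonal_group CARD('k option))" "Dm \<in> carrier (orthogonal_group CARD('k option))"
    "Jm \<in> carrier (orthogonal_group CARD('k option))" "Am \<in> carrier (orthogonal_group CARD('k option))"
    "Am' \<in> carrier (orthogonal_group CARD('k option))" "Bm \<in> carrier (orthogonal_group CARD('k option))"
    unfolding bdefs N[symmetric]
    by (rule bsum_orthogonal, rule ME_orthogonal MO_orthogonal MS_orthogonal MD_orthogonal MJ_orthogonal MA_orthogonal MB_orthogonal)+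
  have car: "ME d m r x \<in> carrier_mat (2 * d) (2 * d)" "MO d m r x \<in> carrier_mat (2 * d) (2 * d)"
    "MA d m r x \<in> carrier_mat (2 * d) (2 * d)" "MS d \<in> carrier_mat (2 * d) (2 * d)"
    "MD d \<in> carrier_mat (2 * d) (2 * d)" "MJ d \<in> carrier_mat (2 * d) (2 * d)"
    "MB d \<in> carrier_mat (2 * d) (2 * d)" for r x
    by (rule orthogonal_group_carrierD, rule ME_orthogonal MO_orthogonal MS_orthogonal MD_orthogonal MJ_orthogonal MA_orthogonal MB_orthogonal)+
  have bm: "bsum p F * bsum p F' = bsum p (\<lambda>j. F j * F' j)"
    if "\<And>j. F j \<in> carrier_mat (2 * d) (2 * d)" "\<And>j. F' j \<in> carrier_mat (2 * d) (2 * d)" for F F'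
    by (rule bsum_mult[OF that])
  have mp: "mpow CARD('k option) (bsum p F) i = bsum p (\<lambda>j. mpow (2 * d) (F j) i)"
    if "\<And>j. F j \<in> carrier_mat (2 * d) (2 * d)" for F i
    unfolding N[symmetric] by (rule mpow_bsum[OF that])
  have one: "bsum p (\<lambda>j. 1\<^sub>m (2 * d)) = 1\<^sub>m CARD('k option)"
    unfolding N[symmetric] by (rule bsum_one)
  note mc = mult_carrier_mat[of _ "2 * d" "2 * d" _ "2 * d"] mpow_carrier
  have EO: "Em * Om = Am" "Om * Em = Em * Om"
    unfolding bdefs by (simp_all add: bm car ME_MO MO_ME)
  have sq: "Sm * Sm = 1\<^sub>m CARD('k option)" "Dm * Dm = 1\<^sub>m CARD('k option)"
    unfolding bdefs by (simp_all add: bm car MS_MS MD_MD one)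
  have conj: "Em * (Sm * Em) = Sm" "Om * (Sm * Om) = Sm" "Dm * Em = Em * Dm" "Om * (Dm * Om) = Dm"
    unfolding bdefs by (simp_all add: bm car mc ME_MS_ME MO_MS_MO MD_ME MO_MD_MO)
  have comm: "Sm * Bm = Bm * Sm" "Sm * Dm = Dm * Sm" "Bm * Dm = Dm * (Bm * Sm)"
    unfolding bdefs by (simp_all add: bm car mc MS_MB[OF d0] MS_MD MB_MD[OF d0 ev(1)])
  have BE: "Bm * Em = mpow CARD('k option) Om r1 * Bm"
    unfolding bdefs by (simp add: bm car mc mp MB_ME[OF d0 ev(1) m0 p1(4)])
  have Epow: "mpow CARD('k option) Em m = 1\<^sub>m CARD('k option)"
    unfolding bdefs by (simp add: mp car) (simp add: ME_def mpow_dg_one[OF m0] one)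
  have J: "Jm * Am = Am' * Jm" "Bm * (Jm * (Bm * Sm)) = Jm"
    unfolding bdefs by (simp_all add: bm car mc MJ_MA[OF d0 ev(1) m0 p1(4) rr] MB_MJ_MB_MS[OF ev(2,1)])
  note oo = orthogonal_group_mult and pp = mpow_orthogonal
  have no: "\<And>x :: int. \<And>e. odd e \<Longrightarrow> \<not> int m dvd x \<Longrightarrow> \<not> int m dvd (int r1 ^ e * x - x) \<and> \<not> int m dvd (int r1 ^ e * x + x)"
    by (rule no_odd_power_eigenvalue[OF d r1 r2 rr])
  obtain c :: "int \<Rightarrow> real" where c: "\<And>i j. int m dvd i - j \<Longrightarrow> c i = c j"
    "\<And>i. c (- i) = c i" "\<And>i. c (int r1 * i) = - c i" "(\<Sum>i<m. c (int i)) = 0"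
    "\<And>k. (\<Sum>i<m. c (int i) * c (k - int i)) = (if int m dvd k then 1 else 0) - 1 / real m"
    by (rule signed_kernel_exists[OF m0 p1(4) ev(1) d0 no]) blast+
  \<comment> \<open>On \<open>eigs ev\<close> the action is multiplicative, so each relation becomes
    an identity between block matrices.\<close>
  interpret T: transplantation "eigs ev" "act Em" "act Om" "act Bm" "act Sm" "act Dm" m r1 c
  proof (rule transplantation.intro)
    fix v assume v: "v \<in> eigs ev"
    note aa = act_act[OF _ _ v]
    show "act Em v \<in> eigs ev" "act Om v \<in> eigs ev" "act Bm v \<in> eigs ev" "act Sm v \<in> eigs ev" "act Dm v \<in> eigs ev"
      by (rule act_eigs[OF orth(1) v] act_eigs[OF orth(2) v] act_eigs[OF orth(8) v] act_eigs[OF orth(3) v] act_eigs[OF orth(4) v])+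
    show "(act Em ^^ m) v = v" unfolding act_pow[OF orth(1) v] Epow by (rule act_one[OF v])
    show "act Om (act Em v) = act Em (act Om v)" by (simp add: aa orth EO(2))
    show "act Sm (act Sm v) = v" "act Dm (act Dm v) = v" by (simp_all add: aa orth sq act_one[OF v])
    show "act Em (act Sm (act Em v)) = act Sm v" "act Om (act Sm (act Om v)) = act Sm v"
      "act Dm (act Em v) = act Em (act Dm v)" "act Om (act Dm (act Om v)) = act Dm v"
      by (simp_all add: aa orth oo conj)
    show "act Sm (act Bm v) = act Bm (act Sm v)" "act Sm (act Dm v) = act Dm (act Sm v)"
      "act Bm (act Dm v) = act Dm (act Bm (act Sm v))"
      by (simp_all add: aa orth oo comm)
    show "act Bm (act Em v) = (act Om ^^ r1) (act Bm v)"
      unfolding act_pow[OF orth(2) act_eigs[OF orth(8) v]] by (simp add: aa orth pp BE)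
  qed (use m0 p1(3) subspace_eigs linear_act orth c in auto)
  have free: "free_orth_group CARD('k option) G1" "free_orth_group CARD('k option) G2"
    unfolding G1_def G2_def N[symmetric]
    by (rule free_orth_group_rho_sum[OF d p1(1,5,4,3) k] free_orth_group_rho_sum[OF d p1(1,5) p2(4,3) k]; assumption)+
  have G: "G1 = range (wev CARD('k option) (gen_mat Am Bm))" "G2 = range (wev CARD('k option) (gen_mat Am' Bm))"
    unfolding G1_def G2_def N Am_def Am'_def Bm_def by simp_all
  have F1: "invs G1 ev = T.F1"
    unfolding G invs_range[OF orth(6,8)] unfolding T.F1_def EO(1)[symmetric]
    by (rule Collect_cong) (auto simp: act_act[OF orth(1,2)])
  \<comment> \<open>\<open>J\<close> intertwines the first \<open>A\<close> with the second and
    \<open>B S\<close> with the inverse of \<open>B\<close>, so it maps \<open>F2\<close> into the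
    invariants of the second group.\<close>
  have PsiJ: "act Jm (T.\<Psi> \<phi>) \<in> invs G2 ev" if "\<phi> \<in> invs G1 ev" for \<phi>
  proof -
    have "T.\<Psi> \<phi> \<in> T.F2" using T.Psi_F2 that unfolding F1 by blast
    then have w: "T.\<Psi> \<phi> \<in> eigs ev" "act Em (act Om (T.\<Psi> \<phi>)) = T.\<Psi> \<phi>" "act Bm (act Sm (T.\<Psi> \<phi>)) = T.\<Psi> \<phi>"
      unfolding T.F2_def by blast+
    note aa = act_act[OF _ _ w(1)]
    have "act Am' (act Jm (T.\<Psi> \<phi>)) = act Jm (act Am (T.\<Psi> \<phi>))"
      by (simp add: aa orth J(1))
    also have "act Am (T.\<Psi> \<phi>) = T.\<Psi> \<phi>"
      using w(2) unfolding aa[OF orth(1,2)] EO(1) .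
    finally have 1: "act Am' (act Jm (T.\<Psi> \<phi>)) = act Jm (T.\<Psi> \<phi>)" .
    have "act Bm (act Jm (act (Bm * Sm) (T.\<Psi> \<phi>))) = act Jm (T.\<Psi> \<phi>)"
      by (simp add: aa orth oo J(2))
    moreover have "act (Bm * Sm) (T.\<Psi> \<phi>) = T.\<Psi> \<phi>" using w(3) unfolding aa[OF orth(8,3)] .
    ultimately have "act Bm (act Jm (T.\<Psi> \<phi>)) = act Jm (T.\<Psi> \<phi>)" by simp
    then show ?thesis
      unfolding G invs_range[OF orth(7,8)] using 1 act_eigs[OF orth(5) w(1)] by blast
  qed
  show ?thesis
  proof (rule eigen_multiplicity_mono[OF free, of "\<lambda>\<phi>. act Jm (T.\<Psi> \<phi>)"])
    show "linear (\<lambda>\<phi>. act Jm (T.\<Psi> \<phi>))"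
      using linear_compose[OF T.linear_Psi linear_act[OF orth(5)]] by (simp add: o_def)
    show "act Jm (T.\<Psi> \<phi>) \<in> invs G2 ev" if "\<phi> \<in> invs G1 ev" for \<phi> by (rule PsiJ[OF that])
    show "\<phi> = 0" if \<phi>: "\<phi> \<in> invs G1 ev" and 0: "act Jm (T.\<Psi> \<phi>) = 0" for \<phi>
    proof -
      have f: "\<phi> \<in> T.F1" using \<phi> unfolding F1 .
      then have "T.\<Psi> \<phi> \<in> eigs ev" using T.Psi_F2 unfolding T.F2_def by blast
      from act_transpose[OF orth(5) this] have "T.\<Psi> \<phi> = 0"
        unfolding 0 linear_0[OF linear_act[OF orthogonal_group_transpose(1)[OF orth(5)]]] by simp
      then show ?thesis by (rule T.Psi_injective[OF f])
    qed
  qed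
qed

end

theorem theorem4p4:
  fixes d m n r1 r2 p :: nat and k l :: "nat \<Rightarrow> int"
  assumes "Gamma_params d m n r1" and "Gamma_params d m n r2"
    and "type_I (Gamma_group m n r1)" and "type_I (Gamma_group m n r2)"
    and "fixed_point_free (Gamma_group m n r1)" and "fixed_point_free (Gamma_group m n r2)"
    and "\<not> cyclic_group (Gamma_group m n r1)" and "\<not> cyclic_group (Gamma_group m n r2)"
    and "n = 2 * d"
    and "[int r1 * int r2 = - 1] (mod int m)"
    and "p > 0"
    and "\<forall>j\<in>{1..p}. gcd (k j) (int m) = 1 \<and> gcd (l j) (int n) = 1"
    and "CARD('k::finite) = 2 * d * p - 1"
  shows "strongly_isospectral
    (sphere_quotient (2 * d * p) (rho_sum d m n r1 p k l ` carrier (Gamma_group m n r1))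
      :: (real vec set, 'k) riem)
    (sphere_quotient (2 * d * p) (rho_sum d m n r2 p k l ` carrier (Gamma_group m n r2)))"
proof -
  note r1 = assms(1)[unfolded assms(9)] and r2 = assms(2)[unfolded assms(9)]
  note p1 = Gamma_paramsD[OF r1] and p2 = Gamma_paramsD[OF r2]
  obtain t where d: "d = 2 ^ t"
    using fixed_point_free_two_power[OF r1 assms(5)[unfolded assms(9)]] by blast
  have k: "coprime (k j) (int m)" and l: "odd (l j)" if "j \<in> {1..p}" for j
  proof -
    have g: "coprime (k j) (int m)" "coprime (l j) (2 * int d)"
      using assms(9,12) that unfolding coprime_iff_gcd_eq_1 by simp_all
    show "coprime (k j) (int m)" by (rule g(1))
    show "odd (l j)" using g(2) by auto
  qed
  have N: "2 * d * p = CARD('k option)"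
    using assms(11,13) p1(2) by (simp add: card_option)
  define G where "G r = range (wev (2 * d * p) (gen_mat (BA d m r p k) (BB d p)))" for r
  have G: "rho_sum d m n r1 p k l ` carrier (Gamma_group m n r1) = G r1"
    "rho_sum d m n r2 p k l ` carrier (Gamma_group m n r2) = G r2"
    unfolding assms(9) G_def
    by (rule rho_sum_image[OF p1(2,1,4) l] rho_sum_image[OF p1(2,1) p2(4) l]; assumption)+
  have free: "free_orth_group CARD('k option) (G r1)" "free_orth_group CARD('k option) (G r2)"
    unfolding G_def N[symmetric]
    by (rule free_orth_group_rho_sum[OF d p1(1,5,4,3) k] free_orth_group_rho_sum[OF d p1(1,5) p2(4,3) k]; assumption)+
  have rr: "[int r2 * int r1 = - 1] (mod int m)" using assms(10) by (simp add: mult.commute)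
  have "eigen_multiplicity (sq (G r1) :: (_, 'k) riem) (E (sq (G r1))) (D (sq (G r1))) ev =
      eigen_multiplicity (sq (G r2) :: (_, 'k) riem) (E (sq (G r2))) (D (sq (G r2))) ev"
    if nat: "natural_bundle E L" "natural_operator E L D"
    for E :: "(real vec set, 'k) riem \<Rightarrow> real vec set vbundle" and L D ev
  proof (cases "m = 1")
    case True
    \<comment> \<open>Modulo 1 every rotation in \<open>A\<close> is by a whole turn, so the two
      matrix groups coincide.\<close>
    have "BA d m r1 p k = BA d m r2 p k"
      unfolding BA_def MA_def True by (rule bsum_cong, rule dg_cong) simp_all
    then show ?thesis by (simp add: G_def)
  next
    case False
    interpret sphere_op E L D
      by (intro sphere_op.intro natural_op.intro nat)
    \<comment> \<open>The congruence for \<open>r1 r2\<close> is symmetric, so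
      \<open>eigen_multiplicity_le\<close> is used in both directions.\<close>
    show ?thesis
      unfolding G_def
      by (intro antisym eigen_multiplicity_le[OF N d False] r1 r2 assms(10) rr k)
  qed
  then show ?thesis
    unfolding strongly_isospectral_def G N
    using riemannian_manifold_sq[OF free(1)] riemannian_manifold_sq[OF free(2)]
      compact_space_sq[OF free(1)] compact_space_sq[OF free(2)] by blast
qed

end
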